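(* Let $\mathcal{A}$ be a $k$-linear, Hom-finite abelian category, $F\colon\mathcal{A}\to\mathcal{A}$ an exact functor, $\eta\colon F\to\mathrm{id}_{\mathcal{A}}$ a natural transformation and $p\ge2$ an integer. Assume that for every $X\in\mathcal{A}$ there is an epimorphism $M\twoheadrightarrow X$ in $\mathcal{A}$ with $\eta(M)\colon FM\to M$ a monomorphism. Suppose $T$ is a cotilting object in $\mathcal{A}_\eta$ and $U$ is a cotilting object in $\mathcal{A}$. If (1) $\eta(U)\colon FU\to U$ is injective (a monomorphism), and (2) $\operatorname{Ext}^i_{\mathcal{A}_\eta}(\operatorname{cok}\eta(U),T)=0$ for all $i>0$, then $\iota\,\delta(T)\oplus\pi_\rho U$ is a cotilting object in $\mathcal{A}[\eta^{\frac1p}]$.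
   Context: $k$ is an algebraically closed field. Morphisms are composed left to right. $\operatorname{Ext}$ denotes Yoneda $\operatorname{Ext}$, with $\operatorname{Ext}^0=\operatorname{Hom}$. $\mathcal{A}[\eta^{\frac1p}]$: objects are sequences $M_0=FM_p\xrightarrow{f_1}M_1\xrightarrow{f_2}\cdots\xrightarrow{f_p}M_p$ in $\mathcal{A}$ such that for each $1\le j\le p$ the composite $FM_j\xrightarrow{Ff_{j+1}}\cdots\xrightarrow{Ff_p}FM_p\xrightarrow{f_1}M_1\xrightarrow{f_2}\cdots\xrightarrow{f_j}M_j$ equals $\eta(M_j)$. Morphisms are families $\varphi_j\colon M_j\to N_j$ ($1\le j\le p$) commuting with the structure maps, with $\varphi_0:=F\varphi_p$. $\mathcal{A}_\eta$ is the full subcategory of $\mathcal{A}$ of objects $M$ with $\eta(M)=0$. For an abelian category $\mathcal{B}$ and $q\ge1$, $\mathcal{B}[0^{\frac1q}]$ is the category whose objects are arbitrary sequences $0\to M_1\to\cdots\to M_q$ of objects and morphisms in $\mathcal{B}$ (no condition on composites) and whose morphisms are families $\varphi_j\colon M_j\to N_j$ ($1\le j\le q$) commuting with the structure maps, i.e. representations in $\mathcal{B}$ of the linearly oriented quiver of Dynkin type $A$ with $q$ vertices. $\delta\colon\mathcal{A}_\eta\to\mathcal{A}_\eta[0^{\frac1{p-1}}]$ sends $M$ to $\bigoplus_{j=1}^{p-1}(0\to M\xrightarrow{\mathrm{id}}\cdots\xrightarrow{\mathrm{id}}M\to0\to\cdots\to0)$, where in the $j$-th summand $M$ occupies positions $1,\dots,j$.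 $\iota\colon\mathcal{A}_\eta[0^{\frac1{p-1}}]\to\mathcal{A}[\eta^{\frac1p}]$ sends $(0\to M_1\to\cdots\to M_{p-1})$ to $(0\to M_1\to\cdots\to M_{p-1}\to0)$. $\pi_\rho\colon\mathcal{A}\to\mathcal{A}[\eta^{\frac1p}]$ sends $M$ to $(FM\xrightarrow{\eta(M)}M\xrightarrow{\mathrm{id}}M\to\cdots\xrightarrow{\mathrm{id}}M)$. Cotilting: an object $T$ of an abelian category $\mathcal{C}$ is cotilting if $\operatorname{Ext}^i_{\mathcal{C}}(T,T)=0$ for all $i>0$, and for $M\in\mathcal{C}$, $\operatorname{Ext}^i_{\mathcal{C}}(M,T)=0$ for all $i\ge0$ implies $M=0$. *)

theory Defs
  imports "HOL-Algebra.Module" "HOL-Algebra.Algebraic_Closure"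
begin

no_notation var (\<open>X\<index>\<close>)  \<comment> \<open>frees the identifier \<open>X\<close>\<close>

section \<open>Categories\<close>

text \<open>
  Morphisms compose from left to right: for \<open>f : X \<rightarrow> Y\<close> and \<open>g : Y \<rightarrow> Z\<close> the composite
  \<open>X \<rightarrow> Z\<close> is written \<open>f \<cdot> g\<close>.

  Hom-sets are not required to be pairwise disjoint, so a family of components can serve as a
  morphism of diagrams without recording its source and target. Every category can be presented
  with disjoint Hom-sets, and then neither the untagged composition nor the untagged action of
  a functor on morphisms is a restriction.
\<close>

record ('o, 'm) cat =
  Ob :: "'o set"
  Hom :: "'o \<Rightarrow> 'o \<Rightarrow> 'm set"
  ident :: "'o \<Rightarrow> 'm"
  cmp :: "'m \<Rightarrow> 'm \<Rightarrow> 'm" (infixl \<open>\<cdot>\<index>\<close> 70)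

locale category =
  fixes C :: "('o, 'm) cat" (structure)
  assumes ident_in_Hom: "X \<in> Ob C \<Longrightarrow> ident C X \<in> Hom C X X"
    and cmp_in_Hom:
      "\<lbrakk>X \<in> Ob C; Y \<in> Ob C; Z \<in> Ob C; f \<in> Hom C X Y; g \<in> Hom C Y Z\<rbrakk> \<Longrightarrow> f \<cdot> g \<in> Hom C X Z"
    and ident_left: "\<lbrakk>X \<in> Ob C; Y \<in> Ob C; f \<in> Hom C X Y\<rbrakk> \<Longrightarrow> ident C X \<cdot> f = f"
    and ident_right: "\<lbrakk>X \<in> Ob C; Y \<in> Ob C; f \<in> Hom C X Y\<rbrakk> \<Longrightarrow> f \<cdot> ident C Y = f"
    and cmp_assoc:
      "\<lbrakk>W \<in> Ob C; X \<in> Ob C; Y \<in> Ob C; Z \<in> Ob C; f \<in> Hom C W X; g \<in> Hom C X Y; h \<in> Hom C Y Z\<rbrakk>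
        \<Longrightarrow> (f \<cdot> g) \<cdot> h = f \<cdot> (g \<cdot> h)"

definition is_mono :: "('o, 'm) cat \<Rightarrow> 'o \<Rightarrow> 'o \<Rightarrow> 'm \<Rightarrow> bool" where
  "is_mono C X Y f \<longleftrightarrow> f \<in> Hom C X Y \<and>
    (\<forall>W\<in>Ob C. \<forall>g\<in>Hom C W X. \<forall>h\<in>Hom C W X. g \<cdot>\<^bsub>C\<^esub> f = h \<cdot>\<^bsub>C\<^esub> f \<longrightarrow> g = h)"

definition is_epi :: "('o, 'm) cat \<Rightarrow> 'o \<Rightarrow> 'o \<Rightarrow> 'm \<Rightarrow> bool" where
  "is_epi C X Y f \<longleftrightarrow> f \<in> Hom C X Y \<and>
    (\<forall>W\<in>Ob C. \<forall>g\<in>Hom C Y W. \<forall>h\<in>Hom C Y W. f \<cdot>\<^bsub>C\<^esub> g = f \<cdot>\<^bsub>C\<^esub> h \<longrightarrow> g = h)"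

definition is_zero_obj :: "('o, 'm) cat \<Rightarrow> 'o \<Rightarrow> bool" where
  "is_zero_obj C Z \<longleftrightarrow> Z \<in> Ob C \<and>
    (\<forall>X\<in>Ob C. (\<exists>!f. f \<in> Hom C X Z) \<and> (\<exists>!f. f \<in> Hom C Z X))"

text \<open>Well defined as soon as the category has a zero object.\<close>

definition zero_mor :: "('o, 'm) cat \<Rightarrow> 'o \<Rightarrow> 'o \<Rightarrow> 'm" where
  "zero_mor C X Y = (THE f. \<exists>Z a b. is_zero_obj C Z \<and>
     a \<in> Hom C X Z \<and> b \<in> Hom C Z Y \<and> f = a \<cdot>\<^bsub>C\<^esub> b)"

definition is_kernel :: "('o, 'm) cat \<Rightarrow> 'o \<Rightarrow> 'o \<Rightarrow> 'm \<Rightarrow> 'o \<Rightarrow> 'm \<Rightarrow> bool" where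
  "is_kernel C X Y f K k \<longleftrightarrow> K \<in> Ob C \<and> k \<in> Hom C K X \<and> k \<cdot>\<^bsub>C\<^esub> f = zero_mor C K Y \<and>
    (\<forall>W\<in>Ob C. \<forall>h\<in>Hom C W X. h \<cdot>\<^bsub>C\<^esub> f = zero_mor C W Y \<longrightarrow>
      (\<exists>!u. u \<in> Hom C W K \<and> u \<cdot>\<^bsub>C\<^esub> k = h))"

definition is_cokernel :: "('o, 'm) cat \<Rightarrow> 'o \<Rightarrow> 'o \<Rightarrow> 'm \<Rightarrow> 'o \<Rightarrow> 'm \<Rightarrow> bool" where
  "is_cokernel C X Y f Q q \<longleftrightarrow> Q \<in> Ob C \<and> q \<in> Hom C Y Q \<and> f \<cdot>\<^bsub>C\<^esub> q = zero_mor C X Q \<and>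
    (\<forall>W\<in>Ob C. \<forall>h\<in>Hom C Y W. f \<cdot>\<^bsub>C\<^esub> h = zero_mor C X W \<longrightarrow>
      (\<exists>!u. u \<in> Hom C Q W \<and> q \<cdot>\<^bsub>C\<^esub> u = h))"

text \<open>
  \<open>D\<close> is a direct sum (biproduct) of the family \<open>S\<close>: a product and a coproduct at the same time,
  with the projections and injections composing to the identity matrix.
\<close>

definition is_direct_sum :: "('o, 'm) cat \<Rightarrow> 'i set \<Rightarrow> ('i \<Rightarrow> 'o) \<Rightarrow> 'o \<Rightarrow> bool" where
  "is_direct_sum C I S D \<longleftrightarrow> D \<in> Ob C \<and> (\<forall>i\<in>I. S i \<in> Ob C) \<and>
    (\<exists>inj prj.
      (\<forall>i\<in>I. inj i \<in> Hom C (S i) D \<and> prj i \<in> Hom C D (S i)) \<and>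
      (\<forall>i\<in>I. \<forall>j\<in>I. inj i \<cdot>\<^bsub>C\<^esub> prj j = (if i = j then ident C (S i) else zero_mor C (S i) (S j))) \<and>
      (\<forall>W\<in>Ob C. \<forall>g. (\<forall>i\<in>I. g i \<in> Hom C (S i) W) \<longrightarrow>
        (\<exists>!u. u \<in> Hom C D W \<and> (\<forall>i\<in>I. inj i \<cdot>\<^bsub>C\<^esub> u = g i))) \<and>
      (\<forall>W\<in>Ob C. \<forall>g. (\<forall>i\<in>I. g i \<in> Hom C W (S i)) \<longrightarrow>
        (\<exists>!u. u \<in> Hom C W D \<and> (\<forall>i\<in>I. u \<cdot>\<^bsub>C\<^esub> prj i = g i))))"

abbreviation is_direct_sum2 :: "('o, 'm) cat \<Rightarrow> 'o \<Rightarrow> 'o \<Rightarrow> 'o \<Rightarrow> bool" where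
  "is_direct_sum2 C X Y D \<equiv> is_direct_sum C (UNIV :: bool set) (\<lambda>b. if b then X else Y) D"

locale abelian_category = category +
  assumes ex_zero_obj: "\<exists>Z. is_zero_obj C Z"
    and ex_direct_sum2: "\<lbrakk>X \<in> Ob C; Y \<in> Ob C\<rbrakk> \<Longrightarrow> \<exists>D. is_direct_sum2 C X Y D"
    and ex_kernel: "\<lbrakk>X \<in> Ob C; Y \<in> Ob C; f \<in> Hom C X Y\<rbrakk> \<Longrightarrow> \<exists>K k. is_kernel C X Y f K k"
    and ex_cokernel: "\<lbrakk>X \<in> Ob C; Y \<in> Ob C; f \<in> Hom C X Y\<rbrakk> \<Longrightarrow> \<exists>Q q. is_cokernel C X Y f Q q"
    and mono_normal: "\<lbrakk>X \<in> Ob C; Y \<in> Ob C; is_mono C X Y f\<rbrakk>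
      \<Longrightarrow> \<exists>Z\<in>Ob C. \<exists>g\<in>Hom C Y Z. is_kernel C Y Z g X f"
    and epi_normal: "\<lbrakk>X \<in> Ob C; Y \<in> Ob C; is_epi C X Y f\<rbrakk>
      \<Longrightarrow> \<exists>W\<in>Ob C. \<exists>g\<in>Hom C W X. is_cokernel C W X g Y f"

text \<open>
  A \<open>k\<close>-linear structure on \<open>C\<close>: \<open>H X Y\<close> is a \<open>k\<close>-vector space with underlying set \<open>Hom C X Y\<close>
  (the multiplicative part of the \<open>module\<close> record is irrelevant), and composition is bilinear.
\<close>

locale linear_category = category +
  fixes k :: "'k ring" and H :: "'o \<Rightarrow> 'o \<Rightarrow> ('k, 'm) module"
  assumes base_field: "field k"
    and Hom_module: "\<lbrakk>X \<in> Ob C; Y \<in> Ob C\<rbrakk> \<Longrightarrow> module k (H X Y)"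
    and carrier_Hom: "\<lbrakk>X \<in> Ob C; Y \<in> Ob C\<rbrakk> \<Longrightarrow> carrier (H X Y) = Hom C X Y"
    and cmp_add_left:
      "\<lbrakk>X \<in> Ob C; Y \<in> Ob C; Z \<in> Ob C; f \<in> Hom C X Y; f' \<in> Hom C X Y; g \<in> Hom C Y Z\<rbrakk>
        \<Longrightarrow> (f \<oplus>\<^bsub>H X Y\<^esub> f') \<cdot> g = (f \<cdot> g) \<oplus>\<^bsub>H X Z\<^esub> (f' \<cdot> g)"
    and cmp_add_right:
      "\<lbrakk>X \<in> Ob C; Y \<in> Ob C; Z \<in> Ob C; f \<in> Hom C X Y; g \<in> Hom C Y Z; g' \<in> Hom C Y Z\<rbrakk>
        \<Longrightarrow> f \<cdot> (g \<oplus>\<^bsub>H Y Z\<^esub> g') = (f \<cdot> g) \<oplus>\<^bsub>H X Z\<^esub> (f \<cdot> g')"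
    and cmp_smult_left:
      "\<lbrakk>X \<in> Ob C; Y \<in> Ob C; Z \<in> Ob C; a \<in> carrier k; f \<in> Hom C X Y; g \<in> Hom C Y Z\<rbrakk>
        \<Longrightarrow> (a \<odot>\<^bsub>H X Y\<^esub> f) \<cdot> g = a \<odot>\<^bsub>H X Z\<^esub> (f \<cdot> g)"
    and cmp_smult_right:
      "\<lbrakk>X \<in> Ob C; Y \<in> Ob C; Z \<in> Ob C; a \<in> carrier k; f \<in> Hom C X Y; g \<in> Hom C Y Z\<rbrakk>
        \<Longrightarrow> f \<cdot> (a \<odot>\<^bsub>H Y Z\<^esub> g) = a \<odot>\<^bsub>H X Z\<^esub> (f \<cdot> g)"

definition finite_dimensional :: "'k ring \<Rightarrow> ('k, 'm) module \<Rightarrow> bool" where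
  "finite_dimensional k V \<longleftrightarrow> (\<exists>B. finite B \<and> B \<subseteq> carrier V \<and>
     (\<forall>v\<in>carrier V. \<exists>c\<in>B \<rightarrow> carrier k. v = (\<Oplus>\<^bsub>V\<^esub>b\<in>B. c b \<odot>\<^bsub>V\<^esub> b)))"

definition hom_finite :: "('o, 'm) cat \<Rightarrow> 'k ring \<Rightarrow> ('o \<Rightarrow> 'o \<Rightarrow> ('k, 'm) module) \<Rightarrow> bool" where
  "hom_finite C k H \<longleftrightarrow> (\<forall>X\<in>Ob C. \<forall>Y\<in>Ob C. finite_dimensional k (H X Y))"


section \<open>Functors and natural transformations\<close>

definition is_functor ::
    "('o, 'm) cat \<Rightarrow> ('p, 'n) cat \<Rightarrow> ('o \<Rightarrow> 'p) \<Rightarrow> ('m \<Rightarrow> 'n) \<Rightarrow> bool" where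
  "is_functor C D Fo Fm \<longleftrightarrow>
    (\<forall>X\<in>Ob C. Fo X \<in> Ob D \<and> Fm (ident C X) = ident D (Fo X)) \<and>
    (\<forall>X\<in>Ob C. \<forall>Y\<in>Ob C. \<forall>f\<in>Hom C X Y. Fm f \<in> Hom D (Fo X) (Fo Y)) \<and>
    (\<forall>X\<in>Ob C. \<forall>Y\<in>Ob C. \<forall>Z\<in>Ob C. \<forall>f\<in>Hom C X Y. \<forall>g\<in>Hom C Y Z.
      Fm (f \<cdot>\<^bsub>C\<^esub> g) = Fm f \<cdot>\<^bsub>D\<^esub> Fm g)"

text \<open>The sequence \<open>0 \<rightarrow> X \<rightarrow> Y \<rightarrow> Z \<rightarrow> 0\<close> given by \<open>f\<close> and \<open>g\<close> is exact.\<close>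

definition short_exact :: "('o, 'm) cat \<Rightarrow> 'o \<Rightarrow> 'm \<Rightarrow> 'o \<Rightarrow> 'm \<Rightarrow> 'o \<Rightarrow> bool" where
  "short_exact C X f Y g Z \<longleftrightarrow> is_kernel C Y Z g X f \<and> is_cokernel C X Y f Z g"

text \<open>Between abelian categories such a functor is automatically additive.\<close>

definition is_exact_functor ::
    "('o, 'm) cat \<Rightarrow> ('p, 'n) cat \<Rightarrow> ('o \<Rightarrow> 'p) \<Rightarrow> ('m \<Rightarrow> 'n) \<Rightarrow> bool" where
  "is_exact_functor C D Fo Fm \<longleftrightarrow> is_functor C D Fo Fm \<and>
    (\<forall>X\<in>Ob C. \<forall>Y\<in>Ob C. \<forall>Z\<in>Ob C. \<forall>f\<in>Hom C X Y. \<forall>g\<in>Hom C Y Z.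
      short_exact C X f Y g Z \<longrightarrow> short_exact D (Fo X) (Fm f) (Fo Y) (Fm g) (Fo Z))"

definition is_nat_transf ::
    "('o, 'm) cat \<Rightarrow> ('p, 'n) cat \<Rightarrow> ('o \<Rightarrow> 'p) \<Rightarrow> ('m \<Rightarrow> 'n) \<Rightarrow> ('o \<Rightarrow> 'p) \<Rightarrow> ('m \<Rightarrow> 'n)
      \<Rightarrow> ('o \<Rightarrow> 'n) \<Rightarrow> bool" where
  "is_nat_transf C D Fo Fm Go Gm \<eta> \<longleftrightarrow>
    (\<forall>X\<in>Ob C. \<eta> X \<in> Hom D (Fo X) (Go X)) \<and>
    (\<forall>X\<in>Ob C. \<forall>Y\<in>Ob C. \<forall>f\<in>Hom C X Y. Fm f \<cdot>\<^bsub>D\<^esub> \<eta> Y = \<eta> X \<cdot>\<^bsub>D\<^esub> Gm f)"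


section \<open>Yoneda Ext and cotilting objects\<close>

text \<open>
  \<open>X \<rightarrow> Y \<rightarrow> Z\<close> is exact at \<open>Y\<close>: the image of \<open>f\<close>, that is, the kernel of a cokernel of \<open>f\<close>, is a
  kernel of \<open>g\<close>.
\<close>

definition exact_at :: "('o, 'm) cat \<Rightarrow> 'o \<Rightarrow> 'm \<Rightarrow> 'o \<Rightarrow> 'm \<Rightarrow> 'o \<Rightarrow> bool" where
  "exact_at C X f Y g Z \<longleftrightarrow>
    (\<exists>Q q I i. is_cokernel C X Y f Q q \<and> is_kernel C Y Q q I i \<and> is_kernel C Y Z g I i)"

text \<open>
  For \<open>n \<ge> 1\<close>, the \<open>n\<close>-extensions \<open>0 \<rightarrow> Y = E\<^sub>0 \<rightarrow> E\<^sub>1 \<rightarrow> \<dots> \<rightarrow> E\<^sub>n \<rightarrow> E\<^sub>n\<^sub>+\<^sub>1 = X \<rightarrow> 0\<close> of \<open>X\<close> by \<open>Y\<close>, with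
  \<open>d i : E\<^sub>i \<rightarrow> E\<^sub>i\<^sub>+\<^sub>1\<close>.
\<close>

definition extensions ::
    "('o, 'm) cat \<Rightarrow> nat \<Rightarrow> 'o \<Rightarrow> 'o \<Rightarrow> ((nat \<Rightarrow> 'o) \<times> (nat \<Rightarrow> 'm)) set" where
  "extensions C n X Y = {(E, d).
     E \<in> {0..Suc n} \<rightarrow>\<^sub>E Ob C \<and> d \<in> (\<Pi>\<^sub>E i\<in>{0..n}. Hom C (E i) (E (Suc i))) \<and>
     E 0 = Y \<and> E (Suc n) = X \<and>
     is_mono C (E 0) (E 1) (d 0) \<and> is_epi C (E n) (E (Suc n)) (d n) \<and>
     (\<forall>i\<in>{1..n}. exact_at C (E (i - 1)) (d (i - 1)) (E i) (d i) (E (Suc i)))}"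

text \<open>Pairs of extensions connected by a morphism of extensions that is the identity on both ends.\<close>

definition extension_step ::
    "('o, 'm) cat \<Rightarrow> nat \<Rightarrow> 'o \<Rightarrow> 'o \<Rightarrow> ((nat \<Rightarrow> 'o) \<times> (nat \<Rightarrow> 'm)) rel" where
  "extension_step C n X Y = {((E, d), (E', d')).
     (E, d) \<in> extensions C n X Y \<and> (E', d') \<in> extensions C n X Y \<and>
     (\<exists>u. (\<forall>i\<in>{0..Suc n}. u i \<in> Hom C (E i) (E' i)) \<and>
          u 0 = ident C Y \<and> u (Suc n) = ident C X \<and>
          (\<forall>i\<in>{0..n}. d i \<cdot>\<^bsub>C\<^esub> u (Suc i) = u i \<cdot>\<^bsub>C\<^esub> d' i))}"

text \<open>\<open>Ext\<^sup>n(X, Y)\<close> for \<open>n \<ge> 1\<close>, as the set of Yoneda equivalence classes.\<close>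

definition yoneda_Ext ::
    "('o, 'm) cat \<Rightarrow> nat \<Rightarrow> 'o \<Rightarrow> 'o \<Rightarrow> ((nat \<Rightarrow> 'o) \<times> (nat \<Rightarrow> 'm)) set set" where
  "yoneda_Ext C n X Y =
     extensions C n X Y // (extension_step C n X Y \<union> (extension_step C n X Y)\<inverse>)\<^sup>*"

text \<open>
  \<open>Ext\<^sup>n(X, Y) = 0\<close>, where \<open>Ext\<^sup>0 = Hom\<close>. For \<open>n \<ge> 1\<close> the group structure (Baer sum) is not needed:
  a group is zero if and only if its underlying set has exactly one element.
\<close>

definition Ext_zero :: "('o, 'm) cat \<Rightarrow> nat \<Rightarrow> 'o \<Rightarrow> 'o \<Rightarrow> bool" where
  "Ext_zero C n X Y \<longleftrightarrow>
    (if n = 0 then Hom C X Y = {zero_mor C X Y} else is_singleton (yoneda_Ext C n X Y))"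

definition cotilting :: "('o, 'm) cat \<Rightarrow> 'o \<Rightarrow> bool" where
  "cotilting C T \<longleftrightarrow> abelian_category C \<and> T \<in> Ob C \<and>
    (\<forall>i>0. Ext_zero C i T T) \<and>
    (\<forall>M\<in>Ob C. (\<forall>i. Ext_zero C i M T) \<longrightarrow> is_zero_obj C M)"


section \<open>The categories of sequences\<close>

text \<open>The full subcategory \<open>\<A>\<^sub>\<eta>\<close>.\<close>

definition ker_cat :: "('o, 'm) cat \<Rightarrow> ('o \<Rightarrow> 'o) \<Rightarrow> ('o \<Rightarrow> 'm) \<Rightarrow> ('o, 'm) cat" where
  "ker_cat A Fo \<eta> = A\<lparr>Ob := {M \<in> Ob A. \<eta> M = zero_mor A (Fo M) M}\<rparr>"

text \<open>\<open>path C X f i n\<close> is the composite \<open>f (i+1) \<cdot> \<dots> \<cdot> f (i+n)\<close>, starting at the object \<open>X\<close>.\<close>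

primrec path :: "('o, 'm) cat \<Rightarrow> 'o \<Rightarrow> (nat \<Rightarrow> 'm) \<Rightarrow> nat \<Rightarrow> nat \<Rightarrow> 'm" where
  "path C X f i 0 = ident C X"
| "path C X f i (Suc n) = path C X f i n \<cdot>\<^bsub>C\<^esub> f (i + n + 1)"

text \<open>
  The category \<open>\<A>[\<eta>\<^sup>1\<^sup>/\<^sup>p]\<close>. An object is a pair \<open>(M, f)\<close> of a family of objects \<open>M j\<close> and a family of
  structure maps \<open>f j : M\<^sub>j\<^sub>-\<^sub>1 \<rightarrow> M\<^sub>j\<close>, both indexed by \<open>1 \<le> j \<le> p\<close>; the entry \<open>M\<^sub>0 = F M\<^sub>p\<close> is not
  stored and is supplied by \<open>root_entry\<close>. Likewise \<open>root_comp\<close> supplies \<open>\<phi>\<^sub>0 = F \<phi>\<^sub>p\<close>.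
\<close>

definition root_entry :: "('o \<Rightarrow> 'o) \<Rightarrow> nat \<Rightarrow> (nat \<Rightarrow> 'o) \<Rightarrow> nat \<Rightarrow> 'o" where
  "root_entry Fo p M j = (if j = 0 then Fo (M p) else M j)"

definition root_comp :: "('m \<Rightarrow> 'm) \<Rightarrow> nat \<Rightarrow> (nat \<Rightarrow> 'm) \<Rightarrow> nat \<Rightarrow> 'm" where
  "root_comp Fm p \<phi> j = (if j = 0 then Fm (\<phi> p) else \<phi> j)"

definition root_cat ::
    "('o, 'm) cat \<Rightarrow> ('o \<Rightarrow> 'o) \<Rightarrow> ('m \<Rightarrow> 'm) \<Rightarrow> ('o \<Rightarrow> 'm) \<Rightarrow> nat
      \<Rightarrow> ((nat \<Rightarrow> 'o) \<times> (nat \<Rightarrow> 'm), nat \<Rightarrow> 'm) cat" where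
  "root_cat A Fo Fm \<eta> p = \<lparr>
     Ob = {(M, f).
       M \<in> {1..p} \<rightarrow>\<^sub>E Ob A \<and>
       f \<in> (\<Pi>\<^sub>E j\<in>{1..p}. Hom A (root_entry Fo p M (j - 1)) (M j)) \<and>
       (\<forall>j\<in>{1..p}. path A (Fo (M j)) (\<lambda>i. Fm (f i)) j (p - j) \<cdot>\<^bsub>A\<^esub> path A (Fo (M p)) f 0 j = \<eta> (M j))},
     Hom = (\<lambda>(M, f) (N, g). {\<phi> \<in> (\<Pi>\<^sub>E j\<in>{1..p}. Hom A (M j) (N j)).
       \<forall>j\<in>{1..p}. f j \<cdot>\<^bsub>A\<^esub> \<phi> j = root_comp Fm p \<phi> (j - 1) \<cdot>\<^bsub>A\<^esub> g j}),
     ident = (\<lambda>(M, f). \<lambda>j\<in>{1..p}. ident A (M j)),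
     cmp = (\<lambda>\<phi> \<psi>. \<lambda>j\<in>{1..p}. \<phi> j \<cdot>\<^bsub>A\<^esub> \<psi> j)\<rparr>"

text \<open>
  The category \<open>\<B>[0\<^sup>1\<^sup>/\<^sup>q]\<close>. Only the maps \<open>f j : M\<^sub>j\<^sub>-\<^sub>1 \<rightarrow> M\<^sub>j\<close> with \<open>2 \<le> j \<le> q\<close> are stored, since
  \<open>0 \<rightarrow> M\<^sub>1\<close> carries no information.
\<close>

definition seq_cat ::
    "('o, 'm) cat \<Rightarrow> nat \<Rightarrow> ((nat \<Rightarrow> 'o) \<times> (nat \<Rightarrow> 'm), nat \<Rightarrow> 'm) cat" where
  "seq_cat B q = \<lparr>
     Ob = {(M, f). M \<in> {1..q} \<rightarrow>\<^sub>E Ob B \<and> f \<in> (\<Pi>\<^sub>E j\<in>{2..q}. Hom B (M (j - 1)) (M j))},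
     Hom = (\<lambda>(M, f) (N, g). {\<phi> \<in> (\<Pi>\<^sub>E j\<in>{1..q}. Hom B (M j) (N j)).
       \<forall>j\<in>{2..q}. f j \<cdot>\<^bsub>B\<^esub> \<phi> j = \<phi> (j - 1) \<cdot>\<^bsub>B\<^esub> g j}),
     ident = (\<lambda>(M, f). \<lambda>j\<in>{1..q}. ident B (M j)),
     cmp = (\<lambda>\<phi> \<psi>. \<lambda>j\<in>{1..q}. \<phi> j \<cdot>\<^bsub>B\<^esub> \<psi> j)\<rparr>"

text \<open>
  Zero objects and direct sums are only determined up to isomorphism. The constructions below
  take the zero object \<open>z\<close> as an argument, and the values of \<open>\<delta>\<close> are described by a predicate.
\<close>

text \<open>\<open>0 \<rightarrow> M = \<dots> = M \<rightarrow> z \<rightarrow> \<dots> \<rightarrow> z\<close>, with \<open>M\<close> in the positions \<open>1, \<dots>, j\<close>.\<close>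

definition interval_seq ::
    "('o, 'm) cat \<Rightarrow> nat \<Rightarrow> 'o \<Rightarrow> 'o \<Rightarrow> nat \<Rightarrow> (nat \<Rightarrow> 'o) \<times> (nat \<Rightarrow> 'm)" where
  "interval_seq B q z M j =
     ((\<lambda>i\<in>{1..q}. if i \<le> j then M else z),
      (\<lambda>i\<in>{2..q}. if i \<le> j then ident B M else zero_mor B (if i - 1 \<le> j then M else z) z))"

text \<open>\<open>D\<close> is a value of the functor \<open>\<delta> : \<B> \<rightarrow> \<B>[0\<^sup>1\<^sup>/\<^sup>q]\<close> at \<open>M\<close>.\<close>

definition is_delta ::
    "('o, 'm) cat \<Rightarrow> nat \<Rightarrow> 'o \<Rightarrow> 'o \<Rightarrow> (nat \<Rightarrow> 'o) \<times> (nat \<Rightarrow> 'm) \<Rightarrow> bool" where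
  "is_delta B q z M D \<longleftrightarrow> is_direct_sum (seq_cat B q) {1..q} (interval_seq B q z M) D"

text \<open>\<open>\<iota>\<close> on objects: \<open>F z \<rightarrow> M\<^sub>1 \<rightarrow> \<dots> \<rightarrow> M\<^sub>p\<^sub>-\<^sub>1 \<rightarrow> z\<close>.\<close>

definition iota ::
    "('o, 'm) cat \<Rightarrow> ('o \<Rightarrow> 'o) \<Rightarrow> nat \<Rightarrow> 'o \<Rightarrow> (nat \<Rightarrow> 'o) \<times> (nat \<Rightarrow> 'm)
      \<Rightarrow> (nat \<Rightarrow> 'o) \<times> (nat \<Rightarrow> 'm)" where
  "iota A Fo p z = (\<lambda>(M, f).
     ((\<lambda>j\<in>{1..p}. if j < p then M j else z),
      (\<lambda>j\<in>{1..p}. if j = 1 then zero_mor A (Fo z) (M 1)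
                  else if j < p then f j else zero_mor A (M (p - 1)) z)))"

text \<open>\<open>\<pi>\<^sub>\<rho>\<close> on objects.\<close>

definition pi_rho ::
    "('o, 'm) cat \<Rightarrow> ('o \<Rightarrow> 'm) \<Rightarrow> nat \<Rightarrow> 'o \<Rightarrow> (nat \<Rightarrow> 'o) \<times> (nat \<Rightarrow> 'm)" where
  "pi_rho A \<eta> p M =
     ((\<lambda>j\<in>{1..p}. M), (\<lambda>j\<in>{1..p}. if j = 1 then \<eta> M else ident A M))"

end

theory Submission
  imports Defs
begin

text \<open>
  Split an extension into short exact sequences. Then \<open>Ext\<^sup>n(X, Y) = 0\<close> is equivalent to a statement about
  liftings after passing to covers of \<open>X\<close>, and in this form dimension shifting is elementary: if
  \<open>J\<close> is exact and has a left adjoint \<open>L\<close> that is exact on sufficiently many good objects, then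
  \<open>Ext(X, J Y)\<close> and \<open>Ext(L X, Y)\<close> vanish simultaneously for good \<open>X\<close>. This applies to \<open>\<pi>\<^sub>\<rho>\<close>, with left adjoint
  \<open>M \<mapsto> M\<^sub>p\<close>, and to the functors \<open>J\<^sub>j\<close> that put an object of \<open>\<A>\<^sub>\<eta>\<close> in the positions \<open>1, \<dots>, j\<close>, with left
  adjoint \<open>M \<mapsto> cok(F M\<^sub>p \<rightarrow> M\<^sub>j)\<close>, which is exact where \<open>\<eta>(M\<^sub>p)\<close> is a monomorphism. As \<open>\<iota> \<delta>(T)\<close> is the direct
  sum of the \<open>J\<^sub>j T\<close>, the conditions (1) and (2) give the vanishing of the self-extensions. If
  \<open>Ext(M, \<iota> \<delta>(T) \<oplus> \<pi>\<^sub>\<rho> U) = 0\<close> in all degrees, then \<open>M\<^sub>p = 0\<close> because \<open>U\<close> is cotilting, so that \<open>M\<close> is good, and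
  then \<open>M\<^sub>j = 0\<close> because \<open>T\<close> is cotilting.
\<close>

text \<open>Enough projectives or injectives are not assumed, and Yoneda equivalence is a zigzag of
  maps, so neither resolutions nor representatives give direct access to \<open>Ext\<close>. Covers
  replace both. A map \<open>g : W \<rightarrow> K'\<close> into the end of 0 -> K -> E -> K' -> 0
  lifts to \<open>E\<close> after an epimorphism \<open>P \<rightarrow> W\<close>, and the induced
  map on its kernel \<open>N\<close> carries the class with the degree lowered by one. Two lifts
  differ by a map to \<open>K\<close>, so covers may be refined freely.

  This freedom is what an adjoint with a small domain of exactness calls for. The functor cok(F M_p
  -> M_j) is only right exact; by the snake lemma it is exact where F M_p -> M_j is a monomorphism,
  and this follows from \<open>\<eta>\<close> being one at M_p, since that map is the composite F
  M_p -> M_j -> M_p. Refining each cover to a good \<open>P\<close> makes \<open>N\<close> good as a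
  subobject, and the induction on the degree goes through. Good covers come from the assumption on
  epimorphisms in the theorem. Condition (2) has its form because the cokernel belonging to pi_rho U
  is cok \<open>\<eta>\<close>(U) for every j.\<close>

notation cmp (infixl ";;\<index>" 70)
notation iff (infixr "<->" 25)

section \<open>Abelian categories\<close>

definition arr :: "('o, 'm) cat => 'm => 'o => 'o => bool" where
  "arr C f X Y <-> X \<in> Ob C \<and> Y \<in> Ob C \<and> f \<in> Hom C X Y"

lemma arrD: "arr C f X Y ==> X \<in> Ob C" "arr C f X Y ==> Y \<in> Ob C" "arr C f X Y ==> f \<in> Hom C X Y"
  by (auto simp: arr_def)

lemma arrI: "X \<in> Ob C ==> Y \<in> Ob C ==> f \<in> Hom C X Y ==> arr C f X Y"
  by (auto simp: arr_def)

context category begin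

lemma arr_ident[intro]: "X \<in> Ob C ==> arr C (ident C X) X X"
  by (auto simp: arr_def ident_in_Hom)

lemma arr_cmp[intro]: "arr C f X Y ==> arr C g Y Z ==> arr C (f ;; g) X Z"
  using cmp_in_Hom by (auto simp: arr_def)

lemma id_left[simp]: "arr C f X Y ==> ident C X ;; f = f"
  using ident_left by (auto simp: arr_def)

lemma id_right[simp]: "arr C f X Y ==> f ;; ident C Y = f"
  using ident_right by (auto simp: arr_def)

lemma arr_assoc:
  "arr C f W X ==> arr C g X Y ==> arr C h Y Z ==> (f ;; g) ;; h = f ;; (g ;; h)"
  using cmp_assoc by (auto simp: arr_def)

lemma zero_objD:
  assumes "is_zero_obj C Z"
  shows "Z \<in> Ob C"
    and "arr C f X Z ==> arr C g X Z ==> f = g"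
    and "arr C f Z X ==> arr C g Z X ==> f = g"
  using assms unfolding is_zero_obj_def arr_def by blast+

lemma zero_obj_ex:
  assumes "is_zero_obj C Z" "X \<in> Ob C"
  shows "\<exists>f. arr C f X Z" "\<exists>f. arr C f Z X"
  using assms unfolding is_zero_obj_def arr_def by blast+

text \<open>Two zero objects are linked by the map \<open>c\<close>, and uniqueness of maps into and
  out of zero objects makes both factorizations agree. This gives the definite description in
  \<open>zero_mor\<close> its meaning.\<close>

lemma zero_mor_eq:
  assumes Z: "is_zero_obj C Z" and a: "arr C a X Z" and b: "arr C b Z Y"
  shows "zero_mor C X Y = a ;; b"
  unfolding zero_mor_def
proof (rule the_equality)
  show "\<exists>Z a' b'. is_zero_obj C Z \<and> a' \<in> Hom C X Z \<and> b' \<in> Hom C Z Y \<and> a ;; b = a' ;; b'"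
    using assms by (auto simp: arr_def)
next
  fix f assume "\<exists>Z a b. is_zero_obj C Z \<and> a \<in> Hom C X Z \<and> b \<in> Hom C Z Y \<and> f = a ;; b"
  then obtain Z' a' b' where Z': "is_zero_obj C Z'" and a': "a' \<in> Hom C X Z'"
    and b': "b' \<in> Hom C Z' Y" and f: "f = a' ;; b'" by blast
  have A': "arr C a' X Z'" "arr C b' Z' Y"
    using a' b' zero_objD(1)[OF Z'] a b by (auto simp: arr_def)
  obtain c where c: "arr C c Z Z'" using zero_obj_ex(1)[OF Z' zero_objD(1)[OF Z]] by blast
  have "a' = a ;; c" using zero_objD(2)[OF Z' A'(1)] a c by blast
  moreover have "b = c ;; b'" using zero_objD(3)[OF Z b] A' c by blast
  ultimately show "f = a ;; b" using f arr_assoc[OF a c A'(2)] by simp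
qed

end

text \<open>
  The composition and addition laws are unconditional: ill-typed composites are required to obey
  them too. Every \<open>k\<close>-linear category can be presented like this, by adding a junk morphism.
\<close>

locale abcat = abelian_category C for C :: "('o, 'm) cat" (structure) +
  fixes pls :: "'m => 'm => 'm" (infixl \<open>\<boxplus>\<close> 65)
    and ng :: "'m => 'm"
  assumes assoc: "(f ;; g) ;; h = f ;; (g ;; h)"
    and pls_assoc: "(f \<boxplus> g) \<boxplus> h = f \<boxplus> (g \<boxplus> h)"
    and pls_comm: "f \<boxplus> g = g \<boxplus> f"
    and distl: "(f \<boxplus> g) ;; h = f ;; h \<boxplus> g ;; h"
    and distr: "f ;; (g \<boxplus> h) = f ;; g \<boxplus> f ;; h"
    and ngl: "ng f ;; g = ng (f ;; g)"
    and ngr: "f ;; ng g = ng (f ;; g)"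
    and arr_pls[intro]: "arr C f X Y ==> arr C g X Y ==> arr C (f \<boxplus> g) X Y"
    and arr_ng[intro]: "arr C f X Y ==> arr C (ng f) X Y"
    and pls_zero[simp]: "arr C f X Y ==> f \<boxplus> zero_mor C X Y = f"
    and pls_ng: "arr C f X Y ==> f \<boxplus> ng f = zero_mor C X Y"
begin

abbreviation ar where "ar \<equiv> arr C"
abbreviation zr where "zr \<equiv> zero_mor C"
abbreviation idt where "idt \<equiv> ident C"

lemma pls_left_comm: "f \<boxplus> (g \<boxplus> h) = g \<boxplus> (f \<boxplus> h)"
  by (metis pls_assoc pls_comm)

lemma ar_zr[intro, simp]: assumes "X \<in> Ob C" "Y \<in> Ob C" shows "ar (zr X Y) X Y"
  by (metis arr_cmp ex_zero_obj zero_obj_ex assms zero_mor_eq)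

lemma zr_left[simp]: assumes f: "ar f Y Z" and X: "X \<in> Ob C" shows "zr X Y ;; f = zr X Z"
proof -
  obtain N where N: "is_zero_obj C N" using ex_zero_obj by blast
  obtain a b where a: "ar a X N" and b: "ar b N Y" using zero_obj_ex[OF N] X f arrD by metis
  show ?thesis using zero_mor_eq[OF N a b] zero_mor_eq[OF N a arr_cmp[OF b f]] assoc by metis
qed

lemma zr_right[simp]: assumes f: "ar f X Y" and Z: "Z \<in> Ob C" shows "f ;; zr Y Z = zr X Z"
proof -
  obtain N where N: "is_zero_obj C N" using ex_zero_obj by blast
  obtain a b where a: "ar a Y N" and b: "ar b N Z" using zero_obj_ex[OF N] Z f arrD by metis
  show ?thesis using zero_mor_eq[OF N a b] zero_mor_eq[OF N arr_cmp[OF f a] b] assoc by metis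
qed

lemma zr_simps[simp]:
  "X \<in> Ob C ==> Y \<in> Ob C ==> idt X ;; zr X Y = zr X Y"
  "X \<in> Ob C ==> Y \<in> Ob C ==> zr X Y ;; idt Y = zr X Y"
  "X \<in> Ob C ==> Y \<in> Ob C ==> Z \<in> Ob C ==> zr X Y ;; zr Y Z = zr X Z"
  "X \<in> Ob C ==> Y \<in> Ob C ==> zr X Y \<boxplus> zr X Y = zr X Y"
  by (auto intro: zr_left zr_right pls_zero id_left id_right)

text \<open>If the identity of \<open>Z\<close> is zero, every map into or out of \<open>Z\<close>
  is zero by composing with it. In this form being zero is an equation, which for diagrams can be
  checked entry by entry.\<close>

lemma zero_obj_iff: "is_zero_obj C Z <-> Z \<in> Ob C \<and> idt Z = zr Z Z"
proof
  assume "is_zero_obj C Z" then show "Z \<in> Ob C \<and> idt Z = zr Z Z"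
    by (metis zero_objD ar_zr arr_ident)
next
  assume a: "Z \<in> Ob C \<and> idt Z = zr Z Z"
  have "f = zr X Z" if "ar f X Z" for f X using id_right[OF that] zr_right[OF that] a by metis
  moreover have "f = zr Z X" if "ar f Z X" for f X using id_left[OF that] zr_left[OF that] a by metis
  ultimately show "is_zero_obj C Z"
    unfolding is_zero_obj_def using a ar_zr by (metis arr_def)
qed

lemma to_zero: "is_zero_obj C Z ==> ar f X Z ==> f = zr X Z"
  by (metis zero_objD(2) ar_zr arrD)

lemma from_zero: "is_zero_obj C Z ==> ar f Z X ==> f = zr Z X"
  by (metis zero_objD(3) ar_zr arrD)

lemma pls_zero'[simp]: "ar f X Y ==> zr X Y \<boxplus> f = f"
  using pls_comm pls_zero by metis

lemma ng_pls: "ar f X Y ==> ng f \<boxplus> f = zr X Y"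
  using pls_comm pls_ng by metis

lemma pls_cancel: assumes "ar f X Y" "ar g X Y" "ar h X Y" shows "h \<boxplus> f = h \<boxplus> g <-> f = g"
  by (metis assms ng_pls pls_assoc pls_zero')

lemma sub_zero_iff: assumes "ar f X Y" "ar g X Y" shows "f \<boxplus> ng g = zr X Y <-> f = g"
  by (metis assms arr_ng pls_cancel pls_comm pls_ng)

lemma sub_eq_iff: assumes "ar f X Y" "ar g X Y" "ar h X Y" shows "f \<boxplus> ng g = h <-> f = g \<boxplus> h"
proof -
  have "f \<boxplus> ng g = h <-> g \<boxplus> (f \<boxplus> ng g) = g \<boxplus> h"
    using pls_cancel[of "f \<boxplus> ng g" X Y h g] assms by (metis arr_ng arr_pls)
  also have "g \<boxplus> (f \<boxplus> ng g) = f"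
    by (metis assms pls_left_comm pls_ng pls_zero)
  finally show ?thesis .
qed

lemma monoI:
  assumes "ar f X Y" "\<And>W g. ar g W X ==> g ;; f = zr W Y ==> g = zr W X"
  shows "is_mono C X Y f"
  unfolding is_mono_def
proof (intro conjI ballI impI)
  fix W g h assume "W \<in> Ob C" "g \<in> Hom C W X" "h \<in> Hom C W X" and e: "g ;; f = h ;; f"
  then have g: "ar g W X" "ar h W X" using assms(1) by (auto simp: arr_def)
  have "(g \<boxplus> ng h) ;; f = zr W Y" using e g assms(1) by (metis distl ngl pls_ng arr_cmp)
  then have "g \<boxplus> ng h = zr W X" using assms(2) g by (meson arr_ng arr_pls)
  then show "g = h" using sub_zero_iff g by metis
qed (use assms(1) in \<open>auto simp: arr_def\<close>)

lemma epiI: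
  assumes "ar f X Y" "\<And>W g. ar g Y W ==> f ;; g = zr X W ==> g = zr Y W"
  shows "is_epi C X Y f"
  unfolding is_epi_def
proof (intro conjI ballI impI)
  fix W g h assume "W \<in> Ob C" "g \<in> Hom C Y W" "h \<in> Hom C Y W" and e: "f ;; g = f ;; h"
  then have g: "ar g Y W" "ar h Y W" using assms(1) by (auto simp: arr_def)
  have "f ;; (g \<boxplus> ng h) = zr X W" using e g assms(1) by (metis distr ngr pls_ng arr_cmp)
  then have "g \<boxplus> ng h = zr Y W" using assms(2) g by (meson arr_ng arr_pls)
  then show "g = h" using sub_zero_iff g by metis
qed (use assms(1) in \<open>auto simp: arr_def\<close>)

lemma monoD: "is_mono C X Y f ==> ar g W X ==> ar h W X ==> g ;; f = h ;; f ==> g = h"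
  unfolding is_mono_def arr_def by blast

lemma epiD: "is_epi C X Y f ==> ar g Y W ==> ar h Y W ==> f ;; g = f ;; h ==> g = h"
  unfolding is_epi_def arr_def by blast

lemma mono_arr: "is_mono C X Y f ==> X \<in> Ob C ==> Y \<in> Ob C ==> ar f X Y"
  by (simp add: arr_def is_mono_def)

lemma epi_arr: "is_epi C X Y f ==> X \<in> Ob C ==> Y \<in> Ob C ==> ar f X Y"
  by (simp add: arr_def is_epi_def)

lemma monoD0: assumes "is_mono C X Y f" "Y \<in> Ob C" "ar g W X" "g ;; f = zr W Y" shows "g = zr W X"
proof -
  have O: "W \<in> Ob C" "X \<in> Ob C" using assms(3) by (simp_all add: arr_def)
  show ?thesis using monoD[OF assms(1,3) ar_zr[OF O]] zr_left[OF mono_arr[OF assms(1) O(2) assms(2)] O(1)] assms(4) by simp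
qed

lemma epiD0: assumes "is_epi C X Y f" "X \<in> Ob C" "ar g Y W" "f ;; g = zr X W" shows "g = zr Y W"
proof -
  have O: "W \<in> Ob C" "Y \<in> Ob C" using assms(3) by (simp_all add: arr_def)
  show ?thesis using epiD[OF assms(1,3) ar_zr[OF O(2,1)]] zr_right[OF epi_arr[OF assms(1,2) O(2)] O(1)] assms(4) by simp
qed

lemma mono_cmp: assumes "ar f X Y" "ar g Y Z" "is_mono C X Y f" "is_mono C Y Z g" shows "is_mono C X Z (f ;; g)"
proof (rule monoI[OF arr_cmp[OF assms(1,2)]])
  fix W h assume h: "ar h W X" "h ;; (f ;; g) = zr W Z"
  have "h ;; f = zr W Y"
    using monoD0[OF assms(4) arrD(2)[OF assms(2)] arr_cmp[OF h(1) assms(1)]] h(2) by (simp add: assoc)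
  then show "h = zr W X" by (rule monoD0[OF assms(3) arrD(2)[OF assms(1)] h(1)])
qed

lemma epi_cmp: assumes "ar f X Y" "ar g Y Z" "is_epi C X Y f" "is_epi C Y Z g" shows "is_epi C X Z (f ;; g)"
proof (rule epiI[OF arr_cmp[OF assms(1,2)]])
  fix W h assume h: "ar h Z W" "f ;; g ;; h = zr X W"
  have "g ;; h = zr Y W"
    using epiD0[OF assms(3) arrD(1)[OF assms(1)] arr_cmp[OF assms(2) h(1)]] h(2) by (simp add: assoc)
  then show "h = zr Z W" by (rule epiD0[OF assms(4) arrD(1)[OF assms(2)] h(1)])
qed

lemma mono_left: assumes "ar f X Y" "ar g Y Z" "is_mono C X Z (f ;; g)" shows "is_mono C X Y f"
proof (rule monoI[OF assms(1)])
  fix W h assume h: "ar h W X" "h ;; f = zr W Y"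
  have "h ;; (f ;; g) = zr W Z" using zr_left[OF assms(2) arrD(1)[OF h(1)]] by (simp add: assoc[symmetric] h)
  then show "h = zr W X" using monoD0[OF assms(3) arrD(2)[OF assms(2)] h(1)] by simp
qed

lemma epi_right: assumes "ar f X Y" "ar g Y Z" "is_epi C X Z (f ;; g)" shows "is_epi C Y Z g"
proof (rule epiI[OF assms(2)])
  fix W h assume h: "ar h Z W" "g ;; h = zr Y W"
  have "(f ;; g) ;; h = zr X W" using zr_right[OF assms(1) arrD(2)[OF h(1)]] by (simp add: assoc h)
  then show "h = zr Z W" using epiD0[OF assms(3) arrD(1)[OF assms(1)] h(1)] by simp
qed

lemma id_mono[intro, simp]: "X \<in> Ob C ==> is_mono C X X (idt X)"
  by (rule monoI) auto

lemma id_epi[intro, simp]: "X \<in> Ob C ==> is_epi C X X (idt X)"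
  by (rule epiI) auto

lemma kernelD:
  assumes "is_kernel C X Y f K k" "X \<in> Ob C"
  shows "ar k K X" "k ;; f = zr K Y"
    and "ar h W X ==> h ;; f = zr W Y ==> \<exists>u. ar u W K \<and> u ;; k = h"
    and "ar u W K ==> ar v W K ==> ar f X Y ==> u ;; k = v ;; k ==> u = v"
proof -
  show 1: "ar k K X" "k ;; f = zr K Y" using assms by (auto simp: is_kernel_def arr_def)
  show "\<exists>u. ar u W K \<and> u ;; k = h" if "ar h W X" "h ;; f = zr W Y"
    using that assms unfolding is_kernel_def arr_def by metis
  show "u = v" if u: "ar u W K" "ar v W K" and f: "ar f X Y" and e: "u ;; k = v ;; k"
  proof -
    have *: "ar (u ;; k) W X" "(u ;; k) ;; f = zr W Y"
      using 1 u f by (auto simp: assoc arrD)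
    then have "\<exists>!w. w \<in> Hom C W K \<and> w ;; k = u ;; k"
      using assms unfolding is_kernel_def arr_def by blast
    then show ?thesis using e u unfolding arr_def by auto
  qed
qed

lemma kernelI:
  assumes "ar f X Y" "ar k K X" "k ;; f = zr K Y"
    and "\<And>W h. ar h W X ==> h ;; f = zr W Y ==> \<exists>u. ar u W K \<and> u ;; k = h"
    and "is_mono C K X k"
  shows "is_kernel C X Y f K k"
  unfolding is_kernel_def
proof (intro conjI ballI impI)
  fix W h assume "W \<in> Ob C" "h \<in> Hom C W X" "h ;; f = zr W Y"
  then obtain u where u: "ar u W K" "u ;; k = h" using assms by (metis arr_def)
  show "\<exists>!u. u \<in> Hom C W K \<and> u ;; k = h"
    using u assms(5) monoD by (intro ex1I[of _ u]) (auto simp: arr_def)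
qed (use assms in \<open>auto simp: arr_def\<close>)

lemma kernel_mono:
  assumes "is_kernel C X Y f K k" "ar f X Y" shows "is_mono C K X k"
  using kernelD[OF assms(1)] assms(2)
  by (intro monoI) (auto simp: arr_def, metis ar_zr arr_def zr_left)

lemma cokernelD:
  assumes "is_cokernel C X Y f Q q" "Y \<in> Ob C"
  shows "ar q Y Q" "f ;; q = zr X Q"
    and "ar h Y W ==> f ;; h = zr X W ==> \<exists>u. ar u Q W \<and> q ;; u = h"
    and "ar u Q W ==> ar v Q W ==> ar f X Y ==> q ;; u = q ;; v ==> u = v"
proof -
  show 1: "ar q Y Q" "f ;; q = zr X Q" using assms by (auto simp: is_cokernel_def arr_def)
  show "\<exists>u. ar u Q W \<and> q ;; u = h" if "ar h Y W" "f ;; h = zr X W"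
    using that assms unfolding is_cokernel_def arr_def by metis
  show "u = v" if u: "ar u Q W" "ar v Q W" and f: "ar f X Y" and e: "q ;; u = q ;; v"
  proof -
    have *: "ar (q ;; u) Y W" "f ;; (q ;; u) = zr X W"
      using 1 u f by (auto simp: assoc[symmetric] arrD)
    then have "\<exists>!w. w \<in> Hom C Q W \<and> q ;; w = q ;; u"
      using assms unfolding is_cokernel_def arr_def by blast
    then show ?thesis using e u unfolding arr_def by auto
  qed
qed

lemma cokernelI:
  assumes "ar f X Y" "ar q Y Q" "f ;; q = zr X Q"
    and "\<And>W h. ar h Y W ==> f ;; h = zr X W ==> \<exists>u. ar u Q W \<and> q ;; u = h"
    and "is_epi C Y Q q"
  shows "is_cokernel C X Y f Q q"
  unfolding is_cokernel_def
proof (intro conjI ballI impI)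
  fix W h assume "W \<in> Ob C" "h \<in> Hom C Y W" "f ;; h = zr X W"
  then obtain u where u: "ar u Q W" "q ;; u = h" using assms by (metis arr_def)
  show "\<exists>!u. u \<in> Hom C Q W \<and> q ;; u = h"
    using u assms(5) epiD by (intro ex1I[of _ u]) (auto simp: arr_def)
qed (use assms in \<open>auto simp: arr_def\<close>)

lemma cokernel_epi:
  assumes "is_cokernel C X Y f Q q" "ar f X Y" shows "is_epi C Y Q q"
  using cokernelD[OF assms(1)] assms(2)
  by (intro epiI) (auto simp: arr_def, metis ar_zr arr_def zr_right)

lemma obtain_kernel:
  assumes "ar f X Y"
  obtains K k where "is_kernel C X Y f K k" "is_mono C K X k" "ar k K X" "k ;; f = zr K Y"
  using ex_kernel assms kernel_mono kernelD(1,2) by (metis arrD)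

lemma obtain_cokernel:
  assumes "ar f X Y"
  obtains Q q where "is_cokernel C X Y f Q q" "is_epi C Y Q q" "ar q Y Q" "f ;; q = zr X Q"
  using ex_cokernel assms cokernel_epi cokernelD(1,2) by (metis arrD)

text \<open>Normality makes \<open>m\<close> the kernel of some \<open>g\<close>, and
  \<open>g\<close> factors through the cokernel \<open>q\<close>. Whatever is killed by
  \<open>q\<close> is therefore killed by \<open>g\<close> and factors through
  \<open>m\<close>.\<close>

lemma mono_kernel_of_cokernel:
  assumes m: "is_mono C X Y m" "ar m X Y" and c: "is_cokernel C X Y m Q q"
  shows "is_kernel C Y Q q X m"
proof -
  obtain Z g where Z: "Z \<in> Ob C" "g \<in> Hom C Y Z" "is_kernel C Y Z g X m"
    using mono_normal m arrD by metis
  have g: "ar g Y Z" using Z m arrD by (auto simp: arr_def)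
  have Y: "Y \<in> Ob C" using m arrD by metis
  obtain v where v: "ar v Q Z" "q ;; v = g"
    using cokernelD(3)[OF c Y g] kernelD(2)[OF Z(3) Y] by blast
  show ?thesis
  proof (rule kernelI)
    fix W h assume h: "ar h W Y" "h ;; q = zr W Q"
    have "h ;; g = zr W Z" using h v by (metis assoc zr_left arrD(1))
    then show "\<exists>u. ar u W X \<and> u ;; m = h" using kernelD(3)[OF Z(3) Y h(1)] by blast
  qed (use cokernelD[OF c Y] m in auto)
qed

lemma epi_cokernel_of_kernel:
  assumes e: "is_epi C X Y e" "ar e X Y" and c: "is_kernel C X Y e K k"
  shows "is_cokernel C K X k Y e"
proof -
  obtain Z g where Z: "Z \<in> Ob C" "g \<in> Hom C Z X" "is_cokernel C Z X g Y e"
    using epi_normal e arrD by metis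
  have g: "ar g Z X" using Z e arrD by (auto simp: arr_def)
  have X: "X \<in> Ob C" using e arrD by metis
  obtain v where v: "ar v Z K" "v ;; k = g"
    using kernelD(3)[OF c X g] cokernelD(2)[OF Z(3) X] by blast
  show ?thesis
  proof (rule cokernelI)
    fix W h assume h: "ar h X W" "k ;; h = zr K W"
    have "g ;; h = zr Z W" using h v by (metis assoc zr_right arrD(2))
    then show "\<exists>u. ar u Y W \<and> e ;; u = h" using cokernelD(3)[OF Z(3) X h(1)] by blast
  qed (use kernelD[OF c X] e in auto)
qed

lemma ses_iff:
  assumes "ar g Y Z"
  shows "short_exact C X f Y g Z <-> is_kernel C Y Z g X f \<and> is_epi C Y Z g"
  unfolding short_exact_def
  using epi_cokernel_of_kernel[OF _ assms] cokernel_epi kernelD(1)[of Y Z g X f] assms arrD by metis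

lemma ses_iff':
  assumes "ar f X Y"
  shows "short_exact C X f Y g Z <-> is_cokernel C X Y f Z g \<and> is_mono C X Y f"
  unfolding short_exact_def
  using mono_kernel_of_cokernel[OF _ assms] kernel_mono cokernelD(1)[of X Y f Z g] assms arrD by metis

lemma sesD:
  assumes "short_exact C X f Y g Z" "Y \<in> Ob C"
  shows "ar f X Y" "ar g Y Z" "is_kernel C Y Z g X f" "is_cokernel C X Y f Z g"
    "is_mono C X Y f" "is_epi C Y Z g" "f ;; g = zr X Z"
proof -
  show *: "is_kernel C Y Z g X f" "is_cokernel C X Y f Z g"
    using assms by (auto simp: short_exact_def)
  show "ar f X Y" "ar g Y Z" "f ;; g = zr X Z"
    using kernelD[OF *(1) assms(2)] cokernelD[OF *(2) assms(2)] by auto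
  then show "is_mono C X Y f" "is_epi C Y Z g" using * kernel_mono cokernel_epi by metis+
qed

lemma epi_ses:
  assumes "is_epi C P W e" "ar e P W"
  obtains N m where "short_exact C N m P e W"
  using obtain_kernel[OF assms(2)] ses_iff[OF assms(2)] assms by metis

lemma mono_ses:
  assumes "is_mono C X Y f" "ar f X Y"
  obtains Z g where "short_exact C X f Y g Z"
  using obtain_cokernel[OF assms(2)] ses_iff'[OF assms(2)] assms by metis

text \<open>For \<open>e\<close> to be an epimorphism, let \<open>e ;; g\<close> be zero. Then
  \<open>e\<close> factors through the kernel \<open>k\<close> of \<open>g\<close>, so the cokernel
  \<open>d\<close> of \<open>k ;; m\<close> kills \<open>f\<close>, factors through \<open>q\<close>
  and kills \<open>m\<close>. Hence \<open>m\<close> factors through \<open>k ;; m\<close>, which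
  gives \<open>k\<close> a section and forces \<open>g\<close> to be zero.\<close>

lemma image_fact:
  assumes f: "ar f X Y" and c: "is_cokernel C X Y f Q q" and k: "is_kernel C Y Q q I m"
  shows "\<exists>e. ar e X I \<and> e ;; m = f \<and> is_epi C X I e"
proof -
  have Y: "Y \<in> Ob C" using f arrD by metis
  note c' = cokernelD[OF c Y]
  note k' = kernelD[OF k Y]
  have m: "is_mono C I Y m" using kernel_mono k c' by metis
  obtain e where e: "ar e X I" "e ;; m = f" using k'(3)[OF f c'(2)] by blast
  have "is_epi C X I e"
  proof (rule epiI[OF e(1)])
    fix W g assume g: "ar g I W" "e ;; g = zr X W"
    obtain K k where k: "is_kernel C I W g K k" "is_mono C K I k" "ar k K I" "k ;; g = zr K W"
      using obtain_kernel[OF g(1)] .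
    obtain e' where e': "ar e' X K" "e' ;; k = e"
      using kernelD(3)[OF k(1) _ e(1) g(2)] g arrD by metis
    have km: "is_mono C K Y (k ;; m)" "ar (k ;; m) K Y" using k m k'(1) mono_cmp by auto
    obtain D d where d: "is_cokernel C K Y (k ;; m) D d" "ar d Y D" "(k ;; m) ;; d = zr K D"
      using obtain_cokernel[OF km(2)] .
    have "f ;; d = zr X D" using d(3) e' e by (metis assoc zr_right arrD(2) d(2))
    then obtain v where v: "ar v Q D" "q ;; v = d" using c'(3)[OF d(2)] by blast
    have "m ;; d = zr I D" using v k'(2) k'(1) by (metis assoc zr_left arrD(1))
    then obtain w where w: "ar w I K" "w ;; (k ;; m) = m"
      using kernelD(3)[OF mono_kernel_of_cokernel[OF km d(1)] Y k'(1)] by blast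
    have "w ;; k = idt I" using monoD[OF m, of "w ;; k" I "idt I"] w k(3) k'(1)
      by (metis arr_cmp arr_ident assoc id_left arrD(2))
    then show "g = zr I W" using k(4) w(1) g by (metis assoc id_left zr_right arrD(2))
  qed
  then show ?thesis using e by blast
qed

lemma mono_epi_iso:
  assumes "ar f X Y" "is_mono C X Y f" "is_epi C X Y f"
  obtains g where "ar g Y X" "f ;; g = idt X" "g ;; f = idt Y"
proof -
  obtain Q q where q: "is_cokernel C X Y f Q q" "ar q Y Q" "f ;; q = zr X Q"
    using obtain_cokernel[OF assms(1)] .
  have Y: "X \<in> Ob C" "Y \<in> Ob C" "Q \<in> Ob C" using assms(1) q arrD by metis+
  have "q = zr Y Q" using epiD0[OF assms(3) Y(1) q(2,3)] .
  then have "idt Y ;; q = zr Y Q" using Y q(2) by simp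
  then obtain g where g: "ar g Y X" "g ;; f = idt Y"
    using kernelD(3)[OF mono_kernel_of_cokernel[OF assms(2,1) q(1)] Y(2)] Y by blast
  moreover have "f ;; g = idt X"
    using monoD[OF assms(2), of "f ;; g" X "idt X"] g assms(1) Y
    by (metis arr_cmp arr_ident assoc id_left id_right)
  ultimately show ?thesis using that by blast
qed

text \<open>Factoring through a monomorphism can be tested after an epimorphism: the cokernel of
  \<open>j\<close> kills \<open>e ;; x\<close>, hence \<open>x\<close>. This ends the diagram
  chases, where maps out of a cover play the role of elements.\<close>

lemma epi_descent:
  assumes j: "is_mono C X Y j" "ar j X Y" and e: "is_epi C P W e" "ar e P W"
    and x: "ar x W Y" and y: "ar y P X" "y ;; j = e ;; x"
  shows "\<exists>u. ar u W X \<and> u ;; j = x"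
proof -
  obtain Q q where q: "is_cokernel C X Y j Q q" "ar q Y Q" "j ;; q = zr X Q"
    using obtain_cokernel[OF j(2)] .
  have "e ;; (x ;; q) = zr P Q" using y q by (metis assoc zr_right arrD(2))
  then have "x ;; q = zr W Q" using epiD0[OF e(1)] e(2) x q(2) by (meson arr_cmp arrD)
  then show ?thesis
    using kernelD(3)[OF mono_kernel_of_cokernel[OF j q(1)] _ x] j arrD by metis
qed

text \<open>The last equation is the uniqueness clause of the coproduct property: both sides have
  the injections themselves as their restrictions to the summands.\<close>

lemma direct_sum2D:
  assumes "X \<in> Ob C" "Y \<in> Ob C" and D: "is_direct_sum2 C X Y D"
  obtains i1 i2 p1 p2 where "ar i1 X D" "ar i2 Y D" "ar p1 D X" "ar p2 D Y"
    "i1 ;; p1 = idt X" "i2 ;; p2 = idt Y" "i1 ;; p2 = zr X Y" "i2 ;; p1 = zr Y X"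
    "p1 ;; i1 \<boxplus> p2 ;; i2 = idt D"
proof -
  let ?S = "\<lambda>b. if b then X else Y"
  have DO: "D \<in> Ob C" using D by (simp add: is_direct_sum_def)
  obtain inj prj where
    ip: "\<forall>i\<in>UNIV. inj i \<in> Hom C (?S i) D \<and> prj i \<in> Hom C D (?S i)" and
    c: "\<forall>i\<in>UNIV. \<forall>j\<in>UNIV. inj i ;; prj j = (if i = j then idt (?S i) else zr (?S i) (?S j))" and
    u: "\<forall>W\<in>Ob C. \<forall>g. (\<forall>i\<in>UNIV. g i \<in> Hom C (?S i) W) -->
        (\<exists>!u. u \<in> Hom C D W \<and> (\<forall>i\<in>UNIV. inj i ;; u = g i))"
    using D unfolding is_direct_sum_def by (elim conjE exE) rule
  have a: "ar (inj True) X D" "ar (inj False) Y D" "ar (prj True) D X" "ar (prj False) D Y"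
    using bspec[OF ip, of True] bspec[OF ip, of False] assms DO by (auto simp: arr_def)
  have e: "inj True ;; prj True = idt X" "inj False ;; prj False = idt Y"
    "inj True ;; prj False = zr X Y" "inj False ;; prj True = zr Y X"
    using c by auto
  have ex: "\<exists>!u. u \<in> Hom C D D \<and> (\<forall>i\<in>UNIV. inj i ;; u = inj i)"
    using u[rule_format, of D inj] DO ip by auto
  let ?u = "prj True ;; inj True \<boxplus> prj False ;; inj False"
  have au: "ar ?u D D" using a by blast
  have "inj True ;; ?u = inj True"
    using a e assms by (simp add: distr assoc[symmetric])
  moreover have "inj False ;; ?u = inj False"
    using a e assms by (simp add: distr assoc[symmetric])
  ultimately have "\<forall>i\<in>UNIV. inj i ;; ?u = inj i" by (metis (full_types))
  moreover have "\<forall>i\<in>UNIV. inj i ;; idt D = inj i"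
    using a by (metis (full_types) id_right)
  ultimately have "?u = idt D"
    using ex au DO ident_in_Hom[OF DO] by (metis arrD(3))
  then show ?thesis using that a e by blast
qed

lemma sum2:
  assumes "X \<in> Ob C" "Y \<in> Ob C"
  obtains D i1 i2 p1 p2 where "ar i1 X D" "ar i2 Y D" "ar p1 D X" "ar p2 D Y"
    "i1 ;; p1 = idt X" "i2 ;; p2 = idt Y" "i1 ;; p2 = zr X Y" "i2 ;; p1 = zr Y X"
    "p1 ;; i1 \<boxplus> p2 ;; i2 = idt D"
proof -
  obtain D where "is_direct_sum2 C X Y D" using ex_direct_sum2 assms by blast
  from direct_sum2D[OF assms this] show ?thesis using that by metis
qed

text \<open>\<open>P\<close> is the kernel of the difference map \<open>?d\<close> on the direct
  sum. If \<open>g\<close> is an epimorphism, so is \<open>?d\<close>, because its restriction to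
  \<open>Y\<close> is \<open>ng g\<close>; thus \<open>?d\<close> is the cokernel of
  \<open>k\<close>. A map \<open>t\<close> killed by \<open>k ;; p1\<close> then gives
  \<open>p1 ;; t = ?d ;; r\<close>; restricting to \<open>Y\<close> yields \<open>r = 0\<close>, and
  so \<open>t\<close> vanishes.\<close>

lemma pullback:
  assumes f: "ar f X Z" and g: "ar g Y Z"
  obtains P p1 p2 where "ar p1 P X" "ar p2 P Y" "p1 ;; f = p2 ;; g"
    "\<And>W a b. ar a W X ==> ar b W Y ==> a ;; f = b ;; g ==> \<exists>u. ar u W P \<and> u ;; p1 = a \<and> u ;; p2 = b"
    "\<And>W u v. ar u W P ==> ar v W P ==> u ;; p1 = v ;; p1 ==> u ;; p2 = v ;; p2 ==> u = v"
    "is_epi C Y Z g ==> is_epi C P X p1"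
    "is_epi C X Z f ==> is_epi C P Y p2"
proof -
  have O: "X \<in> Ob C" "Y \<in> Ob C" "Z \<in> Ob C" using f g arrD by metis+
  obtain D i1 i2 p1 p2 where D: "ar i1 X D" "ar i2 Y D" "ar p1 D X" "ar p2 D Y"
    and e: "i1 ;; p1 = idt X" "i2 ;; p2 = idt Y" "i1 ;; p2 = zr X Y" "i2 ;; p1 = zr Y X"
    and s: "p1 ;; i1 \<boxplus> p2 ;; i2 = idt D" using sum2[OF O(1,2)] .
  have DO: "D \<in> Ob C" using D arrD by metis
  let ?d = "p1 ;; f \<boxplus> ng (p2 ;; g)"
  have d: "ar ?d D Z" using D f g by blast
  obtain P k where k: "is_kernel C D Z ?d P k" "is_mono C P D k" "ar k P D" "k ;; ?d = zr P Z"
    using obtain_kernel[OF d] .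
  have PO: "P \<in> Ob C" using k arrD by metis
  have i1d: "i1 ;; ?d = f"
    unfolding distr ngr assoc[symmetric] e using f g O by (simp, metis ar_zr pls_ng pls_zero pls_zero' arr_ng)
  have i2d: "i2 ;; ?d = ng g"
    unfolding distr ngr assoc[symmetric] e using f g O by (simp, metis arr_ng pls_zero')
  show ?thesis
  proof (rule that[of "k ;; p1" P "k ;; p2"])
    show "ar (k ;; p1) P X" "ar (k ;; p2) P Y" using k D by auto
    have "k ;; p1 ;; f \<boxplus> ng (k ;; p2 ;; g) = zr P Z" using k(4) by (simp add: distr ngr assoc)
    then show "k ;; p1 ;; f = k ;; p2 ;; g"
      using sub_zero_iff[of "k ;; p1 ;; f" P Z "k ;; p2 ;; g"] k D f g by blast
  next
    fix W a b assume a: "ar a W X" "ar b W Y" "a ;; f = b ;; g"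
    let ?h = "a ;; i1 \<boxplus> b ;; i2"
    have WO: "W \<in> Ob C" using a arrD by metis
    have h: "ar ?h W D" using a D by blast
    have h1: "?h ;; p1 = a" "?h ;; p2 = b" using a O WO by (simp_all add: distl assoc e)
    have "?h ;; ?d = zr W Z"
      unfolding distr ngr assoc[symmetric] h1 using a f pls_ng by (metis arr_cmp)
    then obtain u where "ar u W P" "u ;; k = ?h" using kernelD(3)[OF k(1) DO h] by blast
    then show "\<exists>u. ar u W P \<and> u ;; (k ;; p1) = a \<and> u ;; (k ;; p2) = b"
      using h1 by (metis assoc)
  next
    fix W u v assume u: "ar u W P" "ar v W P" "u ;; (k ;; p1) = v ;; (k ;; p1)" "u ;; (k ;; p2) = v ;; (k ;; p2)"
    have "u ;; k ;; (p1 ;; i1 \<boxplus> p2 ;; i2) = v ;; k ;; (p1 ;; i1 \<boxplus> p2 ;; i2)"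
      using u unfolding distr by (metis assoc)
    then have "u ;; k = v ;; k" unfolding s using k u by (metis id_right arr_cmp)
    then show "u = v" using monoD k u by metis
  next
    assume g': "is_epi C Y Z g"
    have "is_epi C D Z ?d"
    proof (rule epi_right[OF D(2) d])
      show "is_epi C Y Z (i2 ;; ?d)" unfolding i2d
      proof (rule epiI)
        fix W h assume h: "ar h Z W" "ng g ;; h = zr Y W"
        then have "g ;; h = zr Y W" using g unfolding ngl by (metis arr_cmp pls_ng pls_zero)
        then show "h = zr Z W" using epiD0 g' h O by metis
      qed (use g in auto)
    qed
    then have ck: "is_cokernel C P D k Z ?d" using epi_cokernel_of_kernel d k(1) by blast
    show "is_epi C P X (k ;; p1)"
    proof (rule epiI)
      fix W t assume t: "ar t X W" "k ;; p1 ;; t = zr P W"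
      have "ar (p1 ;; t) D W" using t D by auto
      then obtain r where r: "ar r Z W" "?d ;; r = p1 ;; t"
        using cokernelD(3)[OF ck DO] t assoc by metis
      have WO: "W \<in> Ob C" using t arrD by metis
      have "ng g ;; r = zr Y W" using r i2d t e(4) WO by (metis assoc zr_left O(2))
      then have "g ;; r = zr Y W" using g r unfolding ngl by (metis arr_cmp pls_ng pls_zero)
      then have "r = zr Z W" using epiD0[OF g' O(2) r(1)] by blast
      then have "p1 ;; t = zr D W" using r d WO by (metis zr_right)
      then show "t = zr X W" using e(1) t D WO by (metis assoc id_left zr_right)
    qed (use k D in auto)
  next
    assume f': "is_epi C X Z f"
    have "is_epi C D Z ?d"
      by (rule epi_right[OF D(1) d]) (simp add: i1d f')
    then have ck: "is_cokernel C P D k Z ?d" using epi_cokernel_of_kernel d k(1) by blast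
    show "is_epi C P Y (k ;; p2)"
    proof (rule epiI)
      fix W t assume t: "ar t Y W" "k ;; p2 ;; t = zr P W"
      have "ar (p2 ;; t) D W" using t D by auto
      then obtain r where r: "ar r Z W" "?d ;; r = p2 ;; t"
        using cokernelD(3)[OF ck DO] t assoc by metis
      have WO: "W \<in> Ob C" using t arrD by metis
      have "f ;; r = zr X W" using r i1d t e(3) WO by (metis assoc zr_left O(1))
      then have "r = zr Z W" using epiD0[OF f' O(1) r(1)] by blast
      then have "p2 ;; t = zr D W" using r d WO by (metis zr_right)
      then show "t = zr Y W" using e(2) t D WO by (metis assoc id_left zr_right)
    qed (use k D in auto)
  qed
qed

end

section \<open>Vanishing of Ext\<close>

text \<open>The map \<open>h\<close> lifts \<open>g\<close> along \<open>b\<close> after the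
  epimorphism \<open>e\<close>, and \<open>g'\<close> is the induced map of kernels. The pullback
  along \<open>g\<close> of the sequence K -> E -> K' is then the pushout along \<open>g'\<close> of
  N -> P -> W, which is the source of all dimension shifting. The target K' of \<open>g\<close> is
  left to the context.\<close>

definition cover ::
    "('o, 'm) cat => 'o => 'm => 'o => 'm => 'o => 'm => 'o => 'm => 'o => 'm => 'm => 'm => bool" where
  "cover C W g K a E b N m P e h g' <-> P \<in> Ob C \<and> short_exact C N m P e W \<and>
     arr C h P E \<and> arr C g' N K \<and> h ;;\<^bsub>C\<^esub> b = e ;;\<^bsub>C\<^esub> g \<and> g' ;;\<^bsub>C\<^esub> a = m ;;\<^bsub>C\<^esub> h"

definition tower ::
    "('o, 'm) cat => nat => (nat => 'o) => (nat => 'o) => (nat => 'm) => (nat => 'm) => bool" where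
  "tower C n K E a b <-> (\<forall>i<n. E i \<in> Ob C \<and> short_exact C (K i) (a i) (E i) (b i) (K (Suc i)))"

text \<open>
  A tower consists of exact sequences \<open>0 \<rightarrow> K\<^sub>i \<rightarrow> E\<^sub>i \<rightarrow> K\<^sub>i\<^sub>+\<^sub>1 \<rightarrow> 0\<close>. For \<open>t : K\<^sub>0 \<rightarrow> Y\<close> and \<open>g : W \<rightarrow> K\<^sub>i\<^sub>+\<^sub>1\<close>,
  \<open>zext\<close> states that the class in \<open>Ext\<^sup>i\<^sup>+\<^sup>1(W, Y)\<close> of the spliced tower, pushed out along \<open>t\<close> and pulled
  back along \<open>g\<close>, is zero.
\<close>

primrec zext ::
    "('o, 'm) cat => (nat => 'o) => (nat => 'o) => (nat => 'm) => (nat => 'm) => 'o => 'm => nat => 'o => 'm => bool" where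
  "zext C K E a b Y t 0 = (\<lambda>W g. \<exists>N m P e h g' s.
     cover C W g (K 0) (a 0) (E 0) (b 0) N m P e h g' \<and> arr C s P Y \<and> g' ;;\<^bsub>C\<^esub> t = m ;;\<^bsub>C\<^esub> s)"
| "zext C K E a b Y t (Suc i) = (\<lambda>W g. \<exists>N m P e h g'.
     cover C W g (K (Suc i)) (a (Suc i)) (E (Suc i)) (b (Suc i)) N m P e h g' \<and>
     zext C K E a b Y t i N g')"

text \<open>The index is shifted: \<open>vanishing C n\<close> is about degree \<open>n + 1\<close>.
  Arbitrary \<open>t\<close> and \<open>g\<close> in place of identities make the notion functorial
  in both arguments without forming pushouts or pullbacks of towers.\<close>

definition vanishing :: "('o, 'm) cat => nat => 'o => 'o => bool" where
  "vanishing C n X Y <-> (\<forall>K E a b t g. tower C (Suc n) K E a b --> arr C t (K 0) Y -->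
     arr C g X (K (Suc n)) --> zext C K E a b Y t n X g)"

section \<open>Covers, their refinements, and calculation with vanishing classes\<close>

context abcat begin

lemma ses_fill:
  assumes s: "short_exact C N m P e W" "P \<in> Ob C" and s': "short_exact C K a E b K'" "E \<in> Ob C"
    and h: "ar h P E" "ar g W K'" "h ;; b = e ;; g"
  shows "\<exists>g'. ar g' N K \<and> g' ;; a = m ;; h"
proof -
  note d = sesD[OF s] and d' = sesD[OF s']
  have "m ;; h ;; b = m ;; e ;; g" by (simp add: assoc h(3))
  then have "m ;; h ;; b = zr N K'" using zr_left[OF h(2) arrD(1)[OF d(1)]] by (simp add: d(7))
  then show ?thesis by (rule kernelD(3)[OF d'(3) s'(2) arr_cmp[OF d(1) h(1)]])
qed

text \<open>Pulling back does not change the kernel: \<open>m1\<close> is the map into the pullback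
  with components zero and \<open>m\<close>.\<close>

lemma pullback_ses:
  assumes s: "short_exact C N m P e W" "P \<in> Ob C" and x: "ar x V W"
  obtains m1 P1 e1 y where "P1 \<in> Ob C" "short_exact C N m1 P1 e1 V" "ar y P1 P"
    "y ;; e = e1 ;; x" "m1 ;; y = m" "is_mono C V W x ==> is_mono C P1 P y"
proof -
  note d = sesD[OF s]
  obtain P1 e1 y where p: "ar e1 P1 V" "ar y P1 P" "e1 ;; x = y ;; e" and
    u: "\<And>W a b. ar a W V ==> ar b W P ==> a ;; x = b ;; e ==> \<exists>u. ar u W P1 \<and> u ;; e1 = a \<and> u ;; y = b" and
    j: "\<And>W u v. ar u W P1 ==> ar v W P1 ==> u ;; e1 = v ;; e1 ==> u ;; y = v ;; y ==> u = v" and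
    e: "is_epi C P W e ==> is_epi C P1 V e1"
    by (rule pullback[OF x d(2)]) (rule that, assumption+)
  have O: "N \<in> Ob C" "V \<in> Ob C" "P1 \<in> Ob C" "W \<in> Ob C" using d(1,2) x p(1) by (simp_all add: arr_def)
  have "zr N V ;; x = m ;; e" using x O d(7) by simp
  then obtain m1 where m1: "ar m1 N P1" "m1 ;; e1 = zr N V" "m1 ;; y = m"
    using u[OF ar_zr[OF O(1,2)] d(1)] by blast
  have "is_kernel C P1 V e1 N m1"
  proof (rule kernelI[OF p(1) m1(1,2)])
    fix Q h assume h: "ar h Q P1" "h ;; e1 = zr Q V"
    have Q: "Q \<in> Ob C" using h arrD(1) by metis
    have "h ;; y ;; e = zr Q W"
      using zr_left[OF x Q] by (simp add: assoc p(3)[symmetric]) (simp add: assoc[symmetric] h(2))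
    then obtain v where v: "ar v Q N" "v ;; m = h ;; y" using kernelD(3)[OF d(3) s(2)] h(1) p(2) by blast
    have "v ;; m1 = h"
    proof (rule j[OF _ h(1)])
      show "ar (v ;; m1) Q P1" using v m1 by blast
      show "v ;; m1 ;; e1 = h ;; e1" using v(1) O by (simp add: assoc m1(2) h(2))
      show "v ;; m1 ;; y = h ;; y" using v by (simp add: assoc m1(3))
    qed
    then show "\<exists>u. ar u Q N \<and> u ;; m1 = h" using v by blast
  next
    show "is_mono C N P1 m1" using mono_left[OF m1(1) p(2)] d(5) m1(3) by simp
  qed
  then have S: "short_exact C N m1 P1 e1 V" using ses_iff[OF p(1)] e d(6) by blast
  have M: "is_mono C P1 P y" if xm: "is_mono C V W x"
  proof (rule monoI[OF p(2)])
    fix Q h assume h: "ar h Q P1" "h ;; y = zr Q P"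
    have Q: "Q \<in> Ob C" using h arrD(1) by metis
    have "h ;; e1 ;; x = zr Q W"
      using zr_left[OF d(2) Q] by (simp add: assoc p(3)) (simp add: assoc[symmetric] h(2))
    then have "h ;; e1 = zr Q V" using monoD0[OF xm O(4)] h(1) p(1) by blast
    then show "h = zr Q P1"
      using j[OF h(1) ar_zr[OF Q O(3)]] p(1,2) h(2) Q by simp
  qed
  show ?thesis using that[OF O(3) S p(2) p(3)[symmetric] m1(3) M] .
qed

lemma coverD:
  assumes "cover C W g K a E b N m P e h g'"
  shows "P \<in> Ob C" "short_exact C N m P e W" "ar h P E" "ar g' N K" "h ;; b = e ;; g" "g' ;; a = m ;; h"
    "ar m N P" "ar e P W" "is_epi C P W e"
proof -
  show 1: "P \<in> Ob C" "short_exact C N m P e W" "ar h P E" "ar g' N K" "h ;; b = e ;; g" "g' ;; a = m ;; h"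
    using assms by (auto simp: cover_def)
  show "ar m N P" "ar e P W" "is_epi C P W e" using sesD[OF 1(2,1)] by auto
qed

lemma coverI:
  assumes "P \<in> Ob C" "short_exact C N m P e W" "ar h P E" "ar g' N K" "h ;; b = e ;; g" "g' ;; a = m ;; h"
  shows "cover C W g K a E b N m P e h g'"
  using assms by (simp add: cover_def)

text \<open>The kernel \<open>N\<close> and the induced map \<open>g'\<close> stay the same, so
  whatever is known about \<open>g'\<close> at the lower levels can be reused verbatim.\<close>

lemma cover_restrict:
  assumes c: "cover C W g K a E b N m P e h g'" and x: "ar x V W"
  obtains m1 P1 e1 y where "cover C V (x ;; g) K a E b N m1 P1 e1 (y ;; h) g'" "ar y P1 P"
    "m1 ;; y = m" "y ;; e = e1 ;; x"
proof -
  note d = coverD[OF c]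
  obtain m1 P1 e1 y where p: "P1 \<in> Ob C" "short_exact C N m1 P1 e1 V" "ar y P1 P"
    "y ;; e = e1 ;; x" "m1 ;; y = m" using pullback_ses[OF d(2,1) x] by metis
  have "cover C V (x ;; g) K a E b N m1 P1 e1 (y ;; h) g'"
  proof (rule coverI[OF p(1,2)])
    show "ar (y ;; h) P1 E" using p d by blast
    show "y ;; h ;; b = e1 ;; (x ;; g)" by (simp add: assoc d(5)) (simp add: assoc[symmetric] p(4))
    show "g' ;; a = m1 ;; (y ;; h)" by (simp add: assoc[symmetric] p(5) d(6))
  qed (rule d(4))
  then show ?thesis using that p by blast
qed

lemma epi_kernel_fill:
  assumes s: "short_exact C N m P e W" "P \<in> Ob C" and r: "ar r P1 P" "is_epi C P1 P r"
  obtains N1 m1 x where "short_exact C N1 m1 P1 (r ;; e) W" "ar x N1 N" "x ;; m = m1 ;; r"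
proof -
  note d = sesD[OF s]
  have P1: "P1 \<in> Ob C" using r arrD(1) by metis
  obtain N1 m1 where n: "short_exact C N1 m1 P1 (r ;; e) W"
    using epi_ses[OF epi_cmp[OF r(1) d(2) r(2) d(6)] arr_cmp[OF r(1) d(2)]] .
  have "idt W \<in> Hom C W W" using ident_in_Hom d(2) arrD(2) by metis
  then have "\<exists>g'. ar g' N1 N \<and> g' ;; m = m1 ;; r"
    using ses_fill[OF n P1 s r(1), of "idt W"] id_right[OF arr_cmp[OF r(1) d(2)]] d(2) by (auto simp: arr_def)
  then show ?thesis using that n by blast
qed

lemma cover_refine:
  assumes c: "cover C W g K a E b N m P e h g'" and r: "ar r P1 P" "is_epi C P1 P r"
  obtains N1 m1 x where "cover C W g K a E b N1 m1 P1 (r ;; e) (r ;; h) (x ;; g')" "ar x N1 N"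
    "x ;; m = m1 ;; r"
proof -
  note d = coverD[OF c]
  obtain N1 m1 x where n: "short_exact C N1 m1 P1 (r ;; e) W" "ar x N1 N" "x ;; m = m1 ;; r"
    using epi_kernel_fill[OF d(2,1) r] .
  have "cover C W g K a E b N1 m1 P1 (r ;; e) (r ;; h) (x ;; g')"
  proof (rule coverI[OF arrD(1)[OF r(1)] n(1)])
    show "ar (r ;; h) P1 E" "ar (x ;; g') N1 K" using r n d by blast+
    show "r ;; h ;; b = r ;; e ;; g" by (simp add: assoc d(5))
    show "x ;; g' ;; a = m1 ;; (r ;; h)" by (simp add: assoc d(6)) (simp add: assoc[symmetric] n(3))
  qed
  then show ?thesis using that n by blast
qed

lemma cover_exists:
  assumes s: "short_exact C K a E b K'" "E \<in> Ob C" and g: "ar g W K'"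
  obtains N m P e h g' where "cover C W g K a E b N m P e h g'"
proof -
  obtain m1 P1 e1 y where p: "P1 \<in> Ob C" "short_exact C K m1 P1 e1 W" "ar y P1 E"
    "y ;; b = e1 ;; g" "m1 ;; y = a" using pullback_ses[OF s g] by metis
  have "cover C W g K a E b K m1 P1 e1 y (idt K)"
    using p sesD(1)[OF s] by (intro coverI) (auto simp: arr_def ident_in_Hom)
  then show ?thesis using that by blast
qed

lemma common_refinement:
  assumes "short_exact C N m P e W" "P \<in> Ob C" "short_exact C N' m' P' e' W" "P' \<in> Ob C"
  obtains Q r r' where "ar r Q P" "is_epi C Q P r" "ar r' Q P'" "is_epi C Q P' r'" "r ;; e = r' ;; e'"
  using pullback[OF sesD(2)[OF assms(1,2)] sesD(2)[OF assms(3,4)]] sesD(6)[OF assms(1,2)] sesD(6)[OF assms(3,4)]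
  by metis

lemma towerD:
  assumes "tower C n K E a b" "i < n"
  shows "short_exact C (K i) (a i) (E i) (b i) (K (Suc i))" "E i \<in> Ob C"
    "ar (a i) (K i) (E i)" "ar (b i) (E i) (K (Suc i))"
  using assms sesD(1,2) unfolding tower_def by blast+

lemma tower_mono: "tower C n K E a b ==> m <= n ==> tower C m K E a b"
  by (auto simp: tower_def)

text \<open>A case distinction replaces an induction: by \<open>cover_restrict\<close> only the top
  cover changes, and the lower levels see the same \<open>N\<close> and \<open>g'\<close>.\<close>

lemma zext_restrict:
  assumes z: "zext C K E a b Y t i W g" and x: "ar x V W"
  shows "zext C K E a b Y t i V (x ;; g)"
proof (cases i)
  case 0
  obtain N m P e h g' s where c: "cover C W g (K 0) (a 0) (E 0) (b 0) N m P e h g'" and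
    s: "ar s P Y" "g' ;; t = m ;; s" using z 0 by auto
  obtain m1 P1 e1 y where c': "cover C V (x ;; g) (K 0) (a 0) (E 0) (b 0) N m1 P1 e1 (y ;; h) g'"
    "ar y P1 P" "m1 ;; y = m" using cover_restrict[OF c x] .
  have "ar (y ;; s) P1 Y" "g' ;; t = m1 ;; (y ;; s)" using s c' by (auto simp: assoc[symmetric])
  then show ?thesis using c' 0 by (simp, blast)
next
  case (Suc j)
  obtain N m P e h g' where c: "cover C W g (K i) (a i) (E i) (b i) N m P e h g'" and
    s: "zext C K E a b Y t j N g'" using z Suc by auto
  obtain m1 P1 e1 y where c': "cover C V (x ;; g) (K i) (a i) (E i) (b i) N m1 P1 e1 (y ;; h) g'"
    "ar y P1 P" "m1 ;; y = m" using cover_restrict[OF c x] .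
  then show ?thesis using s Suc by (simp, blast)
qed

lemma zero_ses: "is_zero_obj C Z0 ==> W \<in> Ob C ==> short_exact C Z0 (zr Z0 W) W (idt W) W"
proof -
  assume Z0: "is_zero_obj C Z0" and W: "W \<in> Ob C"
  have OO: "Z0 \<in> Ob C" using Z0 by (simp add: zero_obj_iff)
  have "is_kernel C W W (idt W) Z0 (zr Z0 W)"
  proof (rule kernelI)
    fix V h assume h: "ar h V W" "h ;; idt W = zr V W"
    then show "\<exists>u. ar u V Z0 \<and> u ;; zr Z0 W = h"
      using OO W by (intro exI[of _ "zr V Z0"]) (simp add: arrD)
  next
    show "is_mono C Z0 W (zr Z0 W)"
      by (rule monoI) (use OO W to_zero[OF Z0] in auto)
  qed (use OO W in auto)
  then show ?thesis using ses_iff[of "idt W" W W Z0 "zr Z0 W"] W by auto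
qed

text \<open>A map that lifts to \<open>E i\<close> is covered by the identity of \<open>W\<close>,
  with a zero object as kernel. The map induced on that kernel is zero and lifts again, so the
  recursion continues with zero maps.\<close>

lemma zext_lift:
  assumes "tower C (Suc i) K E a b" and t: "ar t (K 0) Y" and h: "ar h W (E i)"
  shows "zext C K E a b Y t i W (h ;; b i)"
  using assms(1) h
proof (induction i arbitrary: W h)
  case 0
  obtain Z0 where Z0: "is_zero_obj C Z0" using ex_zero_obj by blast
  have W: "W \<in> Ob C" "Z0 \<in> Ob C" "K 0 \<in> Ob C" "Y \<in> Ob C"
    using 0 Z0 t by (simp_all add: arr_def zero_obj_iff)
  note T = towerD[OF 0(1) lessI]
  have "cover C W (h ;; b 0) (K 0) (a 0) (E 0) (b 0) Z0 (zr Z0 W) W (idt W) h (zr Z0 (K 0))"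
    using zero_ses[OF Z0 W(1)] W 0 T by (intro coverI) (auto simp: assoc[symmetric])
  moreover have "ar (zr W Y) W Y" "zr Z0 (K 0) ;; t = zr Z0 W ;; zr W Y" using W t by auto
  ultimately show ?case by (simp, blast)
next
  case (Suc i)
  obtain Z0 where Z0: "is_zero_obj C Z0" using ex_zero_obj by blast
  note T = towerD[OF Suc.prems(1) lessI]
  have T': "tower C (Suc i) K E a b" using tower_mono[OF Suc.prems(1)] by simp
  note T1 = towerD[OF T' lessI]
  have W: "W \<in> Ob C" "Z0 \<in> Ob C" "K (Suc i) \<in> Ob C" using Suc Z0 T by (simp_all add: arr_def zero_obj_iff)
  have "cover C W (h ;; b (Suc i)) (K (Suc i)) (a (Suc i)) (E (Suc i)) (b (Suc i)) Z0 (zr Z0 W) W (idt W) h (zr Z0 (K (Suc i)))"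
    using zero_ses[OF Z0 W(1)] W Suc T by (intro coverI) (auto simp: assoc[symmetric])
  moreover have "zext C K E a b Y t i Z0 (zr Z0 (K (Suc i)))"
    using Suc.IH[OF T', of "zr Z0 (E i)" Z0] T1 W by simp
  ultimately show ?case by (simp, blast)
qed

lemma zext_zero:
  assumes "tower C (Suc i) K E a b" "ar t (K 0) Y" "W \<in> Ob C"
  shows "zext C K E a b Y t i W (zr W (K (Suc i)))"
  using zext_lift[OF assms(1,2), of "zr W (E i)" W] towerD[OF assms(1) lessI] assms(3) by simp

text \<open>Over a common refinement of two covers the lifts, and with them the induced maps on the
  kernel, may be added.\<close>

lemma zext_add:
  assumes "tower C (Suc i) K E a b" "ar t (K 0) Y" "ar g W (K (Suc i))" "ar k W (K (Suc i))"
    "zext C K E a b Y t i W g" "zext C K E a b Y t i W k"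
  shows "zext C K E a b Y t i W (g \<boxplus> k)"
  using assms
proof (induction i arbitrary: W g k)
  case 0
  obtain N m P e h g' s where c: "cover C W g (K 0) (a 0) (E 0) (b 0) N m P e h g'" and
    s: "ar s P Y" "g' ;; t = m ;; s" using 0(5) by auto
  obtain N2 m2 P2 e2 h2 g2 s2 where c2: "cover C W k (K 0) (a 0) (E 0) (b 0) N2 m2 P2 e2 h2 g2" and
    s2: "ar s2 P2 Y" "g2 ;; t = m2 ;; s2" using 0(6) by auto
  note d = coverD[OF c] and d2 = coverD[OF c2]
  obtain Q r r' where q: "ar r Q P" "is_epi C Q P r" "ar r' Q P2" "is_epi C Q P2 r'" "r ;; e = r' ;; e2"
    using common_refinement[OF d(2,1) d2(2,1)] .
  obtain N1 m1 x where n: "short_exact C N1 m1 Q (r ;; e) W" "ar x N1 N" "x ;; m = m1 ;; r"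
    using epi_kernel_fill[OF d(2,1) q(1,2)] .
  have "\<exists>x'. ar x' N1 N2 \<and> x' ;; m2 = m1 ;; r'"
    using ses_fill[OF n(1) arrD(1)[OF q(1)] d2(2,1) q(3), of "idt W"] q(5) d2(8) q(3) arr_ident[OF arrD(2)[OF d2(8)]] id_right[OF arr_cmp[OF q(3) d2(8)]]
    by simp
  then obtain x' where x': "ar x' N1 N2" "x' ;; m2 = m1 ;; r'" by blast
  have "cover C W (g \<boxplus> k) (K 0) (a 0) (E 0) (b 0) N1 m1 Q (r ;; e) (r ;; h \<boxplus> r' ;; h2) (x ;; g' \<boxplus> x' ;; g2)"
  proof (rule coverI[OF arrD(1)[OF q(1)] n(1)])
    show "ar (r ;; h \<boxplus> r' ;; h2) Q (E 0)" using q d d2 by blast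
    show "ar (x ;; g' \<boxplus> x' ;; g2) N1 (K 0)" using n x' d d2 by blast
    show "(r ;; h \<boxplus> r' ;; h2) ;; b 0 = r ;; e ;; (g \<boxplus> k)"
      by (simp add: distl distr assoc d(5) d2(5)) (simp add: assoc[symmetric] q(5))
    show "(x ;; g' \<boxplus> x' ;; g2) ;; a 0 = m1 ;; (r ;; h \<boxplus> r' ;; h2)"
      by (simp add: distl distr assoc d(6) d2(6)) (simp add: assoc[symmetric] n(3) x'(2))
  qed
  moreover have "ar (r ;; s \<boxplus> r' ;; s2) Q Y" using s s2 q by blast
  moreover have "(x ;; g' \<boxplus> x' ;; g2) ;; t = m1 ;; (r ;; s \<boxplus> r' ;; s2)"
    by (simp add: distl distr assoc s s2) (simp add: assoc[symmetric] n(3) x'(2))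
  ultimately show ?case by (simp, blast)
next
  case (Suc i)
  obtain N m P e h g' where c: "cover C W g (K (Suc i)) (a (Suc i)) (E (Suc i)) (b (Suc i)) N m P e h g'" and
    s: "zext C K E a b Y t i N g'" using Suc(6) by auto
  obtain N2 m2 P2 e2 h2 g2 where c2: "cover C W k (K (Suc i)) (a (Suc i)) (E (Suc i)) (b (Suc i)) N2 m2 P2 e2 h2 g2" and
    s2: "zext C K E a b Y t i N2 g2" using Suc(7) by auto
  note d = coverD[OF c] and d2 = coverD[OF c2]
  obtain Q r r' where q: "ar r Q P" "is_epi C Q P r" "ar r' Q P2" "is_epi C Q P2 r'" "r ;; e = r' ;; e2"
    using common_refinement[OF d(2,1) d2(2,1)] .
  obtain N1 m1 x where n: "short_exact C N1 m1 Q (r ;; e) W" "ar x N1 N" "x ;; m = m1 ;; r"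
    using epi_kernel_fill[OF d(2,1) q(1,2)] .
  have "\<exists>x'. ar x' N1 N2 \<and> x' ;; m2 = m1 ;; r'"
    using ses_fill[OF n(1) arrD(1)[OF q(1)] d2(2,1) q(3), of "idt W"] q(5) d2(8) q(3) arr_ident[OF arrD(2)[OF d2(8)]] id_right[OF arr_cmp[OF q(3) d2(8)]]
    by simp
  then obtain x' where x': "ar x' N1 N2" "x' ;; m2 = m1 ;; r'" by blast
  have "cover C W (g \<boxplus> k) (K (Suc i)) (a (Suc i)) (E (Suc i)) (b (Suc i)) N1 m1 Q (r ;; e) (r ;; h \<boxplus> r' ;; h2) (x ;; g' \<boxplus> x' ;; g2)"
  proof (rule coverI[OF arrD(1)[OF q(1)] n(1)])
    show "ar (r ;; h \<boxplus> r' ;; h2) Q (E (Suc i))" using q d d2 by blast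
    show "ar (x ;; g' \<boxplus> x' ;; g2) N1 (K (Suc i))" using n x' d d2 by blast
    show "(r ;; h \<boxplus> r' ;; h2) ;; b (Suc i) = r ;; e ;; (g \<boxplus> k)"
      by (simp add: distl distr assoc d(5) d2(5)) (simp add: assoc[symmetric] q(5))
    show "(x ;; g' \<boxplus> x' ;; g2) ;; a (Suc i) = m1 ;; (r ;; h \<boxplus> r' ;; h2)"
      by (simp add: distl distr assoc d(6) d2(6)) (simp add: assoc[symmetric] n(3) x'(2))
  qed
  moreover have "zext C K E a b Y t i N1 (x ;; g' \<boxplus> x' ;; g2)"
    using Suc.IH[OF tower_mono[OF Suc.prems(1)] Suc.prems(2) _ _ zext_restrict[OF s n(2)] zext_restrict[OF s2 x'(1)]]
      n(2) x'(1) d(4) d2(4) by auto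
  ultimately show ?case by (simp, blast)
qed

text \<open>
  Whether the class of an extension vanishes can be tested on any given cover, after refining it:
  two lifts differ by a map into the kernel.
\<close>

lemma cover_difference:
  assumes s: "short_exact C K a E b K'" "E \<in> Ob C"
    and c: "cover C W g K a E b N m P e h g'" and c0: "cover C W g K a E b N0 m0 P0 e0 h0 g0"
  obtains Q r r0 d N1 m1 x x0 where "ar r Q P" "is_epi C Q P r" "ar r0 Q P0"
    "short_exact C N1 m1 Q (r ;; e) W" "ar x N1 N" "x ;; m = m1 ;; r" "ar x0 N1 N0" "x0 ;; m0 = m1 ;; r0"
    "ar d Q K" "x ;; g' = x0 ;; g0 \<boxplus> m1 ;; d"
proof -
  note d = coverD[OF c] and d0 = coverD[OF c0] and sd = sesD[OF s]
  obtain Q r r0 where q: "ar r Q P" "is_epi C Q P r" "ar r0 Q P0" "is_epi C Q P0 r0" "r ;; e = r0 ;; e0"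
    using common_refinement[OF d(2,1) d0(2,1)] .
  obtain N1 m1 x where n: "short_exact C N1 m1 Q (r ;; e) W" "ar x N1 N" "x ;; m = m1 ;; r"
    using epi_kernel_fill[OF d(2,1) q(1,2)] .
  have "\<exists>x'. ar x' N1 N0 \<and> x' ;; m0 = m1 ;; r0"
    using ses_fill[OF n(1) arrD(1)[OF q(1)] d0(2,1) q(3), of "idt W"] q(5) d0(8) q(3) arr_ident[OF arrD(2)[OF d0(8)]] id_right[OF arr_cmp[OF q(3) d0(8)]]
    by simp
  then obtain x0 where x0: "ar x0 N1 N0" "x0 ;; m0 = m1 ;; r0" by blast
  have m1: "ar m1 N1 Q" using sesD(1)[OF n(1) arrD(1)[OF q(1)]] .
  have ah: "ar (r ;; h) Q E" "ar (r0 ;; h0) Q E" using q d d0 by blast+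
  have "r ;; h ;; b = r0 ;; h0 ;; b"
    by (simp add: assoc d(5) d0(5)) (simp add: assoc[symmetric] q(5))
  then have "(r ;; h \<boxplus> ng (r0 ;; h0)) ;; b = zr Q K'"
    using sub_zero_iff[of "r ;; h ;; b" Q K' "r0 ;; h0 ;; b"] ah sd(2) by (simp only: distl ngl, metis arr_cmp)
  then obtain dd where dd: "ar dd Q K" "dd ;; a = r ;; h \<boxplus> ng (r0 ;; h0)"
    using kernelD(3)[OF sd(3) s(2)] ah by blast
  have e1: "r ;; h = r0 ;; h0 \<boxplus> dd ;; a"
    using sub_eq_iff[OF ah arr_cmp[OF dd(1) sd(1)]] dd(2) by simp
  have "x ;; g' = x0 ;; g0 \<boxplus> m1 ;; dd"
  proof (rule monoD[OF sd(5)])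
    show "ar (x ;; g') N1 K" "ar (x0 ;; g0 \<boxplus> m1 ;; dd) N1 K" using n x0 d d0 m1 dd by blast+
    have "x ;; g' ;; a = m1 ;; (r ;; h)" by (simp add: assoc d(6)) (simp add: assoc[symmetric] n(3))
    also have "\<dots> = m1 ;; r0 ;; h0 \<boxplus> m1 ;; dd ;; a" unfolding e1 distr by (simp add: assoc)
    also have "\<dots> = x0 ;; (m0 ;; h0) \<boxplus> m1 ;; dd ;; a" by (simp only: x0(2)[symmetric] assoc)
    finally show "x ;; g' ;; a = (x0 ;; g0 \<boxplus> m1 ;; dd) ;; a" by (simp add: distl assoc d0(6))
  qed
  then show ?thesis using that q n x0 dd by blast
qed

text \<open>At the bottom the difference \<open>d\<close> of the two lifts is absorbed by the
  extension of \<open>t\<close>: if \<open>s0\<close> works for the first cover,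
  \<open>r0 ;; s0 \<boxplus> d ;; t\<close> works for the refinement.\<close>

lemma zext_refine0:
  assumes T: "tower C (Suc 0) K E a b" and t: "ar t (K 0) Y" and z: "zext C K E a b Y t 0 W g"
    and c: "cover C W g (K 0) (a 0) (E 0) (b 0) N m P e h g'"
  obtains P1 r N1 m1 x s where "ar r P1 P" "is_epi C P1 P r"
    "cover C W g (K 0) (a 0) (E 0) (b 0) N1 m1 P1 (r ;; e) (r ;; h) (x ;; g')" "ar x N1 N" "x ;; m = m1 ;; r"
    "ar s P1 Y" "x ;; g' ;; t = m1 ;; s"
proof -
  obtain N0 m0 P0 e0 h0 g0 s0 where c0: "cover C W g (K 0) (a 0) (E 0) (b 0) N0 m0 P0 e0 h0 g0" and
    s0: "ar s0 P0 Y" "g0 ;; t = m0 ;; s0" using z by auto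
  obtain Q r r0 d N1 m1 x x0 where q: "ar r Q P" "is_epi C Q P r" "ar r0 Q P0"
    "short_exact C N1 m1 Q (r ;; e) W" "ar x N1 N" "x ;; m = m1 ;; r" "ar x0 N1 N0" "x0 ;; m0 = m1 ;; r0"
    "ar d Q (K 0)" "x ;; g' = x0 ;; g0 \<boxplus> m1 ;; d"
    using cover_difference[OF towerD(1,2)[OF T lessI] c c0] .
  note dd = coverD[OF c]
  have "cover C W g (K 0) (a 0) (E 0) (b 0) N1 m1 Q (r ;; e) (r ;; h) (x ;; g')"
  proof (rule coverI[OF arrD(1)[OF q(1)] q(4)])
    show "ar (r ;; h) Q (E 0)" "ar (x ;; g') N1 (K 0)" using q dd by blast+
    show "r ;; h ;; b 0 = r ;; e ;; g" by (simp add: assoc dd(5))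
    show "x ;; g' ;; a 0 = m1 ;; (r ;; h)" by (simp add: assoc dd(6)) (simp add: assoc[symmetric] q(6))
  qed
  moreover have "ar (r0 ;; s0 \<boxplus> d ;; t) Q Y" using q s0 t by blast
  moreover have "x ;; g' ;; t = m1 ;; (r0 ;; s0 \<boxplus> d ;; t)"
    unfolding q(10) distl distr assoc s0 by (simp add: assoc[symmetric] q(8))
  ultimately show ?thesis using that q by blast
qed

text \<open>Here the difference \<open>d\<close> ends in \<open>K (Suc i)\<close>, the right end of
  the next sequence. One more cover \<open>f\<close> lifts it to \<open>E i\<close>, after which its
  contribution vanishes by \<open>zext_lift\<close> and is added by \<open>zext_add\<close>.\<close>

lemma zext_refine:
  assumes T: "tower C (Suc (Suc i)) K E a b" and t: "ar t (K 0) Y" and z: "zext C K E a b Y t (Suc i) W g"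
    and c: "cover C W g (K (Suc i)) (a (Suc i)) (E (Suc i)) (b (Suc i)) N m P e h g'"
  obtains P1 r N1 m1 x where "ar r P1 P" "is_epi C P1 P r"
    "cover C W g (K (Suc i)) (a (Suc i)) (E (Suc i)) (b (Suc i)) N1 m1 P1 (r ;; e) (r ;; h) (x ;; g')"
    "ar x N1 N" "x ;; m = m1 ;; r" "zext C K E a b Y t i N1 (x ;; g')"
proof -
  obtain N0 m0 P0 e0 h0 g0 where c0: "cover C W g (K (Suc i)) (a (Suc i)) (E (Suc i)) (b (Suc i)) N0 m0 P0 e0 h0 g0" and
    z0: "zext C K E a b Y t i N0 g0" using z by auto
  obtain Q r r0 d N1 m1 x x0 where q: "ar r Q P" "is_epi C Q P r" "ar r0 Q P0"
    "short_exact C N1 m1 Q (r ;; e) W" "ar x N1 N" "x ;; m = m1 ;; r" "ar x0 N1 N0" "x0 ;; m0 = m1 ;; r0"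
    "ar d Q (K (Suc i))" "x ;; g' = x0 ;; g0 \<boxplus> m1 ;; d"
    using cover_difference[OF towerD(1,2)[OF T lessI] c c0] .
  note dd = coverD[OF c] and dd0 = coverD[OF c0]
  have T': "tower C (Suc i) K E a b" using tower_mono[OF T] by simp
  note Ti = towerD[OF T' lessI]
  obtain R f l where R: "ar f R Q" "ar l R (E i)" "f ;; d = l ;; b i" "is_epi C R Q f"
    using pullback[OF q(9) Ti(4)] sesD(6)[OF Ti(1,2)] by metis
  obtain N2 m2 y where y: "short_exact C N2 m2 R (f ;; (r ;; e)) W" "ar y N2 N1" "y ;; m1 = m2 ;; f"
    using epi_kernel_fill[OF q(4) arrD(1)[OF q(1)] R(1,4)] .
  have m2: "ar m2 N2 R" using sesD(1)[OF y(1) arrD(1)[OF R(1)]] .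
  have "cover C W g (K (Suc i)) (a (Suc i)) (E (Suc i)) (b (Suc i)) N2 m2 R (f ;; r ;; e) (f ;; r ;; h) (y ;; x ;; g')"
  proof (rule coverI[OF arrD(1)[OF R(1)]])
    show "short_exact C N2 m2 R (f ;; r ;; e) W" using y(1) by (simp add: assoc)
    show "ar (f ;; r ;; h) R (E (Suc i))" "ar (y ;; x ;; g') N2 (K (Suc i))" using R q y dd by blast+
    show "f ;; r ;; h ;; b (Suc i) = f ;; r ;; e ;; g" by (simp add: assoc dd(5))
    have "y ;; x ;; g' ;; a (Suc i) = y ;; (x ;; m) ;; h" by (simp add: assoc dd(6))
    also have "\<dots> = m2 ;; (f ;; r ;; h)" unfolding q(6) by (simp add: assoc[symmetric] y(3))
    finally show "y ;; x ;; g' ;; a (Suc i) = m2 ;; (f ;; r ;; h)" .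
  qed
  moreover have "zext C K E a b Y t i N2 (y ;; x ;; g')"
  proof -
    have e: "y ;; x ;; g' = y ;; x0 ;; g0 \<boxplus> m2 ;; l ;; b i"
    proof -
      have "y ;; x ;; g' = y ;; x0 ;; g0 \<boxplus> y ;; m1 ;; d" by (simp add: assoc q(10) distr)
      also have "y ;; m1 ;; d = m2 ;; l ;; b i" by (simp add: y(3) assoc R(3))
      finally show ?thesis .
    qed
    have A: "ar (y ;; x0) N2 N0" "ar (m2 ;; l) N2 (E i)" using y q m2 R by blast+
    have B: "ar (y ;; x0 ;; g0) N2 (K (Suc i))" "ar (m2 ;; l ;; b i) N2 (K (Suc i))"
      using A dd0(4) Ti(4) by blast+
    show ?thesis unfolding e
      by (rule zext_add[OF T' t B zext_restrict[OF z0 A(1)] zext_lift[OF T' t A(2)]])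
  qed
  moreover have "ar (f ;; r) R P" "is_epi C R P (f ;; r)" "ar (y ;; x) N2 N" using R q y epi_cmp by blast+
  moreover have "y ;; x ;; m = m2 ;; (f ;; r)" by (simp add: assoc q(6)) (simp add: assoc[symmetric] y(3))
  ultimately show ?thesis using that by blast
qed

definition tower_mor where
  "tower_mor n K E a b K' E' a' b' u v <->
     (\<forall>i\<le>n. ar (u i) (K i) (K' i)) \<and> (\<forall>i<n. ar (v i) (E i) (E' i)) \<and>
     (\<forall>i<n. a i ;; v i = u i ;; a' i \<and> b i ;; u (Suc i) = v i ;; b' i)"

lemma tower_mor_mono: "tower_mor n K E a b K' E' a' b' u v ==> m <= n ==> tower_mor m K E a b K' E' a' b' u v"
  by (auto simp: tower_mor_def)

lemma tower_morD:
  assumes "tower_mor n K E a b K' E' a' b' u v" "i < n"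
  shows "ar (u i) (K i) (K' i)" "ar (u (Suc i)) (K (Suc i)) (K' (Suc i))" "ar (v i) (E i) (E' i)"
    "a i ;; v i = u i ;; a' i" "b i ;; u (Suc i) = v i ;; b' i"
  using assms by (auto simp: tower_mor_def)

text \<open>Only the lift and the induced map are composed with the map of sequences;
  \<open>N\<close>, \<open>P\<close> and \<open>e\<close> are kept. Towers can therefore be compared
  one level at a time.\<close>

lemma cover_push:
  assumes c: "cover C W g K a E b N m P e h g'"
    and v: "ar v E E'" "ar u K K'" "a ;; v = u ;; a'" "b ;; w = v ;; b'"
  shows "cover C W (g ;; w) K' a' E' b' N m P e (h ;; v) (g' ;; u)"
proof -
  note d = coverD[OF c]
  have "h ;; v ;; b' = e ;; (g ;; w)" by (simp add: assoc v(4)[symmetric]) (simp add: assoc[symmetric] d(5))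
  moreover have "g' ;; u ;; a' = m ;; (h ;; v)" by (simp add: assoc v(3)[symmetric]) (simp add: assoc[symmetric] d(6))
  ultimately show ?thesis using d v by (intro coverI) auto
qed

lemma zext_push:
  assumes m: "tower_mor (Suc i) K E a b K' E' a' b' u v" and t: "u 0 ;; t' = t"
    and z: "zext C K E a b Y t i W g"
  shows "zext C K' E' a' b' Y t' i W (g ;; u (Suc i))"
  using m z
proof (induction i arbitrary: W g)
  case 0
  note M = tower_morD[OF 0(1) lessI]
  obtain N m P e h g' s where c: "cover C W g (K 0) (a 0) (E 0) (b 0) N m P e h g'" and
    s: "ar s P Y" "g' ;; t = m ;; s" using 0(2) by auto
  have "g' ;; u 0 ;; t' = m ;; s" using s t by (simp add: assoc)
  then show ?case using cover_push[OF c M(3,1,4,5)] s(1) by (simp, blast)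
next
  case (Suc i)
  note M = tower_morD[OF Suc(2) lessI]
  obtain N m P e h g' where c: "cover C W g (K (Suc i)) (a (Suc i)) (E (Suc i)) (b (Suc i)) N m P e h g'" and
    s: "zext C K E a b Y t i N g'" using Suc(3) by auto
  show ?case using cover_push[OF c M(3,1,4,5)] Suc.IH[OF tower_mor_mono[OF Suc(2)] s] by (simp, blast)
qed

text \<open>A cover over the first tower is also one over the second, where vanishing can be tested
  on it after refinement. The refinement found there serves the first tower too, since it does not
  touch the induced maps other than by restriction.\<close>

lemma zext_pull:
  assumes m: "tower_mor (Suc i) K E a b K' E' a' b' u v" and t: "u 0 ;; t' = t"
    and T: "tower C (Suc i) K E a b" "tower C (Suc i) K' E' a' b'" "ar t' (K' 0) Y"
    and g: "ar g W (K (Suc i))"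
    and z: "zext C K' E' a' b' Y t' i W (g ;; u (Suc i))"
  shows "zext C K E a b Y t i W g"
  using m T(1,2) g z
proof (induction i arbitrary: W g)
  case 0
  note M = tower_morD[OF 0(1) lessI] and TT = towerD[OF 0(2) lessI]
  obtain N m P e h g' where c: "cover C W g (K 0) (a 0) (E 0) (b 0) N m P e h g'"
    using cover_exists[OF TT(1,2) 0(4)] .
  note c' = cover_push[OF c M(3,1,4,5)]
  obtain P1 r N1 m1 x s where r: "ar r P1 P" "is_epi C P1 P r" "ar x N1 N" "x ;; m = m1 ;; r"
    "cover C W (g ;; u (Suc 0)) (K' 0) (a' 0) (E' 0) (b' 0) N1 m1 P1 (r ;; e) (r ;; (h ;; v 0)) (x ;; (g' ;; u 0))"
    "ar s P1 Y" "x ;; (g' ;; u 0) ;; t' = m1 ;; s"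
    using zext_refine0[OF 0(3) T(3) 0(5) c'] by metis
  note d = coverD[OF c]
  have "cover C W g (K 0) (a 0) (E 0) (b 0) N1 m1 P1 (r ;; e) (r ;; h) (x ;; g')"
  proof (rule coverI[OF arrD(1)[OF r(1)] coverD(2)[OF r(5)]])
    show "ar (r ;; h) P1 (E 0)" "ar (x ;; g') N1 (K 0)" using r d by blast+
    show "r ;; h ;; b 0 = r ;; e ;; g" by (simp add: assoc d(5))
    show "x ;; g' ;; a 0 = m1 ;; (r ;; h)" by (simp add: assoc d(6)) (simp add: assoc[symmetric] r(4))
  qed
  moreover have "x ;; g' ;; t = m1 ;; s" using r(7) t by (simp add: assoc)
  ultimately show ?case using r(6) by (simp, blast)
next
  case (Suc i)
  note M = tower_morD[OF Suc(2) lessI] and TT = towerD[OF Suc(3) lessI]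
  obtain N m P e h g' where c: "cover C W g (K (Suc i)) (a (Suc i)) (E (Suc i)) (b (Suc i)) N m P e h g'"
    using cover_exists[OF TT(1,2) Suc(5)] .
  note c' = cover_push[OF c M(3,1,4,5)]
  obtain P1 r N1 m1 x where r: "ar r P1 P" "is_epi C P1 P r" "ar x N1 N" "x ;; m = m1 ;; r"
    "cover C W (g ;; u (Suc (Suc i))) (K' (Suc i)) (a' (Suc i)) (E' (Suc i)) (b' (Suc i)) N1 m1 P1 (r ;; e) (r ;; (h ;; v (Suc i))) (x ;; (g' ;; u (Suc i)))"
    "zext C K' E' a' b' Y t' i N1 (x ;; (g' ;; u (Suc i)))"
    using zext_refine[OF Suc(4) T(3) Suc(6) c'] by metis
  note d = coverD[OF c]
  have "cover C W g (K (Suc i)) (a (Suc i)) (E (Suc i)) (b (Suc i)) N1 m1 P1 (r ;; e) (r ;; h) (x ;; g')"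
  proof (rule coverI[OF arrD(1)[OF r(1)] coverD(2)[OF r(5)]])
    show "ar (r ;; h) P1 (E (Suc i))" "ar (x ;; g') N1 (K (Suc i))" using r d by blast+
    show "r ;; h ;; b (Suc i) = r ;; e ;; g" by (simp add: assoc d(5))
    show "x ;; g' ;; a (Suc i) = m1 ;; (r ;; h)" by (simp add: assoc d(6)) (simp add: assoc[symmetric] r(4))
  qed
  moreover have "zext C K E a b Y t i N1 (x ;; g')"
    using Suc.IH[OF tower_mor_mono[OF Suc(2)] tower_mono[OF Suc(3)] tower_mono[OF Suc(4)], of "x ;; g'" N1] r d
    by (auto simp: assoc)
  ultimately show ?case by (simp, blast)
qed

lemma zext_post:
  assumes y: "ar y Y Y'" and z: "zext C K E a b Y t i W g"
  shows "zext C K E a b Y' (t ;; y) i W g"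
  using z
proof (induction i arbitrary: W g)
  case 0
  then obtain N m P e h g' s where c: "cover C W g (K 0) (a 0) (E 0) (b 0) N m P e h g'" and
    s: "ar s P Y" "g' ;; t = m ;; s" by auto
  have "ar (s ;; y) P Y'" "g' ;; (t ;; y) = m ;; (s ;; y)" using s y by (auto simp: assoc[symmetric])
  then show ?case using c by (simp, blast)
next
  case (Suc i)
  then show ?case by (simp, blast)
qed

text \<open>The two hypotheses come with unrelated covers. The cover of the first is kept and
  refined until it also witnesses the second.\<close>

lemma zext_target_add:
  assumes "tower C (Suc i) K E a b" "ar t (K 0) Y" "ar t' (K 0) Y" "ar g W (K (Suc i))"
    "zext C K E a b Y t i W g" "zext C K E a b Y t' i W g"
  shows "zext C K E a b Y (t \<boxplus> t') i W g"
  using assms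
proof (induction i arbitrary: W g)
  case 0
  obtain N m P e h g' s where c: "cover C W g (K 0) (a 0) (E 0) (b 0) N m P e h g'" and
    s: "ar s P Y" "g' ;; t = m ;; s" using 0(5) by auto
  obtain P1 r N1 m1 x s1 where r: "ar r P1 P" "ar x N1 N" "x ;; m = m1 ;; r"
    "cover C W g (K 0) (a 0) (E 0) (b 0) N1 m1 P1 (r ;; e) (r ;; h) (x ;; g')"
    "ar s1 P1 Y" "x ;; g' ;; t' = m1 ;; s1"
    using zext_refine0[OF 0(1) 0(3) 0(6) c] by metis
  have "x ;; g' ;; t = m1 ;; (r ;; s)" by (simp add: assoc s) (simp add: assoc[symmetric] r(3))
  then have "x ;; g' ;; (t \<boxplus> t') = m1 ;; (r ;; s \<boxplus> s1)" using r(6) by (simp add: distr)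
  moreover have "ar (r ;; s \<boxplus> s1) P1 Y" using r s by blast
  ultimately show ?case using r(4) by (simp, blast)
next
  case (Suc i)
  obtain N m P e h g' where c: "cover C W g (K (Suc i)) (a (Suc i)) (E (Suc i)) (b (Suc i)) N m P e h g'" and
    s: "zext C K E a b Y t i N g'" using Suc(6) by auto
  obtain P1 r N1 m1 x where r: "ar r P1 P" "ar x N1 N" "x ;; m = m1 ;; r"
    "cover C W g (K (Suc i)) (a (Suc i)) (E (Suc i)) (b (Suc i)) N1 m1 P1 (r ;; e) (r ;; h) (x ;; g')"
    "zext C K E a b Y t' i N1 (x ;; g')"
    using zext_refine[OF Suc(2) Suc(4) Suc(7) c] by metis
  have "zext C K E a b Y (t \<boxplus> t') i N1 (x ;; g')"
    using Suc.IH[OF tower_mono[OF Suc(2)] Suc(3,4) _ zext_restrict[OF s r(2)] r(5)] r(2) coverD(4)[OF c] by auto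
  then show ?case using r(4) by (simp, blast)
qed

end

section \<open>Yoneda extensions as spliced towers\<close>

definition ext_tower where
  "ext_tower C n X Y E d K a b <-> tower C (Suc n) K (\<lambda>i. E (Suc i)) a b \<and> K 0 = Y \<and> K (Suc n) = X \<and>
     d 0 = a 0 \<and> (\<forall>i<n. d (Suc i) = b i ;;\<^bsub>C\<^esub> a (Suc i)) \<and> d (Suc n) = b n"

lemma index_cases:
  assumes "i <= Suc n"
  obtains "i = 0" | "i = Suc n" | j where "i = Suc j" "j < n"
  using assms by (cases i) (auto simp: le_less)

context abcat begin

lemma biproduct_eq:
  assumes "ar h W D" "ar p1 D X" "ar i1 X D" "ar p2 D Y" "ar i2 Y D"
    "p1 ;; i1 \<boxplus> p2 ;; i2 = idt D" "h ;; p1 = zr W X"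
  shows "h ;; p2 ;; i2 = h"
proof -
  have W: "W \<in> Ob C" using assms(1) arrD(1) by metis
  have "h = h ;; (p1 ;; i1 \<boxplus> p2 ;; i2)" using assms(1,6) by simp
  also have "\<dots> = h ;; p1 ;; i1 \<boxplus> h ;; p2 ;; i2" by (simp add: distr assoc)
  also have "\<dots> = zr W D \<boxplus> h ;; p2 ;; i2" using zr_left[OF assms(3) W] by (simp add: assms(7))
  also have "\<dots> = h ;; p2 ;; i2" by (rule pls_zero'[OF arr_cmp[OF arr_cmp[OF assms(1,4)] assms(5)]])
  finally show ?thesis by simp
qed

lemma kernel_cmp_mono:
  assumes "is_kernel C X Z (f ;; m) K k" "ar f X Y" "ar m Y Z" "is_mono C Y Z m"
  shows "is_kernel C X Y f K k"
proof -
  note d = kernelD[OF assms(1) arrD(1)[OF assms(2)]]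
  show ?thesis
  proof (rule kernelI[OF assms(2) d(1)])
    show "k ;; f = zr K Y"
      using monoD0[OF assms(4) arrD(2)[OF assms(3)] arr_cmp[OF d(1) assms(2)]] d(2) by (simp add: assoc)
    show "is_mono C K X k" using kernel_mono[OF assms(1)] assms by blast
    fix W h assume h: "ar h W X" "h ;; f = zr W Y"
    have "h ;; (f ;; m) = zr W Z" using zr_left[OF assms(3) arrD(1)[OF h(1)]] by (simp add: assoc[symmetric] h(2))
    then show "\<exists>u. ar u W K \<and> u ;; k = h" by (rule d(3)[OF h(1)])
  qed
qed

lemma kernel_cmp_mono':
  assumes "is_kernel C X Y f K k" "ar f X Y" "ar m Y Z" "is_mono C Y Z m"
  shows "is_kernel C X Z (f ;; m) K k"
proof -
  note d = kernelD[OF assms(1) arrD(1)[OF assms(2)]]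
  show ?thesis
  proof (rule kernelI[OF arr_cmp[OF assms(2,3)] d(1)])
    show "k ;; (f ;; m) = zr K Z" using zr_left[OF assms(3) arrD(1)[OF d(1)]] d(2) by (simp add: assoc[symmetric])
    show "is_mono C K X k" using kernel_mono[OF assms(1)] assms by blast
    fix W h assume h: "ar h W X" "h ;; (f ;; m) = zr W Z"
    have "h ;; f = zr W Y"
      using monoD0[OF assms(4) arrD(2)[OF assms(3)] arr_cmp[OF h(1) assms(2)]] h(2) by (simp add: assoc)
    then show "\<exists>u. ar u W K \<and> u ;; k = h" by (rule d(3)[OF h(1)])
  qed
qed

lemma cokernel_epi_cmp:
  assumes "is_cokernel C Y Z f Q q" "ar f Y Z" "ar e X Y" "is_epi C X Y e"
  shows "is_cokernel C X Z (e ;; f) Q q"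
proof -
  note d = cokernelD[OF assms(1) arrD(2)[OF assms(2)]]
  show ?thesis
  proof (rule cokernelI[OF arr_cmp[OF assms(3,2)] d(1)])
    show "e ;; f ;; q = zr X Q" using zr_right[OF assms(3) arrD(2)[OF d(1)]] d(2) by (simp add: assoc)
    show "is_epi C Z Q q" using cokernel_epi[OF assms(1)] assms by blast
    fix W h assume h: "ar h Z W" "e ;; f ;; h = zr X W"
    have "f ;; h = zr Y W"
      using epiD0[OF assms(4) arrD(1)[OF assms(3)] arr_cmp[OF assms(2) h(1)]] h(2) by (simp add: assoc)
    then show "\<exists>u. ar u Q W \<and> q ;; u = h" by (rule d(3)[OF h(1)])
  qed
qed

lemma kernel_iso:
  assumes k: "is_kernel C X Y f K k" "ar f X Y" and u: "ar u K' K" "is_mono C K' K u" "is_epi C K' K u"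
  shows "is_kernel C X Y f K' (u ;; k)"
proof -
  note d = kernelD[OF k(1) arrD(1)[OF k(2)]]
  obtain v where v: "ar v K K'" "v ;; u = idt K" using mono_epi_iso[OF u] by metis
  show ?thesis
  proof (rule kernelI[OF k(2) arr_cmp[OF u(1) d(1)]])
    show "u ;; k ;; f = zr K' Y" using zr_right[OF u(1) arrD(2)[OF k(2)]] d(2) by (simp add: assoc)
    show "is_mono C K' X (u ;; k)" using mono_cmp[OF u(1) d(1) u(2)] kernel_mono[OF k] by blast
    fix W h assume "ar h W X" "h ;; f = zr W Y"
    then obtain w where w: "ar w W K" "w ;; k = h" using d(3) by blast
    have "w ;; v ;; (u ;; k) = w ;; (v ;; u) ;; k" by (simp add: assoc)
    then have "w ;; v ;; (u ;; k) = h" using w v by simp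
    then show "\<exists>w. ar w W K' \<and> w ;; (u ;; k) = h" using w v by blast
  qed
qed

text \<open>The objects \<open>K i\<close> are the images provided by exactness, and each inner
  differential is an epimorphism onto its image followed by the inclusion. The end terms
  \<open>E 0\<close> and \<open>E (Suc (Suc n))\<close> are no middle terms of the tower, which
  explains the shift to \<open>E (Suc i)\<close>.\<close>

lemma extension_has_tower:
  assumes x: "(E, d) \<in> extensions C (Suc n) X Y"
  shows "\<exists>K a b. ext_tower C n X Y E d K a b"
proof -
  have EO: "\<And>i. i <= Suc (Suc n) ==> E i \<in> Ob C" and
    dH: "\<And>i. i <= Suc n ==> ar (d i) (E i) (E (Suc i))" and
    ends: "E 0 = Y" "E (Suc (Suc n)) = X" and
    m: "is_mono C (E 0) (E (Suc 0)) (d 0)" and e: "is_epi C (E (Suc n)) (E (Suc (Suc n))) (d (Suc n))" and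
    ex: "\<And>i. i <= n ==> exact_at C (E i) (d i) (E (Suc i)) (d (Suc i)) (E (Suc (Suc i)))"
    using x unfolding extensions_def arr_def PiE_def Pi_def by force+
  have "\<forall>i\<in>{..n}. \<exists>w. (case w of (Q, q, I, m) => is_cokernel C (E i) (E (Suc i)) (d i) Q q \<and>
      is_kernel C (E (Suc i)) Q q I m \<and> is_kernel C (E (Suc i)) (E (Suc (Suc i))) (d (Suc i)) I m)"
  proof
    fix i assume "i \<in> {..n}"
    then obtain Q q I m where "is_cokernel C (E i) (E (Suc i)) (d i) Q q"
      "is_kernel C (E (Suc i)) Q q I m" "is_kernel C (E (Suc i)) (E (Suc (Suc i))) (d (Suc i)) I m"
      using ex[of i] unfolding exact_at_def by auto
    then show "\<exists>w. (case w of (Q, q, I, m) => is_cokernel C (E i) (E (Suc i)) (d i) Q q \<and>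
      is_kernel C (E (Suc i)) Q q I m \<and> is_kernel C (E (Suc i)) (E (Suc (Suc i))) (d (Suc i)) I m)"
      by (intro exI[of _ "(Q, q, I, m)"]) simp
  qed
  from bchoice[OF this] obtain w where w: "\<forall>i\<in>{..n}. (case w i of (Q, q, I, m) => is_cokernel C (E i) (E (Suc i)) (d i) Q q \<and>
      is_kernel C (E (Suc i)) Q q I m \<and> is_kernel C (E (Suc i)) (E (Suc (Suc i))) (d (Suc i)) I m)"
    by blast
  define I where "I i = fst (snd (snd (w i)))" for i
  define mm where "mm i = snd (snd (snd (w i)))" for i
  have w1: "is_kernel C (E (Suc i)) (E (Suc (Suc i))) (d (Suc i)) (I i) (mm i)" if "i <= n" for i
    using w[rule_format, of i] that by (auto simp: I_def mm_def split: prod.splits)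
  have "\<exists>e. ar e (E i) (I i) \<and> e ;; mm i = d i \<and> is_epi C (E i) (I i) e" if "i <= n" for i
    using w[rule_format, of i] that dH[of i] image_fact[of "d i" "E i" "E (Suc i)" _ _ "I i" "mm i"]
    by (auto simp: I_def mm_def split: prod.splits)
  then have "\<forall>i\<in>{..n}. \<exists>e. ar e (E i) (I i) \<and> e ;; mm i = d i \<and> is_epi C (E i) (I i) e" by simp
  from bchoice[OF this] obtain ee where "\<forall>i\<in>{..n}. ar (ee i) (E i) (I i) \<and> ee i ;; mm i = d i \<and> is_epi C (E i) (I i) (ee i)"
    by blast
  then have ee: "ar (ee i) (E i) (I i) \<and> ee i ;; mm i = d i \<and> is_epi C (E i) (I i) (ee i)" if "i <= n" for i
    using that by simp
  have mm: "ar (mm i) (I i) (E (Suc i))" "is_mono C (I i) (E (Suc i)) (mm i)" if "i <= n" for i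
    using w1[OF that] kernelD(1)[OF w1[OF that]] kernel_mono[OF w1[OF that]] EO dH that by auto
  \<comment> \<open>\<open>I i\<close> is the image of \<open>d i\<close>. At the left end
    \<open>I 0\<close> is traded for \<open>Y\<close> itself, to which it is isomorphic because
    \<open>d 0\<close> is a monomorphism; at the right end \<open>X\<close> takes the place of an
    image because \<open>d (Suc n)\<close> is an epimorphism.\<close>
  define K where "K i = (if i = 0 then Y else if i <= n then I i else X)" for i
  define a where "a i = (if i = 0 then d 0 else mm i)" for i
  define b where "b i = (if i < n then ee (Suc i) else d (Suc n))" for i
  have bK: "ar (b i) (E (Suc i)) (K (Suc i)) \<and> is_epi C (E (Suc i)) (K (Suc i)) (b i)" if "i <= n" for i
    using that ee[of "Suc i"] dH[of "Suc n"] e ends by (cases "i = n") (auto simp: b_def K_def)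
  have "is_kernel C (E (Suc 0)) (E (Suc (Suc 0))) (d (Suc 0)) Y (d 0)"
  proof -
    have "is_kernel C (E (Suc 0)) (E (Suc (Suc 0))) (d (Suc 0)) (E 0) (ee 0 ;; mm 0)"
      using kernel_iso[OF w1[of 0], of "ee 0" "E 0"] ee[of 0] dH[of "Suc 0"] mono_left[of "ee 0" "E 0" "I 0" "mm 0" "E (Suc 0)"] mm[of 0] m
      by auto
    then show ?thesis using ee[of 0] ends by simp
  qed
  then have ka: "is_kernel C (E (Suc i)) (E (Suc (Suc i))) (d (Suc i)) (K i) (a i)" if "i <= n" for i
    using w1[OF that] that by (auto simp: K_def a_def)
  have db: "d (Suc i) = b i ;; a (Suc i)" if "i < n" for i
    using ee[of "Suc i"] that by (auto simp: a_def b_def)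
  have kb: "is_kernel C (E (Suc i)) (K (Suc i)) (b i) (K i) (a i)" if "i <= n" for i
  proof (cases "i = n")
    case True then show ?thesis using ka[of n] ends by (simp add: b_def K_def)
  next
    case False
    then have i: "i < n" using that by simp
    have "ar (a (Suc i)) (K (Suc i)) (E (Suc (Suc i)))" "is_mono C (K (Suc i)) (E (Suc (Suc i))) (a (Suc i))"
      using mm[of "Suc i"] i by (auto simp: a_def K_def)
    then show ?thesis using kernel_cmp_mono[of "E (Suc i)" "E (Suc (Suc i))" "b i" "a (Suc i)" "K i" "a i" "K (Suc i)"]
      ka[OF that] db[OF i] bK[OF that] by simp
  qed
  have "tower C (Suc n) K (\<lambda>i. E (Suc i)) a b"
    unfolding tower_def
  proof (intro allI impI conjI)
    fix i assume i: "i < Suc n"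
    show "E (Suc i) \<in> Ob C" using EO i by simp
    show "short_exact C (K i) (a i) (E (Suc i)) (b i) (K (Suc i))"
      using ses_iff[of "b i" "E (Suc i)" "K (Suc i)"] bK[of i] kb[of i] i by auto
  qed
  then have "ext_tower C n X Y E d K a b"
    unfolding ext_tower_def using db by (simp add: K_def a_def b_def)
  then show ?thesis by blast
qed

text \<open>Exactness of the splice reduces to the single sequences: an epimorphism in front of
  \<open>a (Suc i)\<close> does not alter its cokernel, and a monomorphism behind \<open>b i\<close>
  does not alter its kernel.\<close>

lemma tower_gives_extension:
  assumes T: "tower C (Suc n) K E a b"
  obtains E' d where "(E', d) \<in> extensions C (Suc n) (K (Suc n)) (K 0)"
    "ext_tower C n (K (Suc n)) (K 0) E' d K a b" "\<And>i. i <= n ==> E' (Suc i) = E i"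
proof -
  define E' where "E' = (\<lambda>i\<in>{0..Suc (Suc n)}. if i = 0 then K 0 else if i = Suc (Suc n) then K (Suc n) else E (i - 1))"
  define d where "d = (\<lambda>i\<in>{0..Suc n}. if i = 0 then a 0 else if i = Suc n then b n else b (i - 1) ;; a i)"
  have E': "E' 0 = K 0" "E' (Suc (Suc n)) = K (Suc n)" "\<And>i. i <= n ==> E' (Suc i) = E i"
    by (auto simp: E'_def)
  have d: "d 0 = a 0" "d (Suc n) = b n" "\<And>i. i < n ==> d (Suc i) = b i ;; a (Suc i)"
    by (auto simp: d_def)
  note TD = towerD[OF T]
  have s: "short_exact C (K i) (a i) (E i) (b i) (K (Suc i))" "E i \<in> Ob C" "ar (a i) (K i) (E i)"
    "ar (b i) (E i) (K (Suc i))" "K i \<in> Ob C" "K (Suc i) \<in> Ob C" if "i <= n" for i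
    using TD[of i] that by (auto simp: arr_def)
  have Ti: "tower C (Suc n) K (\<lambda>i. E' (Suc i)) a b"
    using s E' by (auto simp: tower_def)
  have dH: "ar (d i) (E' i) (E' (Suc i))" if "i <= Suc n" for i
  proof -
    from that show ?thesis
    proof (cases rule: index_cases)
      case (3 j)
      then show ?thesis using s[of j] s[of "Suc j"] E'(3)[of j] E'(3)[of "Suc j"] d(3)[of j] by auto
    qed (use s d E' in auto)
  qed
  have ex: "exact_at C (E' i) (d i) (E' (Suc i)) (d (Suc i)) (E' (Suc (Suc i)))" if i: "i <= n" for i
  proof -
    note si = s[OF i] and sd = sesD[OF s(1,2)[OF i]]
    have "is_cokernel C (E' i) (E' (Suc i)) (d i) (K (Suc i)) (b i)"
    proof (cases i)
      case 0 then show ?thesis using sd(4) E' d by simp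
    next
      case (Suc j)
      then have j: "j < n" using i by simp
      have "is_epi C (E j) (K (Suc j)) (b j)" using sesD(6)[OF s(1,2)[of j]] j by simp
      then show ?thesis
        using cokernel_epi_cmp[OF sd(4) sd(1), of "b j" "E j"] s(4)[of j] j Suc E' d by simp
    qed
    moreover have "is_kernel C (E' (Suc i)) (K (Suc i)) (b i) (K i) (a i)" using sd(3) E' i by simp
    moreover have "is_kernel C (E' (Suc i)) (E' (Suc (Suc i))) (d (Suc i)) (K i) (a i)"
    proof (cases "i = n")
      case True then show ?thesis using sd(3) E' d by simp
    next
      case False
      then have j: "i < n" using i by simp
      have "is_mono C (K (Suc i)) (E (Suc i)) (a (Suc i))" using sesD(5)[OF s(1,2)[of "Suc i"]] j by simp
      then show ?thesis
        using kernel_cmp_mono'[OF sd(3) sd(2), of "a (Suc i)" "E (Suc i)"] s(3)[of "Suc i"] j E' d by simp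
    qed
    ultimately show ?thesis unfolding exact_at_def by blast
  qed
  have EO: "E' i \<in> Ob C" if "i <= Suc (Suc n)" for i
    using that dH[of i] dH[of "Suc n"] by (cases "i = Suc (Suc n)") (auto simp: arr_def)
  have "(E', d) \<in> extensions C (Suc n) (K (Suc n)) (K 0)"
    unfolding extensions_def
  proof (clarsimp, intro conjI)
    show "E' \<in> {0..Suc (Suc n)} \<rightarrow>\<^sub>E Ob C" using EO by (auto simp: PiE_def E'_def extensional_def)
    show "d \<in> (\<Pi>\<^sub>E i\<in>{0..Suc n}. Hom C (E' i) (E' (Suc i)))"
      using dH by (auto simp: PiE_def arr_def) (auto simp: d_def extensional_def)
    show "E' 0 = K 0" "E' (Suc (Suc n)) = K (Suc n)" by (fact E')+
    show "is_mono C (E' 0) (E' (Suc 0)) (d 0)"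
      using sesD(5)[OF s(1,2)[of 0]] E' d by simp
    show "is_epi C (E' (Suc n)) (E' (Suc (Suc n))) (d (Suc n))"
      using sesD(6)[OF s(1,2)[of n]] E' d by simp
    show "\<forall>i\<in>{Suc 0..Suc n}. exact_at C (E' (i - Suc 0)) (d (i - Suc 0)) (E' i) (d i) (E' (Suc i))"
    proof
      fix i assume "i \<in> {Suc 0..Suc n}"
      then obtain j where "i = Suc j" "j <= n" by (cases i) auto
      then show "exact_at C (E' (i - Suc 0)) (d (i - Suc 0)) (E' i) (d i) (E' (Suc i))" using ex[of j] by simp
    qed
  qed
  moreover have "ext_tower C n (K (Suc n)) (K 0) E' d K a b"
    using Ti d by (simp add: ext_tower_def)
  ultimately show ?thesis using that E'(3) by blast
qed

text \<open>The maps between the \<open>K i\<close> are induced on cokernels from left to right;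
  compatibility with the next inclusion follows by cancelling the epimorphism \<open>b i\<close>. In
  the last place the identity of \<open>X\<close> makes the square commute.\<close>

lemma extension_step_tower:
  assumes s: "((E, d), (E', d')) \<in> extension_step C (Suc n) X Y"
    and T: "ext_tower C n X Y E d K a b" and T': "ext_tower C n X Y E' d' K' a' b'"
  shows "\<exists>u v. tower_mor (Suc n) K (\<lambda>i. E (Suc i)) a b K' (\<lambda>i. E' (Suc i)) a' b' u v \<and>
    u 0 = idt Y \<and> u (Suc n) = idt X"
proof -
  have x: "(E, d) \<in> extensions C (Suc n) X Y" "(E', d') \<in> extensions C (Suc n) X Y"
    and "\<exists>w. (\<forall>i\<in>{0..Suc (Suc n)}. w i \<in> Hom C (E i) (E' i)) \<and> w 0 = idt Y \<and> w (Suc (Suc n)) = idt X \<and>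
      (\<forall>i\<in>{0..Suc n}. d i ;; w (Suc i) = w i ;; d' i)"
    using s unfolding extension_step_def by auto
  then obtain w where w': "\<forall>i\<in>{0..Suc (Suc n)}. w i \<in> Hom C (E i) (E' i)" and
    we: "w 0 = idt Y" "w (Suc (Suc n)) = idt X" and
    wc': "\<forall>i\<in>{0..Suc n}. d i ;; w (Suc i) = w i ;; d' i" by blast
  have w: "w i \<in> Hom C (E i) (E' i)" if "i <= Suc (Suc n)" for i using w' that by simp
  have wc: "d i ;; w (Suc i) = w i ;; d' i" if "i <= Suc n" for i using wc' that by simp
  have EO: "E i \<in> Ob C" "E' i \<in> Ob C" if "i <= Suc (Suc n)" for i
    using x that unfolding extensions_def PiE_def Pi_def by auto
  have wa: "ar (w i) (E i) (E' i)" if "i <= Suc (Suc n)" for i using w[OF that] EO[OF that] by (simp add: arr_def)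
  have Tt: "tower C (Suc n) K (\<lambda>i. E (Suc i)) a b" "tower C (Suc n) K' (\<lambda>i. E' (Suc i)) a' b'"
    and K: "K 0 = Y" "K' 0 = Y" "K (Suc n) = X" "K' (Suc n) = X"
    and d: "d 0 = a 0" "d' 0 = a' 0" "d (Suc n) = b n" "d' (Suc n) = b' n"
    "\<And>i. i < n ==> d (Suc i) = b i ;; a (Suc i)" "\<And>i. i < n ==> d' (Suc i) = b' i ;; a' (Suc i)"
    using T T' by (auto simp: ext_tower_def)
  note D = towerD[OF Tt(1)] and D' = towerD[OF Tt(2)]
  have X: "X \<in> Ob C" "Y \<in> Ob C"
    using D(3)[of 0] D(4)[of n] K by (simp_all add: arr_def)
  have step: "\<exists>x. ar x (K (Suc i)) (K' (Suc i)) \<and> b i ;; x = w (Suc i) ;; b' i"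
    if i: "i <= n" and u: "a i ;; w (Suc i) = u ;; a' i" "ar u (K i) (K' i)" for i u
  proof -
    have l: "i < Suc n" using i by simp
    note si = sesD[OF D(1,2)[OF l]] and si' = sesD[OF D'(1,2)[OF l]]
    have "a i ;; (w (Suc i) ;; b' i) = zr (K i) (K' (Suc i))"
      using zr_right[OF u(2) arrD(2)[OF si'(2)]] by (simp add: assoc[symmetric] u(1)) (simp add: assoc si'(7))
    then show ?thesis using cokernelD(3)[OF si(4) D(2)[OF l] arr_cmp[OF wa si'(2)]] l by auto
  qed
  have "\<exists>u. tower_mor i K (\<lambda>i. E (Suc i)) a b K' (\<lambda>i. E' (Suc i)) a' b' u (\<lambda>i. w (Suc i)) \<and>
      u 0 = idt Y \<and> a i ;; w (Suc i) = u i ;; a' i" if "i <= n" for i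
    using that
  proof (induction i)
    case 0
    have "a 0 ;; w (Suc 0) = idt Y ;; a' 0" using wc[of 0] d we by simp
    then show ?case using X K by (intro exI[of _ "\<lambda>_. idt Y"]) (auto simp: tower_mor_def)
  next
    case (Suc i)
    then obtain u where u: "tower_mor i K (\<lambda>i. E (Suc i)) a b K' (\<lambda>i. E' (Suc i)) a' b' u (\<lambda>i. w (Suc i))"
      "u 0 = idt Y" "a i ;; w (Suc i) = u i ;; a' i" by auto
    have ui: "ar (u i) (K i) (K' i)" using u(1) by (simp add: tower_mor_def)
    obtain x where x: "ar x (K (Suc i)) (K' (Suc i))" "b i ;; x = w (Suc i) ;; b' i"
      using step[OF _ u(3) ui] Suc by auto
    have l: "i < Suc n" "Suc i < Suc n" using Suc by auto
    have "a (Suc i) ;; w (Suc (Suc i)) = x ;; a' (Suc i)"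
    proof (rule epiD[OF sesD(6)[OF D(1,2)[OF l(1)]]])
      show "ar (a (Suc i) ;; w (Suc (Suc i))) (K (Suc i)) (E' (Suc (Suc i)))"
        using D(3)[OF l(2)] wa[of "Suc (Suc i)"] l by auto
      show "ar (x ;; a' (Suc i)) (K (Suc i)) (E' (Suc (Suc i)))"
        using x D'(3)[OF l(2)] by auto
      show "b i ;; (a (Suc i) ;; w (Suc (Suc i))) = b i ;; (x ;; a' (Suc i))"
        using wc[of "Suc i"] l by (simp add: assoc[symmetric] x(2)) (simp add: d assoc)
    qed
    then show ?case using u x wa l
      by (intro exI[of _ "u(Suc i := x)"]) (auto simp: tower_mor_def le_Suc_eq less_Suc_eq)
  qed
  from this[of n] obtain u where u: "tower_mor n K (\<lambda>i. E (Suc i)) a b K' (\<lambda>i. E' (Suc i)) a' b' u (\<lambda>i. w (Suc i))"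
      "u 0 = idt Y" "a n ;; w (Suc n) = u n ;; a' n" by auto
  have "b n ;; idt X = w (Suc n) ;; b' n" using wc[of "Suc n"] d we K D(4)[of n] by simp
  then have "tower_mor (Suc n) K (\<lambda>i. E (Suc i)) a b K' (\<lambda>i. E' (Suc i)) a' b' (u(Suc n := idt X)) (\<lambda>i. w (Suc i))"
    using u wa X K by (auto simp: tower_mor_def le_Suc_eq less_Suc_eq)
  moreover have "(u(Suc n := idt X)) 0 = idt Y" "(u(Suc n := idt X)) (Suc n) = idt X" using u by simp_all
  ultimately show ?thesis by blast
qed

lemma tower_mor_extension_step:
  assumes T: "ext_tower C n X Y E d K a b" and T': "ext_tower C n X Y E' d' K' a' b'"
    and x: "(E, d) \<in> extensions C (Suc n) X Y" "(E', d') \<in> extensions C (Suc n) X Y"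
    and m: "tower_mor (Suc n) K (\<lambda>i. E (Suc i)) a b K' (\<lambda>i. E' (Suc i)) a' b' u v" "u 0 = idt Y" "u (Suc n) = idt X"
  shows "((E, d), (E', d')) \<in> extension_step C (Suc n) X Y"
proof -
  have Tt: "tower C (Suc n) K (\<lambda>i. E (Suc i)) a b" "tower C (Suc n) K' (\<lambda>i. E' (Suc i)) a' b'"
    and K: "K 0 = Y" "K' 0 = Y" "K (Suc n) = X" "K' (Suc n) = X"
    and d: "d 0 = a 0" "d' 0 = a' 0" "d (Suc n) = b n" "d' (Suc n) = b' n"
    "\<And>i. i < n ==> d (Suc i) = b i ;; a (Suc i)" "\<And>i. i < n ==> d' (Suc i) = b' i ;; a' (Suc i)"
    using T T' by (auto simp: ext_tower_def)
  have Ee: "E 0 = Y" "E' 0 = Y" "E (Suc (Suc n)) = X" "E' (Suc (Suc n)) = X" using x by (auto simp: extensions_def)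
  have O: "X \<in> Ob C" "Y \<in> Ob C"
    using towerD(3)[OF Tt(1), of 0] towerD(4)[OF Tt(1), of n] K by (simp_all add: arr_def)
  note M = tower_morD[OF m(1)]
  define w where "w i = (if i = 0 then idt Y else if i = Suc (Suc n) then idt X else v (i - 1))" for i
  have w: "w 0 = idt Y" "w (Suc (Suc n)) = idt X" "\<And>i. i < Suc n ==> w (Suc i) = v i" by (auto simp: w_def)
  have "w i \<in> Hom C (E i) (E' i)" if "i <= Suc (Suc n)" for i
  proof -
    from that show ?thesis
      by (cases rule: index_cases) (use w Ee O M(3) ident_in_Hom in \<open>auto simp: arr_def\<close>)
  qed
  moreover have "d i ;; w (Suc i) = w i ;; d' i" if "i <= Suc n" for i
  proof -
    from that show ?thesis
    proof (cases rule: index_cases)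
      case 1 then show ?thesis using w d M(4)[of 0] m(2) by simp
    next
      case 2 then show ?thesis using w d M(5)[of n] m(3) by simp
    next
      case (3 j)
      then have "b j ;; a (Suc j) ;; v (Suc j) = b j ;; u (Suc j) ;; a' (Suc j)"
        using M(4)[of "Suc j"] by (simp add: assoc)
      then show ?thesis using 3 w d M(5)[of j] by (simp add: assoc[symmetric])
    qed
  qed
  ultimately have "\<exists>u. (\<forall>i\<in>{0..Suc (Suc n)}. u i \<in> Hom C (E i) (E' i)) \<and> u 0 = idt Y \<and> u (Suc (Suc n)) = idt X \<and>
      (\<forall>i\<in>{0..Suc n}. d i ;; u (Suc i) = u i ;; d' i)"
    using w by (intro exI[of _ w]) simp
  then show ?thesis using x unfolding extension_step_def by simp
qed

lemma split_ses:
  assumes "X \<in> Ob C" "Y \<in> Ob C"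
  obtains a E b r s where "short_exact C X a E b Y" "E \<in> Ob C" "ar r E X" "ar s Y E"
    "a ;; r = idt X" "s ;; b = idt Y" "s ;; r = zr Y X" "r ;; a \<boxplus> b ;; s = idt E"
proof -
  obtain D i1 i2 p1 p2 where D: "ar i1 X D" "ar i2 Y D" "ar p1 D X" "ar p2 D Y"
    "i1 ;; p1 = idt X" "i2 ;; p2 = idt Y" "i1 ;; p2 = zr X Y" "i2 ;; p1 = zr Y X"
    "p1 ;; i1 \<boxplus> p2 ;; i2 = idt D" using sum2[OF assms] .
  have "is_kernel C D Y p2 X i1"
  proof (rule kernelI[OF D(4,1,7)])
    show "is_mono C X D i1" by (rule mono_left[OF D(1,3)]) (simp add: D assms)
    fix W h assume h: "ar h W D" "h ;; p2 = zr W Y"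
    have W: "W \<in> Ob C" using h arrD(1) by metis
    have s: "p2 ;; i2 \<boxplus> p1 ;; i1 = idt D" using D(9) pls_comm by metis
    have "h ;; p1 ;; i1 = h" by (rule biproduct_eq[OF h(1) D(4,2,3,1) s h(2)])
    then show "\<exists>u. ar u W X \<and> u ;; i1 = h" using h D by blast
  qed
  moreover have "is_epi C D Y p2" by (rule epi_right[OF D(2,4)]) (simp add: D assms)
  ultimately have "short_exact C X i1 D p2 Y" using ses_iff[OF D(4)] by blast
  then show ?thesis using that D arrD(2)[OF D(1)] by blast
qed

text \<open>Vanishing is turned back into an actual tower over \<open>W\<close>. Its upper sequences
  are the covers N -> P -> W themselves, and its lowest sequence is split, as witnessed by the
  retraction \<open>r\<close>. This is the only place where the recursive condition has to produce
  extensions.\<close>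

lemma zext_realize:
  assumes T: "tower C (Suc i) K E a b" and g: "ar g W (K (Suc i))"
    and z: "zext C K E a b (K 0) (idt (K 0)) i W g"
  shows "\<exists>K' E' a' b' u v r. tower C (Suc i) K' E' a' b' \<and> K' 0 = K 0 \<and> K' (Suc i) = W \<and>
    tower_mor (Suc i) K' E' a' b' K E a b u v \<and> u 0 = idt (K 0) \<and> u (Suc i) = g \<and>
    ar r (E' 0) (K 0) \<and> a' 0 ;; r = idt (K 0)"
  using T g z
proof (induction i arbitrary: W g)
  case 0
  note D = towerD[OF 0(1) lessI]
  obtain N m P e h g' s where c: "cover C W g (K 0) (a 0) (E 0) (b 0) N m P e h g'" and
    s: "ar s P (K 0)" "g' ;; idt (K 0) = m ;; s" using 0(3) by auto
  note d = coverD[OF c] and sd = sesD[OF coverD(2,1)[OF c]]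
  have O: "W \<in> Ob C" "K 0 \<in> Ob C" using 0(2) s by (simp_all add: arr_def)
  have g': "g' = m ;; s" using s d(4) by simp
  \<comment> \<open>Correcting the lift \<open>h\<close> by the extension \<open>s\<close> makes it
    vanish on the kernel of the cover, so it descends to a lift \<open>w\<close> of \<open>g\<close>
    itself. The sequence pulled back along \<open>g\<close> is thus split and can be replaced by a
    direct sum.\<close>
  have "m ;; (h \<boxplus> ng (s ;; a 0)) = zr N (E 0)"
  proof -
    have "m ;; h = m ;; (s ;; a 0)" using d(6) g' by (simp add: assoc)
    moreover have "ar (m ;; h) N (E 0)" using d by blast
    ultimately show ?thesis using pls_ng by (simp add: distr ngr)
  qed
  moreover have hh: "ar (h \<boxplus> ng (s ;; a 0)) P (E 0)" using d s D by blast
  ultimately obtain w where w: "ar w W (E 0)" "e ;; w = h \<boxplus> ng (s ;; a 0)"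
    using cokernelD(3)[OF sd(4) d(1)] by blast
  have wb: "w ;; b 0 = g"
  proof (rule epiD[OF sd(6) arr_cmp[OF w(1) D(4)] 0(2)])
    have "e ;; (w ;; b 0) = h ;; b 0 \<boxplus> ng (s ;; (a 0 ;; b 0))"
      by (simp add: assoc[symmetric] w(2) distl ngl)
    also have "s ;; (a 0 ;; b 0) = zr P (K (Suc 0))" using s(1) sesD(7)[OF D(1,2)] D by (simp add: arrD)
    also have "ng (zr P (K (Suc 0))) = zr P (K (Suc 0))"
      using pls_ng[of "zr P (K (Suc 0))"] d(1) D(4) by (metis ar_zr arrD(2) arr_ng pls_zero')
    finally show "e ;; (w ;; b 0) = e ;; g" using d(5) 0(2) d(8) by (metis arr_cmp pls_zero)
  qed
  obtain a1 E1 b1 r s1 where S: "short_exact C (K 0) a1 E1 b1 W" "E1 \<in> Ob C" "ar r E1 (K 0)" "ar s1 W E1"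
    "a1 ;; r = idt (K 0)" "s1 ;; b1 = idt W" using split_ses[OF O(2,1)] by metis
  note SD = sesD[OF S(1,2)]
  define K' where "K' j = (if j = 0 then K 0 else W)" for j :: nat
  define u where "u j = (if j = 0 then idt (K 0) else g)" for j :: nat
  let ?v = "r ;; a 0 \<boxplus> b1 ;; w"
  have v: "ar ?v E1 (E 0)" using S SD D w by blast
  have "a1 ;; ?v = idt (K 0) ;; a 0 \<boxplus> zr (K 0) (E 0)"
    using zr_left[OF w(1) O(2)] by (simp add: distr assoc[symmetric] S SD(7))
  then have av: "a1 ;; ?v = a 0" using D(3) by simp
  have "?v ;; b 0 = r ;; (a 0 ;; b 0) \<boxplus> b1 ;; g" by (simp add: distl assoc wb)
  then have bv: "?v ;; b 0 = b1 ;; g"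
    using sesD(7)[OF D(1,2)] S(3) SD(2) 0(2) D(4) by simp (metis arr_cmp arrD(2) pls_zero' zr_right)
  have "tower C (Suc 0) K' (\<lambda>_. E1) (\<lambda>_. a1) (\<lambda>_. b1)" using S by (simp add: tower_def K'_def)
  moreover have "tower_mor (Suc 0) K' (\<lambda>_. E1) (\<lambda>_. a1) (\<lambda>_. b1) K E a b u (\<lambda>_. ?v)"
    using O 0(2) v av bv D(3) by (auto simp: tower_mor_def K'_def u_def le_Suc_eq)
  ultimately have fin: "tower C (Suc 0) K' (\<lambda>_. E1) (\<lambda>_. a1) (\<lambda>_. b1) \<and> K' 0 = K 0 \<and> K' (Suc 0) = W \<and>
    tower_mor (Suc 0) K' (\<lambda>_. E1) (\<lambda>_. a1) (\<lambda>_. b1) K E a b u (\<lambda>_. ?v) \<and> u 0 = idt (K 0) \<and> u (Suc 0) = g \<and>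
    ar r E1 (K 0) \<and> a1 ;; r = idt (K 0)"
    using S(3,5) by (simp add: K'_def u_def)
  show ?case
    by (rule exI[of _ K'], rule exI[of _ "\<lambda>_. E1"], rule exI[of _ "\<lambda>_. a1"], rule exI[of _ "\<lambda>_. b1"],
        rule exI[of _ u], rule exI[of _ "\<lambda>_. ?v"], rule exI[of _ r], rule fin)
next
  case (Suc i)
  obtain N m P e h g' where c: "cover C W g (K (Suc i)) (a (Suc i)) (E (Suc i)) (b (Suc i)) N m P e h g'" and
    s: "zext C K E a b (K 0) (idt (K 0)) i N g'" using Suc(4) by auto
  note d = coverD[OF c]
  obtain K' E' a' b' u v r where F: "tower C (Suc i) K' E' a' b'" "K' 0 = K 0" "K' (Suc i) = N"
    "tower_mor (Suc i) K' E' a' b' K E a b u v" "u 0 = idt (K 0)" "u (Suc i) = g'"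
    "ar r (E' 0) (K 0)" "a' 0 ;; r = idt (K 0)"
    using Suc.IH[OF tower_mono[OF Suc(2)] d(4) s] by auto
  let ?K = "K'(Suc (Suc i) := W)" and ?E = "E'(Suc i := P)" and ?a = "a'(Suc i := m)" and ?b = "b'(Suc i := e)"
    and ?u = "u(Suc (Suc i) := g)" and ?v = "v(Suc i := h)"
  have "tower C (Suc (Suc i)) ?K ?E ?a ?b"
    using F(1,3) d by (auto simp: tower_def less_Suc_eq)
  moreover have "tower_mor (Suc (Suc i)) ?K ?E ?a ?b K E a b ?u ?v"
    using F(3,4,6) d Suc(3) by (auto simp: tower_mor_def less_Suc_eq le_Suc_eq)
  ultimately have fin: "tower C (Suc (Suc i)) ?K ?E ?a ?b \<and> ?K 0 = K 0 \<and> ?K (Suc (Suc i)) = W \<and>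
    tower_mor (Suc (Suc i)) ?K ?E ?a ?b K E a b ?u ?v \<and> ?u 0 = idt (K 0) \<and> ?u (Suc (Suc i)) = g \<and>
    ar r (?E 0) (K 0) \<and> ?a 0 ;; r = idt (K 0)"
    using F by simp
  show ?case
    by (rule exI[of _ ?K], rule exI[of _ ?E], rule exI[of _ ?a], rule exI[of _ ?b],
        rule exI[of _ ?u], rule exI[of _ ?v], rule exI[of _ r], rule fin)
qed

text \<open>\<open>E'\<close> is the cokernel of the map K -> E + Y with components \<open>a\<close>
  and the negative of \<open>t\<close>. That the map from \<open>Y\<close> is the kernel of
  \<open>b'\<close> is shown by a chase on covers, ended by \<open>epi_descent\<close>.\<close>

lemma pushout_ses:
  assumes s: "short_exact C K a E b Q" "E \<in> Ob C" and t: "ar t K Y"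
  obtains j E' b' v where "short_exact C Y j E' b' Q" "E' \<in> Ob C" "ar v E E'" "a ;; v = t ;; j" "v ;; b' = b"
proof -
  note d = sesD[OF s]
  have O: "K \<in> Ob C" "Y \<in> Ob C" "Q \<in> Ob C" using d(1,2) t by (simp_all add: arr_def)
  obtain D i1 i2 p1 p2 where D: "ar i1 E D" "ar i2 Y D" "ar p1 D E" "ar p2 D Y"
    "i1 ;; p1 = idt E" "i2 ;; p2 = idt Y" "i1 ;; p2 = zr E Y" "i2 ;; p1 = zr Y E"
    "p1 ;; i1 \<boxplus> p2 ;; i2 = idt D" using sum2[OF s(2) O(2)] .
  have DO: "D \<in> Ob C" using D(1) by (simp add: arr_def)
  let ?s = "a ;; i1 \<boxplus> ng (t ;; i2)"
  have sa: "ar ?s K D" using d D t by blast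
  have sp1: "?s ;; p1 = a"
  proof -
    have "?s ;; p1 = a \<boxplus> ng (zr K E)" using d(1) t O s(2) by (simp add: distl ngl assoc D)
    also have "ng (zr K E) = zr K E"
      using pls_ng[of "zr K E" K E] O(1) s(2) by (metis ar_zr arr_ng pls_zero')
    finally show ?thesis using d(1) by simp
  qed
  have sm: "is_mono C K D ?s" by (rule mono_left[OF sa D(3)]) (simp add: sp1 d(5))
  obtain E' c where c: "is_cokernel C K D ?s E' c" "is_epi C D E' c" "ar c D E'" "?s ;; c = zr K E'"
    using obtain_cokernel[OF sa] .
  have EO: "E' \<in> Ob C" using c(3) by (simp add: arr_def)
  have sk: "is_kernel C D E' c K ?s" by (rule mono_kernel_of_cokernel[OF sm sa c(1)])
  have "?s ;; (p1 ;; b) = zr K Q" using d(7) by (simp add: assoc[symmetric] sp1)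
  then obtain b' where b': "ar b' E' Q" "c ;; b' = p1 ;; b"
    using cokernelD(3)[OF c(1) DO arr_cmp[OF D(3) d(2)]] by blast
  let ?j = "i2 ;; c" and ?v = "i1 ;; c"
  have j: "ar ?j Y E'" and v: "ar ?v E E'" using D c by blast+
  have vb: "?v ;; b' = b" using d(2) by (simp add: assoc b'(2)) (simp add: assoc[symmetric] D)
  have av: "a ;; ?v = t ;; ?j"
  proof -
    have "a ;; ?v \<boxplus> ng (t ;; ?j) = zr K E'" using c(4) by (simp add: distl ngl assoc)
    then show ?thesis using sub_zero_iff[of "a ;; ?v" K E' "t ;; ?j"] d v t j by blast
  qed
  have jm: "is_mono C Y E' ?j"
  proof (rule monoI[OF j])
    fix W x assume x: "ar x W Y" "x ;; ?j = zr W E'"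
    have W: "W \<in> Ob C" using x(1) arrD(1) by metis
    obtain y where y: "ar y W K" "y ;; ?s = x ;; i2"
      using kernelD(3)[OF sk DO arr_cmp[OF x(1) D(2)]] x(2) by (auto simp: assoc)
    have "y ;; a = x ;; (i2 ;; p1)" by (subst sp1[symmetric]) (simp add: assoc[symmetric] y(2))
    then have "y = zr W K" using monoD0[OF d(5) s(2) y(1)] x(1) s(2) D(8) by simp
    then have "x ;; i2 = zr W D" using y(2) sa W by simp
    then have "x ;; (i2 ;; p2) = zr W Y" using D(4) W by (simp add: assoc[symmetric])
    then show "x = zr W Y" using D(6) x(1) by simp
  qed
  have "is_kernel C E' Q b' Y ?j"
  proof (rule kernelI[OF b'(1) j _ _ jm])
    show "?j ;; b' = zr Y Q" using zr_left[OF d(2) O(2)] by (simp add: assoc b'(2)) (simp add: assoc[symmetric] D)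
    fix W x assume x: "ar x W E'" "x ;; b' = zr W Q"
    have W: "W \<in> Ob C" using x(1) arrD(1) by metis
    obtain P e y where p: "ar e P W" "ar y P D" "e ;; x = y ;; c" "is_epi C P W e"
      using pullback[OF x(1) c(3)] c(2) by metis
    have P: "P \<in> Ob C" using p(1) arrD(1) by metis
    have "y ;; p1 ;; b = e ;; (x ;; b')" by (simp add: assoc b'(2)[symmetric]) (simp add: assoc[symmetric] p(3))
    then have "y ;; p1 ;; b = zr P Q" using x(2) p(1) O by simp
    then obtain w where w: "ar w P K" "w ;; a = y ;; p1" using kernelD(3)[OF d(3) s(2) arr_cmp[OF p(2) D(3)]] by blast
    \<comment> \<open>The component of \<open>y\<close> in \<open>E\<close> comes from
      \<open>w : P \<rightarrow> K\<close>. Subtracting \<open>w ;; ?s\<close> removes that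
      component without changing the image in \<open>E'\<close>, so only a part from
      \<open>Y\<close> is left.\<close>
    let ?q = "y \<boxplus> ng (w ;; ?s)"
    have q: "ar ?q P D" using p w sa by blast
    have yp: "ar (y ;; p1) P E" using p D by blast
    have "?q ;; p1 = y ;; p1 \<boxplus> ng (w ;; (?s ;; p1))" by (simp add: distl ngl assoc)
    then have qp1: "?q ;; p1 = zr P E" unfolding sp1 w(2) using pls_ng[OF yp] by simp
    have q2: "?q = ?q ;; p2 ;; i2" by (rule biproduct_eq[OF q D(3,1,4,2,9) qp1, symmetric])
    have yc: "ar (y ;; c) P E'" using p c by blast
    have "?q ;; c = y ;; c \<boxplus> ng (w ;; (?s ;; c))" by (simp add: distl ngl assoc)
    also have "w ;; (?s ;; c) = zr P E'" using c(4) w(1) EO by simp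
    also have "y ;; c \<boxplus> ng (zr P E') = y ;; c"
      using sub_eq_iff[OF yc ar_zr[OF P EO] yc] yc by simp
    finally have "?q ;; c = e ;; x" using p(3) by simp
    then have "?q ;; p2 ;; ?j = e ;; x" using arg_cong[OF q2, of "\<lambda>z. z ;; c"] by (simp add: assoc)
    moreover have "ar (?q ;; p2) P Y" using q D by blast
    ultimately show "\<exists>u. ar u W Y \<and> u ;; ?j = x" using epi_descent[OF jm j p(4,1) x(1)] by blast
  qed
  moreover have "is_epi C E' Q b'" by (rule epi_right[OF v b'(1)]) (simp add: vb d(6))
  ultimately have "short_exact C Y ?j E' b' Q" using ses_iff[OF b'(1)] by blast
  then show ?thesis using that[OF _ EO v av vb] by blast
qed

lemma split_tower:
  assumes "\<And>i. i <= Suc n ==> K i \<in> Ob C"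
  obtains E a b s where "tower C (Suc n) K E a b" "\<And>i. i <= n ==> ar (s i) (K (Suc i)) (E i) \<and> s i ;; b i = idt (K (Suc i))"
proof -
  have "\<forall>i\<in>{..n}. \<exists>w. (case w of (E, a, b, s) => E \<in> Ob C \<and> short_exact C (K i) a E b (K (Suc i)) \<and>
    ar s (K (Suc i)) E \<and> s ;; b = idt (K (Suc i)))"
  proof
    fix i assume i: "i \<in> {..n}"
    have "K i \<in> Ob C" "K (Suc i) \<in> Ob C" using assms i by auto
    then obtain a E b r s where "short_exact C (K i) a E b (K (Suc i))" "E \<in> Ob C" "ar s (K (Suc i)) E"
      "s ;; b = idt (K (Suc i))" using split_ses by metis
    then show "\<exists>w. (case w of (E, a, b, s) => E \<in> Ob C \<and> short_exact C (K i) a E b (K (Suc i)) \<and>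
      ar s (K (Suc i)) E \<and> s ;; b = idt (K (Suc i)))" by (intro exI[of _ "(E, a, b, s)"]) simp
  qed
  from bchoice[OF this] obtain w where w: "\<forall>i\<in>{..n}. (case w i of (E, a, b, s) => E \<in> Ob C \<and> short_exact C (K i) a E b (K (Suc i)) \<and>
    ar s (K (Suc i)) E \<and> s ;; b = idt (K (Suc i)))" by blast
  show ?thesis
    by (rule that[of "\<lambda>i. fst (w i)" "\<lambda>i. fst (snd (w i))" "\<lambda>i. fst (snd (snd (w i)))" "\<lambda>i. snd (snd (snd (w i)))"])
      (use w in \<open>auto simp: tower_def split_beta less_Suc_eq_le\<close>)
qed

text \<open>Quantified over every way of cutting the extension into short exact sequences, since the
  objects \<open>K i\<close> are determined only up to isomorphism.\<close>

definition zero_class where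
  "zero_class n X Y x <-> (\<forall>K a b. ext_tower C n X Y (fst x) (snd x) K a b -->
     zext C K (\<lambda>i. fst x (Suc i)) a b Y (idt Y) n X (idt X))"

text \<open>The induced map of towers is the identity at both ends, so \<open>zext_push\<close> and
  \<open>zext_pull\<close> give the two implications. The towers \<open>L\<close> and
  \<open>L'\<close> guard against an empty quantification.\<close>

lemma zero_class_step:
  assumes s: "(x, y) \<in> extension_step C (Suc n) X Y"
  shows "zero_class n X Y x <-> zero_class n X Y y"
proof -
  obtain E d E' d' where xy: "x = (E, d)" "y = (E', d')" by (cases x, cases y)
  have x: "(E, d) \<in> extensions C (Suc n) X Y" "(E', d') \<in> extensions C (Suc n) X Y"
    using s by (auto simp: extension_step_def xy)
  obtain L al bl where L: "ext_tower C n X Y E d L al bl" using extension_has_tower[OF x(1)] by blast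
  obtain L' al' bl' where L': "ext_tower C n X Y E' d' L' al' bl'" using extension_has_tower[OF x(2)] by blast
  have O: "X \<in> Ob C" "Y \<in> Ob C"
    using L towerD(3)[of "Suc n" L _ al bl 0] towerD(4)[of "Suc n" L _ al bl n] by (auto simp: ext_tower_def arr_def)
  have *: "zext C K (\<lambda>i. E (Suc i)) a b Y (idt Y) n X (idt X) <-> zext C K' (\<lambda>i. E' (Suc i)) a' b' Y (idt Y) n X (idt X)"
    if T: "ext_tower C n X Y E d K a b" "ext_tower C n X Y E' d' K' a' b'" for K a b K' a' b'
  proof -
    obtain u v where u: "tower_mor (Suc n) K (\<lambda>i. E (Suc i)) a b K' (\<lambda>i. E' (Suc i)) a' b' u v"
      "u 0 = idt Y" "u (Suc n) = idt X" using extension_step_tower[OF _ T] s xy by blast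
    have Tt: "tower C (Suc n) K (\<lambda>i. E (Suc i)) a b" "tower C (Suc n) K' (\<lambda>i. E' (Suc i)) a' b'"
      "K (Suc n) = X" "K' 0 = Y" using T by (auto simp: ext_tower_def)
    show ?thesis
      using zext_push[OF u(1), where t' = "idt Y" and t = "idt Y" and W = X and g = "idt X"]
        zext_pull[OF u(1), where t' = "idt Y" and t = "idt Y" and W = X and g = "idt X"] u Tt O
        id_left[OF arr_ident[OF O(1)]] id_left[OF arr_ident[OF O(2)]]
      by auto
  qed
  show ?thesis unfolding zero_class_def xy fst_conv snd_conv using * L L' by meson
qed

lemma zero_class_rtrancl:
  assumes "(x, y) \<in> (extension_step C (Suc n) X Y \<union> (extension_step C (Suc n) X Y)\<inverse>)\<^sup>*"
  shows "zero_class n X Y x <-> zero_class n X Y y"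
  using assms
proof (induction rule: rtrancl_induct)
  case (step y z)
  then show ?case using zero_class_step by blast
qed simp

end

lemma Ext_zero_Suc_iff:
  "Ext_zero C (Suc n) X Y <-> extensions C (Suc n) X Y \<noteq> {} \<and>
    (\<forall>x\<in>extensions C (Suc n) X Y. \<forall>y\<in>extensions C (Suc n) X Y.
      (x, y) \<in> (extension_step C (Suc n) X Y \<union> (extension_step C (Suc n) X Y)\<inverse>)\<^sup>*)"
  (is "_ <-> ?S \<noteq> {} \<and> (\<forall>x\<in>?S. \<forall>y\<in>?S. (x, y) \<in> ?R\<^sup>*)")
proof
  assume "Ext_zero C (Suc n) X Y"
  then obtain q where q: "?S // ?R\<^sup>* = {q}" unfolding Ext_zero_def yoneda_Ext_def is_singleton_def by auto
  then have "?S \<noteq> {}" by (auto simp: quotient_def)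
  moreover have "(x, y) \<in> ?R\<^sup>*" if "x \<in> ?S" "y \<in> ?S" for x y
  proof -
    have "?R\<^sup>* `` {x} = ?R\<^sup>* `` {y}"
      using quotientI[OF that(1), of "?R\<^sup>*", unfolded q] quotientI[OF that(2), of "?R\<^sup>*", unfolded q] by simp
    then show ?thesis by (metis Image_singleton_iff rtrancl.rtrancl_refl)
  qed
  ultimately show "?S \<noteq> {} \<and> (\<forall>x\<in>?S. \<forall>y\<in>?S. (x, y) \<in> ?R\<^sup>*)" by blast
next
  assume a: "?S \<noteq> {} \<and> (\<forall>x\<in>?S. \<forall>y\<in>?S. (x, y) \<in> ?R\<^sup>*)"
  then obtain x where x: "x \<in> ?S" by blast
  have e: "?R\<^sup>* `` {y} = ?R\<^sup>* `` {x}" if y: "y \<in> ?S" for y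
  proof -
    have "(x, y) \<in> ?R\<^sup>*" "(y, x) \<in> ?R\<^sup>*" using a x y by blast+
    then show ?thesis by (meson Image_singleton_iff equalityI rtrancl_trans subsetI)
  qed
  have "?S // ?R\<^sup>* = (\<lambda>y. ?R\<^sup>* `` {y}) ` ?S" by (simp add: quotient_def UNION_singleton_eq_range)
  also have "\<dots> = {?R\<^sup>* `` {x}}" using e x by blast
  finally show "Ext_zero C (Suc n) X Y" unfolding Ext_zero_def yoneda_Ext_def is_singleton_def by simp
qed

context abcat begin

text \<open>Pulling the top sequence back along \<open>g\<close> and pushing the bottom one out
  along \<open>t\<close> yields an honest extension of \<open>X\<close> by \<open>Y\<close>. It is
  Yoneda equivalent to a split one, whose class vanishes because the identity of \<open>X\<close>
  lifts. The maps of towers from both constructions bring the result back to the given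
  tower.\<close>

lemma Ext_zero_imp_vanishing:
  assumes z: "Ext_zero C (Suc n) X Y"
  shows "vanishing C n X Y"
  unfolding vanishing_def
proof (intro allI impI)
  fix K E a b t g assume T: "tower C (Suc n) K E a b" and t: "ar t (K 0) Y" and g: "ar g X (K (Suc n))"
  note D = towerD[OF T]
  have O: "X \<in> Ob C" "Y \<in> Ob C" using t g by (simp_all add: arr_def)
  have KO: "K i \<in> Ob C" if "i <= Suc n" for i
    using D(3)[of i] D(4)[of n] that by (cases "i = Suc n") (auto simp: arr_def)
  obtain m1 P1 e1 y where p: "P1 \<in> Ob C" "short_exact C (K n) m1 P1 e1 X" "ar y P1 (E n)"
    "y ;; b n = e1 ;; g" "m1 ;; y = a n" using pullback_ses[OF D(1,2)[OF lessI] g] by metis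
  let ?K = "K(Suc n := X)" and ?E = "E(n := P1)" and ?a = "a(n := m1)" and ?b = "b(n := e1)"
  have T1: "tower C (Suc n) ?K ?E ?a ?b" using T p by (auto simp: tower_def less_Suc_eq)
  note pd = sesD[OF p(2,1)]
  have M1: "tower_mor (Suc n) ?K ?E ?a ?b K E a b (\<lambda>i. if i = Suc n then g else idt (K i)) (\<lambda>i. if i = n then y else idt (E i))"
    unfolding tower_mor_def
  proof (intro conjI allI impI)
    fix i assume i: "i < Suc n"
    note Di = D[OF i] and l = id_left[OF D(3)[OF i]] id_right[OF D(3)[OF i]] id_left[OF D(4)[OF i]] id_right[OF D(4)[OF i]]
      id_left[OF D(3)[OF lessI]]
    show "?a i ;; (if i = n then y else idt (E i)) = (if i = Suc n then g else idt (K i)) ;; a i"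
      using i l p(5) by auto
    show "?b i ;; (if Suc i = Suc n then g else idt (K (Suc i))) = (if i = n then y else idt (E i)) ;; b i"
      using i l p(4) by auto
  qed (use D KO g p in auto)
  note D1 = towerD[OF T1, of 0]
  obtain j E' b' v where q: "short_exact C Y j E' b' (?K (Suc 0))" "E' \<in> Ob C" "ar v (?E 0) E'" "?a 0 ;; v = t ;; j" "v ;; b' = ?b 0"
    by (rule pushout_ses[OF D1(1,2)[OF zero_less_Suc], of t Y]) (use t in simp, rule that, assumption+)
  note qd = sesD[OF q(1,2)]
  let ?K2 = "?K(0 := Y)" and ?E2 = "?E(0 := E')" and ?a2 = "?a(0 := j)" and ?b2 = "?b(0 := b')"
  let ?u = "(\<lambda>i. idt (?K i))(0 := t)" and ?v = "(\<lambda>i. idt (?E i))(0 := v)"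
  have T2: "tower C (Suc n) ?K2 ?E2 ?a2 ?b2"
    unfolding tower_def
  proof (intro allI impI)
    fix i assume i: "i < Suc n"
    show "?E2 i \<in> Ob C \<and> short_exact C (?K2 i) (?a2 i) (?E2 i) (?b2 i) (?K2 (Suc i))"
      using towerD(1,2)[OF T1 i] q(1,2) by (cases i) simp_all
  qed
  have K1O: "?K i \<in> Ob C" if "i <= Suc n" for i using KO[OF that] O by auto
  have M2: "tower_mor (Suc n) ?K ?E ?a ?b ?K2 ?E2 ?a2 ?b2 ?u ?v"
    unfolding tower_mor_def
  proof (intro conjI allI impI)
    fix i assume i: "i <= Suc n"
    show "ar (?u i) (?K i) (?K2 i)" using t arr_ident[OF K1O[OF i]] by (cases i) auto
  next
    fix i assume i: "i < Suc n"
    note Di = towerD[OF T1 i]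
    show "ar (?v i) (?E i) (?E2 i)" using q arr_ident[OF Di(2)] by (cases i) auto
    show "?a i ;; ?v i = ?u i ;; ?a2 i" using q id_right[OF Di(3)] id_left[OF Di(3)] by (cases i) auto
    show "?b i ;; ?u (Suc i) = ?v i ;; ?b2 i" using q id_right[OF Di(4)] id_left[OF Di(4)] by (cases i) auto
  qed
  obtain E3 d3 where x3: "(E3, d3) \<in> extensions C (Suc n) (?K2 (Suc n)) (?K2 0)"
    "ext_tower C n (?K2 (Suc n)) (?K2 0) E3 d3 ?K2 ?a2 ?b2" "\<And>i. i <= n ==> E3 (Suc i) = ?E2 i"
    by (rule tower_gives_extension[OF T2]) (rule that, assumption+)
  have K2e: "?K2 (Suc n) = X" "?K2 0 = Y" by simp_all
  have K2O: "?K2 i \<in> Ob C" if "i <= Suc n" for i using K1O[OF that] O by auto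
  \<comment> \<open>A base point for the zigzag: the same objects \<open>?K2 i\<close>, but with
    every sequence split.\<close>
  obtain Es as bs ss where S: "tower C (Suc n) ?K2 Es as bs"
    "\<And>i. i <= n ==> ar (ss i) (?K2 (Suc i)) (Es i) \<and> ss i ;; bs i = idt (?K2 (Suc i))"
    by (rule split_tower[OF K2O]) (assumption, rule that, assumption+)
  obtain E4 d4 where x4: "(E4, d4) \<in> extensions C (Suc n) (?K2 (Suc n)) (?K2 0)"
    "ext_tower C n (?K2 (Suc n)) (?K2 0) E4 d4 ?K2 as bs" "\<And>i. i <= n ==> E4 (Suc i) = Es i"
    by (rule tower_gives_extension[OF S(1)]) (rule that, assumption+)
  \<comment> \<open>Another tower of this extension may have different objects in between, but its
    last map is always \<open>d4 (Suc n)\<close>, for which \<open>ss n\<close> is a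
    section.\<close>
  have "zero_class n X Y (E4, d4)"
    unfolding zero_class_def
  proof (intro allI impI)
    fix K' a' b' assume "ext_tower C n X Y (fst (E4, d4)) (snd (E4, d4)) K' a' b'"
    then have T': "tower C (Suc n) K' (\<lambda>i. E4 (Suc i)) a' b'" "K' 0 = Y" "K' (Suc n) = X" "b' n = d4 (Suc n)"
      by (auto simp: ext_tower_def)
    have "bs n = d4 (Suc n)" using x4 by (simp add: ext_tower_def)
    then have "ss n ;; b' n = idt X" "ar (ss n) X (E4 (Suc n))" using S(2)[of n] x4(3)[of n] T' by auto
    then show "zext C K' (\<lambda>i. fst (E4, d4) (Suc i)) a' b' Y (idt Y) n X (idt X)"
      using zext_lift[OF T'(1), of "idt Y" Y "ss n" X] T' O by auto
  qed
  moreover have "((E4, d4), (E3, d3)) \<in> (extension_step C (Suc n) X Y \<union> (extension_step C (Suc n) X Y)\<inverse>)\<^sup>*"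
    using z x3(1) x4(1) unfolding Ext_zero_Suc_iff K2e by blast
  ultimately have "zero_class n X Y (E3, d3)" using zero_class_rtrancl by blast
  then have "zext C ?K2 (\<lambda>i. E3 (Suc i)) ?a2 ?b2 Y (idt Y) n X (idt X)"
    using x3(2) by (simp add: zero_class_def)
  moreover have T3: "tower C (Suc n) ?K2 (\<lambda>i. E3 (Suc i)) ?a2 ?b2" using x3(2) by (simp add: ext_tower_def)
  moreover have "tower_mor (Suc n) ?K ?E ?a ?b ?K2 (\<lambda>i. E3 (Suc i)) ?a2 ?b2 ?u ?v"
    using M2 x3(3) by (auto simp: tower_mor_def)
  ultimately have "zext C ?K ?E ?a ?b Y t n X (idt X)"
    using zext_pull[OF _ _ T1 T3, where u = ?u and v = ?v and t' = "idt Y" and t = t and W = X and g = "idt X"] t O by auto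
  from zext_push[OF M1 _ this, of t] show "zext C K E a b Y t n X g" using g t by simp
qed

text \<open>The base point is the split tower on Y, 0, ..., 0, X. By \<open>zext_realize\<close> any
  extension receives a map from one whose first sequence splits, and the retraction of that sequence
  gives a map on to the base point. So each extension is joined to the base point by two steps, in
  opposite directions.\<close>

lemma vanishing_imp_Ext_zero:
  assumes v: "vanishing C n X Y" and O: "X \<in> Ob C" "Y \<in> Ob C"
  shows "Ext_zero C (Suc n) X Y"
proof -
  obtain Z where Z: "is_zero_obj C Z" using ex_zero_obj by blast
  have ZO: "Z \<in> Ob C" using Z by (simp add: zero_obj_iff)
  define K where "K i = (if i = 0 then Y else if i = Suc n then X else Z)" for i
  have Ke: "K 0 = Y" "K (Suc n) = X" by (auto simp: K_def)
  have KO: "K i \<in> Ob C" for i using O ZO by (auto simp: K_def)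
  obtain E a b s where T: "tower C (Suc n) K E a b"
    and s: "\<And>i. i <= n ==> ar (s i) (K (Suc i)) (E i) \<and> s i ;; b i = idt (K (Suc i))"
    by (rule split_tower[OF KO]) (rule that, assumption+)
  note D = towerD[OF T]
  obtain E0 d0 where x0: "(E0, d0) \<in> extensions C (Suc n) X Y"
    "ext_tower C n X Y E0 d0 K a b" "\<And>i. i <= n ==> E0 (Suc i) = E i"
    by (rule tower_gives_extension[OF T, unfolded Ke]) (rule that, assumption+)
  let ?R = "extension_step C (Suc n) X Y \<union> (extension_step C (Suc n) X Y)\<inverse>"
  have main: "(x, (E0, d0)) \<in> ?R\<^sup>* \<and> ((E0, d0), x) \<in> ?R\<^sup>*" if "x \<in> extensions C (Suc n) X Y" for x
  proof -
    obtain E1 d1 where xe: "x = (E1, d1)" by (cases x)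
    have x1: "(E1, d1) \<in> extensions C (Suc n) X Y" using that xe by simp
    obtain K1 a1 b1 where L: "ext_tower C n X Y E1 d1 K1 a1 b1" using extension_has_tower[OF x1] by blast
    then have T1: "tower C (Suc n) K1 (\<lambda>i. E1 (Suc i)) a1 b1" "K1 0 = Y" "K1 (Suc n) = X" by (auto simp: ext_tower_def)
    have "zext C K1 (\<lambda>i. E1 (Suc i)) a1 b1 Y (idt Y) n X (idt X)"
      using v T1 arr_ident[OF O(1)] arr_ident[OF O(2)] unfolding vanishing_def by metis
    then obtain K2 E2 a2 b2 u v r where F: "tower C (Suc n) K2 E2 a2 b2" "K2 0 = Y" "K2 (Suc n) = X"
      "tower_mor (Suc n) K2 E2 a2 b2 K1 (\<lambda>i. E1 (Suc i)) a1 b1 u v" "u 0 = idt Y" "u (Suc n) = idt X"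
      "ar r (E2 0) Y" "a2 0 ;; r = idt Y"
      using zext_realize[OF T1(1), of "idt X" X, unfolded T1(2,3), OF arr_ident[OF O(1)]] by blast
    note D2 = towerD[OF F(1)]
    have K2O: "K2 i \<in> Ob C" if "i <= Suc n" for i
      using D2(3)[of i] F(3) O that by (cases "i = Suc n") (auto simp: arr_def)
    obtain E3 d3 where x3: "(E3, d3) \<in> extensions C (Suc n) X Y"
      "ext_tower C n X Y E3 d3 K2 a2 b2" "\<And>i. i <= n ==> E3 (Suc i) = E2 i"
      by (rule tower_gives_extension[OF F(1), unfolded F(2,3)]) (rule that, assumption+)
    have "tower_mor (Suc n) K2 (\<lambda>i. E3 (Suc i)) a2 b2 K1 (\<lambda>i. E1 (Suc i)) a1 b1 u v"
      using F(4) x3(3) by (auto simp: tower_mor_def)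
    then have s1: "((E3, d3), (E1, d1)) \<in> extension_step C (Suc n) X Y"
      using tower_mor_extension_step[OF x3(2) L x3(1) x1] F by blast
    define u' where "u' i = (if i = 0 then idt Y else if i = Suc n then idt X else zr (K2 i) Z)" for i
    have u': "ar (u' i) (K2 i) (K i)" if "i <= Suc n" for i
      using K2O[OF that] ZO O F(2,3) by (auto simp: u'_def K_def)
    \<comment> \<open>The target \<open>E i\<close> is split, so a map into it is given by a
      component in \<open>K i\<close> and one in \<open>K (Suc i)\<close>. The first component comes
      from \<open>r\<close> at \<open>i = 0\<close> and is zero for larger \<open>i\<close>, where
      \<open>K i\<close> is a zero object.\<close>
    define v' where "v' i = (if i = 0 then r ;; a 0 else zr (E2 i) (E i)) \<boxplus> b2 i ;; u' (Suc i) ;; s i" for i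
    have "tower_mor (Suc n) K2 E2 a2 b2 K E a b u' v'"
      unfolding tower_mor_def
    proof (intro conjI allI impI)
      fix i assume i: "i < Suc n"
      have si: "ar (s i) (K (Suc i)) (E i)" "s i ;; b i = idt (K (Suc i))" using s i by auto
      note Di = D[OF i] and D2i = D2[OF i]
      have ui: "ar (u' (Suc i)) (K2 (Suc i)) (K (Suc i))" using u' i by simp
      have c: "ar (if i = 0 then r ;; a 0 else zr (E2 i) (E i)) (E2 i) (E i)"
        using F(7) Di D2i Ke by auto
      have bu: "ar (b2 i ;; u' (Suc i)) (E2 i) (K (Suc i))" using D2i ui by blast
      show "ar (v' i) (E2 i) (E i)" unfolding v'_def using c bu si by blast
      have KO2: "K2 i \<in> Ob C" using D2i(3) by (simp add: arr_def)
      have ab: "a2 i ;; b2 i = zr (K2 i) (K2 (Suc i))" "a i ;; b i = zr (K i) (K (Suc i))"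
        using sesD(7)[OF D2i(1,2)] sesD(7)[OF Di(1,2)] by auto
      have us: "ar (u' (Suc i) ;; s i) (K2 (Suc i)) (E i)" using ui si by blast
      have "a2 i ;; (b2 i ;; u' (Suc i) ;; s i) = zr (K2 i) (E i)"
        using zr_left[OF us KO2] ab(1) by (simp add: assoc) (simp add: assoc[symmetric])
      moreover have "a2 i ;; (if i = 0 then r ;; a 0 else zr (E2 i) (E i)) = u' i ;; a i"
      proof (cases "i = 0")
        case True then show ?thesis using F(8) by (simp add: assoc[symmetric] u'_def)
      next
        case False
        then have "u' i = zr (K2 i) Z" "K i = Z" using i by (auto simp: u'_def K_def)
        then show ?thesis using False D2i Di KO2 ZO by simp
      qed
      moreover have "ar (u' i ;; a i) (K2 i) (E i)" using u'[of i] i Di by auto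
      ultimately show "a2 i ;; v' i = u' i ;; a i" unfolding v'_def distr by simp
      have "(if i = 0 then r ;; a 0 else zr (E2 i) (E i)) ;; b i = zr (E2 i) (K (Suc i))"
        using F(7) Di D2i Ke ab(2) by (auto simp: assoc arrD)
      moreover have "b2 i ;; u' (Suc i) ;; s i ;; b i = b2 i ;; u' (Suc i)"
        using id_right[OF bu] unfolding si(2)[symmetric] by (simp add: assoc)
      ultimately show "b2 i ;; u' (Suc i) = v' i ;; b i" unfolding v'_def distl using pls_zero'[OF bu] by simp
    qed (use u' in auto)
    then have "tower_mor (Suc n) K2 (\<lambda>i. E3 (Suc i)) a2 b2 K (\<lambda>i. E0 (Suc i)) a b u' v'"
      using x3(3) x0(3) by (auto simp: tower_mor_def)
    then have s2: "((E3, d3), (E0, d0)) \<in> extension_step C (Suc n) X Y"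
      using tower_mor_extension_step[OF x3(2) x0(2) x3(1) x0(1)] by (simp add: u'_def)
    have "((E1, d1), (E3, d3)) \<in> ?R" "((E3, d3), (E0, d0)) \<in> ?R" "((E0, d0), (E3, d3)) \<in> ?R" "((E3, d3), (E1, d1)) \<in> ?R"
      using s1 s2 by blast+
    then show ?thesis unfolding xe by (meson r_into_rtrancl rtrancl_trans)
  qed
  show ?thesis unfolding Ext_zero_Suc_iff
  proof (intro conjI ballI)
    show "extensions C (Suc n) X Y \<noteq> {}" using x0(1) by (metis empty_iff)
    fix x y assume "x \<in> extensions C (Suc n) X Y" "y \<in> extensions C (Suc n) X Y"
    then show "(x, y) \<in> ?R\<^sup>*" using rtrancl_trans[OF conjunct1[OF main] conjunct2[OF main]] by metis
  qed
qed

lemma Ext_zero_iff_vanishing: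
  "X \<in> Ob C ==> Y \<in> Ob C ==> Ext_zero C (Suc n) X Y <-> vanishing C n X Y"
  using Ext_zero_imp_vanishing vanishing_imp_Ext_zero by blast

end

section \<open>Vanishing for retracts and finite direct sums\<close>

context abcat begin

primrec psum where
  "psum Y a b 0 = zr Y Y"
| "psum Y a b (Suc m) = psum Y a b m \<boxplus> a m ;; b m"

lemma psum_arr:
  assumes "Y \<in> Ob C" "\<And>j. j < m ==> ar (a j) Y (X j) \<and> ar (b j) (X j) Y"
  shows "ar (psum Y a b m) Y Y"
  using assms(2)
proof (induction m)
  case (Suc m)
  then have "ar (psum Y a b m) Y Y" "ar (a m ;; b m) Y Y" by auto
  then show ?case by auto
qed (use assms(1) in auto)

lemma zext_target_zero:
  assumes "tower C (Suc i) K E a b" "Y \<in> Ob C" "ar g W (K (Suc i))"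
  shows "zext C K E a b Y (zr (K 0) Y) i W g"
  using assms
proof (induction i arbitrary: W g)
  case 0
  obtain N m P e h g' where c: "cover C W g (K 0) (a 0) (E 0) (b 0) N m P e h g'"
    using cover_exists[OF towerD(1,2)[OF 0(1) lessI] 0(3)] .
  note d = coverD[OF c]
  have "g' ;; zr (K 0) Y = m ;; zr P Y" using d(4,7) 0(2) by simp
  then show ?case using c ar_zr[OF d(1) 0(2)] by (simp, blast)
next
  case (Suc i)
  obtain N m P e h g' where c: "cover C W g (K (Suc i)) (a (Suc i)) (E (Suc i)) (b (Suc i)) N m P e h g'"
    using cover_exists[OF towerD(1,2)[OF Suc(2) lessI] Suc(4)] .
  show ?case using c Suc.IH[OF tower_mono[OF Suc(2)] Suc(3) coverD(4)[OF c]] by (simp, blast)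
qed

lemma vanishing_retract:
  assumes v: "vanishing C n X Y" and i: "ar i Y1 Y" "ar p Y Y1" "i ;; p = idt Y1"
  shows "vanishing C n X Y1"
  unfolding vanishing_def
proof (intro allI impI)
  fix K E a b t g assume T: "tower C (Suc n) K E a b" "ar t (K 0) Y1" "ar g X (K (Suc n))"
  have "zext C K E a b Y (t ;; i) n X g"
    using v T arr_cmp[OF T(2) i(1)] unfolding vanishing_def by simp
  from zext_post[OF i(2) this] have "zext C K E a b Y1 (t ;; i ;; p) n X g" .
  then show "zext C K E a b Y1 t n X g" using id_right[OF T(2)] by (simp add: assoc i(3))
qed

text \<open>\<open>t\<close> is the sum of the maps \<open>t ;; (a j ;; b j)\<close>, each of which
  passes through \<open>Z j\<close>; \<open>zext_target_add\<close> collects them.\<close>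

lemma vanishing_target_sum:
  assumes Y: "Y \<in> Ob C" and ab: "\<And>j. j < m ==> ar (a j) Y (Z j) \<and> ar (b j) (Z j) Y"
    and s: "psum Y a b m = idt Y" and v: "\<And>j. j < m ==> vanishing C n X (Z j)"
  shows "vanishing C n X Y"
  unfolding vanishing_def
proof (intro allI impI)
  fix K E c d t g assume T: "tower C (Suc n) K E c d" "ar t (K 0) Y" "ar g X (K (Suc n))"
  have "zext C K E c d Y (t ;; psum Y a b l) n X g" if "l <= m" for l
    using that
  proof (induction l)
    case 0
    then show ?case using zext_target_zero[OF T(1) Y T(3)] T(2) Y by simp
  next
    case (Suc l)
    then have l: "l < m" "l <= m" by simp_all
    have al: "ar (a l) Y (Z l)" "ar (b l) (Z l) Y" using ab[OF l(1)] by auto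
    have "zext C K E c d (Z l) (t ;; a l) n X g"
      using v[OF l(1)] T arr_cmp[OF T(2) al(1)] unfolding vanishing_def by simp
    from zext_post[OF al(2) this] have "zext C K E c d Y (t ;; (a l ;; b l)) n X g" by (simp add: assoc)
    moreover have "ar (t ;; psum Y a b l) (K 0) Y" "ar (t ;; (a l ;; b l)) (K 0) Y"
      using arr_cmp[OF T(2) psum_arr[OF Y, of l a Z b]] ab l T(2) al by auto
    ultimately show ?case using zext_target_add[OF T(1) _ _ T(3) Suc.IH[OF l(2)]] by (simp add: distr)
  qed
  from this[of m] show "zext C K E c d Y t n X g" using s T(2) by simp
qed

text \<open>Dually, \<open>g\<close> is the sum of the maps \<open>a j ;; b j ;; g\<close>. Each is
  a restriction along \<open>a j\<close> of a class on \<open>Z j\<close>.\<close>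

lemma vanishing_source_sum:
  assumes Y: "Y \<in> Ob C" and ab: "\<And>j. j < m ==> ar (a j) Y (Z j) \<and> ar (b j) (Z j) Y"
    and s: "psum Y a b m = idt Y" and v: "\<And>j. j < m ==> vanishing C n (Z j) X"
  shows "vanishing C n Y X"
  unfolding vanishing_def
proof (intro allI impI)
  fix K E c d t g assume T: "tower C (Suc n) K E c d" "ar t (K 0) X" "ar g Y (K (Suc n))"
  have "zext C K E c d X t n Y (psum Y a b l ;; g)" if "l <= m" for l
    using that
  proof (induction l)
    case 0
    then show ?case using zext_zero[OF T(1,2) Y] T(3) Y by simp
  next
    case (Suc l)
    then have l: "l < m" "l <= m" by simp_all
    have al: "ar (a l) Y (Z l)" "ar (b l) (Z l) Y" using ab[OF l(1)] by auto
    have "zext C K E c d X t n (Z l) (b l ;; g)"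
      using v[OF l(1)] T arr_cmp[OF al(2) T(3)] unfolding vanishing_def by simp
    from zext_restrict[OF this al(1)] have "zext C K E c d X t n Y (a l ;; b l ;; g)" by (simp add: assoc)
    moreover have "ar (psum Y a b l ;; g) Y (K (Suc n))" "ar (a l ;; b l ;; g) Y (K (Suc n))"
      using arr_cmp[OF psum_arr[OF Y, of l a Z b] T(3)] ab l T(3) al by auto
    ultimately show ?case using zext_add[OF T(1,2) _ _ Suc.IH[OF l(2)]] by (simp add: distl)
  qed
  from this[of m] show "zext C K E c d X t n Y g" using s T(3) by simp
qed

lemma vanishing_zero: "is_zero_obj C Z ==> vanishing C n Z Y"
  unfolding vanishing_def
  by (metis from_zero zext_zero zero_obj_iff)

lemma cover_refine_along:
  assumes c: "cover C W g K a E b N m P e h g'" and r: "ar r P1 P" "short_exact C N1 m1 P1 (r ;; e) W"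
    "ar x N1 N" "x ;; m = m1 ;; r"
  shows "cover C W g K a E b N1 m1 P1 (r ;; e) (r ;; h) (x ;; g')"
proof (rule coverI[OF arrD(1)[OF r(1)] r(2)])
  note d = coverD[OF c]
  show "ar (r ;; h) P1 E" "ar (x ;; g') N1 K" using r(1,3) d by blast+
  show "r ;; h ;; b = r ;; e ;; g" by (simp add: assoc d(5))
  show "x ;; g' ;; a = m1 ;; (r ;; h)" by (simp add: assoc d(6)) (simp add: assoc[symmetric] r(4))
qed

end

text \<open>Only the levels up to \<open>i\<close> are read, so lengthening a tower at its upper end
  does not affect the classes below.\<close>

lemma zext_cong:
  assumes "\<And>j. j <= i ==> K j = K2 j \<and> E j = E2 j \<and> a j = a2 j \<and> b j = b2 j"
  shows "zext C K E a b Y t i W g <-> zext C K2 E2 a2 b2 Y t i W g"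
  using assms
proof (induction i arbitrary: W g)
  case (Suc i)
  have "zext C K E a b Y t i W g <-> zext C K2 E2 a2 b2 Y t i W g" for W g
    using Suc by simp
  then show ?case using Suc.prems[of "Suc i"] by simp
qed simp

section \<open>Transfer along partially defined left adjoints\<close>

text \<open>
  \<open>Rf W W' \<epsilon>\<close> says that \<open>\<epsilon> : W \<rightarrow> J W'\<close> is a reflection of \<open>W\<close>. The left adjoint of \<open>J\<close> only has to be
  exact on the good objects, of which there are enough.
\<close>

locale reflective_vanishing =
  C: abcat C plsC ngC + D: abcat D plsD ngD
  for C :: "('o, 'm) cat" (structure) and plsC ngC and D :: "('p, 'n) cat" and plsD ngD +
  fixes Jo :: "'p => 'o" and Jm :: "'n => 'm" and good :: "'o => bool"
    and Rf :: "'o => 'p => 'm => bool"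
  assumes J: "is_exact_functor D C Jo Jm"
    and good_sub: "[|good P; N \<in> Ob C; P \<in> Ob C; is_mono C N P m|] ==> good N"
    and good_cover: "W \<in> Ob C ==> \<exists>P e. P \<in> Ob C \<and> good P \<and> is_epi C P W e"
    and refl_ex: "[|W \<in> Ob C; good W|] ==> \<exists>W' \<epsilon>. Rf W W' \<epsilon>"
    and refl_arr: "[|W \<in> Ob C; Rf W W' \<epsilon>|] ==> W' \<in> Ob D \<and> arr C \<epsilon> W (Jo W')"
    and refl_lift: "[|W \<in> Ob C; Rf W W' \<epsilon>; Y \<in> Ob D; arr C h W (Jo Y)|]
      ==> \<exists>f'. arr D f' W' Y \<and> \<epsilon> ;; Jm f' = h"
    and refl_uniq: "[|W \<in> Ob C; Rf W W' \<epsilon>; arr D f W' Y; arr D g W' Y; \<epsilon> ;; Jm f = \<epsilon> ;; Jm g|] ==> f = g"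
    and refl_ses: "[|short_exact C N m P e W; P \<in> Ob C; good N; good P; good W; Rf N N' \<epsilon>N; Rf P P' \<epsilon>P; Rf W W' \<epsilon>W;
      arr D m' N' P'; arr D e' P' W'; m ;; \<epsilon>P = \<epsilon>N ;; Jm m'; e ;; \<epsilon>W = \<epsilon>P ;; Jm e'|]
      ==> short_exact D N' m' P' e' W'"
begin

lemma J_Ob: "X \<in> Ob D ==> Jo X \<in> Ob C"
  using J by (simp add: is_exact_functor_def is_functor_def)

lemma J_arr: "arr D f X Y ==> arr C (Jm f) (Jo X) (Jo Y)"
  using J by (simp add: is_exact_functor_def is_functor_def arr_def)

lemma J_cmp: "arr D f X Y ==> arr D g Y Z ==> Jm (f ;;\<^bsub>D\<^esub> g) = Jm f ;; Jm g"
  using J unfolding is_exact_functor_def is_functor_def arr_def by blast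

lemma J_ident: "X \<in> Ob D ==> Jm (ident D X) = ident C (Jo X)"
  using J by (simp add: is_exact_functor_def is_functor_def)

lemma J_ses: "short_exact D X f Y g Z ==> Y \<in> Ob D ==> short_exact C (Jo X) (Jm f) (Jo Y) (Jm g) (Jo Z)"
  using J D.sesD(1,2)[of X f Y g Z] unfolding is_exact_functor_def arr_def by blast

lemma J_tower: "tower D n K E a b ==> tower C n (\<lambda>i. Jo (K i)) (\<lambda>i. Jo (E i)) (\<lambda>i. Jm (a i)) (\<lambda>i. Jm (b i))"
  using J_ses J_Ob by (simp add: tower_def)

lemma J_cover:
  assumes s: "short_exact D K a E b K'" "E \<in> Ob D" and g: "arr D g W K'"
    and c: "cover D W g K a E b N m P e h g'"
  shows "cover C (Jo W) (Jm g) (Jo K) (Jm a) (Jo E) (Jm b) (Jo N) (Jm m) (Jo P) (Jm e) (Jm h) (Jm g')"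
proof -
  note d = D.coverD[OF c] and sd = D.sesD[OF s]
  show ?thesis
  proof (rule C.coverI[OF J_Ob[OF d(1)] J_ses[OF d(2,1)] J_arr[OF d(3)] J_arr[OF d(4)]])
    show "Jm h ;; Jm b = Jm e ;; Jm g"
      using J_cmp[OF d(3) sd(2)] J_cmp[OF d(8) g] d(5) by simp
    show "Jm g' ;; Jm a = Jm m ;; Jm h"
      using J_cmp[OF d(4) sd(1)] J_cmp[OF d(7,3)] d(6) by simp
  qed
qed

lemma J_zext:
  assumes "tower D (Suc i) K E a b" "arr D t (K 0) Y" "arr D g W (K (Suc i))" "zext D K E a b Y t i W g"
  shows "zext C (\<lambda>i. Jo (K i)) (\<lambda>i. Jo (E i)) (\<lambda>i. Jm (a i)) (\<lambda>i. Jm (b i)) (Jo Y) (Jm t) i (Jo W) (Jm g)"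
  using assms
proof (induction i arbitrary: W g)
  case 0
  obtain N m P e h g' s where c: "cover D W g (K 0) (a 0) (E 0) (b 0) N m P e h g'" and
    s: "arr D s P Y" "g' ;;\<^bsub>D\<^esub> t = m ;;\<^bsub>D\<^esub> s" using 0(4) by auto
  note d = D.coverD[OF c] and T = D.towerD[OF 0(1) lessI]
  have "Jm g' ;; Jm t = Jm m ;; Jm s"
    using J_cmp[OF d(4) 0(2)] J_cmp[OF d(7) s(1)] s(2) by simp
  then show ?case using J_cover[OF T(1,2) 0(3) c] J_arr[OF s(1)] by (simp, blast)
next
  case (Suc i)
  obtain N m P e h g' where c: "cover D W g (K (Suc i)) (a (Suc i)) (E (Suc i)) (b (Suc i)) N m P e h g'" and
    s: "zext D K E a b Y t i N g'" using Suc(5) by auto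
  note d = D.coverD[OF c] and T = D.towerD[OF Suc(2) lessI]
  show ?case using J_cover[OF T(1,2) Suc(4) c] Suc.IH[OF D.tower_mono[OF Suc(2)] Suc(3) d(4) s] by (simp, blast)
qed

lemma good_refine:
  assumes c: "cover C W g K a E b N m P e h g'"
  obtains r P1 N1 m1 x where "good P1" "arr C r P1 P" "cover C W g K a E b N1 m1 P1 (r ;; e) (r ;; h) (x ;; g')"
    "arr C x N1 N" "x ;; m = m1 ;; r"
proof -
  obtain P1 r where P1: "P1 \<in> Ob C" "good P1" "is_epi C P1 P r" using good_cover C.coverD(1)[OF c] by metis
  have r: "arr C r P1 P" using C.epi_arr[OF P1(3,1) C.coverD(1)[OF c]] .
  show ?thesis using C.cover_refine[OF c r P1(3)] that P1 r by metis
qed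

text \<open>Goodness of \<open>P\<close> passes to its subobject \<open>N\<close>, so all three
  terms have reflections and \<open>refl_ses\<close> applies to the transposed maps.\<close>

lemma reflect_ses:
  assumes s: "short_exact C N m P e W" "P \<in> Ob C" and g: "good P" "good W" and W: "Rf W W' \<eta>"
  obtains N' \<eta>N P' \<eta>P m' e' where "Rf N N' \<eta>N" "Rf P P' \<eta>P" "short_exact D N' m' P' e' W'" "P' \<in> Ob D"
    "m ;; \<eta>P = \<eta>N ;; Jm m'" "e ;; \<eta> = \<eta>P ;; Jm e'" "N \<in> Ob C" "good N"
proof -
  note d = C.sesD[OF s]
  have O: "N \<in> Ob C" "W \<in> Ob C" using d(1,2) by (simp_all add: arr_def)
  have gN: "good N" using good_sub[OF g(1) O(1) s(2) d(5)] .
  obtain N' \<eta>N where N': "Rf N N' \<eta>N" using refl_ex[OF O(1) gN] by blast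
  obtain P' \<eta>P where P': "Rf P P' \<eta>P" using refl_ex[OF s(2) g(1)] by blast
  have aN: "N' \<in> Ob D" "arr C \<eta>N N (Jo N')" using refl_arr[OF O(1) N'] by auto
  have aP: "P' \<in> Ob D" "arr C \<eta>P P (Jo P')" using refl_arr[OF s(2) P'] by auto
  have aW: "W' \<in> Ob D" "arr C \<eta> W (Jo W')" using refl_arr[OF O(2) W] by auto
  obtain m' where m': "arr D m' N' P'" "\<eta>N ;; Jm m' = m ;; \<eta>P"
    using refl_lift[OF O(1) N' aP(1) C.arr_cmp[OF d(1) aP(2)]] by blast
  obtain e' where e': "arr D e' P' W'" "\<eta>P ;; Jm e' = e ;; \<eta>"
    using refl_lift[OF s(2) P' aW(1) C.arr_cmp[OF d(2) aW(2)]] by blast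
  have "short_exact D N' m' P' e' W'"
    by (rule refl_ses[OF s gN g N' P' W m'(1) e'(1) m'(2)[symmetric] e'(2)[symmetric]])
  then show ?thesis using that N' P' aP(1) m' e' O gN by metis
qed

text \<open>The adjuncts of \<open>h\<close> and \<open>g'\<close> form a cover in \<open>D\<close>.
  Its two commutative squares are checked after composing with the reflection maps, where they
  become the squares of the given cover.\<close>

lemma cover_transpose:
  assumes s: "short_exact D K a E b K'" "E \<in> Ob D" and W: "W \<in> Ob C" "good W" "Rf W W' \<eta>"
    and g: "arr D g W' K'" and P: "good P"
    and c: "cover C W (\<eta> ;; Jm g) (Jo K) (Jm a) (Jo E) (Jm b) N m P e h g'"
  obtains N' \<eta>N P' \<eta>P m' e' h1 g1 where "Rf N N' \<eta>N" "Rf P P' \<eta>P" "cover D W' g K a E b N' m' P' e' h1 g1"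
    "\<eta>N ;; Jm g1 = g'" "m ;; \<eta>P = \<eta>N ;; Jm m'" "N \<in> Ob C" "good N"
proof -
  note d = C.coverD[OF c] and sd = D.sesD[OF s]
  obtain N' \<eta>N P' \<eta>P m' e' where r: "Rf N N' \<eta>N" "Rf P P' \<eta>P" "short_exact D N' m' P' e' W'" "P' \<in> Ob D"
    "m ;; \<eta>P = \<eta>N ;; Jm m'" "e ;; \<eta> = \<eta>P ;; Jm e'" "N \<in> Ob C" "good N"
    using reflect_ses[OF d(2,1) P W(2,3)] .
  note rd = D.sesD[OF r(3,4)]
  have KO: "K \<in> Ob D" using sd(1) by (simp add: arr_def)
  obtain h1 where h1: "arr D h1 P' E" "\<eta>P ;; Jm h1 = h" using refl_lift[OF d(1) r(2) s(2) d(3)] by blast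
  obtain g1 where g1: "arr D g1 N' K" "\<eta>N ;; Jm g1 = g'" using refl_lift[OF r(7) r(1) KO d(4)] by blast
  have "cover D W' g K a E b N' m' P' e' h1 g1"
  proof (rule D.coverI[OF r(4,3) h1(1) g1(1)])
    show "h1 ;;\<^bsub>D\<^esub> b = e' ;;\<^bsub>D\<^esub> g"
    proof (rule refl_uniq[OF d(1) r(2) D.arr_cmp[OF h1(1) sd(2)] D.arr_cmp[OF rd(2) g]])
      have "\<eta>P ;; Jm (h1 ;;\<^bsub>D\<^esub> b) = h ;; Jm b"
        unfolding J_cmp[OF h1(1) sd(2)] by (simp add: C.assoc[symmetric] h1(2))
      also have "\<dots> = e ;; \<eta> ;; Jm g" by (simp add: d(5) C.assoc)
      also have "\<dots> = \<eta>P ;; Jm (e' ;;\<^bsub>D\<^esub> g)" unfolding J_cmp[OF rd(2) g] by (simp add: r(6) C.assoc)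
      finally show "\<eta>P ;; Jm (h1 ;;\<^bsub>D\<^esub> b) = \<eta>P ;; Jm (e' ;;\<^bsub>D\<^esub> g)" .
    qed
    show "g1 ;;\<^bsub>D\<^esub> a = m' ;;\<^bsub>D\<^esub> h1"
    proof (rule refl_uniq[OF r(7) r(1) D.arr_cmp[OF g1(1) sd(1)] D.arr_cmp[OF rd(1) h1(1)]])
      have "\<eta>N ;; Jm (g1 ;;\<^bsub>D\<^esub> a) = g' ;; Jm a"
        unfolding J_cmp[OF g1(1) sd(1)] by (simp add: C.assoc[symmetric] g1(2))
      also have "\<dots> = m ;; \<eta>P ;; Jm h1" by (simp add: d(6) C.assoc h1(2))
      also have "\<dots> = \<eta>N ;; Jm (m' ;;\<^bsub>D\<^esub> h1)" unfolding J_cmp[OF rd(1) h1(1)] by (simp add: r(5) C.assoc)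
      finally show "\<eta>N ;; Jm (g1 ;;\<^bsub>D\<^esub> a) = \<eta>N ;; Jm (m' ;;\<^bsub>D\<^esub> h1)" .
    qed
  qed
  then show ?thesis using that r g1 by metis
qed

text \<open>At each level the cover is refined until \<open>P\<close> is good and is then
  transposed. The new kernel is good again, so the induction can continue with its
  reflection.\<close>

lemma zext_transpose:
  assumes "tower D (Suc i) K E a b" "arr D t (K 0) Y" "W \<in> Ob C" "good W" "Rf W W' \<eta>" "arr D g W' (K (Suc i))"
    "zext C (\<lambda>i. Jo (K i)) (\<lambda>i. Jo (E i)) (\<lambda>i. Jm (a i)) (\<lambda>i. Jm (b i)) (Jo Y) (Jm t) i W (\<eta> ;; Jm g)"
  shows "zext D K E a b Y t i W' g"
  using assms
proof (induction i arbitrary: W W' \<eta> g)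
  case 0
  note T = D.towerD[OF 0(1) lessI]
  have YO: "Y \<in> Ob D" using 0(2) by (simp add: arr_def)
  obtain N0 m0 P0 e0 h0 g0 s0 where c0: "cover C W (\<eta> ;; Jm g) (Jo (K 0)) (Jm (a 0)) (Jo (E 0)) (Jm (b 0)) N0 m0 P0 e0 h0 g0"
    and s0: "arr C s0 P0 (Jo Y)" "g0 ;; Jm t = m0 ;; s0" using 0(7) by auto
  obtain r P N m x where R: "good P" "arr C r P P0"
    "cover C W (\<eta> ;; Jm g) (Jo (K 0)) (Jm (a 0)) (Jo (E 0)) (Jm (b 0)) N m P (r ;; e0) (r ;; h0) (x ;; g0)"
    "arr C x N N0" "x ;; m0 = m ;; r" using good_refine[OF c0] .
  obtain N' \<eta>N P' \<eta>P m' e' h1 g1 where c: "Rf N N' \<eta>N" "Rf P P' \<eta>P" "cover D W' g (K 0) (a 0) (E 0) (b 0) N' m' P' e' h1 g1"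
    "\<eta>N ;; Jm g1 = x ;; g0" "m ;; \<eta>P = \<eta>N ;; Jm m'" "N \<in> Ob C" "good N"
    using cover_transpose[OF T(1,2) 0(3-6) R(1,3)] .
  note d = D.coverD[OF c(3)] and dR = C.coverD[OF R(3)]
  obtain s1 where s1: "arr D s1 P' Y" "\<eta>P ;; Jm s1 = r ;; s0"
    using refl_lift[OF dR(1) c(2) YO C.arr_cmp[OF R(2) s0(1)]] by blast
  have "g1 ;;\<^bsub>D\<^esub> t = m' ;;\<^bsub>D\<^esub> s1"
  proof (rule refl_uniq[OF c(6) c(1) D.arr_cmp[OF d(4) 0(2)] D.arr_cmp[OF d(7) s1(1)]])
    have "\<eta>N ;; Jm (g1 ;;\<^bsub>D\<^esub> t) = x ;; (g0 ;; Jm t)"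
      unfolding J_cmp[OF d(4) 0(2)] by (simp add: C.assoc[symmetric] c(4))
    also have "\<dots> = x ;; m0 ;; s0" by (simp add: s0 C.assoc)
    also have "\<dots> = m ;; \<eta>P ;; Jm s1" by (simp add: R(5) C.assoc s1(2))
    also have "\<dots> = \<eta>N ;; Jm (m' ;;\<^bsub>D\<^esub> s1)" unfolding J_cmp[OF d(7) s1(1)] by (simp add: c(5) C.assoc)
    finally show "\<eta>N ;; Jm (g1 ;;\<^bsub>D\<^esub> t) = \<eta>N ;; Jm (m' ;;\<^bsub>D\<^esub> s1)" .
  qed
  then show ?case using c(3) s1(1) by (simp, blast)
next
  case (Suc i)
  note T = D.towerD[OF Suc(2) lessI]
  obtain N0 m0 P0 e0 h0 g0 where c0: "cover C W (\<eta> ;; Jm g) (Jo (K (Suc i))) (Jm (a (Suc i))) (Jo (E (Suc i))) (Jm (b (Suc i))) N0 m0 P0 e0 h0 g0"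
    and s0: "zext C (\<lambda>i. Jo (K i)) (\<lambda>i. Jo (E i)) (\<lambda>i. Jm (a i)) (\<lambda>i. Jm (b i)) (Jo Y) (Jm t) i N0 g0" using Suc(8) by auto
  obtain r P N m x where R: "good P" "arr C r P P0"
    "cover C W (\<eta> ;; Jm g) (Jo (K (Suc i))) (Jm (a (Suc i))) (Jo (E (Suc i))) (Jm (b (Suc i))) N m P (r ;; e0) (r ;; h0) (x ;; g0)"
    "arr C x N N0" "x ;; m0 = m ;; r" using good_refine[OF c0] .
  obtain N' \<eta>N P' \<eta>P m' e' h1 g1 where c: "Rf N N' \<eta>N" "Rf P P' \<eta>P"
    "cover D W' g (K (Suc i)) (a (Suc i)) (E (Suc i)) (b (Suc i)) N' m' P' e' h1 g1"
    "\<eta>N ;; Jm g1 = x ;; g0" "m ;; \<eta>P = \<eta>N ;; Jm m'" "N \<in> Ob C" "good N"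
    using cover_transpose[OF T(1,2) Suc(4-7) R(1,3)] .
  have "zext D K E a b Y t i N' g1"
    using Suc.IH[OF D.tower_mono[OF Suc(2)] Suc(3) c(6,7,1) D.coverD(4)[OF c(3)]] C.zext_restrict[OF s0 R(4)] by (simp add: c(4))
  then show ?case using c(3) by (simp, blast)
qed

text \<open>One cover of \<open>W\<close> serves two sequences: the given one and the image under
  \<open>J\<close> of the reflected sequence, with the reflection maps as lift and as induced map.
  The last clause keeps this after restriction to an arbitrary \<open>V\<close>, so that a
  refinement found for one sequence can be used for the other.\<close>

lemma good_cover_reflect:
  assumes s: "short_exact C K a E b K'" "E \<in> Ob C" and W: "W \<in> Ob C" "good W" "Rf W W' \<eta>" and g: "arr C g W K'"
  obtains N m P e h g' N' \<eta>N P' \<eta>P m' e' where "cover C W g K a E b N m P e h g'" "N \<in> Ob C" "good N" "Rf N N' \<eta>N"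
    "short_exact D N' m' P' e' W'" "P' \<in> Ob D"
    "\<And>V x m1 P1 e1 y. arr C x V W ==> arr C y P1 P ==> m1 ;; y = m ==> y ;; e = e1 ;; x ==>
      short_exact C N m1 P1 e1 V ==> cover C V (x ;; \<eta>) (Jo N') (Jm m') (Jo P') (Jm e') N m1 P1 e1 (y ;; \<eta>P) \<eta>N"
proof -
  obtain N0 m0 P0 e0 h0 g0 where c0: "cover C W g K a E b N0 m0 P0 e0 h0 g0" using C.cover_exists[OF s g] .
  obtain r P N m x where R: "good P" "arr C r P P0"
    "cover C W g K a E b N m P (r ;; e0) (r ;; h0) (x ;; g0)" "arr C x N N0" "x ;; m0 = m ;; r"
    using good_refine[OF c0] .
  note d = C.coverD[OF R(3)]
  obtain N' \<eta>N P' \<eta>P m' e' where q: "Rf N N' \<eta>N" "Rf P P' \<eta>P" "short_exact D N' m' P' e' W'" "P' \<in> Ob D"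
    "m ;; \<eta>P = \<eta>N ;; Jm m'" "r ;; e0 ;; \<eta> = \<eta>P ;; Jm e'" "N \<in> Ob C" "good N"
    using reflect_ses[OF d(2,1) R(1) W(2,3)] .
  have aP: "arr C \<eta>P P (Jo P')" and aN: "arr C \<eta>N N (Jo N')"
    using refl_arr[OF d(1) q(2)] refl_arr[OF q(7,1)] by auto
  have "cover C V (x ;; \<eta>) (Jo N') (Jm m') (Jo P') (Jm e') N m1 P1 e1 (y ;; \<eta>P) \<eta>N"
    if x: "arr C x V W" "arr C y P1 P" "m1 ;; y = m" "y ;; (r ;; e0) = e1 ;; x" "short_exact C N m1 P1 e1 V"
    for V x m1 P1 e1 y
  proof (rule C.coverI[OF arrD(1)[OF x(2)] x(5) C.arr_cmp[OF x(2) aP] aN])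
    have "y ;; \<eta>P ;; Jm e' = y ;; (r ;; e0) ;; \<eta>" by (simp add: C.assoc q(6)[symmetric])
    then show "y ;; \<eta>P ;; Jm e' = e1 ;; (x ;; \<eta>)" by (simp add: x(4) C.assoc)
    show "\<eta>N ;; Jm m' = m1 ;; (y ;; \<eta>P)" by (simp add: q(5)[symmetric]) (simp add: C.assoc[symmetric] x(3))
  qed
  then show ?thesis using that[OF R(3) q(7,8,1,3,4)] by blast
qed

text \<open>The converse transfer requires a tower in \<open>D\<close> from one in \<open>C\<close>.
  It is assembled from the reflections of successive good covers, and the original class is the
  pullback of its \<open>J\<close>-image along \<open>\<eta>\<close>. The quantifier over
  \<open>x : V \<rightarrow> W\<close> strengthens the induction, as refinements replace kernels by
  objects over them.\<close>

lemma reflected_tower: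
  assumes "tower C (Suc i) K E a b" "Y \<in> Ob D" "arr C t (K 0) (Jo Y)" "W \<in> Ob C" "good W" "Rf W W' \<eta>" "arr C g W (K (Suc i))"
  shows "\<exists>K' E' a' b' t'. tower D (Suc i) K' E' a' b' \<and> K' (Suc i) = W' \<and> arr D t' (K' 0) Y \<and>
    (\<forall>V x. arr C x V W -->
      zext C (\<lambda>i. Jo (K' i)) (\<lambda>i. Jo (E' i)) (\<lambda>i. Jm (a' i)) (\<lambda>i. Jm (b' i)) (Jo Y) (Jm t') i V (x ;; \<eta>) -->
      zext C K E a b (Jo Y) t i V (x ;; g))"
  using assms
proof (induction i arbitrary: W W' \<eta> g)
  case 0
  note T = C.towerD[OF 0(1) lessI]
  obtain N m P e h g' N' \<eta>N P' \<eta>P m' e' where c: "cover C W g (K 0) (a 0) (E 0) (b 0) N m P e h g'" "N \<in> Ob C" "good N" "Rf N N' \<eta>N"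
    "short_exact D N' m' P' e' W'" "P' \<in> Ob D" and
    k: "\<And>V x m1 P1 e1 y. arr C x V W ==> arr C y P1 P ==> m1 ;; y = m ==> y ;; e = e1 ;; x ==>
      short_exact C N m1 P1 e1 V ==> cover C V (x ;; \<eta>) (Jo N') (Jm m') (Jo P') (Jm e') N m1 P1 e1 (y ;; \<eta>P) \<eta>N"
    by (rule good_cover_reflect[OF T(1,2) 0(4-7)]) (rule that, assumption+)
  note d = C.coverD[OF c(1)]
  obtain t' where t': "arr D t' N' Y" "\<eta>N ;; Jm t' = g' ;; t"
    using refl_lift[OF c(2,4) 0(2) C.arr_cmp[OF d(4) 0(3)]] by blast
  define K' where "K' j = (if j = 0 then N' else W')" for j :: nat
  have Ke: "K' 0 = N'" "K' (Suc 0) = W'" by (simp_all add: K'_def)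
  have T': "tower D (Suc 0) K' (\<lambda>_. P') (\<lambda>_. m') (\<lambda>_. e')" using c(5,6) by (simp add: tower_def K'_def)
  have fin: "zext C K E a b (Jo Y) t 0 V (x ;; g)" if x: "arr C x V W"
    and z: "zext C (\<lambda>i. Jo (K' i)) (\<lambda>i. Jo P') (\<lambda>i. Jm m') (\<lambda>i. Jm e') (Jo Y) (Jm t') 0 V (x ;; \<eta>)" for V x
  proof -
    obtain m1 P1 e1 y where p: "cover C V (x ;; g) (K 0) (a 0) (E 0) (b 0) N m1 P1 e1 (y ;; h) g'" "arr C y P1 P"
      "m1 ;; y = m" "y ;; e = e1 ;; x" using C.cover_restrict[OF c(1) x] .
    have q: "cover C V (x ;; \<eta>) (Jo (K' 0)) (Jm m') (Jo P') (Jm e') N m1 P1 e1 (y ;; \<eta>P) \<eta>N"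
      unfolding Ke by (rule k[OF x p(2-4) C.coverD(2)[OF p(1)]])
    have tt: "arr C (Jm t') (Jo (K' 0)) (Jo Y)" unfolding Ke by (rule J_arr[OF t'(1)])
    obtain P2 r N2 m2 x1 s where r: "arr C r P2 P1"
      "cover C V (x ;; \<eta>) (Jo (K' 0)) (Jm m') (Jo P') (Jm e') N2 m2 P2 (r ;; e1) (r ;; (y ;; \<eta>P)) (x1 ;; \<eta>N)"
      "arr C x1 N2 N" "x1 ;; m1 = m2 ;; r" "arr C s P2 (Jo Y)" "x1 ;; \<eta>N ;; Jm t' = m2 ;; s"
      using C.zext_refine0[OF J_tower[OF T'] tt z q] .
    have "cover C V (x ;; g) (K 0) (a 0) (E 0) (b 0) N2 m2 P2 (r ;; e1) (r ;; (y ;; h)) (x1 ;; g')"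
      by (rule C.cover_refine_along[OF p(1) r(1) C.coverD(2)[OF r(2)] r(3,4)])
    moreover have "x1 ;; g' ;; t = m2 ;; s" using r(6) t'(2) by (simp add: C.assoc)
    ultimately show ?thesis using r(5) by (simp, blast)
  qed
  show ?case
    by (rule exI[of _ K'], rule exI[of _ "\<lambda>_. P'"], rule exI[of _ "\<lambda>_. m'"], rule exI[of _ "\<lambda>_. e'"], rule exI[of _ t'])
      (use T' Ke t'(1) fin in blast)
next
  case (Suc i)
  note T = C.towerD[OF Suc(2) lessI]
  have T0: "tower C (Suc i) K E a b" using C.tower_mono[OF Suc(2)] by simp
  obtain N m P e h g' N' \<eta>N P' \<eta>P m' e' where c: "cover C W g (K (Suc i)) (a (Suc i)) (E (Suc i)) (b (Suc i)) N m P e h g'" "N \<in> Ob C" "good N" "Rf N N' \<eta>N"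
    "short_exact D N' m' P' e' W'" "P' \<in> Ob D" and
    k: "\<And>V x m1 P1 e1 y. arr C x V W ==> arr C y P1 P ==> m1 ;; y = m ==> y ;; e = e1 ;; x ==>
      short_exact C N m1 P1 e1 V ==> cover C V (x ;; \<eta>) (Jo N') (Jm m') (Jo P') (Jm e') N m1 P1 e1 (y ;; \<eta>P) \<eta>N"
    by (rule good_cover_reflect[OF T(1,2) Suc(5-8)]) (rule that, assumption+)
  note d = C.coverD[OF c(1)]
  obtain K0 E0 a0 b0 t' where F: "tower D (Suc i) K0 E0 a0 b0" "K0 (Suc i) = N'" "arr D t' (K0 0) Y"
    "\<And>V x. arr C x V N ==>
      zext C (\<lambda>i. Jo (K0 i)) (\<lambda>i. Jo (E0 i)) (\<lambda>i. Jm (a0 i)) (\<lambda>i. Jm (b0 i)) (Jo Y) (Jm t') i V (x ;; \<eta>N) ==>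
      zext C K E a b (Jo Y) t i V (x ;; g')"
    using Suc.IH[OF T0 Suc(3,4) c(2,3,4) d(4)] by blast
  define K' E' a' b' where "K' = K0(Suc (Suc i) := W')" and "E' = E0(Suc i := P')" and "a' = a0(Suc i := m')" and "b' = b0(Suc i := e')"
  note defs = K'_def E'_def a'_def b'_def
  have Ke: "K' (Suc i) = N'" "K' (Suc (Suc i)) = W'" "E' (Suc i) = P'" "a' (Suc i) = m'" "b' (Suc i) = e'" "K' 0 = K0 0"
    using F(2) by (simp_all add: defs)
  have T': "tower D (Suc (Suc i)) K' E' a' b'" using F(1,2) c(5,6) by (auto simp: tower_def defs less_Suc_eq)
  have fin: "zext C K E a b (Jo Y) t (Suc i) V (x ;; g)" if x: "arr C x V W"
    and z: "zext C (\<lambda>i. Jo (K' i)) (\<lambda>i. Jo (E' i)) (\<lambda>i. Jm (a' i)) (\<lambda>i. Jm (b' i)) (Jo Y) (Jm t') (Suc i) V (x ;; \<eta>)" for V x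
  proof -
    obtain m1 P1 e1 y where p: "cover C V (x ;; g) (K (Suc i)) (a (Suc i)) (E (Suc i)) (b (Suc i)) N m1 P1 e1 (y ;; h) g'" "arr C y P1 P"
      "m1 ;; y = m" "y ;; e = e1 ;; x" using C.cover_restrict[OF c(1) x] .
    have q: "cover C V (x ;; \<eta>) (Jo (K' (Suc i))) (Jm (a' (Suc i))) (Jo (E' (Suc i))) (Jm (b' (Suc i))) N m1 P1 e1 (y ;; \<eta>P) \<eta>N"
      unfolding Ke by (rule k[OF x p(2-4) C.coverD(2)[OF p(1)]])
    have tt: "arr C (Jm t') (Jo (K' 0)) (Jo Y)" unfolding Ke by (rule J_arr[OF F(3)])
    obtain P2 r N2 m2 x1 where r: "arr C r P2 P1"
      "cover C V (x ;; \<eta>) (Jo (K' (Suc i))) (Jm (a' (Suc i))) (Jo (E' (Suc i))) (Jm (b' (Suc i))) N2 m2 P2 (r ;; e1) (r ;; (y ;; \<eta>P)) (x1 ;; \<eta>N)"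
      "arr C x1 N2 N" "x1 ;; m1 = m2 ;; r"
      "zext C (\<lambda>i. Jo (K' i)) (\<lambda>i. Jo (E' i)) (\<lambda>i. Jm (a' i)) (\<lambda>i. Jm (b' i)) (Jo Y) (Jm t') i N2 (x1 ;; \<eta>N)"
      using C.zext_refine[OF J_tower[OF T'] tt z q] .
    have "zext C (\<lambda>i. Jo (K0 i)) (\<lambda>i. Jo (E0 i)) (\<lambda>i. Jm (a0 i)) (\<lambda>i. Jm (b0 i)) (Jo Y) (Jm t') i N2 (x1 ;; \<eta>N)"
      using r(5) by (subst zext_cong[of i _ "\<lambda>i. Jo (K' i)" _ "\<lambda>i. Jo (E' i)" _ "\<lambda>i. Jm (a' i)" _ "\<lambda>i. Jm (b' i)"]) (simp_all add: defs)
    then have "zext C K E a b (Jo Y) t i N2 (x1 ;; g')" by (rule F(4)[OF r(3)])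
    moreover have "cover C V (x ;; g) (K (Suc i)) (a (Suc i)) (E (Suc i)) (b (Suc i)) N2 m2 P2 (r ;; e1) (r ;; (y ;; h)) (x1 ;; g')"
      by (rule C.cover_refine_along[OF p(1) r(1) C.coverD(2)[OF r(2)] r(3,4)])
    ultimately show ?thesis by (simp, blast)
  qed
  show ?case
    by (rule exI[of _ K'], rule exI[of _ E'], rule exI[of _ a'], rule exI[of _ b'], rule exI[of _ t'])
      (use T' Ke F(3) fin in auto)
qed

text \<open>From left to right, the \<open>J\<close>-image of a tower in \<open>D\<close> is tested
  in \<open>C\<close> and the result is transposed. From right to left, the tower in
  \<open>C\<close> is exchanged for the reflected one, whose class vanishes in \<open>D\<close>,
  hence after applying \<open>J\<close> and restricting along \<open>\<eta>\<close>.\<close>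

theorem vanishing_reflection:
  assumes X: "X \<in> Ob C" "good X" "Rf X X' \<eta>" and Y: "Y \<in> Ob D"
  shows "vanishing C n X (Jo Y) <-> vanishing D n X' Y"
proof
  assume v: "vanishing C n X (Jo Y)"
  show "vanishing D n X' Y" unfolding vanishing_def
  proof (intro allI impI)
    fix K E a b t g assume T: "tower D (Suc n) K E a b" and t: "arr D t (K 0) Y" and g: "arr D g X' (K (Suc n))"
    have e: "arr C \<eta> X (Jo X')" using refl_arr[OF X(1,3)] by simp
    have "zext C (\<lambda>i. Jo (K i)) (\<lambda>i. Jo (E i)) (\<lambda>i. Jm (a i)) (\<lambda>i. Jm (b i)) (Jo Y) (Jm t) n X (\<eta> ;; Jm g)"
      using v[unfolded vanishing_def, rule_format, OF J_tower[OF T] J_arr[OF t] C.arr_cmp[OF e J_arr[OF g]]] .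
    then show "zext D K E a b Y t n X' g" by (rule zext_transpose[OF T t X g])
  qed
next
  assume v: "vanishing D n X' Y"
  show "vanishing C n X (Jo Y)" unfolding vanishing_def
  proof (intro allI impI)
    fix K E a b t g assume T: "tower C (Suc n) K E a b" and t: "arr C t (K 0) (Jo Y)" and g: "arr C g X (K (Suc n))"
    have e: "X' \<in> Ob D" "arr C \<eta> X (Jo X')" using refl_arr[OF X(1,3)] by simp_all
    obtain K' E' a' b' t' where F: "tower D (Suc n) K' E' a' b'" "K' (Suc n) = X'" "arr D t' (K' 0) Y"
      "\<And>V x. arr C x V X ==>
      zext C (\<lambda>i. Jo (K' i)) (\<lambda>i. Jo (E' i)) (\<lambda>i. Jm (a' i)) (\<lambda>i. Jm (b' i)) (Jo Y) (Jm t') n V (x ;; \<eta>) ==>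
      zext C K E a b (Jo Y) t n V (x ;; g)"
      using reflected_tower[OF T Y t X g] by blast
    have i: "arr D (ident D X') X' (K' (Suc n))" using D.arr_ident[OF e(1)] F(2) by simp
    have "zext D K' E' a' b' Y t' n X' (ident D X')"
      using v[unfolded vanishing_def, rule_format, OF F(1,3) i] .
    from J_zext[OF F(1,3) i this]
    have "zext C (\<lambda>i. Jo (K' i)) (\<lambda>i. Jo (E' i)) (\<lambda>i. Jm (a' i)) (\<lambda>i. Jm (b' i)) (Jo Y) (Jm t') n (Jo X') (ident C (Jo X'))"
      using J_ident[OF e(1)] by simp
    from C.zext_restrict[OF this e(2)]
    have "zext C (\<lambda>i. Jo (K' i)) (\<lambda>i. Jo (E' i)) (\<lambda>i. Jm (a' i)) (\<lambda>i. Jm (b' i)) (Jo Y) (Jm t') n X (ident C X ;; \<eta>)"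
      using e(2) by simp
    from F(4)[OF C.arr_ident[OF X(1)] this] show "zext C K E a b (Jo Y) t n X g" using g by simp
  qed
qed

text \<open>Degree zero is the adjunction bijection itself, from lifting and uniqueness; exactness
  on good objects enters in positive degrees.\<close>

lemma Hom_zero_reflection:
  assumes X: "X \<in> Ob C" "Rf X X' \<eta>" and Y: "Y \<in> Ob D"
  shows "Ext_zero C 0 X (Jo Y) <-> Ext_zero D 0 X' Y"
proof -
  have e: "X' \<in> Ob D" "arr C \<eta> X (Jo X')" using refl_arr[OF X] by simp_all
  have JY: "Jo Y \<in> Ob C" using J_Ob Y by blast
  have a: "arr D (zero_mor D X' Y) X' Y" "arr C (zero_mor C X (Jo Y)) X (Jo Y)" using e Y JY X by simp_all
  have C0: "Ext_zero C 0 X (Jo Y) <-> (\<forall>f g. arr C f X (Jo Y) --> arr C g X (Jo Y) --> f = g)"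
    unfolding Ext_zero_def using a X JY by (auto simp: arr_def)
  have D0: "Ext_zero D 0 X' Y <-> (\<forall>f g. arr D f X' Y --> arr D g X' Y --> f = g)"
    unfolding Ext_zero_def using a e Y by (auto simp: arr_def)
  show ?thesis unfolding C0 D0
  proof (intro iffI allI impI)
    fix f g assume h: "\<forall>f g. arr C f X (Jo Y) --> arr C g X (Jo Y) --> f = g" and f: "arr D f X' Y" "arr D g X' Y"
    have "\<eta> ;; Jm f = \<eta> ;; Jm g" using h C.arr_cmp[OF e(2) J_arr[OF f(1)]] C.arr_cmp[OF e(2) J_arr[OF f(2)]] by blast
    then show "f = g" by (rule refl_uniq[OF X f])
  next
    fix f g assume h: "\<forall>f g. arr D f X' Y --> arr D g X' Y --> f = g" and f: "arr C f X (Jo Y)" "arr C g X (Jo Y)"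
    obtain f' g' where "arr D f' X' Y" "\<eta> ;; Jm f' = f" "arr D g' X' Y" "\<eta> ;; Jm g' = g"
      using refl_lift[OF X Y f(1)] refl_lift[OF X Y f(2)] by blast
    then show "f = g" using h by metis
  qed
qed

end

section \<open>The category of roots\<close>

locale root = A: abcat A plsA ngA
  for A :: "('o, 'm) cat" (structure) and plsA (infixl \<open>\<boxplus>\<close> 65) and ngA +
  fixes Fo :: "'o => 'o" and Fm :: "'m => 'm" and \<eta> :: "'o => 'm" and p :: nat
  assumes F: "is_exact_functor A A Fo Fm"
    and nat: "is_nat_transf A A Fo Fm (\<lambda>X. X) (\<lambda>f. f) \<eta>"
    and p2: "p \<ge> 2"
begin

abbreviation ar where "ar \<equiv> arr A"
abbreviation zr where "zr \<equiv> zero_mor A"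
abbreviation idt where "idt \<equiv> ident A"

lemma F_Ob[simp]: "X \<in> Ob A ==> Fo X \<in> Ob A"
  using F by (simp add: is_exact_functor_def is_functor_def)

lemma F_arr: "ar f X Y ==> ar (Fm f) (Fo X) (Fo Y)"
  using F by (simp add: is_exact_functor_def is_functor_def arr_def)

lemma F_cmp: "ar f X Y ==> ar g Y Z ==> Fm (f ;; g) = Fm f ;; Fm g"
  using F unfolding is_exact_functor_def is_functor_def arr_def by blast

lemma F_ident: "X \<in> Ob A ==> Fm (idt X) = idt (Fo X)"
  using F by (simp add: is_exact_functor_def is_functor_def)

lemma F_ses: "short_exact A X f Y g Z ==> Y \<in> Ob A ==> short_exact A (Fo X) (Fm f) (Fo Y) (Fm g) (Fo Z)"
  using F A.sesD(1,2)[of X f Y g Z] unfolding is_exact_functor_def arr_def by blast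

lemma eta_arr: "X \<in> Ob A ==> ar (\<eta> X) (Fo X) X"
  using nat by (simp add: is_nat_transf_def arr_def)

lemma eta_nat: "ar f X Y ==> Fm f ;; \<eta> Y = \<eta> X ;; f"
  using nat unfolding is_nat_transf_def arr_def by blast

text \<open>The sequence z -> z -> z of identities is short exact because the identity of
  \<open>z\<close> is zero. Its image is exact, so the identity of \<open>Fo z\<close> is zero
  too.\<close>

lemma F_zero_obj: assumes "is_zero_obj A z" shows "is_zero_obj A (Fo z)"
proof -
  have z: "z \<in> Ob A" "idt z = zr z z" using assms A.zero_obj_iff by auto
  have "short_exact A z (idt z) z (idt z) z" using A.zero_ses[OF assms z(1)] z(2) by simp
  from A.sesD(7)[OF F_ses[OF this z(1)] F_Ob[OF z(1)]] have "idt (Fo z) ;; idt (Fo z) = zr (Fo z) (Fo z)" unfolding F_ident[OF z(1)] .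
  then show ?thesis using A.zero_obj_iff F_Ob[OF z(1)] A.id_left[OF A.arr_ident[OF F_Ob[OF z(1)]]] by simp
qed

lemma F_zr: assumes "X \<in> Ob A" "Y \<in> Ob A" shows "Fm (zr X Y) = zr (Fo X) (Fo Y)"
proof -
  obtain z where z: "is_zero_obj A z" using A.ex_zero_obj by blast
  have zO: "z \<in> Ob A" using z A.zero_obj_iff by auto
  note X = A.ar_zr[OF assms(1) zO] and Y = A.ar_zr[OF zO assms(2)]
  have "zr X z ;; zr z Y = zr X Y" using assms zO by simp
  then have "Fm (zr X Y) = Fm (zr X z) ;; Fm (zr z Y)" using F_cmp[OF X Y] by simp
  also have "Fm (zr X z) = zr (Fo X) (Fo z)" by (rule A.to_zero[OF F_zero_obj[OF z] F_arr[OF X]])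
  finally show ?thesis using A.zr_left[OF F_arr[OF Y] F_Ob[OF assms(1)]] by simp
qed

lemma F_mono: assumes "is_mono A X Y f" "ar f X Y" shows "is_mono A (Fo X) (Fo Y) (Fm f)"
proof -
  obtain Z g where s: "short_exact A X f Y g Z" using A.mono_ses[OF assms] .
  have Y: "Y \<in> Ob A" using assms(2) by (simp add: arr_def)
  show ?thesis using A.sesD(5)[OF F_ses[OF s Y] F_Ob[OF Y]] .
qed

lemma F_epi: assumes "is_epi A X Y f" "ar f X Y" shows "is_epi A (Fo X) (Fo Y) (Fm f)"
proof -
  obtain Z g where s: "short_exact A Z g X f Y" using A.epi_ses[OF assms] .
  have Y: "X \<in> Ob A" using assms(2) by (simp add: arr_def)
  show ?thesis using A.sesD(6)[OF F_ses[OF s Y] F_Ob[OF Y]] .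
qed

text \<open>Exactness is given for short exact sequences only, so \<open>f\<close> is factored
  through its image: the epimorphism onto the image has the same kernel, and \<open>F\<close>
  preserves the inclusion as a monomorphism.\<close>

lemma F_kernel: assumes f: "ar f X Y" and k: "is_kernel A X Y f K k"
  shows "is_kernel A (Fo X) (Fo Y) (Fm f) (Fo K) (Fm k)"
proof -
  have X: "X \<in> Ob A" using f by (simp add: arr_def)
  obtain Q q where q: "is_cokernel A X Y f Q q" "ar q Y Q" using A.obtain_cokernel[OF f] .
  obtain I m where m: "is_kernel A Y Q q I m" "is_mono A I Y m" "ar m I Y" using A.obtain_kernel[OF q(2)] .
  obtain e where e: "ar e X I" "e ;; m = f" "is_epi A X I e" using A.image_fact[OF f q(1) m(1)] by blast
  have "short_exact A K k X e I"
    using A.ses_iff[OF e(1)] A.kernel_cmp_mono[OF _ e(1) m(3,2)] k e by simp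
  from A.sesD(3)[OF F_ses[OF this X] F_Ob[OF X]]
  have "is_kernel A (Fo X) (Fo I) (Fm e) (Fo K) (Fm k)" .
  from A.kernel_cmp_mono'[OF this F_arr[OF e(1)] F_arr[OF m(3)] F_mono[OF m(2,3)]]
  show ?thesis using F_cmp[OF e(1) m(3)] e(2) by simp
qed

text \<open>Exactness implies additivity. \<open>F\<close> carries the split sequence Y -> E -> Y to
  an exact one, so a map into \<open>Fo E\<close> is determined by its composites with
  \<open>Fm r\<close> and \<open>Fm b\<close>. This computes the image of the pair (f, g), and
  composing with the codiagonal gives the sum.\<close>

lemma F_pls: assumes f: "ar f X Y" and g: "ar g X Y" shows "Fm (f \<boxplus> g) = Fm f \<boxplus> Fm g"
proof -
  have O: "X \<in> Ob A" "Y \<in> Ob A" using f by (simp_all add: arr_def)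
  obtain a E b r s where S: "short_exact A Y a E b Y" "E \<in> Ob A" "ar r E Y" "ar s Y E"
    "a ;; r = idt Y" "s ;; b = idt Y" "s ;; r = zr Y Y" "r ;; a \<boxplus> b ;; s = idt E"
    using A.split_ses[OF O(2,2)] .
  note d = A.sesD[OF S(1,2)] and Fd = A.sesD[OF F_ses[OF S(1,2)] F_Ob[OF S(2)]]
  \<comment> \<open>\<open>h\<close> is the pair (f, g) as a map into \<open>E\<close>, a direct sum
    of two copies of \<open>Y\<close>, and \<open>c\<close> is the codiagonal.\<close>
  define h where "h = f ;; a \<boxplus> g ;; s"
  define c where "c = r \<boxplus> b"
  have h: "ar h X E" and c: "ar c E Y" using f g d S by (auto simp: h_def c_def)
  have hc: "h ;; c = f \<boxplus> g"
    using f g S d O by (simp add: h_def c_def A.distl A.distr A.assoc)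
  have hr: "h ;; r = f" using f g S(3,4) O by (simp add: h_def A.distl A.assoc S(5,7))
  have hb: "h ;; b = g" using f g S(3,4) O by (simp add: h_def A.distl A.assoc S(6) d(7))
  have ac: "a ;; c = idt Y" using A.pls_zero[OF A.arr_ident[OF O(2)]] by (simp add: c_def A.distr S(5) d(7))
  have sc: "s ;; c = idt Y" using A.pls_zero'[OF A.arr_ident[OF O(2)]] by (simp add: c_def A.distr S(6,7))
  let ?h = "Fm f ;; Fm a \<boxplus> Fm g ;; Fm s"
  have ah: "ar ?h (Fo X) (Fo E)" "ar (Fm h) (Fo X) (Fo E)"
    using F_arr[OF f] F_arr[OF g] F_arr[OF S(4)] Fd(1) F_arr[OF h] by auto
  have Fb: "Fm s ;; Fm b = idt (Fo Y)" using F_cmp[OF S(4) d(2)] S(6) F_ident[OF O(2)] by simp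
  have Fr: "Fm a ;; Fm r = idt (Fo Y)" using F_cmp[OF d(1) S(3)] S(5) F_ident[OF O(2)] by simp
  have Fsr: "Fm s ;; Fm r = zr (Fo Y) (Fo Y)" using F_cmp[OF S(4,3)] S(7) F_zr[OF O(2,2)] by simp
  have zO: "Fo Y \<in> Ob A" using O by simp
  have "?h ;; Fm b = Fm f ;; (Fm a ;; Fm b) \<boxplus> Fm g ;; (Fm s ;; Fm b)" by (simp add: A.distl A.assoc)
  then have "?h ;; Fm b = Fm g"
    unfolding Fd(7) Fb A.zr_right[OF F_arr[OF f] zO] A.id_right[OF F_arr[OF g]] A.pls_zero'[OF F_arr[OF g]] .
  then have eb: "?h ;; Fm b = Fm h ;; Fm b" using F_cmp[OF h d(2)] hb by simp
  have "?h ;; Fm r = Fm f ;; (Fm a ;; Fm r) \<boxplus> Fm g ;; (Fm s ;; Fm r)" by (simp add: A.distl A.assoc)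
  then have "?h ;; Fm r = Fm f"
    unfolding Fsr Fr A.zr_right[OF F_arr[OF g] zO] A.id_right[OF F_arr[OF f]] A.pls_zero[OF F_arr[OF f]] .
  then have er: "?h ;; Fm r = Fm h ;; Fm r" using F_cmp[OF h S(3)] hr by simp
  let ?d = "Fm h \<boxplus> ngA ?h"
  have ad: "ar ?d (Fo X) (Fo E)" using ah by blast
  have "?d ;; Fm b = zr (Fo X) (Fo Y)"
    using A.pls_ng[OF A.arr_cmp[OF ah(2) Fd(2)]] unfolding A.distl[of "Fm h"] A.ngl eb by simp
  then obtain v where v: "ar v (Fo X) (Fo Y)" "v ;; Fm a = ?d"
    using A.kernelD(3)[OF Fd(3) F_Ob[OF S(2)] ad] by blast
  have "v = v ;; Fm a ;; Fm r" using v(1) Fr by (simp add: A.assoc)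
  also have "\<dots> = zr (Fo X) (Fo Y)"
    using A.pls_ng[OF A.arr_cmp[OF ah(2) F_arr[OF S(3)]]] unfolding v(2) A.distl[of "Fm h"] A.ngl er by simp
  finally have "?d = zr (Fo X) (Fo E)" using v(2) Fd(1) O by simp
  then have e: "Fm h = ?h" using A.sub_zero_iff[OF ah(2,1)] by blast
  have "Fm (f \<boxplus> g) = Fm h ;; Fm c" using F_cmp[OF h c] hc by simp
  also have "\<dots> = Fm f ;; Fm (a ;; c) \<boxplus> Fm g ;; Fm (s ;; c)"
    unfolding e F_cmp[OF d(1) c] F_cmp[OF S(4) c] by (simp add: A.distl A.assoc)
  also have "\<dots> = Fm f \<boxplus> Fm g" unfolding ac sc F_ident[OF O(2)] using F_arr[OF f] F_arr[OF g] by simp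
  finally show ?thesis .
qed

lemma F_ng: assumes f: "ar f X Y" shows "Fm (ngA f) = ngA (Fm f)"
proof -
  have O: "X \<in> Ob A" "Y \<in> Ob A" using f by (simp_all add: arr_def)
  have "Fm f \<boxplus> Fm (ngA f) = Fm f \<boxplus> ngA (Fm f)"
    using F_pls[OF f A.arr_ng[OF f]] A.pls_ng[OF f] A.pls_ng[OF F_arr[OF f]] F_zr[OF O] by simp
  then show ?thesis
    using A.pls_cancel[OF F_arr[OF A.arr_ng[OF f]] A.arr_ng[OF F_arr[OF f]] F_arr[OF f]] by simp
qed

section \<open>Roots and their morphisms in terms of entries and components\<close>

abbreviation R where "R \<equiv> root_cat A Fo Fm \<eta> p"
abbreviation Rcmp (infixl ";;\<^sub>R" 70) where "f ;;\<^sub>R g \<equiv> cmp R f g"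

text \<open>
  Here entries are numbered from \<open>0\<close>, with \<open>M\<^sub>0 = F M\<^sub>p\<close> included, and \<open>st X j\<close> is the map from entry \<open>j\<close>
  to entry \<open>j + 1\<close>.
\<close>

definition en :: "(nat => 'o) \<times> (nat => 'm) => nat => 'o" where "en X = root_entry Fo p (fst X)"
definition st :: "(nat => 'o) \<times> (nat => 'm) => nat => 'm" where "st X j = snd X (Suc j)"
definition cm :: "(nat => 'm) => nat => 'm" where "cm = root_comp Fm p"

definition mko where "mko e s = ((\<lambda>j\<in>{1..p}. e j), (\<lambda>j\<in>{1..p}. s (j - 1)))"
definition mkm where "mkm c = (\<lambda>j\<in>{1..p}. c j)"

primrec pth :: "(nat => 'o) => (nat => 'm) => nat => nat => 'm" where
  "pth e s i 0 = idt (e i)"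
| "pth e s i (Suc n) = pth e s i n ;; s (i + n)"

definition dia where
  "dia e s <-> (\<forall>j\<le>p. e j \<in> Ob A) \<and> e 0 = Fo (e p) \<and> (\<forall>j<p. ar (s j) (e j) (e (Suc j)))"

definition etac where
  "etac e s <-> (\<forall>j. 1 <= j --> j <= p --> Fm (pth e s j (p - j)) ;; pth e s 0 j = \<eta> (e j))"

definition diam where
  "diam e s e' s' c <-> (\<forall>j\<le>p. ar (c j) (e j) (e' j)) \<and> c 0 = Fm (c p) \<and>
     (\<forall>j<p. s j ;; c (Suc j) = c j ;; s' j)"

lemma p1: "1 <= p" "0 < p" using p2 by auto

lemma en_0: "en X 0 = Fo (en X p)"
  using p2 by (simp add: en_def root_entry_def)

lemma en_pos: "1 <= j ==> en X j = fst X j"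
  by (simp add: en_def root_entry_def)

lemma cm_0: "cm \<phi> 0 = Fm (cm \<phi> p)"
  using p2 by (simp add: cm_def root_comp_def)

lemma cm_pos: "1 <= j ==> cm \<phi> j = \<phi> j"
  by (simp add: cm_def root_comp_def)

lemma en_mko: "e 0 = Fo (e p) ==> j <= p ==> en (mko e s) j = e j"
  using p2 by (auto simp: en_def root_entry_def mko_def)

lemma st_mko: "j < p ==> st (mko e s) j = s j"
  by (auto simp: st_def mko_def)

lemma cm_mkm: "c 0 = Fm (c p) ==> j <= p ==> cm (mkm c) j = c j"
  using p2 by (auto simp: cm_def root_comp_def mkm_def)

lemma pth_arr: assumes "dia e s" shows "i + n <= p ==> ar (pth e s i n) (e i) (e (i + n))"
proof (induction n)
  case 0 then show ?case using assms by (simp add: dia_def A.arr_ident)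
next
  case (Suc n)
  then have "ar (pth e s i n) (e i) (e (i + n))" "ar (s (i + n)) (e (i + n)) (e (Suc (i + n)))"
    using assms by (auto simp: dia_def)
  then show ?case by auto
qed

lemma pth_nat:
  assumes d: "dia e s" "dia e' s'" and c: "diam e s e' s' c"
  shows "i + n <= p ==> pth e s i n ;; c (i + n) = c i ;; pth e' s' i n"
proof (induction n)
  case 0
  then have "ar (c i) (e i) (e' i)" using c by (simp add: diam_def)
  then show ?case by simp
next
  case (Suc n)
  then have IH: "pth e s i n ;; c (i + n) = c i ;; pth e' s' i n" and
    cc: "s (i + n) ;; c (Suc (i + n)) = c (i + n) ;; s' (i + n)" using c by (auto simp: diam_def)
  have "pth e s i (Suc n) ;; c (i + Suc n) = pth e s i n ;; c (i + n) ;; s' (i + n)"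
    using cc by (simp add: A.assoc)
  then show ?case using IH by (simp add: A.assoc)
qed

lemma pth_add: assumes d: "dia e s" and "i + n + m <= p"
  shows "pth e s i n ;; pth e s (i + n) m = pth e s i (n + m)"
  using assms(2)
proof (induction m)
  case 0 then show ?case using pth_arr[OF d, of i n] by simp
next
  case (Suc m) then show ?case by (simp add: A.assoc[symmetric] add.assoc)
qed

lemma pth_cong:
  "(\<And>j. i <= j ==> j < i + n ==> s j = s' j) ==> e i = e' i ==> pth e s i n = pth e' s' i n"
  by (induction n) auto

lemma path_pth: "path A (e i) f i n = pth e (\<lambda>j. f (Suc j)) i n"
  by (induction n) auto

lemma Fpath_pth:
  assumes "dia e s" "i + n <= p" "\<And>j. i <= j ==> j < p ==> f (Suc j) = s j"
  shows "path A (Fo (e i)) (\<lambda>i. Fm (f i)) i n = Fm (pth e s i n)"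
  using assms(2)
proof (induction n)
  case 0 then show ?case using assms(1) by (simp add: dia_def F_ident)
next
  case (Suc n)
  have "ar (pth e s i n) (e i) (e (i + n))" "ar (s (i + n)) (e (i + n)) (e (Suc (i + n)))"
    using assms(1) Suc pth_arr[of e s i n] by (auto simp: dia_def)
  then show ?case using Suc assms(3) F_cmp by simp
qed

text \<open>The bridge between the stored families and the view with entry 0. The two composites of
  structure maps in the definition become \<open>pth\<close>, the first one by functoriality of
  \<open>F\<close>.\<close>

lemma R_Ob_iff:
  "X \<in> Ob R <-> fst X \<in> extensional {1..p} \<and> snd X \<in> extensional {1..p} \<and> dia (en X) (st X) \<and> etac (en X) (st X)"
proof -
  have dd: "(fst X \<in> {1..p} \<rightarrow>\<^sub>E Ob A \<and> snd X \<in> (\<Pi>\<^sub>E j\<in>{1..p}. Hom A (root_entry Fo p (fst X) (j - 1)) (fst X j)))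
    <-> fst X \<in> extensional {1..p} \<and> snd X \<in> extensional {1..p} \<and> dia (en X) (st X)" (is "?l <-> ?r")
  proof
    assume l: ?l
    have o1: "en X j \<in> Ob A" if "1 <= j" "j <= p" for j
      using l that by (auto simp: en_pos PiE_def Pi_def)
    have o: "en X j \<in> Ob A" if "j <= p" for j
      using o1[of j] o1[of p] that p1 en_0[of X] by (cases "j = 0") auto
    have "st X j \<in> Hom A (en X j) (en X (Suc j))" if "j < p" for j
    proof -
      have "Suc j \<in> {1..p}" using that by simp
      then have "snd X (Suc j) \<in> Hom A (root_entry Fo p (fst X) (Suc j - 1)) (fst X (Suc j))"
        using l unfolding PiE_def Pi_def by blast
      then show ?thesis by (simp add: st_def en_pos) (simp add: en_def)
    qed
    then show ?r using o l en_0[of X] by (auto simp: dia_def arr_def PiE_def)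
  next
    assume r: ?r
    have "fst X j \<in> Ob A" if "j \<in> {1..p}" for j
      using r that en_pos[of j X] by (auto simp: dia_def)
    moreover have "snd X j \<in> Hom A (root_entry Fo p (fst X) (j - 1)) (fst X j)" if "j \<in> {1..p}" for j
    proof -
      have "j - 1 < p" "Suc (j - 1) = j" using that by auto
      then have "ar (st X (j - 1)) (en X (j - 1)) (en X j)" using r unfolding dia_def by metis
      then show ?thesis using that by (simp add: st_def en_pos arr_def) (simp add: en_def)
    qed
    ultimately show ?l using r by (auto simp: PiE_def)
  qed
  have ee: "(\<forall>j\<in>{1..p}. path A (Fo (fst X j)) (\<lambda>i. Fm (snd X i)) j (p - j) ;; path A (Fo (fst X p)) (snd X) 0 j = \<eta> (fst X j))
    <-> etac (en X) (st X)" if d: "dia (en X) (st X)"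
  proof -
    have st: "st X = (\<lambda>j. snd X (Suc j))" by (simp add: st_def fun_eq_iff)
    have "path A (Fo (fst X j)) (\<lambda>i. Fm (snd X i)) j (p - j) = Fm (pth (en X) (st X) j (p - j))" if "1 <= j" "j <= p" for j
      using Fpath_pth[OF d, of j "p - j" "snd X"] that by (simp add: st_def en_pos)
    moreover have "path A (Fo (fst X p)) (snd X) 0 j = pth (en X) (st X) 0 j" if "1 <= j" "j <= p" for j
      using path_pth[of "en X" 0 "snd X" j] en_0[of X] en_pos[OF p1(1), of X] st by simp
    ultimately show ?thesis unfolding etac_def by (auto simp: en_pos)
  qed
  have "X \<in> Ob R <-> (fst X \<in> {1..p} \<rightarrow>\<^sub>E Ob A \<and> snd X \<in> (\<Pi>\<^sub>E j\<in>{1..p}. Hom A (root_entry Fo p (fst X) (j - 1)) (fst X j)))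
    \<and> (\<forall>j\<in>{1..p}. path A (Fo (fst X j)) (\<lambda>i. Fm (snd X i)) j (p - j) ;; path A (Fo (fst X p)) (snd X) 0 j = \<eta> (fst X j))"
    by (simp add: root_cat_def split_beta)
  then show ?thesis using dd ee by blast
qed

lemma R_ObD:
  assumes "X \<in> Ob R"
  shows "dia (en X) (st X)" "etac (en X) (st X)"
    and "j <= p ==> en X j \<in> Ob A"
    and "j < p ==> ar (st X j) (en X j) (en X (Suc j))"
  using assms unfolding R_Ob_iff by (auto simp: dia_def)

lemma etac_cong:
  assumes "\<And>j. j <= p ==> e j = e' j" "\<And>j. j < p ==> s j = s' j"
  shows "etac e s <-> etac e' s'"
proof -
  have "pth e s i n = pth e' s' i n" if "i + n <= p" for i n using assms that by (intro pth_cong) auto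
  then show ?thesis unfolding etac_def using assms(1) by (auto simp: le_diff_conv)
qed

lemma R_mkoI:
  assumes "dia e s" "etac e s"
  shows "mko e s \<in> Ob R"
proof -
  have e0: "e 0 = Fo (e p)" using assms(1) by (simp add: dia_def)
  have *: "en (mko e s) j = e j" if "j <= p" for j using en_mko[OF e0 that] .
  have "dia (en (mko e s)) (st (mko e s))"
    using assms(1) * by (simp add: dia_def st_mko)
  moreover have "etac (en (mko e s)) (st (mko e s))"
    using assms(2) etac_cong[of "en (mko e s)" e "st (mko e s)" s] * by (simp add: st_mko)
  ultimately show ?thesis unfolding R_Ob_iff by (simp add: mko_def)
qed

lemma R_Hom: "Hom R X Y = {\<phi> \<in> (\<Pi>\<^sub>E j\<in>{1..p}. Hom A (fst X j) (fst Y j)).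
    \<forall>j\<in>{1..p}. snd X j ;; \<phi> j = root_comp Fm p \<phi> (j - 1) ;; snd Y j}"
  by (simp add: root_cat_def split_beta)

lemma R_arr_iff:
  "arr R \<phi> X Y <-> X \<in> Ob R \<and> Y \<in> Ob R \<and> \<phi> \<in> extensional {1..p} \<and> diam (en X) (st X) (en Y) (st Y) (cm \<phi>)"
proof (cases "X \<in> Ob R \<and> Y \<in> Ob R")
  case True
  then have O: "\<And>j. j <= p ==> en X j \<in> Ob A" "\<And>j. j <= p ==> en Y j \<in> Ob A" using R_ObD(3) by blast+
  have "\<phi> \<in> Hom R X Y <-> \<phi> \<in> extensional {1..p} \<and> diam (en X) (st X) (en Y) (st Y) (cm \<phi>)" (is "?l <-> ?r")
  proof
    assume l: ?l
    have a1: "ar (cm \<phi> j) (en X j) (en Y j)" if "1 <= j" "j <= p" for j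
    proof -
      have "\<phi> j \<in> Hom A (fst X j) (fst Y j)" using l that unfolding R_Hom PiE_def Pi_def by simp
      then show ?thesis using O(1)[of j] O(2)[of j] that by (simp add: arr_def cm_pos en_pos)
    qed
    have a: "ar (cm \<phi> j) (en X j) (en Y j)" if "j <= p" for j
      using a1[of j] that F_arr[OF a1[OF p1(1) order_refl]] en_0 cm_0 by (cases "j = 0") auto
    have "st X j ;; cm \<phi> (Suc j) = cm \<phi> j ;; st Y j" if "j < p" for j
    proof -
      have j: "Suc j \<in> {1..p}" using that by simp
      have "\<forall>j\<in>{1..p}. snd X j ;; \<phi> j = root_comp Fm p \<phi> (j - 1) ;; snd Y j" using l unfolding R_Hom by blast
      from bspec[OF this j] show ?thesis by (simp add: st_def cm_pos) (simp add: cm_def)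
    qed
    then show ?r using a cm_0 l by (auto simp: diam_def R_Hom PiE_def)
  next
    assume r: ?r
    have "\<phi> j \<in> Hom A (fst X j) (fst Y j)" if "j \<in> {1..p}" for j
      using r that en_pos[of j X] en_pos[of j Y] cm_pos[of j \<phi>] unfolding diam_def arr_def by auto
    moreover have "snd X j ;; \<phi> j = root_comp Fm p \<phi> (j - 1) ;; snd Y j" if "j \<in> {1..p}" for j
    proof -
      have j: "j - 1 < p" "Suc (j - 1) = j" "1 <= j" using that by auto
      then have "st X (j - 1) ;; cm \<phi> j = cm \<phi> (j - 1) ;; st Y (j - 1)" using r unfolding diam_def by metis
      then show ?thesis using j by (simp add: st_def cm_pos) (simp add: cm_def)
    qed
    ultimately show ?l using r by (auto simp: R_Hom PiE_def)
  qed
  then show ?thesis using True by (simp add: arr_def)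
qed (auto simp: arr_def)

lemma R_arrD:
  assumes "arr R \<phi> X Y"
  shows "X \<in> Ob R" "Y \<in> Ob R" "diam (en X) (st X) (en Y) (st Y) (cm \<phi>)"
    "j <= p ==> ar (cm \<phi> j) (en X j) (en Y j)"
    "j < p ==> st X j ;; cm \<phi> (Suc j) = cm \<phi> j ;; st Y j"
  using assms unfolding R_arr_iff by (auto simp: diam_def)

lemma R_mkmI:
  assumes "X \<in> Ob R" "Y \<in> Ob R" "diam (en X) (st X) (en Y) (st Y) c"
  shows "arr R (mkm c) X Y"
proof -
  have c0: "c 0 = Fm (c p)" using assms(3) by (simp add: diam_def)
  have "cm (mkm c) j = c j" if "j <= p" for j using cm_mkm[OF c0 that] .
  then show ?thesis using assms unfolding R_arr_iff by (simp add: diam_def mkm_def)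
qed

lemma R_arr_eqI:
  assumes "arr R \<phi> X Y" "arr R \<psi> X' Y'" "\<And>j. 1 <= j ==> j <= p ==> cm \<phi> j = cm \<psi> j"
  shows "\<phi> = \<psi>"
proof (rule extensionalityI)
  show "\<phi> \<in> extensional {1..p}" "\<psi> \<in> extensional {1..p}" using assms(1,2) unfolding R_arr_iff by auto
  show "\<phi> j = \<psi> j" if "j \<in> {1..p}" for j using assms(3)[of j] that by (simp add: cm_pos)
qed

lemma R_cmp: "\<phi> ;;\<^sub>R \<psi> = (\<lambda>j\<in>{1..p}. \<phi> j ;; \<psi> j)"
  by (simp add: root_cat_def)

lemma R_id: "ident R X = mkm (\<lambda>j. idt (en X j))"
  by (auto simp: root_cat_def split_beta mkm_def en_pos fun_eq_iff)

lemma cm_cmp: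
  assumes "arr R \<phi> X Y" "arr R \<psi> Y Z" "j <= p"
  shows "cm (\<phi> ;;\<^sub>R \<psi>) j = cm \<phi> j ;; cm \<psi> j"
proof -
  have *: "cm (\<phi> ;;\<^sub>R \<psi>) j = cm \<phi> j ;; cm \<psi> j" if "1 <= j" "j <= p" for j
    using that by (simp add: cm_pos R_cmp)
  show ?thesis
  proof (cases "j = 0")
    case True
    then show ?thesis using *[OF p1(1) order_refl] cm_0 F_cmp[OF R_arrD(4)[OF assms(1) order_refl] R_arrD(4)[OF assms(2) order_refl]] by simp
  qed (use * assms in auto)
qed

lemma cm_id: "X \<in> Ob R ==> j <= p ==> cm (ident R X) j = idt (en X j)"
  using R_ObD(3)[of X p] by (simp add: R_id cm_mkm en_0 F_ident)

lemma R_category: "category R"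
proof
  fix X assume X: "X \<in> Ob R"
  have "arr R (ident R X) X X" unfolding R_id
  proof (rule R_mkmI[OF X X])
    show "diam (en X) (st X) (en X) (st X) (\<lambda>j. idt (en X j))"
      using R_ObD(3)[OF X] A.id_left[OF R_ObD(4)[OF X]] A.id_right[OF R_ObD(4)[OF X]]
      by (simp add: diam_def en_0 F_ident A.arr_ident)
  qed
  then show "ident R X \<in> Hom R X X" by (simp add: arr_def)
next
  fix X Y Z f g assume "X \<in> Ob R" "Y \<in> Ob R" "Z \<in> Ob R" "f \<in> Hom R X Y" "g \<in> Hom R Y Z"
  then have f: "arr R f X Y" and g: "arr R g Y Z" by (auto simp: arr_def)
  have c: "cm (f ;;\<^sub>R g) j = cm f j ;; cm g j" if "j <= p" for j using cm_cmp[OF f g that] .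
  have "diam (en X) (st X) (en Z) (st Z) (cm (f ;;\<^sub>R g))"
    unfolding diam_def
  proof (intro conjI allI impI)
    fix j assume "j <= p" then show "ar (cm (f ;;\<^sub>R g) j) (en X j) (en Z j)"
      using c R_arrD(4)[OF f] R_arrD(4)[OF g] by auto
  next
    fix j assume j: "j < p"
    have "st X j ;; (cm f (Suc j) ;; cm g (Suc j)) = cm f j ;; (st Y j ;; cm g (Suc j))"
      by (simp add: A.assoc[symmetric] R_arrD(5)[OF f j])
    also have "\<dots> = cm f j ;; cm g j ;; st Z j" by (simp add: R_arrD(5)[OF g j] A.assoc)
    finally show "st X j ;; cm (f ;;\<^sub>R g) (Suc j) = cm (f ;;\<^sub>R g) j ;; st Z j" using c j by simp
  qed (rule cm_0)
  then have "arr R (f ;;\<^sub>R g) X Z" using f g by (simp add: R_arr_iff) (simp add: R_cmp)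
  then show "f ;;\<^sub>R g \<in> Hom R X Z" by (simp add: arr_def)
next
  fix X Y f assume "X \<in> Ob R" "Y \<in> Ob R" "f \<in> Hom R X Y"
  then have f: "arr R f X Y" by (simp add: arr_def)
  then have fe: "f \<in> extensional {1..p}" by (simp add: R_arr_iff)
  have a: "idt (fst X j) ;; f j = f j" "f j ;; idt (fst Y j) = f j" if "j \<in> {1..p}" for j
    using R_arrD(4)[OF f, of j] that by (auto simp: cm_pos en_pos)
  show "ident R X ;;\<^sub>R f = f" "f ;;\<^sub>R ident R Y = f"
    using a fe by (auto simp: R_cmp R_id mkm_def en_pos fun_eq_iff extensional_def)
next
  fix W X Y Z f g h
  show "f ;;\<^sub>R g ;;\<^sub>R h = f ;;\<^sub>R (g ;;\<^sub>R h)" by (auto simp: R_cmp A.assoc fun_eq_iff)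
qed

lemma zero_root:
  assumes z: "is_zero_obj A z"
  defines "Z \<equiv> mko (\<lambda>j. if j = 0 then Fo z else z) (\<lambda>j. zr (if j = 0 then Fo z else z) z)"
  shows "is_zero_obj R Z" and "\<And>j. j <= p ==> is_zero_obj A (en Z j)"
    and "X \<in> Ob R ==> arr R (mkm (\<lambda>j. zr (en X j) (en Z j))) X Z"
    and "X \<in> Ob R ==> arr R (mkm (\<lambda>j. zr (en Z j) (en X j))) Z X"
proof -
  have zO: "z \<in> Ob A" using z A.zero_obj_iff by auto
  let ?e = "\<lambda>j. if j = 0 then Fo z else z" and ?s = "\<lambda>j. zr (if j = 0 then Fo z else z) z"
  have d: "dia ?e ?s" using zO p1 by (auto simp: dia_def)
  have "etac ?e ?s" unfolding etac_def
  proof (intro allI impI)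
    fix j assume j: "1 <= j" "j <= p"
    have e: "?e j = z" "?e (j + (p - j)) = z" "?e (0 + j) = z" "?e 0 = Fo z" using j p1 by auto
    have "ar (Fm (pth ?e ?s j (p - j)) ;; pth ?e ?s 0 j) (Fo z) z"
      using A.arr_cmp[OF F_arr[OF pth_arr[OF d, of j "p - j", unfolded e]] pth_arr[OF d, of 0 j, unfolded e]] j by simp
    from A.zero_objD(2)[OF z this eta_arr[OF zO]]
    show "Fm (pth ?e ?s j (p - j)) ;; pth ?e ?s 0 j = \<eta> (?e j)" unfolding e .
  qed
  then have ZO: "Z \<in> Ob R" unfolding Z_def by (rule R_mkoI[OF d])
  have en: "en Z j = ?e j" if "j <= p" for j unfolding Z_def using en_mko[of ?e j ?s] p1 that by auto
  show zz: "is_zero_obj A (en Z j)" if "j <= p" for j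
    using en[OF that] z F_zero_obj[OF z] by simp
  have zO': "en Z j \<in> Ob A" if "j <= p" for j using zz[OF that] A.zero_obj_iff by auto
  show to: "arr R (mkm (\<lambda>j. zr (en X j) (en Z j))) X Z" if X: "X \<in> Ob R" for X
  proof (rule R_mkmI[OF X ZO])
    show "diam (en X) (st X) (en Z) (st Z) (\<lambda>j. zr (en X j) (en Z j))"
      using R_ObD(3)[OF X] A.zr_right[OF R_ObD(4)[OF X]] A.zr_left[OF R_ObD(4)[OF ZO]] zO' by (simp add: diam_def en_0 F_zr)
  qed
  show fr: "arr R (mkm (\<lambda>j. zr (en Z j) (en X j))) Z X" if X: "X \<in> Ob R" for X
  proof (rule R_mkmI[OF ZO X])
    show "diam (en Z) (st Z) (en X) (st X) (\<lambda>j. zr (en Z j) (en X j))"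
      using R_ObD(3)[OF X] A.zr_left[OF R_ObD(4)[OF X]] A.zr_right[OF R_ObD(4)[OF ZO]] zO' by (simp add: diam_def en_0 F_zr)
  qed
  have u1: "f = g" if "arr R f X Z" "arr R g X Z" for f g X
    using A.zero_objD(2)[OF zz] R_arrD(4)[OF that(1)] R_arrD(4)[OF that(2)] by (intro R_arr_eqI[OF that]) blast
  have u2: "f = g" if "arr R f Z X" "arr R g Z X" for f g X
    using A.zero_objD(3)[OF zz] R_arrD(4)[OF that(1)] R_arrD(4)[OF that(2)] by (intro R_arr_eqI[OF that]) blast
  show "is_zero_obj R Z" unfolding is_zero_obj_def
  proof (intro conjI ballI)
    fix X assume X: "X \<in> Ob R"
    show "\<exists>!f. f \<in> Hom R X Z"
      using arrD(3)[OF to[OF X]] u1[OF arrI[OF X ZO] arrI[OF X ZO]] by (intro ex1I)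
    show "\<exists>!f. f \<in> Hom R Z X"
      using arrD(3)[OF fr[OF X]] u2[OF arrI[OF ZO X] arrI[OF ZO X]] by (intro ex1I)
  qed (rule ZO)
qed

lemma R_zero_mor:
  assumes "X \<in> Ob R" "Y \<in> Ob R"
  shows "zero_mor R X Y = mkm (\<lambda>j. zr (en X j) (en Y j))"
proof -
  obtain z where z: "is_zero_obj A z" using A.ex_zero_obj by blast
  let ?Z = "mko (\<lambda>j. if j = 0 then Fo z else z) (\<lambda>j. zr (if j = 0 then Fo z else z) z)"
  note Z = zero_root[OF z]
  have zO: "en ?Z j \<in> Ob A" if "j <= p" for j using Z(2)[OF that] A.zero_obj_iff by auto
  have c: "zero_mor R X Y = mkm (\<lambda>j. zr (en X j) (en ?Z j)) ;;\<^sub>R mkm (\<lambda>j. zr (en ?Z j) (en Y j))"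
    by (rule category.zero_mor_eq[OF R_category Z(1) Z(3)[OF assms(1)] Z(4)[OF assms(2)]])
  show ?thesis unfolding c using zO R_ObD(3)[OF assms(1)] R_ObD(3)[OF assms(2)]
    by (auto simp: R_cmp mkm_def fun_eq_iff)
qed

lemma cm_zero:
  assumes "X \<in> Ob R" "Y \<in> Ob R" "j <= p"
  shows "cm (zero_mor R X Y) j = zr (en X j) (en Y j)"
  unfolding R_zero_mor[OF assms(1,2)]
  using assms R_ObD(3)[OF assms(1), of p] R_ObD(3)[OF assms(2), of p] by (subst cm_mkm) (auto simp: en_0 F_zr)

lemma R_zero_arr: assumes X: "X \<in> Ob R" and Y: "Y \<in> Ob R" shows "arr R (zero_mor R X Y) X Y"
  unfolding R_zero_mor[OF assms]
proof (rule R_mkmI[OF X Y])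
  show "diam (en X) (st X) (en Y) (st Y) (\<lambda>j. zr (en X j) (en Y j))"
    using R_ObD(3)[OF X] R_ObD(3)[OF Y] A.zr_left[OF R_ObD(4)[OF Y]] A.zr_right[OF R_ObD(4)[OF X]]
    by (simp add: diam_def en_0 F_zr)
qed

end

text \<open>The additive laws appear as assumptions because this is applied to roots while their
  category is still being shown to be abelian, when \<open>abcat\<close> is not yet
  available.\<close>

lemma (in category) direct_sum2I:
  fixes pls (infixl "\<boxplus>" 65)
  assumes O: "X \<in> Ob C" "Y \<in> Ob C" "D \<in> Ob C"
    and a: "arr C i1 X D" "arr C i2 Y D" "arr C q1 D X" "arr C q2 D Y"
    and e: "i1 ;; q1 = ident C X" "i2 ;; q2 = ident C Y" "i1 ;; q2 = zero_mor C X Y" "i2 ;; q1 = zero_mor C Y X"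
    and s: "q1 ;; i1 \<boxplus> q2 ;; i2 = ident C D"
    and as: "\<And>f g h. f ;; g ;; h = f ;; (g ;; h)"
    and pls: "\<And>f g X Y. arr C f X Y ==> arr C g X Y ==> arr C (f \<boxplus> g) X Y" "\<And>f g. f \<boxplus> g = g \<boxplus> f"
      "\<And>f X Y. arr C f X Y ==> f \<boxplus> zero_mor C X Y = f"
    and dist: "\<And>f g h. (f \<boxplus> g) ;; h = f ;; h \<boxplus> g ;; h" "\<And>f g h. f ;; (g \<boxplus> h) = f ;; g \<boxplus> f ;; h"
    and zero: "\<And>f X Y Z. arr C f Y Z ==> X \<in> Ob C ==> zero_mor C X Y ;; f = zero_mor C X Z"
      "\<And>f X Y Z. arr C f X Y ==> Z \<in> Ob C ==> f ;; zero_mor C Y Z = zero_mor C X Z"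
  shows "is_direct_sum2 C X Y D"
proof -
  let ?S = "\<lambda>b. if b then X else Y" and ?i = "\<lambda>b. if b then i1 else i2" and ?q = "\<lambda>b. if b then q1 else q2"
  have all_bool: "(\<forall>i\<in>(UNIV :: bool set). P i) <-> P True \<and> P False" for P by (metis (full_types) UNIV_I)
  have 1: "\<exists>!u. u \<in> Hom C D W \<and> (\<forall>i\<in>UNIV. ?i i ;; u = g i)" if W: "W \<in> Ob C" and g: "\<forall>i\<in>UNIV. g i \<in> Hom C (?S i) W" for W g
  proof (rule ex1I[of _ "q1 ;; g True \<boxplus> q2 ;; g False"])
    have g: "arr C (g True) X W" "arr C (g False) Y W" using g W O unfolding all_bool by (simp_all add: arr_def)
    have "i1 ;; (q1 ;; g True \<boxplus> q2 ;; g False) = g True"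
      unfolding dist as[symmetric] e id_left[OF g(1)] zero(1)[OF g(2) O(1)] by (rule pls(3)[OF g(1)])
    moreover have "i2 ;; (q1 ;; g True \<boxplus> q2 ;; g False) = g False"
      unfolding dist as[symmetric] e id_left[OF g(2)] zero(1)[OF g(1) O(2)] pls(2)[of "zero_mor C Y W"] by (rule pls(3)[OF g(2)])
    ultimately show "q1 ;; g True \<boxplus> q2 ;; g False \<in> Hom C D W \<and> (\<forall>i\<in>UNIV. ?i i ;; (q1 ;; g True \<boxplus> q2 ;; g False) = g i)"
      unfolding all_bool using arrD(3)[OF pls(1)[OF arr_cmp[OF a(3) g(1)] arr_cmp[OF a(4) g(2)]]] by simp
    fix u assume u: "u \<in> Hom C D W \<and> (\<forall>i\<in>UNIV. ?i i ;; u = g i)"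
    then have "u = (q1 ;; i1 \<boxplus> q2 ;; i2) ;; u" unfolding s using id_left[OF arrI[OF O(3) W]] by simp
    then show "u = q1 ;; g True \<boxplus> q2 ;; g False" using u unfolding all_bool by (simp only: dist as if_True if_False)
  qed
  have 2: "\<exists>!u. u \<in> Hom C W D \<and> (\<forall>i\<in>UNIV. u ;; ?q i = g i)" if W: "W \<in> Ob C" and g: "\<forall>i\<in>UNIV. g i \<in> Hom C W (?S i)" for W g
  proof (rule ex1I[of _ "g True ;; i1 \<boxplus> g False ;; i2"])
    have g: "arr C (g True) W X" "arr C (g False) W Y" using g W O unfolding all_bool by (simp_all add: arr_def)
    have "(g True ;; i1 \<boxplus> g False ;; i2) ;; q1 = g True"
      unfolding dist as e id_right[OF g(1)] zero(2)[OF g(2) O(1)] by (rule pls(3)[OF g(1)])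
    moreover have "(g True ;; i1 \<boxplus> g False ;; i2) ;; q2 = g False"
      unfolding dist as e id_right[OF g(2)] zero(2)[OF g(1) O(2)] pls(2)[of "zero_mor C W Y"] by (rule pls(3)[OF g(2)])
    ultimately show "g True ;; i1 \<boxplus> g False ;; i2 \<in> Hom C W D \<and> (\<forall>i\<in>UNIV. (g True ;; i1 \<boxplus> g False ;; i2) ;; ?q i = g i)"
      unfolding all_bool using arrD(3)[OF pls(1)[OF arr_cmp[OF g(1) a(1)] arr_cmp[OF g(2) a(2)]]] by simp
    fix u assume u: "u \<in> Hom C W D \<and> (\<forall>i\<in>UNIV. u ;; ?q i = g i)"
    then have "u = u ;; (q1 ;; i1 \<boxplus> q2 ;; i2)" unfolding s using id_right[OF arrI[OF W O(3)]] by simp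
    then show "u = g True ;; i1 \<boxplus> g False ;; i2" using u unfolding all_bool by (simp only: dist as[symmetric] if_True if_False)
  qed
  have 3: "\<forall>i\<in>UNIV. ?i i \<in> Hom C (?S i) D \<and> ?q i \<in> Hom C D (?S i)"
    "\<forall>i\<in>UNIV. \<forall>j\<in>UNIV. ?i i ;; ?q j = (if i = j then ident C (?S i) else zero_mor C (?S i) (?S j))"
    using a e by (auto simp: arr_def)
  show ?thesis unfolding is_direct_sum_def
    by (intro conjI, rule O(3), use O in simp, rule exI[of _ ?i], rule exI[of _ ?q]) (use 1 2 3 in blast)
qed

section \<open>Abelian structure of the root category\<close>

context root begin

lemma F_cokernel: assumes f: "ar f X Y" and c: "is_cokernel A X Y f Q q"
  shows "is_cokernel A (Fo X) (Fo Y) (Fm f) (Fo Q) (Fm q)"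
proof -
  have Y: "Y \<in> Ob A" using f by (simp add: arr_def)
  have q: "ar q Y Q" "is_epi A Y Q q" using A.cokernelD(1)[OF c Y] A.cokernel_epi[OF c f] by auto
  obtain I m where m: "is_kernel A Y Q q I m" "is_mono A I Y m" "ar m I Y" using A.obtain_kernel[OF q(1)] .
  obtain e where e: "ar e X I" "e ;; m = f" "is_epi A X I e" using A.image_fact[OF f c m(1)] by blast
  have "short_exact A I m Y q Q" using A.ses_iff[OF q(1)] m(1) q(2) by simp
  from A.sesD(4)[OF F_ses[OF this Y] F_Ob[OF Y]]
  have "is_cokernel A (Fo I) (Fo Y) (Fm m) (Fo Q) (Fm q)" .
  from A.cokernel_epi_cmp[OF this F_arr[OF m(3)] F_arr[OF e(1)] F_epi[OF e(3,1)]]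
  show ?thesis using F_cmp[OF e(1) m(3)] e(2) by simp
qed

text \<open>Naturality of the composites along \<open>c\<close> moves the root condition to
  \<open>X\<close>, and naturality of \<open>\<eta>\<close> moves it back. A diagram mapping to a
  root thus satisfies the condition up to composition with \<open>c j\<close>, which settles it for
  subobjects and direct sums.\<close>

lemma etac_into:
  assumes d: "dia e s" and X: "X \<in> Ob R" and c: "diam e s (en X) (st X) c" and j: "1 <= j" "j <= p"
  shows "Fm (pth e s j (p - j)) ;; pth e s 0 j ;; c j = \<eta> (e j) ;; c j"
proof -
  note dX = R_ObD[OF X]
  have jj: "j + (p - j) = p" using j by simp
  have cp: "ar (c p) (e p) (en X p)" and cj: "ar (c j) (e j) (en X j)" and c0: "c 0 = Fm (c p)"
    using c j by (auto simp: diam_def)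
  have a1: "ar (pth e s j (p - j)) (e j) (e p)" using pth_arr[OF d, of j "p - j"] jj by simp
  have a2: "ar (pth (en X) (st X) j (p - j)) (en X j) (en X p)" using pth_arr[OF dX(1), of j "p - j"] jj by simp
  have n1: "pth e s 0 j ;; c j = c 0 ;; pth (en X) (st X) 0 j" using pth_nat[OF d dX(1) c, of 0 j] j by simp
  have n2: "pth e s j (p - j) ;; c p = c j ;; pth (en X) (st X) j (p - j)"
    using pth_nat[OF d dX(1) c, of j "p - j"] jj by simp
  have "Fm (pth e s j (p - j)) ;; pth e s 0 j ;; c j = Fm (pth e s j (p - j)) ;; Fm (c p) ;; pth (en X) (st X) 0 j"
    by (simp add: A.assoc n1 c0)
  also have "Fm (pth e s j (p - j)) ;; Fm (c p) = Fm (c j) ;; Fm (pth (en X) (st X) j (p - j))"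
    using F_cmp[OF a1 cp] F_cmp[OF cj a2] n2 by simp
  also have "\<dots> ;; pth (en X) (st X) 0 j = Fm (c j) ;; \<eta> (en X j)"
    using dX(2) j by (simp add: etac_def A.assoc)
  also have "\<dots> = \<eta> (e j) ;; c j" by (rule eta_nat[OF cj])
  finally show ?thesis .
qed

text \<open>For a diagram receiving a map from a root, the condition holds after precomposing with
  \<open>Fm (c j)\<close>. For quotients this can be cancelled because \<open>F\<close> preserves
  epimorphisms.\<close>

lemma etac_from:
  assumes d: "dia e s" and X: "X \<in> Ob R" and c: "diam (en X) (st X) e s c" and j: "1 <= j" "j <= p"
  shows "Fm (c j) ;; (Fm (pth e s j (p - j)) ;; pth e s 0 j) = Fm (c j) ;; \<eta> (e j)"
proof -
  note dX = R_ObD[OF X]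
  have jj: "j + (p - j) = p" using j by simp
  have cp: "ar (c p) (en X p) (e p)" and cj: "ar (c j) (en X j) (e j)" and c0: "c 0 = Fm (c p)"
    using c j by (auto simp: diam_def)
  have a1: "ar (pth e s j (p - j)) (e j) (e p)" using pth_arr[OF d, of j "p - j"] jj by simp
  have a2: "ar (pth (en X) (st X) j (p - j)) (en X j) (en X p)" using pth_arr[OF dX(1), of j "p - j"] jj by simp
  have n1: "pth (en X) (st X) 0 j ;; c j = c 0 ;; pth e s 0 j" using pth_nat[OF dX(1) d c, of 0 j] j by simp
  have n2: "pth (en X) (st X) j (p - j) ;; c p = c j ;; pth e s j (p - j)"
    using pth_nat[OF dX(1) d c, of j "p - j"] jj by simp
  have "Fm (c j) ;; Fm (pth e s j (p - j)) = Fm (pth (en X) (st X) j (p - j)) ;; Fm (c p)"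
    using F_cmp[OF cj a1] F_cmp[OF a2 cp] n2 by simp
  then have "Fm (c j) ;; (Fm (pth e s j (p - j)) ;; pth e s 0 j) = Fm (pth (en X) (st X) j (p - j)) ;; Fm (c p) ;; pth e s 0 j"
    by (simp add: A.assoc[symmetric])
  also have "\<dots> = Fm (pth (en X) (st X) j (p - j)) ;; pth (en X) (st X) 0 j ;; c j" by (simp add: A.assoc n1 c0)
  also have "\<dots> = \<eta> (en X j) ;; c j" using dX(2) j by (simp add: etac_def)
  also have "\<dots> = Fm (c j) ;; \<eta> (e j)" by (rule eta_nat[OF cj, symmetric])
  finally show ?thesis .
qed

lemma etac_arr: assumes d: "dia e s" and j: "1 <= j" "j <= p"
  shows "ar (Fm (pth e s j (p - j)) ;; pth e s 0 j) (Fo (e j)) (e j)" "ar (\<eta> (e j)) (Fo (e j)) (e j)"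
proof -
  have e0: "e 0 = Fo (e p)" "e j \<in> Ob A" using d j by (auto simp: dia_def)
  show "ar (Fm (pth e s j (p - j)) ;; pth e s 0 j) (Fo (e j)) (e j)"
    using F_arr[OF pth_arr[OF d, of j "p - j"]] pth_arr[OF d, of 0 j] j e0 by auto
  show "ar (\<eta> (e j)) (Fo (e j)) (e j)" by (rule eta_arr[OF e0(2)])
qed

lemma etac_mono:
  assumes d: "dia e s" and X: "X \<in> Ob R" and c: "diam e s (en X) (st X) c"
    and m: "\<And>j. 1 <= j ==> j <= p ==> is_mono A (e j) (en X j) (c j)"
  shows "etac e s"
  unfolding etac_def using etac_into[OF d X c] etac_arr[OF d] A.monoD[OF m] by blast

lemma etac_epi:
  assumes d: "dia e s" and X: "X \<in> Ob R" and c: "diam (en X) (st X) e s c"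
    and m: "\<And>j. 1 <= j ==> j <= p ==> is_epi A (en X j) (e j) (c j)"
  shows "etac e s"
  unfolding etac_def
proof (intro allI impI)
  fix j assume j: "1 <= j" "j <= p"
  have "ar (c j) (en X j) (e j)" using c j by (simp add: diam_def)
  from A.epiD[OF F_epi[OF m[OF j] this] etac_arr[OF d j] etac_from[OF d X c j]]
  show "Fm (pth e s j (p - j)) ;; pth e s 0 j = \<eta> (e j)" .
qed

lemma R_cmp_zero_iff:
  assumes "arr R \<phi> X Y" "arr R \<psi> Y Z"
  shows "\<phi> ;;\<^sub>R \<psi> = zero_mor R X Z <-> (\<forall>j. 1 <= j --> j <= p --> cm \<phi> j ;; cm \<psi> j = zr (en X j) (en Z j))"
proof -
  have O: "X \<in> Ob R" "Z \<in> Ob R" using assms R_arrD by blast+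
  have c: "arr R (\<phi> ;;\<^sub>R \<psi>) X Z" using category.arr_cmp[OF R_category assms] .
  show ?thesis
  proof
    assume "\<phi> ;;\<^sub>R \<psi> = zero_mor R X Z"
    then show "\<forall>j. 1 <= j --> j <= p --> cm \<phi> j ;; cm \<psi> j = zr (en X j) (en Z j)"
      using cm_cmp[OF assms] cm_zero[OF O] by metis
  next
    assume "\<forall>j. 1 <= j --> j <= p --> cm \<phi> j ;; cm \<psi> j = zr (en X j) (en Z j)"
    then show "\<phi> ;;\<^sub>R \<psi> = zero_mor R X Z"
      using cm_cmp[OF assms] cm_zero[OF O] by (intro R_arr_eqI[OF c R_zero_arr[OF O]]) simp
  qed
qed

lemma R_kernelI:
  assumes f: "arr R \<phi> X Y" and k: "arr R \<kappa> Z X"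
    and K: "\<And>j. 1 <= j ==> j <= p ==> is_kernel A (en X j) (en Y j) (cm \<phi> j) (en Z j) (cm \<kappa> j)"
  shows "is_kernel R X Y \<phi> Z \<kappa>"
  unfolding is_kernel_def
proof (intro conjI ballI impI)
  note fa = R_arrD[OF f] and ka = R_arrD[OF k]
  show "Z \<in> Ob R" by (rule ka(1))
  show "\<kappa> \<in> Hom R Z X" by (rule arrD(3)[OF k])
  show "\<kappa> ;;\<^sub>R \<phi> = zero_mor R Z Y"
    unfolding R_cmp_zero_iff[OF k f] using A.kernelD(2)[OF K] R_ObD(3)[OF fa(1)] by blast
  fix W h assume W: "W \<in> Ob R" and "h \<in> Hom R W X" and h0: "h ;;\<^sub>R \<phi> = zero_mor R W Y"
  then have h: "arr R h W X" using fa(1) by (simp add: arr_def)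
  have mono: "is_mono A (en Z j) (en X j) (cm \<kappa> j)" if "1 <= j" "j <= p" for j
    using A.kernel_mono[OF K[OF that] fa(4)] that by simp
  have "\<forall>j\<in>{1..p}. \<exists>u. ar u (en W j) (en Z j) \<and> u ;; cm \<kappa> j = cm h j"
  proof
    fix j assume "j \<in> {1..p}"
    then have j: "1 <= j" "j <= p" by auto
    have "cm h j ;; cm \<phi> j = zr (en W j) (en Y j)" using h0 j unfolding R_cmp_zero_iff[OF h f] by blast
    then show "\<exists>u. ar u (en W j) (en Z j) \<and> u ;; cm \<kappa> j = cm h j"
      using A.kernelD(3)[OF K[OF j] R_ObD(3)[OF fa(1) j(2)] R_arrD(4)[OF h j(2)]] by blast
  qed
  from bchoice[OF this] obtain u where u: "\<forall>j\<in>{1..p}. ar (u j) (en W j) (en Z j) \<and> u j ;; cm \<kappa> j = cm h j" by blast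
  define c where "c j = (if j = 0 then Fm (u p) else u j)" for j
  have up: "ar (u p) (en W p) (en Z p)" "u p ;; cm \<kappa> p = cm h p" using u p1 by auto
  have c: "ar (c j) (en W j) (en Z j)" "c j ;; cm \<kappa> j = cm h j" if "j <= p" for j
    using u that F_arr[OF up(1)] F_cmp[OF up(1) ka(4)[OF order_refl]] up(2) cm_0[of h] cm_0[of \<kappa>] en_0
    by (auto simp: c_def)
  have "diam (en W) (st W) (en Z) (st Z) c"
    unfolding diam_def
  proof (intro conjI allI impI)
    show "c 0 = Fm (c p)" using p1 by (simp add: c_def)
    fix j assume j: "j < p"
    then have jj: "1 <= Suc j" "Suc j <= p" "j <= p" by auto
    show "st W j ;; c (Suc j) = c j ;; st Z j"
    proof (rule A.monoD[OF mono[OF jj(1,2)]])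
      show "ar (st W j ;; c (Suc j)) (en W j) (en Z (Suc j))" using R_ObD(4)[OF W j] c(1)[OF jj(2)] by blast
      show "ar (c j ;; st Z j) (en W j) (en Z (Suc j))" using R_ObD(4)[OF ka(1) j] c(1)[OF jj(3)] by blast
      have "st W j ;; c (Suc j) ;; cm \<kappa> (Suc j) = cm h j ;; st X j"
        by (simp add: A.assoc c(2)[OF jj(2)] R_arrD(5)[OF h j])
      also have "\<dots> = c j ;; st Z j ;; cm \<kappa> (Suc j)" by (simp add: A.assoc ka(5)[OF j]) (simp add: A.assoc[symmetric] c(2)[OF jj(3)])
      finally show "st W j ;; c (Suc j) ;; cm \<kappa> (Suc j) = c j ;; st Z j ;; cm \<kappa> (Suc j)" .
    qed
  qed (rule c(1))
  from R_mkmI[OF W ka(1) this] have v: "arr R (mkm c) W Z" .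
  have cv: "cm (mkm c) j = c j" if "j <= p" for j using cm_mkm[of c j] that p1 by (simp add: c_def)
  have vk: "mkm c ;;\<^sub>R \<kappa> = h"
    using cm_cmp[OF v k] cv c(2) by (intro R_arr_eqI[OF category.arr_cmp[OF R_category v k] h]) simp
  show "\<exists>!u. u \<in> Hom R W Z \<and> u ;;\<^sub>R \<kappa> = h"
  proof (rule ex1I[of _ "mkm c"])
    show "mkm c \<in> Hom R W Z \<and> mkm c ;;\<^sub>R \<kappa> = h" using v vk by (simp add: arr_def)
    fix w assume w: "w \<in> Hom R W Z \<and> w ;;\<^sub>R \<kappa> = h"
    then have wa: "arr R w W Z" using W ka(1) by (simp add: arr_def)
    show "w = mkm c"
    proof (rule R_arr_eqI[OF wa v])
      fix j assume j: "1 <= j" "j <= p"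
      have "cm w j ;; cm \<kappa> j = cm (mkm c) j ;; cm \<kappa> j"
        using cm_cmp[OF wa k j(2)] cm_cmp[OF v k j(2)] w vk by simp
      then show "cm w j = cm (mkm c) j"
        using A.monoD[OF mono[OF j] R_arrD(4)[OF wa j(2)] R_arrD(4)[OF v j(2)]] by blast
    qed
  qed
qed

lemma R_cokernelI:
  assumes f: "arr R \<phi> X Y" and k: "arr R \<kappa> Y Z"
    and K: "\<And>j. 1 <= j ==> j <= p ==> is_cokernel A (en X j) (en Y j) (cm \<phi> j) (en Z j) (cm \<kappa> j)"
  shows "is_cokernel R X Y \<phi> Z \<kappa>"
  unfolding is_cokernel_def
proof (intro conjI ballI impI)
  note fa = R_arrD[OF f] and ka = R_arrD[OF k]
  show "Z \<in> Ob R" by (rule ka(2))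
  show "\<kappa> \<in> Hom R Y Z" by (rule arrD(3)[OF k])
  show "\<phi> ;;\<^sub>R \<kappa> = zero_mor R X Z"
    unfolding R_cmp_zero_iff[OF f k] using A.cokernelD(2)[OF K] R_ObD(3)[OF fa(2)] by blast
  fix W h assume W: "W \<in> Ob R" and "h \<in> Hom R Y W" and h0: "\<phi> ;;\<^sub>R h = zero_mor R X W"
  then have h: "arr R h Y W" using fa(2) by (simp add: arr_def)
  have epi1: "is_epi A (en Y j) (en Z j) (cm \<kappa> j)" if "1 <= j" "j <= p" for j
    using A.cokernel_epi[OF K[OF that] fa(4)] that by simp
  \<comment> \<open>Entry 0 has to be included: the square from \<open>j\<close> to
    \<open>j + 1\<close> is checked by cancelling \<open>cm \<kappa> j\<close>, and at 0 this is the
    image under \<open>F\<close> of the last component.\<close>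
  have epi: "is_epi A (en Y j) (en Z j) (cm \<kappa> j)" if "j <= p" for j
    using epi1[of j] that F_epi[OF epi1[OF p1(1) order_refl] ka(4)[OF order_refl]] en_0 cm_0 by (cases "j = 0") auto
  have "\<forall>j\<in>{1..p}. \<exists>u. ar u (en Z j) (en W j) \<and> cm \<kappa> j ;; u = cm h j"
  proof
    fix j assume "j \<in> {1..p}"
    then have j: "1 <= j" "j <= p" by auto
    have "cm \<phi> j ;; cm h j = zr (en X j) (en W j)" using h0 j unfolding R_cmp_zero_iff[OF f h] by blast
    then show "\<exists>u. ar u (en Z j) (en W j) \<and> cm \<kappa> j ;; u = cm h j"
      using A.cokernelD(3)[OF K[OF j] R_ObD(3)[OF fa(2) j(2)] R_arrD(4)[OF h j(2)]] by blast
  qed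
  from bchoice[OF this] obtain u where u: "\<forall>j\<in>{1..p}. ar (u j) (en Z j) (en W j) \<and> cm \<kappa> j ;; u j = cm h j" by blast
  define c where "c j = (if j = 0 then Fm (u p) else u j)" for j
  have up: "ar (u p) (en Z p) (en W p)" "cm \<kappa> p ;; u p = cm h p" using u p1 by auto
  have c: "ar (c j) (en Z j) (en W j)" "cm \<kappa> j ;; c j = cm h j" if "j <= p" for j
    using u that F_arr[OF up(1)] F_cmp[OF ka(4)[OF order_refl] up(1)] up(2) cm_0[of h] cm_0[of \<kappa>] en_0
    by (auto simp: c_def)
  have "diam (en Z) (st Z) (en W) (st W) c"
    unfolding diam_def
  proof (intro conjI allI impI)
    show "c 0 = Fm (c p)" using p1 by (simp add: c_def)
    fix j assume j: "j < p"
    then have jj: "1 <= Suc j" "Suc j <= p" "j <= p" by auto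
    show "st Z j ;; c (Suc j) = c j ;; st W j"
    proof (rule A.epiD[OF epi[OF jj(3)]])
      show "ar (st Z j ;; c (Suc j)) (en Z j) (en W (Suc j))" using R_ObD(4)[OF ka(2) j] c(1)[OF jj(2)] by blast
      show "ar (c j ;; st W j) (en Z j) (en W (Suc j))" using R_ObD(4)[OF W j] c(1)[OF jj(3)] by blast
      have "cm \<kappa> j ;; (st Z j ;; c (Suc j)) = st Y j ;; cm h (Suc j)"
        by (simp add: A.assoc[symmetric] ka(5)[OF j, symmetric]) (simp add: A.assoc c(2)[OF jj(2)])
      also have "\<dots> = cm \<kappa> j ;; (c j ;; st W j)" by (simp add: R_arrD(5)[OF h j]) (simp add: A.assoc[symmetric] c(2)[OF jj(3)])
      finally show "cm \<kappa> j ;; (st Z j ;; c (Suc j)) = cm \<kappa> j ;; (c j ;; st W j)" .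
    qed
  qed (rule c(1))
  from R_mkmI[OF ka(2) W this] have v: "arr R (mkm c) Z W" .
  have cv: "cm (mkm c) j = c j" if "j <= p" for j using cm_mkm[of c j] that p1 by (simp add: c_def)
  have vk: "\<kappa> ;;\<^sub>R mkm c = h"
    using cm_cmp[OF k v] cv c(2) by (intro R_arr_eqI[OF category.arr_cmp[OF R_category k v] h]) simp
  show "\<exists>!u. u \<in> Hom R Z W \<and> \<kappa> ;;\<^sub>R u = h"
  proof (rule ex1I[of _ "mkm c"])
    show "mkm c \<in> Hom R Z W \<and> \<kappa> ;;\<^sub>R mkm c = h" using v vk by (simp add: arr_def)
    fix w assume w: "w \<in> Hom R Z W \<and> \<kappa> ;;\<^sub>R w = h"
    then have wa: "arr R w Z W" using W ka(2) by (simp add: arr_def)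
    show "w = mkm c"
    proof (rule R_arr_eqI[OF wa v])
      fix j assume j: "1 <= j" "j <= p"
      have "cm \<kappa> j ;; cm w j = cm \<kappa> j ;; cm (mkm c) j"
        using cm_cmp[OF k wa j(2)] cm_cmp[OF k v j(2)] w vk by simp
      then show "cm w j = cm (mkm c) j"
        using A.epiD[OF epi[OF j(2)] R_arrD(4)[OF wa j(2)] R_arrD(4)[OF v j(2)]] by blast
    qed
  qed
qed

text \<open>Kernels are taken entrywise. Entry 0 must be \<open>F\<close> of the last kernel, and it
  is the kernel of component 0 by \<open>F_kernel\<close>. The root condition is inherited along
  monomorphisms.\<close>

lemma R_kernel_ex:
  assumes f: "arr R \<phi> X Y"
  shows "\<exists>Z \<kappa>. arr R \<kappa> Z X \<and> (\<forall>j. 1 <= j --> j <= p --> is_kernel A (en X j) (en Y j) (cm \<phi> j) (en Z j) (cm \<kappa> j))"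
proof -
  note fa = R_arrD[OF f]
  have "\<forall>j\<in>{1..p}. \<exists>w. is_kernel A (en X j) (en Y j) (cm \<phi> j) (fst w) (snd w)"
    using A.obtain_kernel[OF fa(4)] by (metis atLeastAtMost_iff fst_conv snd_conv)
  from bchoice[OF this] obtain w where w: "\<forall>j\<in>{1..p}. is_kernel A (en X j) (en Y j) (cm \<phi> j) (fst (w j)) (snd (w j))" by blast
  define K where "K j = (if j = 0 then Fo (fst (w p)) else fst (w j))" for j
  define k where "k j = (if j = 0 then Fm (snd (w p)) else snd (w j))" for j
  have ker: "is_kernel A (en X j) (en Y j) (cm \<phi> j) (K j) (k j)" if "j <= p" for j
    using w that p1 F_kernel[OF fa(4)[OF order_refl], of "fst (w p)" "snd (w p)"] en_0 cm_0
    by (cases "j = 0") (auto simp: K_def k_def)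
  note kD = A.kernelD[OF ker R_ObD(3)[OF fa(1)]]
  have ka: "ar (k j) (K j) (en X j)" if "j <= p" for j using kD(1)[OF that that] .
  have km: "is_mono A (K j) (en X j) (k j)" if "j <= p" for j using A.kernel_mono[OF ker[OF that] fa(4)[OF that]] .
  have KO: "K j \<in> Ob A" if "j <= p" for j using ka[OF that] by (simp add: arr_def)
  have "\<forall>j\<in>{..<p}. \<exists>u. ar u (K j) (K (Suc j)) \<and> u ;; k (Suc j) = k j ;; st X j"
  proof
    fix j assume "j \<in> {..<p}"
    then have j: "j < p" "j <= p" "Suc j <= p" by auto
    have a: "ar (k j ;; st X j) (K j) (en X (Suc j))" using ka[OF j(2)] R_ObD(4)[OF fa(1) j(1)] by blast
    have "k j ;; st X j ;; cm \<phi> (Suc j) = k j ;; cm \<phi> j ;; st Y j" by (simp add: A.assoc fa(5)[OF j(1)])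
    also have "\<dots> = zr (K j) (en Y (Suc j))"
      using kD(2)[OF j(2) j(2)] A.zr_left[OF R_ObD(4)[OF fa(2) j(1)] KO[OF j(2)]] by simp
    finally show "\<exists>u. ar u (K j) (K (Suc j)) \<and> u ;; k (Suc j) = k j ;; st X j"
      using kD(3)[OF j(3) j(3) a] by blast
  qed
  from bchoice[OF this] obtain s where s: "\<forall>j\<in>{..<p}. ar (s j) (K j) (K (Suc j)) \<and> s j ;; k (Suc j) = k j ;; st X j" by blast
  have K0: "K 0 = Fo (K p)" "k 0 = Fm (k p)" using p1 by (simp_all add: K_def k_def)
  have d: "dia K s" using KO K0 s by (simp add: dia_def)
  have dm: "diam K s (en X) (st X) k" using ka K0 s by (simp add: diam_def)
  have e: "etac K s" by (rule etac_mono[OF d fa(1) dm km])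
  have ZO: "mko K s \<in> Ob R" by (rule R_mkoI[OF d e])
  have en: "en (mko K s) j = K j" if "j <= p" for j using en_mko[of K j s] K0 that by simp
  have "diam (en (mko K s)) (st (mko K s)) (en X) (st X) k" using dm en by (simp add: diam_def st_mko)
  from R_mkmI[OF ZO fa(1) this] have "arr R (mkm k) (mko K s) X" .
  moreover have "cm (mkm k) j = k j" if "j <= p" for j using cm_mkm[of k j] K0 that by simp
  ultimately show ?thesis using ker en by (intro exI[of _ "mko K s"] exI[of _ "mkm k"]) simp
qed

lemma R_cokernel_ex:
  assumes f: "arr R \<phi> X Y"
  shows "\<exists>Z \<kappa>. arr R \<kappa> Y Z \<and> (\<forall>j. 1 <= j --> j <= p --> is_cokernel A (en X j) (en Y j) (cm \<phi> j) (en Z j) (cm \<kappa> j))"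
proof -
  note fa = R_arrD[OF f]
  have "\<forall>j\<in>{1..p}. \<exists>w. is_cokernel A (en X j) (en Y j) (cm \<phi> j) (fst w) (snd w)"
    using A.obtain_cokernel[OF fa(4)] by (metis atLeastAtMost_iff fst_conv snd_conv)
  from bchoice[OF this] obtain w where w: "\<forall>j\<in>{1..p}. is_cokernel A (en X j) (en Y j) (cm \<phi> j) (fst (w j)) (snd (w j))" by blast
  define K where "K j = (if j = 0 then Fo (fst (w p)) else fst (w j))" for j
  define k where "k j = (if j = 0 then Fm (snd (w p)) else snd (w j))" for j
  have ker: "is_cokernel A (en X j) (en Y j) (cm \<phi> j) (K j) (k j)" if "j <= p" for j
    using w that p1 F_cokernel[OF fa(4)[OF order_refl], of "fst (w p)" "snd (w p)"] en_0 cm_0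
    by (cases "j = 0") (auto simp: K_def k_def)
  note kD = A.cokernelD[OF ker R_ObD(3)[OF fa(2)]]
  have ka: "ar (k j) (en Y j) (K j)" if "j <= p" for j using kD(1)[OF that that] .
  have km: "is_epi A (en Y j) (K j) (k j)" if "j <= p" for j using A.cokernel_epi[OF ker[OF that] fa(4)[OF that]] .
  have KO: "K j \<in> Ob A" if "j <= p" for j using ka[OF that] by (simp add: arr_def)
  have "\<forall>j\<in>{..<p}. \<exists>u. ar u (K j) (K (Suc j)) \<and> k j ;; u = st Y j ;; k (Suc j)"
  proof
    fix j assume "j \<in> {..<p}"
    then have j: "j < p" "j <= p" "Suc j <= p" by auto
    have a: "ar (st Y j ;; k (Suc j)) (en Y j) (K (Suc j))" using ka[OF j(3)] R_ObD(4)[OF fa(2) j(1)] by blast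
    have "cm \<phi> j ;; (st Y j ;; k (Suc j)) = st X j ;; (cm \<phi> (Suc j) ;; k (Suc j))"
      by (simp add: A.assoc[symmetric] fa(5)[OF j(1)])
    also have "\<dots> = zr (en X j) (K (Suc j))"
      using kD(2)[OF j(3) j(3)] A.zr_right[OF R_ObD(4)[OF fa(1) j(1)] KO[OF j(3)]] by simp
    finally show "\<exists>u. ar u (K j) (K (Suc j)) \<and> k j ;; u = st Y j ;; k (Suc j)"
      using kD(3)[OF j(2) j(2) a] by blast
  qed
  from bchoice[OF this] obtain s where s: "\<forall>j\<in>{..<p}. ar (s j) (K j) (K (Suc j)) \<and> k j ;; s j = st Y j ;; k (Suc j)" by blast
  have K0: "K 0 = Fo (K p)" "k 0 = Fm (k p)" using p1 by (simp_all add: K_def k_def)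
  have d: "dia K s" using KO K0 s by (simp add: dia_def)
  have dm: "diam (en Y) (st Y) K s k" using ka K0 s by (simp add: diam_def)
  have e: "etac K s" by (rule etac_epi[OF d fa(2) dm km])
  have ZO: "mko K s \<in> Ob R" by (rule R_mkoI[OF d e])
  have en: "en (mko K s) j = K j" if "j <= p" for j using en_mko[of K j s] K0 that by simp
  have "diam (en Y) (st Y) (en (mko K s)) (st (mko K s)) k" using dm en by (simp add: diam_def st_mko)
  from R_mkmI[OF fa(2) ZO this] have "arr R (mkm k) Y (mko K s)" .
  moreover have "cm (mkm k) j = k j" if "j <= p" for j using cm_mkm[of k j] K0 that by simp
  ultimately show ?thesis using ker en by (intro exI[of _ "mko K s"] exI[of _ "mkm k"]) simp
qed

definition plsR where "plsR \<phi> \<psi> = (\<lambda>j\<in>{1..p}. \<phi> j \<boxplus> \<psi> j)"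
definition ngR where "ngR \<phi> = (\<lambda>j\<in>{1..p}. ngA (\<phi> j))"

lemma cm_pls: assumes "arr R \<phi> X Y" "arr R \<psi> X Y" "j <= p" shows "cm (plsR \<phi> \<psi>) j = cm \<phi> j \<boxplus> cm \<psi> j"
proof -
  have *: "cm (plsR \<phi> \<psi>) j = cm \<phi> j \<boxplus> cm \<psi> j" if "1 <= j" "j <= p" for j
    using that by (simp add: cm_pos plsR_def)
  show ?thesis
  proof (cases "j = 0")
    case True
    then show ?thesis using *[OF p1(1) order_refl] cm_0 F_pls[OF R_arrD(4)[OF assms(1) order_refl] R_arrD(4)[OF assms(2) order_refl]] by simp
  qed (use * assms in auto)
qed

lemma cm_ng: assumes "arr R \<phi> X Y" "j <= p" shows "cm (ngR \<phi>) j = ngA (cm \<phi> j)"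
proof -
  have *: "cm (ngR \<phi>) j = ngA (cm \<phi> j)" if "1 <= j" "j <= p" for j
    using that by (simp add: cm_pos ngR_def)
  show ?thesis
  proof (cases "j = 0")
    case True
    then show ?thesis using *[OF p1(1) order_refl] cm_0 F_ng[OF R_arrD(4)[OF assms(1) order_refl]] by simp
  qed (use * assms in auto)
qed

lemma R_arr_pls: assumes f: "arr R \<phi> X Y" and g: "arr R \<psi> X Y" shows "arr R (plsR \<phi> \<psi>) X Y"
proof -
  note fa = R_arrD[OF f] and ga = R_arrD[OF g]
  have "diam (en X) (st X) (en Y) (st Y) (cm (plsR \<phi> \<psi>))"
    unfolding diam_def
  proof (intro conjI allI impI)
    fix j assume j: "j <= p"
    show "ar (cm (plsR \<phi> \<psi>) j) (en X j) (en Y j)" using cm_pls[OF f g j] fa(4)[OF j] ga(4)[OF j] by auto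
  next
    fix j assume j: "j < p"
    then show "st X j ;; cm (plsR \<phi> \<psi>) (Suc j) = cm (plsR \<phi> \<psi>) j ;; st Y j"
      using cm_pls[OF f g, of j] cm_pls[OF f g, of "Suc j"] fa(5)[OF j] ga(5)[OF j] by (simp add: A.distl A.distr)
  qed (rule cm_0)
  then show ?thesis using fa(1,2) by (simp add: R_arr_iff) (simp add: plsR_def)
qed

lemma R_arr_ng: assumes f: "arr R \<phi> X Y" shows "arr R (ngR \<phi>) X Y"
proof -
  note fa = R_arrD[OF f]
  have "diam (en X) (st X) (en Y) (st Y) (cm (ngR \<phi>))"
    unfolding diam_def
  proof (intro conjI allI impI)
    fix j assume j: "j <= p"
    show "ar (cm (ngR \<phi>) j) (en X j) (en Y j)" using cm_ng[OF f j] fa(4)[OF j] by auto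
  next
    fix j assume j: "j < p"
    then show "st X j ;; cm (ngR \<phi>) (Suc j) = cm (ngR \<phi>) j ;; st Y j"
      using cm_ng[OF f, of j] cm_ng[OF f, of "Suc j"] fa(5)[OF j] by (simp add: A.ngl A.ngr)
  qed (rule cm_0)
  then show ?thesis using fa(1,2) by (simp add: R_arr_iff) (simp add: ngR_def)
qed

definition biprod where
  "biprod X Y D i1 i2 q1 q2 <-> ar i1 X D \<and> ar i2 Y D \<and> ar q1 D X \<and> ar q2 D Y \<and>
    i1 ;; q1 = idt X \<and> i2 ;; q2 = idt Y \<and> i1 ;; q2 = zr X Y \<and> i2 ;; q1 = zr Y X \<and> q1 ;; i1 \<boxplus> q2 ;; i2 = idt D"

lemma F_biprod: assumes b: "biprod X Y D i1 i2 q1 q2" shows "biprod (Fo X) (Fo Y) (Fo D) (Fm i1) (Fm i2) (Fm q1) (Fm q2)"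
proof -
  have a: "ar i1 X D" "ar i2 Y D" "ar q1 D X" "ar q2 D Y" using b by (auto simp: biprod_def)
  have O: "X \<in> Ob A" "Y \<in> Ob A" "D \<in> Ob A" using a by (simp_all add: arr_def)
  have "Fm (q1 ;; i1 \<boxplus> q2 ;; i2) = Fm q1 ;; Fm i1 \<boxplus> Fm q2 ;; Fm i2"
    using F_pls[OF A.arr_cmp[OF a(3,1)] A.arr_cmp[OF a(4,2)]] F_cmp[OF a(3,1)] F_cmp[OF a(4,2)] by simp
  then show ?thesis
    using b F_arr[OF a(1)] F_arr[OF a(2)] F_arr[OF a(3)] F_arr[OF a(4)] F_ident F_zr O
      F_cmp[OF a(1,3)] F_cmp[OF a(2,4)] F_cmp[OF a(1,4)] F_cmp[OF a(2,3)]
    by (simp add: biprod_def)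
qed

text \<open>The structure maps are block diagonal. The root condition follows by inserting the
  identity as the sum of both projections followed by injections and applying
  \<open>etac_into\<close> to each projection.\<close>

lemma R_biproduct:
  assumes X: "X \<in> Ob R" and Y: "Y \<in> Ob R"
  obtains D i1 i2 q1 q2 where "arr R i1 X D" "arr R i2 Y D" "arr R q1 D X" "arr R q2 D Y"
    "\<And>j. 1 <= j ==> j <= p ==> biprod (en X j) (en Y j) (en D j) (cm i1 j) (cm i2 j) (cm q1 j) (cm q2 j)"
proof -
  have "\<forall>j\<in>{1..p}. \<exists>w. biprod (en X j) (en Y j) (fst w) (fst (snd w)) (fst (snd (snd w))) (fst (snd (snd (snd w)))) (snd (snd (snd (snd w))))"
  proof
    fix j assume "j \<in> {1..p}"
    then have "en X j \<in> Ob A" "en Y j \<in> Ob A" using R_ObD(3)[OF X] R_ObD(3)[OF Y] by auto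
    then obtain D i1 i2 q1 q2 where "ar i1 (en X j) D" "ar i2 (en Y j) D" "ar q1 D (en X j)" "ar q2 D (en Y j)"
      "i1 ;; q1 = idt (en X j)" "i2 ;; q2 = idt (en Y j)" "i1 ;; q2 = zr (en X j) (en Y j)" "i2 ;; q1 = zr (en Y j) (en X j)"
      "q1 ;; i1 \<boxplus> q2 ;; i2 = idt D" by (rule A.sum2)
    then show "\<exists>w. biprod (en X j) (en Y j) (fst w) (fst (snd w)) (fst (snd (snd w))) (fst (snd (snd (snd w)))) (snd (snd (snd (snd w))))"
      by (intro exI[of _ "(D, i1, i2, q1, q2)"]) (simp add: biprod_def)
  qed
  from bchoice[OF this] obtain w where w: "\<forall>j\<in>{1..p}. biprod (en X j) (en Y j) (fst (w j)) (fst (snd (w j))) (fst (snd (snd (w j)))) (fst (snd (snd (snd (w j))))) (snd (snd (snd (snd (w j)))))" by blast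
  define D where "D j = (if j = 0 then Fo (fst (w p)) else fst (w j))" for j
  define i1 where "i1 j = (if j = 0 then Fm (fst (snd (w p))) else fst (snd (w j)))" for j
  define i2 where "i2 j = (if j = 0 then Fm (fst (snd (snd (w p)))) else fst (snd (snd (w j))))" for j
  define q1 where "q1 j = (if j = 0 then Fm (fst (snd (snd (snd (w p))))) else fst (snd (snd (snd (w j)))))" for j
  define q2 where "q2 j = (if j = 0 then Fm (snd (snd (snd (snd (w p))))) else snd (snd (snd (snd (w j)))))" for j
  have b: "biprod (en X j) (en Y j) (D j) (i1 j) (i2 j) (q1 j) (q2 j)" if "j <= p" for j
  proof (cases "j = 0")
    case True
    have "p \<in> {1..p}" using p1 by simp
    from F_biprod[OF bspec[OF w this]] show ?thesis using True en_0 by (simp add: D_def i1_def i2_def q1_def q2_def)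
  next
    case False
    then have "j \<in> {1..p}" using that by simp
    from bspec[OF w this] show ?thesis using False by (simp add: D_def i1_def i2_def q1_def q2_def)
  qed
  have z0: "D 0 = Fo (D p)" "i1 0 = Fm (i1 p)" "i2 0 = Fm (i2 p)" "q1 0 = Fm (q1 p)" "q2 0 = Fm (q2 p)"
    using p1 by (simp_all add: D_def i1_def i2_def q1_def q2_def)
  have a: "ar (i1 j) (en X j) (D j)" "ar (i2 j) (en Y j) (D j)" "ar (q1 j) (D j) (en X j)" "ar (q2 j) (D j) (en Y j)"
    "i1 j ;; q1 j = idt (en X j)" "i2 j ;; q2 j = idt (en Y j)" "i1 j ;; q2 j = zr (en X j) (en Y j)"
    "i2 j ;; q1 j = zr (en Y j) (en X j)" "q1 j ;; i1 j \<boxplus> q2 j ;; i2 j = idt (D j)" "D j \<in> Ob A" if "j <= p" for j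
    using b[OF that] by (auto simp: biprod_def arr_def)
  define s where "s j = q1 j ;; st X j ;; i1 (Suc j) \<boxplus> q2 j ;; st Y j ;; i2 (Suc j)" for j
  have sa: "ar (q1 j ;; st X j ;; i1 (Suc j)) (D j) (D (Suc j))" "ar (q2 j ;; st Y j ;; i2 (Suc j)) (D j) (D (Suc j))" if "j < p" for j
    using a(1-4)[of j] a(1-4)[of "Suc j"] R_ObD(4)[OF X that] R_ObD(4)[OF Y that] that by auto
  have sX: "ar (q1 j ;; st X j) (D j) (en X (Suc j))" "ar (st X j ;; i1 (Suc j)) (en X j) (D (Suc j))" if "j < p" for j
    using a(1-4)[of j] a(1-4)[of "Suc j"] R_ObD(4)[OF X that] that by auto
  have sY: "ar (q2 j ;; st Y j) (D j) (en Y (Suc j))" "ar (st Y j ;; i2 (Suc j)) (en Y j) (D (Suc j))" if "j < p" for j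
    using a(1-4)[of j] a(1-4)[of "Suc j"] R_ObD(4)[OF Y that] that by auto
  have d: "dia D s" using a(10) z0 sa by (auto simp: dia_def s_def)
  have di1: "diam (en X) (st X) D s i1" unfolding diam_def
  proof (intro conjI allI impI)
    fix j assume j: "j < p"
    then have jj: "j <= p" "Suc j <= p" by auto
    have "i1 j ;; s j = i1 j ;; q1 j ;; (st X j ;; i1 (Suc j)) \<boxplus> i1 j ;; q2 j ;; (st Y j ;; i2 (Suc j))"
      by (simp add: s_def A.distr A.assoc)
    also have "\<dots> = st X j ;; i1 (Suc j)"
      unfolding a(5,7)[OF jj(1)] A.id_left[OF sX(2)[OF j]] A.zr_left[OF sY(2)[OF j] R_ObD(3)[OF X jj(1)]]
      by (rule A.pls_zero[OF sX(2)[OF j]])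
    finally show "st X j ;; i1 (Suc j) = i1 j ;; s j" by simp
  qed (use a z0 in auto)
  have di2: "diam (en Y) (st Y) D s i2" unfolding diam_def
  proof (intro conjI allI impI)
    fix j assume j: "j < p"
    then have jj: "j <= p" "Suc j <= p" by auto
    have "i2 j ;; s j = i2 j ;; q1 j ;; (st X j ;; i1 (Suc j)) \<boxplus> i2 j ;; q2 j ;; (st Y j ;; i2 (Suc j))"
      by (simp add: s_def A.distr A.assoc)
    also have "\<dots> = st Y j ;; i2 (Suc j)"
      unfolding a(6,8)[OF jj(1)] A.id_left[OF sY(2)[OF j]] A.zr_left[OF sX(2)[OF j] R_ObD(3)[OF Y jj(1)]]
      by (rule A.pls_zero'[OF sY(2)[OF j]])
    finally show "st Y j ;; i2 (Suc j) = i2 j ;; s j" by simp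
  qed (use a z0 in auto)
  have dq1: "diam D s (en X) (st X) q1" unfolding diam_def
  proof (intro conjI allI impI)
    fix j assume j: "j < p"
    then have jj: "j <= p" "Suc j <= p" by auto
    have "s j ;; q1 (Suc j) = q1 j ;; st X j ;; (i1 (Suc j) ;; q1 (Suc j)) \<boxplus> q2 j ;; st Y j ;; (i2 (Suc j) ;; q1 (Suc j))"
      by (simp add: s_def A.distl A.assoc)
    also have "\<dots> = q1 j ;; st X j"
      unfolding a(5,8)[OF jj(2)] A.id_right[OF sX(1)[OF j]] A.zr_right[OF sY(1)[OF j] R_ObD(3)[OF X jj(2)]]
      by (rule A.pls_zero[OF sX(1)[OF j]])
    finally show "s j ;; q1 (Suc j) = q1 j ;; st X j" .
  qed (use a z0 in auto)
  have dq2: "diam D s (en Y) (st Y) q2" unfolding diam_def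
  proof (intro conjI allI impI)
    fix j assume j: "j < p"
    then have jj: "j <= p" "Suc j <= p" by auto
    have "s j ;; q2 (Suc j) = q1 j ;; st X j ;; (i1 (Suc j) ;; q2 (Suc j)) \<boxplus> q2 j ;; st Y j ;; (i2 (Suc j) ;; q2 (Suc j))"
      by (simp add: s_def A.distl A.assoc)
    also have "\<dots> = q2 j ;; st Y j"
      unfolding a(6,7)[OF jj(2)] A.id_right[OF sY(1)[OF j]] A.zr_right[OF sX(1)[OF j] R_ObD(3)[OF Y jj(2)]]
      by (rule A.pls_zero'[OF sY(1)[OF j]])
    finally show "s j ;; q2 (Suc j) = q2 j ;; st Y j" .
  qed (use a z0 in auto)
  have e: "etac D s" unfolding etac_def
  proof (intro allI impI)
    fix j assume j: "1 <= j" "j <= p"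
    let ?l = "Fm (pth D s j (p - j)) ;; pth D s 0 j"
    have "?l = ?l ;; (q1 j ;; i1 j \<boxplus> q2 j ;; i2 j)" using A.id_right[OF etac_arr(1)[OF d j]] a(9)[OF j(2)] by simp
    also have "\<dots> = (?l ;; q1 j) ;; i1 j \<boxplus> (?l ;; q2 j) ;; i2 j" by (simp only: A.distr A.assoc)
    also have "\<dots> = \<eta> (D j) ;; (q1 j ;; i1 j \<boxplus> q2 j ;; i2 j)"
      unfolding etac_into[OF d X dq1 j] etac_into[OF d Y dq2 j] by (simp only: A.distr A.assoc)
    also have "\<dots> = \<eta> (D j)" using A.id_right[OF etac_arr(2)[OF d j]] a(9)[OF j(2)] by simp
    finally show "?l = \<eta> (D j)" .
  qed
  have DO: "mko D s \<in> Ob R" by (rule R_mkoI[OF d e])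
  have en: "en (mko D s) j = D j" if "j <= p" for j using en_mko[of D j s] z0 that by simp
  have r: "arr R (mkm i1) X (mko D s)" "arr R (mkm i2) Y (mko D s)" "arr R (mkm q1) (mko D s) X" "arr R (mkm q2) (mko D s) Y"
    using di1 di2 dq1 dq2 en by (auto intro!: R_mkmI X Y DO simp: diam_def st_mko)
  have "biprod (en X j) (en Y j) (en (mko D s) j) (cm (mkm i1) j) (cm (mkm i2) j) (cm (mkm q1) j) (cm (mkm q2) j)"
    if "1 <= j" "j <= p" for j using b[OF that(2)] en that z0 by (simp add: cm_mkm)
  then show ?thesis using that[OF r] by blast
qed

lemma R_cmp_assoc: "f ;;\<^sub>R g ;;\<^sub>R h = f ;;\<^sub>R (g ;;\<^sub>R h)"
  by (auto simp: R_cmp A.assoc fun_eq_iff)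

lemma R_distl: "plsR f g ;;\<^sub>R h = plsR (f ;;\<^sub>R h) (g ;;\<^sub>R h)"
  by (auto simp: R_cmp plsR_def A.distl fun_eq_iff)

lemma R_distr: "f ;;\<^sub>R plsR g h = plsR (f ;;\<^sub>R g) (f ;;\<^sub>R h)"
  by (auto simp: R_cmp plsR_def A.distr fun_eq_iff)

lemma R_pls_zero: assumes "arr R f X Y" shows "plsR f (zero_mor R X Y) = f"
proof -
  note fa = R_arrD[OF assms]
  show ?thesis
  proof (rule R_arr_eqI[OF R_arr_pls[OF assms R_zero_arr[OF fa(1,2)]] assms])
    fix j assume j: "1 <= j" "j <= p"
    show "cm (plsR f (zero_mor R X Y)) j = cm f j"
      using cm_pls[OF assms R_zero_arr[OF fa(1,2)] j(2)] cm_zero[OF fa(1,2) j(2)] A.pls_zero[OF fa(4)[OF j(2)]] by simp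
  qed
qed

lemma R_pls_comm: "plsR f g = plsR g f"
  by (auto simp: plsR_def fun_eq_iff A.pls_comm)

lemma R_zero_cmp:
  assumes "arr R f X Y" "Z \<in> Ob R"
  shows "zero_mor R Z X ;;\<^sub>R f = zero_mor R Z Y" "f ;;\<^sub>R zero_mor R Y Z = zero_mor R X Z"
proof -
  note fa = R_arrD[OF assms(1)]
  show "zero_mor R Z X ;;\<^sub>R f = zero_mor R Z Y"
    unfolding R_cmp_zero_iff[OF R_zero_arr[OF assms(2) fa(1)] assms(1)]
    using cm_zero[OF assms(2) fa(1)] A.zr_left[OF fa(4) R_ObD(3)[OF assms(2)]] by simp
  show "f ;;\<^sub>R zero_mor R Y Z = zero_mor R X Z"
    unfolding R_cmp_zero_iff[OF assms(1) R_zero_arr[OF fa(2) assms(2)]]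
    using cm_zero[OF fa(2) assms(2)] A.zr_right[OF fa(4) R_ObD(3)[OF assms(2)]] by simp
qed

lemma R_sum2_ex:
  assumes X: "X \<in> Ob R" and Y: "Y \<in> Ob R"
  shows "\<exists>D. is_direct_sum2 R X Y D"
proof -
  interpret R: category R by (rule R_category)
  obtain D i1 i2 q1 q2 where D: "arr R i1 X D" "arr R i2 Y D" "arr R q1 D X" "arr R q2 D Y" and
    b: "\<And>j. 1 <= j ==> j <= p ==> biprod (en X j) (en Y j) (en D j) (cm i1 j) (cm i2 j) (cm q1 j) (cm q2 j)"
    by (rule R_biproduct[OF X Y]) (rule that, assumption+)
  have DO: "D \<in> Ob R" using D(1) by (simp add: arr_def)
  have i: "arr R (ident R X) X X" "arr R (ident R Y) Y Y" "arr R (ident R D) D D" using R.arr_ident X Y DO by auto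
  have e: "i1 ;;\<^sub>R q1 = ident R X" "i2 ;;\<^sub>R q2 = ident R Y" "i1 ;;\<^sub>R q2 = zero_mor R X Y" "i2 ;;\<^sub>R q1 = zero_mor R Y X"
    using b cm_id[OF X] cm_id[OF Y]
    by (auto simp: R_cmp_zero_iff[OF D(1,4)] R_cmp_zero_iff[OF D(2,3)] biprod_def cm_cmp[OF D(1,3)] cm_cmp[OF D(2,4)]
        intro!: R_arr_eqI[OF R.arr_cmp[OF D(1,3)] i(1)] R_arr_eqI[OF R.arr_cmp[OF D(2,4)] i(2)])
  have s: "plsR (q1 ;;\<^sub>R i1) (q2 ;;\<^sub>R i2) = ident R D"
  proof (rule R_arr_eqI[OF R_arr_pls[OF R.arr_cmp[OF D(3,1)] R.arr_cmp[OF D(4,2)]] i(3)])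
    fix j assume j: "1 <= j" "j <= p"
    show "cm (plsR (q1 ;;\<^sub>R i1) (q2 ;;\<^sub>R i2)) j = cm (ident R D) j"
      using cm_pls[OF R.arr_cmp[OF D(3,1)] R.arr_cmp[OF D(4,2)] j(2)] cm_cmp[OF D(3,1) j(2)] cm_cmp[OF D(4,2) j(2)]
        b[OF j] cm_id[OF DO j(2)] by (simp add: biprod_def)
  qed
  have "is_direct_sum2 R X Y D"
    by (rule R.direct_sum2I[OF X Y DO D e s R_cmp_assoc R_arr_pls R_pls_comm R_pls_zero R_distl R_distr R_zero_cmp])
  then show ?thesis by blast
qed

text \<open>The root of entrywise kernels maps to \<open>X\<close> and is killed by
  \<open>\<phi>\<close>. As \<open>\<phi>\<close> is a monomorphism this map is zero, so every
  entrywise kernel inclusion is zero.\<close>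

lemma R_mono_components:
  assumes m: "is_mono R X Y \<phi>" and f: "arr R \<phi> X Y" and j: "1 <= j" "j <= p"
  shows "is_mono A (en X j) (en Y j) (cm \<phi> j)"
proof -
  interpret R: category R by (rule R_category)
  note fa = R_arrD[OF f]
  obtain Z \<kappa> where k: "arr R \<kappa> Z X" "\<And>j. 1 <= j ==> j <= p ==> is_kernel A (en X j) (en Y j) (cm \<phi> j) (en Z j) (cm \<kappa> j)"
    using R_kernel_ex[OF f] by blast
  have ZO: "Z \<in> Ob R" using k(1) by (simp add: arr_def)
  have "\<kappa> ;;\<^sub>R \<phi> = zero_mor R Z X ;;\<^sub>R \<phi>"
    unfolding R_zero_cmp(1)[OF f ZO] using R_kernelI[OF f k] by (simp add: is_kernel_def)
  then have "\<kappa> = zero_mor R Z X"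
    using m ZO k(1) R_zero_arr[OF ZO fa(1)] unfolding is_mono_def arr_def by blast
  then have k0: "cm \<kappa> j = zr (en Z j) (en X j)" using cm_zero[OF ZO fa(1) j(2)] by simp
  show ?thesis
  proof (rule A.monoI[OF fa(4)[OF j(2)]])
    fix W g assume g: "ar g W (en X j)" "g ;; cm \<phi> j = zr W (en Y j)"
    obtain u where u: "ar u W (en Z j)" "u ;; cm \<kappa> j = g"
      using A.kernelD(3)[OF k(2)[OF j] R_ObD(3)[OF fa(1) j(2)] g] by blast
    then show "g = zr W (en X j)" unfolding k0 using A.zr_right[OF u(1) R_ObD(3)[OF fa(1) j(2)]] by simp
  qed
qed

lemma R_epi_components:
  assumes m: "is_epi R X Y \<phi>" and f: "arr R \<phi> X Y" and j: "1 <= j" "j <= p"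
  shows "is_epi A (en X j) (en Y j) (cm \<phi> j)"
proof -
  interpret R: category R by (rule R_category)
  note fa = R_arrD[OF f]
  obtain Z \<kappa> where k: "arr R \<kappa> Y Z" "\<And>j. 1 <= j ==> j <= p ==> is_cokernel A (en X j) (en Y j) (cm \<phi> j) (en Z j) (cm \<kappa> j)"
    using R_cokernel_ex[OF f] by blast
  have ZO: "Z \<in> Ob R" using k(1) by (simp add: arr_def)
  have "\<phi> ;;\<^sub>R \<kappa> = \<phi> ;;\<^sub>R zero_mor R Y Z"
    unfolding R_zero_cmp(2)[OF f ZO] using R_cokernelI[OF f k] by (simp add: is_cokernel_def)
  then have "\<kappa> = zero_mor R Y Z"
    using m ZO k(1) R_zero_arr[OF fa(2) ZO] unfolding is_epi_def arr_def by blast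
  then have k0: "cm \<kappa> j = zr (en Y j) (en Z j)" using cm_zero[OF fa(2) ZO j(2)] by simp
  show ?thesis
  proof (rule A.epiI[OF fa(4)[OF j(2)]])
    fix W g assume g: "ar g (en Y j) W" "cm \<phi> j ;; g = zr (en X j) W"
    obtain u where u: "ar u (en Z j) W" "cm \<kappa> j ;; u = g"
      using A.cokernelD(3)[OF k(2)[OF j] R_ObD(3)[OF fa(2) j(2)] g] by blast
    then show "g = zr (en Y j) W" unfolding k0 using A.zr_left[OF u(1) R_ObD(3)[OF fa(2) j(2)]] by simp
  qed
qed

lemma R_abelian: "abelian_category R"
proof -
  interpret R: category R by (rule R_category)
  show ?thesis
  proof
    obtain z where "is_zero_obj A z" using A.ex_zero_obj by blast
    from zero_root(1)[OF this] show "\<exists>Z. is_zero_obj R Z" by blast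
  next
    fix X Y assume "X \<in> Ob R" "Y \<in> Ob R"
    then show "\<exists>D. is_direct_sum2 R X Y D" by (rule R_sum2_ex)
  next
    fix X Y f assume "X \<in> Ob R" "Y \<in> Ob R" "f \<in> Hom R X Y"
    then have f: "arr R f X Y" by (simp add: arr_def)
    show "\<exists>K k. is_kernel R X Y f K k" using R_kernel_ex[OF f] R_kernelI[OF f] by blast
    show "\<exists>Q q. is_cokernel R X Y f Q q" using R_cokernel_ex[OF f] R_cokernelI[OF f] by blast
  next
    fix X Y f assume O: "X \<in> Ob R" "Y \<in> Ob R" and m: "is_mono R X Y f"
    then have f: "arr R f X Y" by (simp add: arr_def is_mono_def)
    obtain Z \<kappa> where k: "arr R \<kappa> Y Z" "\<And>j. 1 <= j ==> j <= p ==> is_cokernel A (en X j) (en Y j) (cm f j) (en Z j) (cm \<kappa> j)"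
      using R_cokernel_ex[OF f] by blast
    have "is_kernel R Y Z \<kappa> X f"
      using A.mono_kernel_of_cokernel[OF R_mono_components[OF m f] R_arrD(4)[OF f] k(2)] by (intro R_kernelI[OF k(1) f]) auto
    then show "\<exists>Z\<in>Ob R. \<exists>g\<in>Hom R Y Z. is_kernel R Y Z g X f" using k(1) by (auto simp: arr_def)
  next
    fix X Y f assume O: "X \<in> Ob R" "Y \<in> Ob R" and m: "is_epi R X Y f"
    then have f: "arr R f X Y" by (simp add: arr_def is_epi_def)
    obtain Z \<kappa> where k: "arr R \<kappa> Z X" "\<And>j. 1 <= j ==> j <= p ==> is_kernel A (en X j) (en Y j) (cm f j) (en Z j) (cm \<kappa> j)"
      using R_kernel_ex[OF f] by blast
    have "is_cokernel R Z X \<kappa> Y f"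
      using A.epi_cokernel_of_kernel[OF R_epi_components[OF m f] R_arrD(4)[OF f] k(2)] by (intro R_cokernelI[OF k(1) f]) auto
    then show "\<exists>W\<in>Ob R. \<exists>g\<in>Hom R W X. is_cokernel R W X g Y f" using k(1) by (auto simp: arr_def)
  qed
qed

text \<open>The unconditional laws pass from \<open>A\<close> to roots because composition, sum and
  negative are formed entry by entry on raw families.\<close>

lemma R_abcat: "abcat R plsR ngR"
proof -
  interpret R: abelian_category R by (rule R_abelian)
  show ?thesis
  proof
    fix f g h show "f ;;\<^sub>R g ;;\<^sub>R h = f ;;\<^sub>R (g ;;\<^sub>R h)" by (rule R_cmp_assoc)
    show "plsR (plsR f g) h = plsR f (plsR g h)" by (auto simp: plsR_def fun_eq_iff A.pls_assoc)
    show "plsR f g = plsR g f" by (rule R_pls_comm)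
    show "plsR f g ;;\<^sub>R h = plsR (f ;;\<^sub>R h) (g ;;\<^sub>R h)" by (rule R_distl)
    show "f ;;\<^sub>R plsR g h = plsR (f ;;\<^sub>R g) (f ;;\<^sub>R h)" by (rule R_distr)
    show "ngR f ;;\<^sub>R g = ngR (f ;;\<^sub>R g)" by (auto simp: R_cmp ngR_def A.ngl fun_eq_iff)
    show "f ;;\<^sub>R ngR g = ngR (f ;;\<^sub>R g)" by (auto simp: R_cmp ngR_def A.ngr fun_eq_iff)
  next
    fix f g X Y assume f: "arr R f X Y"
    show "plsR f (zero_mor R X Y) = f" by (rule R_pls_zero[OF f])
    show "arr R (ngR f) X Y" by (rule R_arr_ng[OF f])
    note fa = R_arrD[OF f]
    show "plsR f (ngR f) = zero_mor R X Y"
    proof (rule R_arr_eqI[OF R_arr_pls[OF f R_arr_ng[OF f]] R_zero_arr[OF fa(1,2)]])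
      fix j assume j: "1 <= j" "j <= p"
      show "cm (plsR f (ngR f)) j = cm (zero_mor R X Y) j"
        using cm_pls[OF f R_arr_ng[OF f] j(2)] cm_ng[OF f j(2)] cm_zero[OF fa(1,2) j(2)] A.pls_ng[OF fa(4)[OF j(2)]] by simp
    qed
    assume g: "arr R g X Y"
    show "arr R (plsR f g) X Y" by (rule R_arr_pls[OF f g])
  qed
qed

lemma R_sesI:
  assumes f: "arr R \<phi> X Y" and g: "arr R \<psi> Y Z"
    and s: "\<And>j. 1 <= j ==> j <= p ==> short_exact A (en X j) (cm \<phi> j) (en Y j) (cm \<psi> j) (en Z j)"
  shows "short_exact R X \<phi> Y \<psi> Z"
  unfolding short_exact_def using R_kernelI[OF g f] R_cokernelI[OF f g] s by (simp add: short_exact_def)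

text \<open>An abstract kernel in \<open>R\<close> is compared with the entrywise kernel through its
  universal property; this shows that evaluation at an entry is exact.\<close>

lemma R_sesD:
  assumes s: "short_exact R X \<phi> Y \<psi> Z" and Y: "Y \<in> Ob R" and j: "j <= p"
  shows "short_exact A (en X j) (cm \<phi> j) (en Y j) (cm \<psi> j) (en Z j)"
proof -
  interpret R: abcat R plsR ngR by (rule R_abcat)
  note d = R.sesD[OF s Y]
  note f = d(1) and g = d(2)
  note fa = R_arrD[OF f] and ga = R_arrD[OF g]
  obtain K \<kappa> where k: "arr R \<kappa> K Y" "\<And>j. 1 <= j ==> j <= p ==> is_kernel A (en Y j) (en Z j) (cm \<psi> j) (en K j) (cm \<kappa> j)"
    using R_kernel_ex[OF g] by blast
  have "\<kappa> ;;\<^sub>R \<psi> = zero_mor R K Z" using R_kernelI[OF g k] by (simp add: is_kernel_def)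
  then obtain u where u: "arr R u K X" "u ;;\<^sub>R \<phi> = \<kappa>" using R.kernelD(3)[OF d(3) Y k(1)] by blast
  have main: "short_exact A (en X j) (cm \<phi> j) (en Y j) (cm \<psi> j) (en Z j)" if j: "1 <= j" "j <= p" for j
  proof -
    have "is_kernel A (en Y j) (en Z j) (cm \<psi> j) (en X j) (cm \<phi> j)"
    proof (rule A.kernelI[OF ga(4)[OF j(2)] fa(4)[OF j(2)]])
      show "cm \<phi> j ;; cm \<psi> j = zr (en X j) (en Z j)" using d(7) j unfolding R_cmp_zero_iff[OF f g] by blast
      show "is_mono A (en X j) (en Y j) (cm \<phi> j)" by (rule R_mono_components[OF d(5) f j])
      fix W h assume h: "ar h W (en Y j)" "h ;; cm \<psi> j = zr W (en Z j)"
      obtain w where w: "ar w W (en K j)" "w ;; cm \<kappa> j = h"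
        using A.kernelD(3)[OF k(2)[OF j] R_ObD(3)[OF Y j(2)] h] by blast
      have "w ;; cm u j ;; cm \<phi> j = h" using cm_cmp[OF u(1) f j(2)] u(2) w(2) by (simp add: A.assoc)
      moreover have "ar (w ;; cm u j) W (en X j)" using w(1) R_arrD(4)[OF u(1) j(2)] by blast
      ultimately show "\<exists>u. ar u W (en X j) \<and> u ;; cm \<phi> j = h" by blast
    qed
    then show ?thesis using A.ses_iff[OF ga(4)[OF j(2)]] R_epi_components[OF d(6) g j] by blast
  qed
  show ?thesis
    using main[of j] F_ses[OF main[OF p1(1) order_refl] R_ObD(3)[OF Y order_refl]] en_0 cm_0 j by (cases "j = 0") auto
qed

end

section \<open>Cokernels along a short exact sequence\<close>

context abcat begin

text \<open>A case of the snake lemma: \<open>\<alpha>''\<close> has zero kernel, so no connecting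
  map interferes and the cokernels form a short exact sequence. The chase replaces elements by maps
  from epimorphic covers.\<close>

lemma cokernel_ses:
  assumes r1: "short_exact C X m X' e X''" "X' \<in> Ob C" and r2: "short_exact C Y n Y' f Y''" "Y' \<in> Ob C"
    and v: "ar \<alpha> X Y" "ar \<alpha>' X' Y'" "ar \<alpha>'' X'' Y''" "m ;; \<alpha>' = \<alpha> ;; n" "e ;; \<alpha>'' = \<alpha>' ;; f"
    and mono: "is_mono C X' Y' \<alpha>'" "is_mono C X'' Y'' \<alpha>''"
    and c: "is_cokernel C X Y \<alpha> Z c" "is_cokernel C X' Y' \<alpha>' Z' c'" "is_cokernel C X'' Y'' \<alpha>'' Z'' c''"
    and w: "ar m' Z Z'" "ar e' Z' Z''" "n ;; c' = c ;; m'" "f ;; c'' = c' ;; e'"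
  shows "short_exact C Z m' Z' e' Z''"
proof -
  note d1 = sesD[OF r1] and d2 = sesD[OF r2]
  have O: "X \<in> Ob C" "Y \<in> Ob C" "X'' \<in> Ob C" "Y'' \<in> Ob C" using v by (simp_all add: arr_def)
  have ac: "ar c Y Z" "ar c' Y' Z'" "ar c'' Y'' Z''" and c0: "\<alpha> ;; c = zr X Z" "\<alpha>' ;; c' = zr X' Z'" "\<alpha>'' ;; c'' = zr X'' Z''"
    using cokernelD(1,2)[OF c(1) O(2)] cokernelD(1,2)[OF c(2) r2(2)] cokernelD(1,2)[OF c(3) O(4)] by auto
  have epi: "is_epi C Y Z c" "is_epi C Y' Z' c'" "is_epi C Y'' Z'' c''" using cokernel_epi c v by blast+
  have k': "is_kernel C Y' Z' c' X' \<alpha>'" and k'': "is_kernel C Y'' Z'' c'' X'' \<alpha>''"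
    using mono_kernel_of_cokernel mono v c by blast+
  have ZO: "Z \<in> Ob C" "Z' \<in> Ob C" "Z'' \<in> Ob C" using ac by (simp_all add: arr_def)
  have epi_e': "is_epi C Z' Z'' e'"
    by (rule epi_right[OF ac(2) w(2)]) (use epi_cmp[OF d2(2) ac(3) d2(6) epi(3)] w(4) in simp)
  have mono_m': "is_mono C Z Z' m'"
  proof (rule monoI[OF w(1)])
    fix V x assume x: "ar x V Z" "x ;; m' = zr V Z'"
    obtain P r y where p: "ar r P V" "ar y P Y" "r ;; x = y ;; c" "is_epi C P V r"
      using pullback[OF x(1) ac(1)] epi(1) by metis
    have PO: "P \<in> Ob C" "V \<in> Ob C" using p(1) by (simp_all add: arr_def)
    have "y ;; n ;; c' = r ;; x ;; m'" by (simp add: assoc w(3)) (simp add: assoc[symmetric] p(3))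
    also have "\<dots> = zr P Z'" using p(1) ZO by (simp add: assoc x(2))
    finally obtain u where u: "ar u P X'" "u ;; \<alpha>' = y ;; n"
      using kernelD(3)[OF k' r2(2) arr_cmp[OF p(2) d2(1)]] by blast
    have "u ;; e ;; \<alpha>'' = y ;; n ;; f" by (simp add: assoc v(5)) (simp add: assoc[symmetric] u(2))
    also have "\<dots> = zr P Y''" using p(2) O by (simp add: assoc d2(7))
    finally have "u ;; e = zr P X''" using monoD0[OF mono(2) O(4) arr_cmp[OF u(1) d1(2)]] by blast
    then obtain t where t: "ar t P X" "t ;; m = u" using kernelD(3)[OF d1(3) r1(2) u(1)] by blast
    have "t ;; \<alpha> ;; n = y ;; n" by (simp add: assoc v(4)[symmetric]) (simp add: assoc[symmetric] t(2) u(2))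
    then have "t ;; \<alpha> = y" using monoD[OF d2(5) arr_cmp[OF t(1) v(1)] p(2)] by blast
    then have "r ;; x = t ;; (\<alpha> ;; c)" using p(3) by (simp add: assoc[symmetric])
    then have "r ;; x = zr P Z" using c0(1) t(1) ZO by simp
    then show "x = zr V Z" using epiD0[OF p(4) PO(1) x(1)] by blast
  qed
  have "is_kernel C Z' Z'' e' Z m'"
  proof (rule kernelI[OF w(2,1) _ _ mono_m'])
    have "c ;; (m' ;; e') = n ;; (f ;; c'')" by (simp add: w(4)) (simp add: assoc[symmetric] w(3))
    also have "\<dots> = zr Y Z''" using zr_left[OF ac(3) O(2)] by (simp add: assoc[symmetric] d2(7))
    finally show "m' ;; e' = zr Z Z''" using epiD0[OF epi(1) O(2) arr_cmp[OF w(1,2)]] by blast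
    fix V x assume x: "ar x V Z'" "x ;; e' = zr V Z''"
    obtain P r y where p: "ar r P V" "ar y P Y'" "r ;; x = y ;; c'" "is_epi C P V r"
      using pullback[OF x(1) ac(2)] epi(2) by metis
    have PO: "P \<in> Ob C" "V \<in> Ob C" using p(1) by (simp_all add: arr_def)
    have "y ;; f ;; c'' = r ;; (x ;; e')" by (simp add: assoc w(4)) (simp add: assoc[symmetric] p(3))
    then have "y ;; f ;; c'' = zr P Z''" using p(1) ZO by (simp add: x(2))
    then obtain t where t: "ar t P X''" "t ;; \<alpha>'' = y ;; f" using kernelD(3)[OF k'' O(4) arr_cmp[OF p(2) d2(2)]] by blast
    \<comment> \<open>A second cover lifts \<open>t\<close> from \<open>X''\<close> to
      \<open>X'\<close>. Subtracting the image of the lift moves the representative \<open>y\<close>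
      into \<open>Y\<close> without changing its class in \<open>Z'\<close>.\<close>
    obtain P2 r2 t2 where q: "ar r2 P2 P" "ar t2 P2 X'" "r2 ;; t = t2 ;; e" "is_epi C P2 P r2"
      using pullback[OF t(1) d1(2)] d1(6) by metis
    have a: "ar (r2 ;; y) P2 Y'" "ar (t2 ;; \<alpha>') P2 Y'" using q p v by blast+
    have "r2 ;; y ;; f = t2 ;; \<alpha>' ;; f"
      by (simp add: assoc t(2)[symmetric] v(5)[symmetric]) (simp add: assoc[symmetric] q(3))
    then have "(r2 ;; y \<boxplus> ng (t2 ;; \<alpha>')) ;; f = zr P2 Y''"
      using pls_ng[OF arr_cmp[OF a(2) d2(2)]] by (simp only: distl ngl)
    then obtain s where s: "ar s P2 Y" "s ;; n = r2 ;; y \<boxplus> ng (t2 ;; \<alpha>')"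
      using kernelD(3)[OF d2(3) r2(2)] a by blast
    have e1: "r2 ;; y = t2 ;; \<alpha>' \<boxplus> s ;; n" using sub_eq_iff[OF a arr_cmp[OF s(1) d2(1)]] s(2) by simp
    have P2O: "P2 \<in> Ob C" using q(1) by (simp add: arr_def)
    have "r2 ;; r ;; x = r2 ;; y ;; c'" by (simp add: assoc p(3))
    also have "\<dots> = t2 ;; (\<alpha>' ;; c') \<boxplus> s ;; (n ;; c')" unfolding e1 by (simp add: distl assoc)
    also have "\<dots> = s ;; (n ;; c')"
      unfolding c0(2) zr_right[OF q(2) ZO(2)] using pls_zero'[OF arr_cmp[OF s(1) arr_cmp[OF d2(1) ac(2)]]] .
    finally have "s ;; c ;; m' = r2 ;; r ;; x" by (simp add: w(3) assoc)
    then show "\<exists>u. ar u V Z \<and> u ;; m' = x"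
      using epi_descent[OF mono_m' w(1) epi_cmp[OF q(1) p(1) q(4) p(4)] arr_cmp[OF q(1) p(1)] x(1) arr_cmp[OF s(1) ac(1)]] by blast
  qed
  then show ?thesis using ses_iff[OF w(2)] epi_e' by blast
qed

lemma zero_obj_mono: assumes "is_zero_obj C Z" "ar f Z X" shows "is_mono C Z X f"
  using assms to_zero[OF assms(1)] by (intro monoI) auto

end

text \<open>That the subcategory A_eta is abelian is assumed here because it is part of
  \<open>cotilting\<close> for \<open>T\<close>, from which it will be supplied.\<close>

locale root_ctx = root +
  assumes enough: "\<And>X. X \<in> Ob A ==> \<exists>M\<in>Ob A. (\<exists>e. is_epi A M X e) \<and> is_mono A (Fo M) M (\<eta> M)"
    and B_ab: "abelian_category (ker_cat A Fo \<eta>)"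

sublocale root \<subseteq> R: abcat "root_cat A Fo Fm \<eta> p" plsR ngR
  by (rule R_abcat)

section \<open>The subcategory A_eta and the functor pi_rho\<close>

context root begin

abbreviation B where "B \<equiv> ker_cat A Fo \<eta>"

lemma B_simps[simp]: "Hom B = Hom A" "ident B = ident A" "cmp B = cmp A"
  by (simp_all add: ker_cat_def)

lemma B_Ob: "X \<in> Ob B <-> X \<in> Ob A \<and> \<eta> X = zr (Fo X) X"
  by (simp add: ker_cat_def)

lemma B_arr: "arr B f X Y <-> X \<in> Ob B \<and> Y \<in> Ob B \<and> ar f X Y"
  by (auto simp: arr_def B_Ob)

lemma B_category: "category B"
  by unfold_locales (auto simp: B_Ob A.ident_in_Hom A.cmp_in_Hom A.ident_left A.ident_right A.cmp_assoc)

lemma B_zero_obj: assumes z: "is_zero_obj A z" shows "is_zero_obj B z"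
proof -
  have zO: "z \<in> Ob A" using z A.zero_obj_iff by auto
  have "\<eta> z = zr (Fo z) z" by (rule A.to_zero[OF z eta_arr[OF zO]])
  then show ?thesis using z zO by (auto simp: is_zero_obj_def B_Ob)
qed

lemma B_zero_mor: assumes "X \<in> Ob B" "Y \<in> Ob B" shows "zero_mor B X Y = zr X Y"
proof -
  obtain z where z: "is_zero_obj A z" using A.ex_zero_obj by blast
  have zO: "z \<in> Ob A" "z \<in> Ob B" using z B_zero_obj[OF z] by (auto simp: is_zero_obj_def)
  have X: "X \<in> Ob A" "Y \<in> Ob A" using assms by (auto simp: B_Ob)
  have "zero_mor B X Y = zr X z ;;\<^bsub>B\<^esub> zr z Y"
    using category.zero_mor_eq[OF B_category B_zero_obj[OF z], of "zr X z" X "zr z Y" Y] assms zO X by (simp add: B_arr)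
  then show ?thesis using X zO by simp
qed

lemma B_sub: assumes "is_mono A X Y m" "ar m X Y" "Y \<in> Ob B" shows "X \<in> Ob B"
proof -
  have O: "X \<in> Ob A" "Y \<in> Ob A" using assms(2) by (simp_all add: arr_def)
  have "\<eta> X ;; m = zr (Fo X) Y" using eta_nat[OF assms(2)] assms(3) F_arr[OF assms(2)] O by (simp add: B_Ob)
  then show ?thesis using A.monoD0[OF assms(1) O(2) eta_arr[OF O(1)]] O by (simp add: B_Ob)
qed

text \<open>By naturality \<open>Fm e ;; \<eta> Y\<close> equals \<open>\<eta> X ;; e\<close>, which
  is zero, and \<open>Fm e\<close> is an epimorphism by exactness of \<open>F\<close>.\<close>

lemma B_quot: assumes "is_epi A X Y e" "ar e X Y" "X \<in> Ob B" shows "Y \<in> Ob B"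
proof -
  have O: "X \<in> Ob A" "Y \<in> Ob A" using assms(2) by (simp_all add: arr_def)
  have "Fm e ;; \<eta> Y = zr (Fo X) Y" using eta_nat[OF assms(2)] assms(2,3) O by (simp add: B_Ob)
  then show ?thesis using A.epiD0[OF F_epi[OF assms(1,2)] F_Ob[OF O(1)] eta_arr[OF O(2)]] O by (simp add: B_Ob)
qed

lemma B_sesI:
  assumes s: "short_exact A X f Y g Z" and O: "X \<in> Ob B" "Y \<in> Ob B" "Z \<in> Ob B"
  shows "short_exact B X f Y g Z"
proof -
  have "is_kernel A Y Z g X f" "is_cokernel A X Y f Z g" using s by (auto simp: short_exact_def)
  then show ?thesis unfolding short_exact_def is_kernel_def is_cokernel_def
    using O by (simp add: B_zero_mor) (auto simp: B_zero_mor B_Ob)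
qed

text \<open>The functor \<open>\<pi>\<^sub>\<rho>\<close> is right adjoint to the exact functor taking the last entry.\<close>

definition pm where "pm f = mkm (\<lambda>j. f)"

definition pen where "pen M j = (if j = 0 then Fo M else M)" for j :: nat
definition pst where "pst M j = (if j = 0 then \<eta> M else idt M)" for j :: nat

lemma pi_rho_mko: "pi_rho A \<eta> p M = mko (pen M) (pst M)"
  by (auto simp: pi_rho_def mko_def pen_def pst_def fun_eq_iff)

lemma pth_Suc_left: assumes d: "dia e s" and "i + Suc n <= p"
  shows "pth e s i (Suc n) = s i ;; pth e s (Suc i) n"
proof -
  have "ar (s i) (e i) (e (Suc i))" using assms by (simp add: dia_def)
  then have "pth e s i 1 = s i" by simp
  then show ?thesis using pth_add[OF d, of i 1 n] assms(2) by simp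
qed

lemma pen_dia: "M \<in> Ob A ==> dia (pen M) (pst M)"
  using p1 by (auto simp: dia_def pen_def pst_def eta_arr A.arr_ident)

lemma pen_pth1: "M \<in> Ob A ==> 1 <= i ==> pth (pen M) (pst M) i n = idt M"
  by (induction n) (auto simp: pen_def pst_def A.arr_ident A.id_left[OF A.arr_ident])

lemma pen_pth0: "M \<in> Ob A ==> 1 <= n ==> n <= p ==> pth (pen M) (pst M) 0 n = \<eta> M"
  using pth_Suc_left[OF pen_dia, of M 0 "n - 1"] pen_pth1[of M 1 "n - 1"] A.id_right[OF eta_arr, of M]
  by (cases n) (auto simp: pst_def)

lemma pi_rho_Ob: assumes M: "M \<in> Ob A" shows "pi_rho A \<eta> p M \<in> Ob R"
  unfolding pi_rho_mko
proof (rule R_mkoI[OF pen_dia[OF M]])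
  show "etac (pen M) (pst M)" unfolding etac_def
    using pen_pth1[OF M] pen_pth0[OF M] A.id_left[OF eta_arr[OF M]] by (simp add: F_ident M) (simp add: pen_def)
qed

lemma pi_rho_en: "j <= p ==> en (pi_rho A \<eta> p M) j = pen M j"
  unfolding pi_rho_mko using p1 by (intro en_mko) (auto simp: pen_def)

lemma pi_rho_st: "j < p ==> st (pi_rho A \<eta> p M) j = pst M j"
  unfolding pi_rho_mko by (rule st_mko)

lemma pm_arr: assumes f: "ar f X Y" shows "arr R (pm f) (pi_rho A \<eta> p X) (pi_rho A \<eta> p Y)"
proof -
  have O: "X \<in> Ob A" "Y \<in> Ob A" using f by (simp_all add: arr_def)
  have e: "pm f = mkm (\<lambda>j. if j = 0 then Fm f else f)" by (auto simp: pm_def mkm_def fun_eq_iff)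
  show ?thesis unfolding e
  proof (rule R_mkmI[OF pi_rho_Ob[OF O(1)] pi_rho_Ob[OF O(2)]])
    show "diam (en (pi_rho A \<eta> p X)) (st (pi_rho A \<eta> p X)) (en (pi_rho A \<eta> p Y)) (st (pi_rho A \<eta> p Y)) (\<lambda>j. if j = 0 then Fm f else f)"
      using p1 f F_arr[OF f] eta_nat[OF f] A.id_left[OF f] A.id_right[OF f]
      by (simp add: diam_def pi_rho_en pi_rho_st) (simp add: pen_def pst_def)
  qed
qed

lemma pm_cm: "1 <= j ==> j <= p ==> cm (pm f) j = f"
  by (simp add: cm_pos pm_def mkm_def)

lemma pi_rho_exact: "is_exact_functor A R (pi_rho A \<eta> p) pm"
  unfolding is_exact_functor_def is_functor_def
proof (intro conjI ballI impI)
  fix X assume X: "X \<in> Ob A"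
  show "pi_rho A \<eta> p X \<in> Ob R" by (rule pi_rho_Ob[OF X])
  show "pm (idt X) = ident R (pi_rho A \<eta> p X)" by (auto simp: pm_def R_id mkm_def fun_eq_iff pi_rho_en pen_def)
next
  fix X Y f assume "X \<in> Ob A" "Y \<in> Ob A" "f \<in> Hom A X Y"
  then have "ar f X Y" by (simp add: arr_def)
  from pm_arr[OF this] show "pm f \<in> Hom R (pi_rho A \<eta> p X) (pi_rho A \<eta> p Y)" by (simp add: arr_def)
next
  fix X Y Z f g
  show "pm (f ;; g) = pm f ;;\<^sub>R pm g" by (auto simp: pm_def R_cmp mkm_def fun_eq_iff)
next
  fix X Y Z f g assume "X \<in> Ob A" "Y \<in> Ob A" "Z \<in> Ob A" "f \<in> Hom A X Y" "g \<in> Hom A Y Z" and s: "short_exact A X f Y g Z"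
  then have f: "ar f X Y" and g: "ar g Y Z" by (auto simp: arr_def)
  show "short_exact R (pi_rho A \<eta> p X) (pm f) (pi_rho A \<eta> p Y) (pm g) (pi_rho A \<eta> p Z)"
    by (rule R_sesI[OF pm_arr[OF f] pm_arr[OF g]]) (use s in \<open>simp add: pm_cm pi_rho_en pen_def\<close>)
qed

text \<open>The unit of the adjunction: its component at entry \<open>j\<close> is the composite of
  the remaining structure maps, from entry \<open>j\<close> to entry \<open>p\<close>.\<close>

definition Rp where
  "Rp N N' e <-> N' = en N p \<and> e = mkm (\<lambda>j. pth (en N) (st N) j (p - j))"

text \<open>This is the root condition at index \<open>p\<close>, where the composite under
  \<open>F\<close> is empty.\<close>

lemma pth_0_p: assumes N: "N \<in> Ob R" shows "pth (en N) (st N) 0 p = \<eta> (en N p)"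
proof -
  have "Fm (pth (en N) (st N) p (p - p)) ;; pth (en N) (st N) 0 p = \<eta> (en N p)"
    using R_ObD(2)[OF N] p1 by (simp only: etac_def)
  moreover have "ar (pth (en N) (st N) 0 p) (Fo (en N p)) (en N p)"
    using pth_arr[OF R_ObD(1)[OF N], of 0 p] en_0[of N] by simp
  ultimately show ?thesis using R_ObD(3)[OF N order_refl] by (simp add: F_ident)
qed

lemma Rp_arr: assumes N: "N \<in> Ob R" and r: "Rp N N' e"
  shows "N' \<in> Ob A" "arr R e N (pi_rho A \<eta> p N')"
proof -
  note d = R_ObD[OF N]
  show NO: "N' \<in> Ob A" using r d(3)[OF order_refl] by (simp add: Rp_def)
  let ?c = "\<lambda>j. if j = 0 then idt (Fo N') else pth (en N) (st N) j (p - j)"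
  have e: "e = mkm ?c" using r by (auto simp: Rp_def mkm_def fun_eq_iff)
  have N': "N' = en N p" using r by (simp add: Rp_def)
  show "arr R e N (pi_rho A \<eta> p N')" unfolding e
  proof (rule R_mkmI[OF N pi_rho_Ob[OF NO]])
    show "diam (en N) (st N) (en (pi_rho A \<eta> p N')) (st (pi_rho A \<eta> p N')) ?c"
      unfolding diam_def
    proof (intro conjI allI impI)
      fix j assume j: "j <= p"
      show "ar (?c j) (en N j) (en (pi_rho A \<eta> p N') j)"
        using pth_arr[OF d(1), of j "p - j"] j N' en_0[of N] A.arr_ident[OF F_Ob[OF NO]] by (simp add: pi_rho_en pen_def)
    next
      show "?c 0 = Fm (?c p)" using p1 N' F_ident[OF d(3)[OF order_refl]] by simp
    next
      fix j assume j: "j < p"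
      have a: "ar (pth (en N) (st N) j (p - j)) (en N j) N'" using pth_arr[OF d(1), of j "p - j"] j N' by simp
      have "st N j ;; pth (en N) (st N) (Suc j) (p - Suc j) = pth (en N) (st N) j (p - j)"
        using pth_Suc_left[OF d(1), of j "p - Suc j"] j by (simp add: Suc_diff_Suc)
      then show "st N j ;; ?c (Suc j) = ?c j ;; st (pi_rho A \<eta> p N') j"
        using j a pth_0_p[OF N] N' A.id_left[OF eta_arr[OF NO]] by (simp add: pi_rho_st pst_def)
    qed
  qed
qed

lemma Rp_cm: "Rp N N' e ==> 1 <= j ==> j <= p ==> cm e j = pth (en N) (st N) j (p - j)"
  by (simp add: Rp_def cm_pos mkm_def)

lemma Rp_cm_p: "Rp N N' e ==> cm e p = idt N'"
  using p1 by (simp add: Rp_cm) (simp add: Rp_def)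

text \<open>Every root counts as good here, because taking the last entry is exact on all of
  \<open>R\<close>. A map into pi_rho Y is determined by its last component, since the structure
  maps of pi_rho Y after entry 1 are identities.\<close>

theorem reflective_pi_rho:
  "reflective_vanishing R plsR ngR A plsA ngA (pi_rho A \<eta> p) pm (\<lambda>_. True) Rp"
proof (intro reflective_vanishing.intro reflective_vanishing_axioms.intro)
  show "abcat R plsR ngR" by (rule R_abcat)
  show "abcat A plsA ngA" by unfold_locales
  show "is_exact_functor A R (pi_rho A \<eta> p) pm" by (rule pi_rho_exact)
  show "True" if "True" "N \<in> Ob R" "P \<in> Ob R" "is_mono R N P m" for P N m by simp
  show "\<exists>P e. P \<in> Ob R \<and> True \<and> is_epi R P W e" if "W \<in> Ob R" for W using R.id_epi[OF that] that by blast
  show "\<exists>W' \<epsilon>. Rp W W' \<epsilon>" if "W \<in> Ob R" "True" for W by (simp add: Rp_def)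
  show "W' \<in> Ob A \<and> arr R \<epsilon> W (pi_rho A \<eta> p W')" if "W \<in> Ob R" "Rp W W' \<epsilon>" for W W' \<epsilon>
    using Rp_arr[OF that] by simp
next
  fix W W' \<epsilon> Y h assume W: "W \<in> Ob R" and r: "Rp W W' \<epsilon>" and Y: "Y \<in> Ob A" and h: "arr R h W (pi_rho A \<eta> p Y)"
  have ep: "en W p = W'" "en (pi_rho A \<eta> p Y) p = Y" using r p1 by (simp_all add: Rp_def pi_rho_en pen_def)
  have a: "ar (cm h p) W' Y" using R_arrD(4)[OF h order_refl] ep by simp
  note ra = Rp_arr[OF W r]
  have "\<epsilon> ;;\<^sub>R pm (cm h p) = h"
  proof (rule R_arr_eqI[OF R.arr_cmp[OF ra(2) pm_arr[OF a]] h])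
    fix j assume j: "1 <= j" "j <= p"
    have "pth (en W) (st W) j (p - j) ;; cm h p = cm h j ;; pth (en (pi_rho A \<eta> p Y)) (st (pi_rho A \<eta> p Y)) j (p - j)"
      using pth_nat[OF R_ObD(1)[OF W] R_ObD(1)[OF R_arrD(2)[OF h]] R_arrD(3)[OF h], of j "p - j"] j by simp
    also have "pth (en (pi_rho A \<eta> p Y)) (st (pi_rho A \<eta> p Y)) j (p - j) = pth (pen Y) (pst Y) j (p - j)"
      using j by (intro pth_cong) (auto simp: pi_rho_st pi_rho_en)
    also have "\<dots> = idt Y" by (rule pen_pth1[OF Y j(1)])
    finally have "pth (en W) (st W) j (p - j) ;; cm h p = cm h j"
      using R_arrD(4)[OF h j(2)] j by (simp add: pi_rho_en pen_def)
    then show "cm (\<epsilon> ;;\<^sub>R pm (cm h p)) j = cm h j"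
      using cm_cmp[OF ra(2) pm_arr[OF a] j(2)] Rp_cm[OF r j] pm_cm[OF j] by simp
  qed
  then show "\<exists>f'. ar f' W' Y \<and> \<epsilon> ;;\<^sub>R pm f' = h" using a by blast
next
  fix W W' \<epsilon> f Y g assume W: "W \<in> Ob R" and r: "Rp W W' \<epsilon>" and f: "ar f W' Y" "ar g W' Y" and e: "\<epsilon> ;;\<^sub>R pm f = \<epsilon> ;;\<^sub>R pm g"
  note ra = Rp_arr[OF W r]
  have k: "cm (\<epsilon> ;;\<^sub>R pm h) p = h" if "ar h W' Y" for h
    unfolding cm_cmp[OF ra(2) pm_arr[OF that] order_refl] Rp_cm_p[OF r] pm_cm[OF p1(1) order_refl]
    by (rule A.id_left[OF that])
  have "f = cm (\<epsilon> ;;\<^sub>R pm f) p" by (rule k[OF f(1), symmetric])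
  also have "\<dots> = cm (\<epsilon> ;;\<^sub>R pm g) p" by (simp only: e)
  also have "\<dots> = g" by (rule k[OF f(2)])
  finally show "f = g" .
next
  fix N m P e W N' P' W' \<epsilon>N \<epsilon>P \<epsilon>W m' e'
  assume s: "short_exact R N m P e W" and P: "P \<in> Ob R" and r: "Rp N N' \<epsilon>N" "Rp P P' \<epsilon>P" "Rp W W' \<epsilon>W"
    and m': "ar m' N' P'" and e': "ar e' P' W'" and mm: "m ;;\<^sub>R \<epsilon>P = \<epsilon>N ;;\<^sub>R pm m'" and ee: "e ;;\<^sub>R \<epsilon>W = \<epsilon>P ;;\<^sub>R pm e'"
  note d = R.sesD[OF s P]
  have O: "N \<in> Ob R" "W \<in> Ob R" using d(1,2) by (simp_all add: arr_def)
  note rN = Rp_arr[OF O(1) r(1)] and rP = Rp_arr[OF P r(2)] and rW = Rp_arr[OF O(2) r(3)]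
  have en: "en N p = N'" "en P p = P'" "en W p = W'" using r by (simp_all add: Rp_def)
  have "cm (m ;;\<^sub>R \<epsilon>P) p = cm m p"
    unfolding cm_cmp[OF d(1) rP(2) order_refl] Rp_cm_p[OF r(2)] en(2)[symmetric]
    by (rule A.id_right[OF R_arrD(4)[OF d(1) order_refl]])
  moreover have "cm (\<epsilon>N ;;\<^sub>R pm m') p = m'"
    unfolding cm_cmp[OF rN(2) pm_arr[OF m'] order_refl] Rp_cm_p[OF r(1)] pm_cm[OF p1(1) order_refl]
    by (rule A.id_left[OF m'])
  moreover have "cm (e ;;\<^sub>R \<epsilon>W) p = cm e p"
    unfolding cm_cmp[OF d(2) rW(2) order_refl] Rp_cm_p[OF r(3)] en(3)[symmetric]
    by (rule A.id_right[OF R_arrD(4)[OF d(2) order_refl]])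
  moreover have "cm (\<epsilon>P ;;\<^sub>R pm e') p = e'"
    unfolding cm_cmp[OF rP(2) pm_arr[OF e'] order_refl] Rp_cm_p[OF r(2)] pm_cm[OF p1(1) order_refl]
    by (rule A.id_left[OF e'])
  ultimately have "cm m p = m'" "cm e p = e'" using mm ee by simp_all
  then show "short_exact A N' m' P' e' W'" using R_sesD[OF s P order_refl] en by simp
qed

end

section \<open>Good roots and covers by them\<close>

context root begin

definition good where "good N <-> is_mono A (Fo (en N p)) (en N p) (\<eta> (en N p))"

text \<open>By naturality, \<open>\<eta>\<close> of the smaller last entry followed by the inclusion
  equals \<open>F\<close> of the inclusion followed by \<open>\<eta>\<close> of the larger one. The
  latter is a composite of monomorphisms, as \<open>F\<close> preserves them.\<close>

lemma good_sub: assumes P: "good P" and m: "is_mono R N P m" "arr R m N P" shows "good N"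
proof -
  note d = R_arrD[OF m(2)]
  have mp: "ar (cm m p) (en N p) (en P p)" "is_mono A (en N p) (en P p) (cm m p)"
    using d(4)[OF order_refl] R_mono_components[OF m p1(1) order_refl] by auto
  have "is_mono A (Fo (en N p)) (en P p) (Fm (cm m p) ;; \<eta> (en P p))"
    using A.mono_cmp[OF F_arr[OF mp(1)] eta_arr[OF R_ObD(3)[OF d(2) order_refl]] F_mono[OF mp(2,1)]] P by (simp add: good_def)
  then show ?thesis unfolding good_def eta_nat[OF mp(1)]
    by (rule A.mono_left[OF eta_arr[OF R_ObD(3)[OF d(1) order_refl]] mp(1)])
qed

text \<open>The map to entry \<open>j\<close> is the first part of the composite to entry
  \<open>p\<close>, which is \<open>\<eta>\<close>. A condition on the last entry alone thus
  controls all cokernels at once.\<close>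

lemma good_mono: assumes N: "N \<in> Ob R" "good N" and j: "j <= p"
  shows "is_mono A (Fo (en N p)) (en N j) (pth (en N) (st N) 0 j)"
proof -
  note d = R_ObD(1)[OF N(1)]
  have e: "pth (en N) (st N) 0 j ;; pth (en N) (st N) j (p - j) = \<eta> (en N p)"
    using pth_add[OF d, of 0 j "p - j"] j pth_0_p[OF N(1)] by simp
  have a: "ar (pth (en N) (st N) 0 j) (Fo (en N p)) (en N j)" "ar (pth (en N) (st N) j (p - j)) (en N j) (en N p)"
    using pth_arr[OF d, of 0 j] pth_arr[OF d, of j "p - j"] j en_0[of N] by auto
  show ?thesis by (rule A.mono_left[OF a]) (use N(2) e in \<open>simp add: good_def\<close>)
qed

text \<open>Left adjoint, at \<open>X\<close>, of the functor taking the \<open>i\<close>-th entry; \<open>\<eta>(X)\<close> has to be a monomorphism.\<close>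

definition len where "len X i k = (if k < i then Fo X else X)" for i k :: nat
definition lst where "lst X i k = (if Suc k < i then idt (Fo X) else if Suc k = i then \<eta> X else idt X)" for i k :: nat

lemma len_dia: assumes X: "X \<in> Ob A" and i: "1 <= i" "i <= p" shows "dia (len X i) (lst X i)"
  using X i eta_arr[OF X] by (auto simp: dia_def len_def lst_def A.arr_ident)

lemma len_pth: assumes X: "X \<in> Ob A" and i: "1 <= i" "i <= p"
  shows "k + n <= p ==> pth (len X i) (lst X i) k n = (if i <= k then idt X else if k + n < i then idt (Fo X) else \<eta> X)"
proof (induction n)
  case 0 then show ?case by (simp add: len_def)
next
  case (Suc n)
  show ?case using Suc i A.id_left[OF A.arr_ident[OF X]] A.id_left[OF A.arr_ident[OF F_Ob[OF X]]] A.id_left[OF eta_arr[OF X]] A.id_right[OF eta_arr[OF X]]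
    by (auto simp: lst_def)
qed

lemma len_root:
  assumes X: "X \<in> Ob A" and m: "is_mono A (Fo X) X (\<eta> X)" and i: "1 <= i" "i <= p"
  shows "mko (len X i) (lst X i) \<in> Ob R" "good (mko (len X i) (lst X i))"
proof -
  have "etac (len X i) (lst X i)" unfolding etac_def
  proof (intro allI impI)
    fix k assume k: "1 <= k" "k <= p"
    have l: "pth (len X i) (lst X i) k (p - k) = (if i <= k then idt X else \<eta> X)"
      using len_pth[OF X i, of k "p - k"] k i by simp
    have l0: "pth (len X i) (lst X i) 0 k = (if k < i then idt (Fo X) else \<eta> X)"
      using len_pth[OF X i, of 0 k] k i by simp
    show "Fm (pth (len X i) (lst X i) k (p - k)) ;; pth (len X i) (lst X i) 0 k = \<eta> (len X i k)"
    proof (cases "i <= k")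
      case True
      then show ?thesis using l l0 A.id_left[OF eta_arr[OF X]] by (simp add: F_ident X len_def)
    next
      case False
      \<comment> \<open>The root condition left of \<open>i\<close> asks for
        \<open>\<eta> (Fo X)\<close>, whereas the composite is \<open>Fm (\<eta> X)\<close>.
        Naturality of \<open>\<eta>\<close> at the map \<open>\<eta> X\<close> shows that both agree
        after composing with \<open>\<eta> X\<close>, and this is where it must be a
        monomorphism.\<close>
      have "Fm (\<eta> X) = \<eta> (Fo X)"
        by (rule A.monoD[OF m F_arr[OF eta_arr[OF X]] eta_arr[OF F_Ob[OF X]] eta_nat[OF eta_arr[OF X]]])
      then show ?thesis using False l l0 A.id_right[OF eta_arr[OF F_Ob[OF X]]] by (simp add: len_def)
    qed
  qed
  then show O: "mko (len X i) (lst X i) \<in> Ob R" by (rule R_mkoI[OF len_dia[OF X i]])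
  have "en (mko (len X i) (lst X i)) p = X" using en_mko[of "len X i" p "lst X i"] i by (simp add: len_def)
  then show "good (mko (len X i) (lst X i))" using m by (simp add: good_def)
qed

text \<open>To the right of \<open>i\<close> the map \<open>x\<close> is continued along the
  structure maps of \<open>W\<close>. To the left the components are forced by component 0, which is
  \<open>F\<close> of the last one. The two prescriptions meet at \<open>i\<close>, where the square
  is the root condition of \<open>W\<close>.\<close>

lemma len_map:
  assumes X: "X \<in> Ob A" and m: "is_mono A (Fo X) X (\<eta> X)" and i: "1 <= i" "i <= p"
    and W: "W \<in> Ob R" and x: "ar x X (en W i)"
  shows "\<exists>\<phi>. arr R \<phi> (mko (len X i) (lst X i)) W \<and> cm \<phi> i = x"
proof -
  note d = R_ObD[OF W]
  let ?P = "mko (len X i) (lst X i)"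
  have PO: "?P \<in> Ob R" by (rule len_root(1)[OF X m i])
  have en: "en ?P k = len X i k" if "k <= p" for k using en_mko[of "len X i" k "lst X i"] i that by (simp add: len_def)
  \<comment> \<open>The component at the last entry, written down beforehand because the components
    left of \<open>i\<close> are built from \<open>Fm t\<close>.\<close>
  define t where "t = x ;; pth (en W) (st W) i (p - i)"
  define c where "c k = (if i <= k then x ;; pth (en W) (st W) i (k - i) else Fm t ;; pth (en W) (st W) 0 k)" for k
  have t: "ar t X (en W p)" unfolding t_def using pth_arr[OF d(1), of i "p - i"] x i by auto
  have p0: "ar (pth (en W) (st W) 0 k) (Fo (en W p)) (en W k)" if "k <= p" for k
    using pth_arr[OF d(1), of 0 k] that en_0[of W] by simp
  have ca: "ar (c k) (len X i k) (en W k)" if k: "k <= p" for k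
  proof (cases "i <= k")
    case True
    then show ?thesis using pth_arr[OF d(1), of i "k - i"] x k by (auto simp: c_def len_def)
  next
    case False
    then show ?thesis using A.arr_cmp[OF F_arr[OF t] p0[OF k]] by (simp add: c_def len_def)
  qed
  have "diam (en ?P) (st ?P) (en W) (st W) c"
    unfolding diam_def
  proof (intro conjI allI impI)
    fix k assume "k <= p" then show "ar (c k) (en ?P k) (en W k)" using ca en by simp
  next
    have "c 0 = Fm t ;; idt (en W 0)" using i by (simp add: c_def)
    also have "\<dots> = Fm t" using F_arr[OF t] en_0[of W] by simp
    also have "\<dots> = Fm (c p)" using i by (simp add: c_def t_def)
    finally show "c 0 = Fm (c p)" .
  next
    fix k assume k: "k < p"
    consider "Suc k < i" | "Suc k = i" | "i <= k" by linarith
    then show "st ?P k ;; c (Suc k) = c k ;; st W k"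
    proof cases
      case 1
      have "ar (c (Suc k)) (Fo X) (en W (Suc k))" using ca[of "Suc k"] 1 k by (simp add: len_def)
      then show ?thesis using 1 k by (simp add: st_mko lst_def) (simp add: c_def A.assoc)
    next
      case 2
      have "\<eta> X ;; x = Fm x ;; \<eta> (en W i)" by (rule eta_nat[OF x, symmetric])
      also have "\<dots> = Fm x ;; (Fm (pth (en W) (st W) i (p - i)) ;; pth (en W) (st W) 0 i)"
        using d(2) i by (simp add: etac_def)
      also have "\<dots> = Fm t ;; pth (en W) (st W) 0 i"
        unfolding t_def using F_cmp[OF x, of "pth (en W) (st W) i (p - i)" "en W p"] pth_arr[OF d(1), of i "p - i"] i
        by (simp add: A.assoc)
      also have "\<dots> = c k ;; st W k" using 2 by (auto simp: c_def A.assoc)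
      finally have "\<eta> X ;; x = c k ;; st W k" .
      moreover have "c (Suc k) = x" using 2 x by (simp add: c_def)
      ultimately show ?thesis using 2 k by (simp add: st_mko lst_def)
    next
      case 3
      have "ar (c (Suc k)) X (en W (Suc k))" using ca[of "Suc k"] 3 k by (simp add: len_def)
      then show ?thesis using 3 k by (simp add: st_mko lst_def) (simp add: c_def A.assoc Suc_diff_le)
    qed
  qed
  from R_mkmI[OF PO W this] have "arr R (mkm c) ?P W" .
  moreover have "cm (mkm c) i = x" using i x by (simp add: cm_pos mkm_def c_def)
  ultimately show ?thesis by blast
qed

lemma R_epiI:
  assumes f: "arr R \<phi> X Y" and e: "\<And>j. 1 <= j ==> j <= p ==> is_epi A (en X j) (en Y j) (cm \<phi> j)"
  shows "is_epi R X Y \<phi>"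
proof (rule R.epiI[OF f])
  fix W g assume g: "arr R g Y W" and z: "\<phi> ;;\<^sub>R g = zero_mor R X W"
  note fa = R_arrD[OF f] and ga = R_arrD[OF g]
  show "g = zero_mor R Y W"
  proof (rule R_arr_eqI[OF g R_zero_arr[OF ga(1,2)]])
    fix j assume j: "1 <= j" "j <= p"
    have "cm \<phi> j ;; cm g j = zr (en X j) (en W j)" using z j unfolding R_cmp_zero_iff[OF f g] by blast
    then show "cm g j = cm (zero_mor R Y W) j"
      using A.epiD0[OF e[OF j] R_ObD(3)[OF fa(1) j(2)] ga(4)[OF j(2)]] cm_zero[OF ga(1,2) j(2)] by simp
  qed
qed

text \<open>A map killed by \<open>\<eta>\<close> of the sum has both projections killed by the
  monomorphisms \<open>\<eta>\<close> of the summands. Hence both projections vanish, and the map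
  with them since \<open>F\<close> preserves biproducts.\<close>

lemma good_biprod:
  assumes P: "P \<in> Ob R" "good P" and Q: "Q \<in> Ob R" "good Q" and a: "arr R q1 D P" "arr R q2 D Q"
    and b: "biprod (en P p) (en Q p) (en D p) (cm i1 p) (cm i2 p) (cm q1 p) (cm q2 p)"
  shows "good D"
  unfolding good_def
proof (rule A.monoI)
  have DO: "en D p \<in> Ob A" using R_ObD(3)[OF R_arrD(1)[OF a(1)] order_refl] .
  show "ar (\<eta> (en D p)) (Fo (en D p)) (en D p)" by (rule eta_arr[OF DO])
  fix W x assume x: "ar x W (Fo (en D p))" "x ;; \<eta> (en D p) = zr W (en D p)"
  have W: "W \<in> Ob A" using x(1) by (simp add: arr_def)
  have q: "x ;; Fm (cm q p) = zr W (Fo (en N p))" if q: "arr R q D N" and N: "good N" for q N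
  proof -
    note c = R_arrD(4)[OF q order_refl]
    have NO: "en N p \<in> Ob A" using c by (simp add: arr_def)
    have "x ;; Fm (cm q p) ;; \<eta> (en N p) = x ;; \<eta> (en D p) ;; cm q p" by (simp add: A.assoc eta_nat[OF c])
    then have "x ;; Fm (cm q p) ;; \<eta> (en N p) = zr W (en N p)" unfolding x(2) A.zr_left[OF c W] .
    then show ?thesis using A.monoD0[OF N[unfolded good_def] NO A.arr_cmp[OF x(1) F_arr[OF c]]] by blast
  qed
  note Fb = F_biprod[OF b, unfolded biprod_def]
  have "x ;; Fm (cm q2 p) ;; Fm (cm i2 p) = x"
    by (rule A.biproduct_eq[OF x(1) _ _ _ _ _ q[OF a(1) P(2)], of "Fm (cm i1 p)"]) (use Fb in auto)
  then have "x = zr W (Fo (en Q p)) ;; Fm (cm i2 p)" unfolding q[OF a(2) Q(2)] by simp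
  then show "x = zr W (Fo (en D p))" using Fb W A.zr_left by metis
qed

end

context root_ctx begin

text \<open>One entry is covered at a time: at stage \<open>Suc m\<close> a summand concentrated
  around that entry is added, built from an object of \<open>A\<close> given by
  \<open>enough\<close>. Entries covered before stay covered, since a map from a sum is an
  epimorphism as soon as its restriction to one summand is.\<close>

lemma good_cover: assumes W: "W \<in> Ob R" shows "\<exists>P e. P \<in> Ob R \<and> good P \<and> is_epi R P W e"
proof -
  note d = R_ObD[OF W]
  have "\<exists>P \<phi>. good P \<and> arr R \<phi> P W \<and> (\<forall>k. 1 <= k --> k <= m --> is_epi A (en P k) (en W k) (cm \<phi> k))" if "m <= p" for m
    using that
  proof (induction m)
    case 0
    obtain z where z: "is_zero_obj A z" using A.ex_zero_obj by blast
    obtain Z where Z: "is_zero_obj R Z" "\<And>j. j <= p ==> is_zero_obj A (en Z j)" using zero_root(1,2)[OF z] by blast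
    have ZO: "Z \<in> Ob R" using Z(1) by (simp add: is_zero_obj_def)
    have "good Z" unfolding good_def
      by (rule A.zero_obj_mono[OF F_zero_obj[OF Z(2)[OF order_refl]] eta_arr[OF R_ObD(3)[OF ZO order_refl]]])
    then show ?case using R_zero_arr[OF ZO W] by (intro exI[of _ Z] exI[of _ "zero_mor R Z W"]) simp
  next
    case (Suc m)
    then obtain P \<phi> where P: "good P" "arr R \<phi> P W" "\<And>k. 1 <= k ==> k <= m ==> is_epi A (en P k) (en W k) (cm \<phi> k)" by auto
    have i: "1 <= Suc m" "Suc m <= p" using Suc by auto
    obtain M e where M: "M \<in> Ob A" "is_epi A M (en W (Suc m)) e" "is_mono A (Fo M) M (\<eta> M)" using enough[OF d(3)[OF i(2)]] by blast
    have e: "ar e M (en W (Suc m))" using A.epi_arr[OF M(2,1) d(3)[OF i(2)]] .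
    let ?Q = "mko (len M (Suc m)) (lst M (Suc m))"
    obtain \<psi> where \<psi>: "arr R \<psi> ?Q W" "cm \<psi> (Suc m) = e" using len_map[OF M(1,3) i W e] by blast
    have Q: "?Q \<in> Ob R" "good ?Q" using len_root[OF M(1,3) i] by auto
    have PO: "P \<in> Ob R" using P(2) by (simp add: arr_def)
    obtain D i1 i2 q1 q2 where D: "arr R i1 P D" "arr R i2 ?Q D" "arr R q1 D P" "arr R q2 D ?Q" and
      b: "\<And>j. 1 <= j ==> j <= p ==> biprod (en P j) (en ?Q j) (en D j) (cm i1 j) (cm i2 j) (cm q1 j) (cm q2 j)"
      by (rule R_biproduct[OF PO Q(1)]) (rule that, assumption+)
    define \<theta> where "\<theta> = plsR (q1 ;;\<^sub>R \<phi>) (q2 ;;\<^sub>R \<psi>)"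
    have a: "arr R (q1 ;;\<^sub>R \<phi>) D W" "arr R (q2 ;;\<^sub>R \<psi>) D W"
      using R.arr_cmp[OF D(3) P(2)] R.arr_cmp[OF D(4) \<psi>(1)] by auto
    have t: "arr R \<theta> D W" unfolding \<theta>_def by (rule R_arr_pls[OF a])
    have tc: "cm \<theta> k = cm q1 k ;; cm \<phi> k \<boxplus> cm q2 k ;; cm \<psi> k" if "k <= p" for k
      unfolding \<theta>_def cm_pls[OF a that] cm_cmp[OF D(3) P(2) that] cm_cmp[OF D(4) \<psi>(1) that] ..
    have gD: "good D" by (rule good_biprod[OF PO P(1) Q D(3,4) b[OF p1(1) order_refl]])
    have "is_epi A (en D k) (en W k) (cm \<theta> k)" if k: "1 <= k" "k <= Suc m" for k
    proof -
      have kp: "k <= p" using k i by simp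
      note bk = b[OF k(1) kp, unfolded biprod_def]
      note ca = R_arrD(4)[OF P(2) kp] R_arrD(4)[OF \<psi>(1) kp]
      have O: "en P k \<in> Ob A" "en ?Q k \<in> Ob A" using R_ObD(3)[OF PO kp] R_ObD(3)[OF Q(1) kp] by auto
      have "cm i1 k ;; cm \<theta> k = cm i1 k ;; cm q1 k ;; cm \<phi> k \<boxplus> cm i1 k ;; cm q2 k ;; cm \<psi> k"
        unfolding tc[OF kp] by (simp only: A.distr A.assoc)
      then have e1: "cm i1 k ;; cm \<theta> k = cm \<phi> k"
        using bk A.id_left[OF ca(1)] A.zr_left[OF ca(2) O(1)] A.pls_zero[OF ca(1)] by simp
      have "cm i2 k ;; cm \<theta> k = cm i2 k ;; cm q1 k ;; cm \<phi> k \<boxplus> cm i2 k ;; cm q2 k ;; cm \<psi> k"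
        unfolding tc[OF kp] by (simp only: A.distr A.assoc)
      then have e2: "cm i2 k ;; cm \<theta> k = cm \<psi> k"
        using bk A.id_left[OF ca(2)] A.zr_left[OF ca(1) O(2)] A.pls_zero'[OF ca(2)] by simp
      show ?thesis
      proof (cases "k = Suc m")
        case True
        have "en ?Q (Suc m) = M" using en_mko[of "len M (Suc m)" "Suc m" "lst M (Suc m)"] i by (simp add: len_def)
        then have "is_epi A (en ?Q k) (en W k) (cm i2 k ;; cm \<theta> k)" using M(2) \<psi>(2) True e2 by simp
        then show ?thesis using A.epi_right[OF R_arrD(4)[OF D(2) kp] R_arrD(4)[OF t kp]] by blast
      next
        case False
        then have "is_epi A (en P k) (en W k) (cm i1 k ;; cm \<theta> k)" using P(3)[of k] k e1 by simp
        then show ?thesis using A.epi_right[OF R_arrD(4)[OF D(1) kp] R_arrD(4)[OF t kp]] by blast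
      qed
    qed
    then show ?case using gD t by blast
  qed
  from this[OF order_refl] obtain P \<phi> where P: "good P" "arr R \<phi> P W" "\<And>k. 1 <= k ==> k <= p ==> is_epi A (en P k) (en W k) (cm \<phi> k)" by blast
  have "is_epi R P W \<phi>" by (rule R_epiI[OF P(2,3)])
  then show ?thesis using P(1) arrD(1)[OF P(2)] by blast
qed

lemma B_abcat: "abcat B plsA ngA"
proof -
  interpret B: abelian_category B by (rule B_ab)
  show ?thesis
  proof
    fix f g h
    show "f ;;\<^bsub>B\<^esub> g ;;\<^bsub>B\<^esub> h = f ;;\<^bsub>B\<^esub> (g ;;\<^bsub>B\<^esub> h)" by (simp add: A.assoc)
    show "f \<boxplus> g \<boxplus> h = f \<boxplus> (g \<boxplus> h)" by (rule A.pls_assoc)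
    show "f \<boxplus> g = g \<boxplus> f" by (rule A.pls_comm)
    show "(f \<boxplus> g) ;;\<^bsub>B\<^esub> h = f ;;\<^bsub>B\<^esub> h \<boxplus> g ;;\<^bsub>B\<^esub> h" by (simp add: A.distl)
    show "f ;;\<^bsub>B\<^esub> (g \<boxplus> h) = f ;;\<^bsub>B\<^esub> g \<boxplus> f ;;\<^bsub>B\<^esub> h" by (simp add: A.distr)
    show "ngA f ;;\<^bsub>B\<^esub> g = ngA (f ;;\<^bsub>B\<^esub> g)" by (simp add: A.ngl)
    show "f ;;\<^bsub>B\<^esub> ngA g = ngA (f ;;\<^bsub>B\<^esub> g)" by (simp add: A.ngr)
  next
    fix f g X Y assume f: "arr B f X Y"
    show "f \<boxplus> zero_mor B X Y = f" using f by (simp add: B_zero_mor B_arr)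
    show "f \<boxplus> ngA f = zero_mor B X Y" using f A.pls_ng by (simp add: B_zero_mor B_arr)
    show "arr B (ngA f) X Y" using f by (auto simp: B_arr)
    assume g: "arr B g X Y"
    show "arr B (f \<boxplus> g) X Y" using f g by (auto simp: B_arr)
  qed
qed

end

sublocale root_ctx \<subseteq> B: abcat "ker_cat A Fo \<eta>" plsA ngA
  by (rule B_abcat)

context root_ctx begin

text \<open>A_eta is closed under subobjects and quotients in \<open>A\<close>, so kernels and
  cokernels formed in \<open>A\<close> can be tested inside it. This makes the inclusion
  exact.\<close>

lemma B_sesD:
  assumes s: "short_exact B X f Y g Z" and Y: "Y \<in> Ob B"
  shows "short_exact A X f Y g Z"
proof -
  note d = B.sesD[OF s Y]
  have f: "ar f X Y" and g: "ar g Y Z" and O: "X \<in> Ob B" "Z \<in> Ob B" using d(1,2) by (auto simp: B_arr)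
  have OA: "X \<in> Ob A" "Y \<in> Ob A" "Z \<in> Ob A" using O Y by (auto simp: B_Ob)
  have f0: "f ;; g = zr X Z" using d(7) by (simp add: B_zero_mor[OF O])
  have epi: "is_epi A Y Z g"
  proof (rule A.epiI[OF g])
    fix W h assume h: "ar h Z W" "g ;; h = zr Y W"
    obtain Q c where c: "is_cokernel A Y Z g Q c" "is_epi A Z Q c" "ar c Z Q" "g ;; c = zr Y Q" using A.obtain_cokernel[OF g] .
    have Q: "Q \<in> Ob B" by (rule B_quot[OF c(2,3) O(2)])
    have "c = zero_mor B Z Q"
      by (rule B.epiD0[OF d(6) Y]) (use c(3,4) Q O(2) Y in \<open>simp_all add: B_arr B_zero_mor\<close>)
    then have c0: "c = zr Z Q" using O(2) Q by (simp add: B_zero_mor)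
    obtain u where "ar u Q W" "c ;; u = h" using A.cokernelD(3)[OF c(1) OA(3) h] by blast
    then show "h = zr Z W" using c0 OA by simp
  qed
  have mono: "is_mono A X Y f"
  proof (rule A.monoI[OF f])
    fix W h assume h: "ar h W X" "h ;; f = zr W Y"
    obtain Q c where c: "is_kernel A X Y f Q c" "is_mono A Q X c" "ar c Q X" "c ;; f = zr Q Y" using A.obtain_kernel[OF f] .
    have Q: "Q \<in> Ob B" by (rule B_sub[OF c(2,3) O(1)])
    have "c = zero_mor B Q X"
      by (rule B.monoD0[OF d(5) Y]) (use c(3,4) Q O(1) Y in \<open>simp_all add: B_arr B_zero_mor\<close>)
    then have c0: "c = zr Q X" using O(1) Q by (simp add: B_zero_mor)
    obtain u where "ar u W Q" "u ;; c = h" using A.kernelD(3)[OF c(1) OA(1) h] by blast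
    then show "h = zr W X" using c0 OA by simp
  qed
  have "is_kernel A Y Z g X f"
  proof (rule A.kernelI[OF g f f0 _ mono])
    fix W h assume h: "ar h W Y" "h ;; g = zr W Z"
    obtain Q c where c: "is_kernel A Y Z g Q c" "is_mono A Q Y c" "ar c Q Y" "c ;; g = zr Q Z" using A.obtain_kernel[OF g] .
    have Q: "Q \<in> Ob B" by (rule B_sub[OF c(2,3) Y])
    obtain v where v: "arr B v Q X" "v ;;\<^bsub>B\<^esub> f = c"
      using B.kernelD(3)[OF d(3) Y, of c Q] c(3,4) Q Y O(2) by (auto simp: B_arr B_zero_mor)
    obtain u where u: "ar u W Q" "u ;; c = h" using A.kernelD(3)[OF c(1) OA(2) h] by blast
    have "u ;; v ;; f = h" using u(2) v(2) by (simp add: A.assoc)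
    moreover have "ar (u ;; v) W X" using u(1) v(1) by (auto simp: B_arr)
    ultimately show "\<exists>u. ar u W X \<and> u ;; f = h" by blast
  qed
  then show ?thesis using A.ses_iff[OF g] epi by blast
qed

end

section \<open>The interval functors J_j and their left adjoints\<close>

locale root_interval = root_ctx +
  fixes z :: 'a and j :: nat
  assumes z: "is_zero_obj A z" and j: "1 <= j" "j < p"
begin

definition jen where "jen M i = (if i = 0 then Fo z else if i <= j then M else z)"
definition jst where "jst M i = (if 1 <= i \<and> i < j then idt M else zr (jen M i) (jen M (Suc i)))"
text \<open>Literally \<open>iota\<close> of an interval sequence, so that the summands of iota
  delta(T) are values of this functor on the nose. Calculations use the form in
  \<open>Jo_mko\<close>.\<close>

definition Jo where "Jo M = iota A Fo p z (interval_seq B (p - 1) z M j)"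
definition Jm where "Jm f = mkm (\<lambda>i. if i <= j then f else idt z)"

lemma zO: "z \<in> Ob A" "z \<in> Ob B"
  using z B_zero_obj[OF z] by (auto simp: is_zero_obj_def)

lemma Jo_mko: assumes M: "M \<in> Ob B" shows "Jo M = mko (jen M) (jst M)"
proof -
  have 1: "fst (Jo M) = fst (mko (jen M) (jst M))"
    using j by (auto simp: Jo_def iota_def interval_seq_def mko_def jen_def fun_eq_iff)
  have "snd (Jo M) i = snd (mko (jen M) (jst M)) i" for i
  proof (cases "i \<in> {1..p}")
    case True
    then obtain k where k: "i = Suc k" "k < p" by (cases i) auto
    have mB: "zero_mor B (if k <= j then M else z) z = zr (if k <= j then M else z) z" using M zO by (auto simp: B_zero_mor)
    consider "k = 0" | "0 < k" "Suc k < p" | "0 < k" "Suc k = p" using k by linarith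
    then show ?thesis
    proof cases
      case 1
      moreover have "Suc 0 <= p - Suc 0" using j by simp
      ultimately show ?thesis using k j by (simp add: Jo_def iota_def interval_seq_def mko_def jst_def jen_def)
    next
      case 2
      then have "k \<in> {1..p - Suc 0}" "Suc k \<in> {2..p - Suc 0}" by auto
      then show ?thesis using 2 k j mB by (auto simp: Jo_def iota_def interval_seq_def mko_def jst_def jen_def)
    next
      case 3
      then show ?thesis using k j by (auto simp: Jo_def iota_def interval_seq_def mko_def jst_def jen_def)
    qed
  next
    case False
    have "snd (Jo M) = restrict (snd (Jo M)) {1..p}" by (simp add: Jo_def iota_def interval_seq_def)
    then have "snd (Jo M) i = undefined" using False by (metis restrict_apply)
    moreover have "snd (mko (jen M) (jst M)) i = undefined" using False by (auto simp: mko_def)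
    ultimately show ?thesis by simp
  qed
  then have "snd (Jo M) = snd (mko (jen M) (jst M))" by (simp add: fun_eq_iff)
  then show ?thesis using 1 prod_eqI by blast
qed

lemma jen_dia: assumes M: "M \<in> Ob B" shows "dia (jen M) (jst M)"
  using M zO j p1 by (auto simp: dia_def jen_def jst_def B_Ob A.arr_ident)

lemma jen_pth: assumes M: "M \<in> Ob B" and i: "1 <= i"
  shows "i + n <= j ==> pth (jen M) (jst M) i n = idt M"
proof (induction n)
  case 0 then show ?case using i by (simp add: jen_def)
next
  case (Suc n)
  then show ?case using i A.id_left[OF A.arr_ident, of M] M by (simp add: jst_def B_Ob)
qed

text \<open>Each composite in the root condition passes through \<open>Fo z\<close>, a zero object,
  and \<open>\<eta>\<close> vanishes on the entries because they lie in A_eta.\<close>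

lemma Jo_Ob: assumes M: "M \<in> Ob B" shows "Jo M \<in> Ob R"
  unfolding Jo_mko[OF M]
proof (rule R_mkoI[OF jen_dia[OF M]])
  note d = jen_dia[OF M]
  show "etac (jen M) (jst M)" unfolding etac_def
  proof (intro allI impI)
    fix i assume i: "1 <= i" "i <= p"
    have e: "jen M p = z" "jen M 0 = Fo z" using j by (auto simp: jen_def)
    have MO: "jen M i \<in> Ob A" using M zO i by (auto simp: jen_def B_Ob)
    have a: "ar (Fm (pth (jen M) (jst M) i (p - i))) (Fo (jen M i)) (Fo z)"
      using F_arr[OF pth_arr[OF d, of i "p - i"]] i e by simp
    have b: "ar (pth (jen M) (jst M) 0 i) (Fo z) (jen M i)" using pth_arr[OF d, of 0 i] i e by simp
    have "Fm (pth (jen M) (jst M) i (p - i)) ;; pth (jen M) (jst M) 0 i = zr (Fo (jen M i)) (jen M i)"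
      unfolding A.to_zero[OF F_zero_obj[OF z] a] by (rule A.zr_left[OF b F_Ob[OF MO]])
    moreover have "\<eta> (jen M i) = zr (Fo (jen M i)) (jen M i)"
      using M zO i by (auto simp: jen_def B_Ob)
    ultimately show "Fm (pth (jen M) (jst M) i (p - i)) ;; pth (jen M) (jst M) 0 i = \<eta> (jen M i)" by simp
  qed
qed

lemma Jo_en: assumes M: "M \<in> Ob B" "i <= p" shows "en (Jo M) i = jen M i"
  unfolding Jo_mko[OF M(1)] using j M(2) by (intro en_mko) (auto simp: jen_def)

lemma Jo_st: assumes M: "M \<in> Ob B" "i < p" shows "st (Jo M) i = jst M i"
  unfolding Jo_mko[OF M(1)] using M(2) by (rule st_mko)

lemma Jm_arr: assumes f: "arr B f X Y" shows "arr R (Jm f) (Jo X) (Jo Y)"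
proof -
  have O: "X \<in> Ob B" "Y \<in> Ob B" and fa: "ar f X Y" using f by (auto simp: B_arr)
  have OA: "X \<in> Ob A" "Y \<in> Ob A" using O by (auto simp: B_Ob)
  let ?c = "\<lambda>i. if i = 0 then idt (Fo z) else if i <= j then f else idt z"
  have e: "Jm f = mkm ?c" by (auto simp: Jm_def mkm_def fun_eq_iff)
  have a: "ar (?c i) (jen X i) (jen Y i)" if "i <= p" for i
    using fa zO by (auto simp: jen_def A.arr_ident)
  show ?thesis unfolding e
  proof (rule R_mkmI[OF Jo_Ob[OF O(1)] Jo_Ob[OF O(2)]])
    show "diam (en (Jo X)) (st (Jo X)) (en (Jo Y)) (st (Jo Y)) ?c"
      unfolding diam_def
    proof (intro conjI allI impI)
      fix i assume "i <= p" then show "ar (?c i) (en (Jo X) i) (en (Jo Y) i)" using a O by (simp add: Jo_en)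
    next
      show "?c 0 = Fm (?c p)" using j zO by (simp add: F_ident)
    next
      fix i assume i: "i < p"
      show "st (Jo X) i ;; ?c (Suc i) = ?c i ;; st (Jo Y) i"
      proof (cases "1 <= i \<and> i < j")
        case True
        then show ?thesis using i O A.id_left[OF fa] A.id_right[OF fa] by (simp add: Jo_st jst_def)
      next
        case False
        have JX: "jen X i \<in> Ob A" "jen Y (Suc i) \<in> Ob A" using OA zO by (auto simp: jen_def)
        have st: "st (Jo X) i = zr (jen X i) (jen X (Suc i))" "st (Jo Y) i = zr (jen Y i) (jen Y (Suc i))"
          using False i O by (auto simp: Jo_st jst_def)
        show ?thesis unfolding st using A.zr_right[OF a[of i] JX(2)] A.zr_left[OF a[of "Suc i"] JX(1)] i by simp
      qed
    qed
  qed
qed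

lemma Jm_cm: "1 <= i ==> i <= p ==> cm (Jm f) i = (if i <= j then f else idt z)"
  by (simp add: cm_pos Jm_def mkm_def)

lemma J_exact: "is_exact_functor B R Jo Jm"
  unfolding is_exact_functor_def is_functor_def
proof (intro conjI ballI impI)
  fix X assume X: "X \<in> Ob B"
  show "Jo X \<in> Ob R" by (rule Jo_Ob[OF X])
  show "Jm (ident B X) = ident R (Jo X)" using X by (auto simp: Jm_def R_id mkm_def fun_eq_iff Jo_en jen_def)
next
  fix X Y f assume "X \<in> Ob B" "Y \<in> Ob B" "f \<in> Hom B X Y"
  then have "arr B f X Y" by (simp add: arr_def)
  from Jm_arr[OF this] show "Jm f \<in> Hom R (Jo X) (Jo Y)" by (simp add: arr_def)
next
  fix X Y Z f g
  show "Jm (f ;;\<^bsub>B\<^esub> g) = Jm f ;;\<^sub>R Jm g"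
    using A.id_left[OF A.arr_ident[OF zO(1)]] by (auto simp: Jm_def R_cmp mkm_def fun_eq_iff)
next
  fix X Y Z f g assume O: "X \<in> Ob B" "Y \<in> Ob B" "Z \<in> Ob B" "f \<in> Hom B X Y" "g \<in> Hom B Y Z" and s: "short_exact B X f Y g Z"
  then have f: "arr B f X Y" and g: "arr B g Y Z" by (auto simp: arr_def)
  have zz: "short_exact A z (idt z) z (idt z) z" using A.zero_ses[OF z zO(1)] z A.zero_obj_iff by simp
  show "short_exact R (Jo X) (Jm f) (Jo Y) (Jm g) (Jo Z)"
    by (rule R_sesI[OF Jm_arr[OF f] Jm_arr[OF g]]) (use B_sesD[OF s O(2)] zz O in \<open>auto simp: Jm_cm Jo_en jen_def\<close>)
qed

text \<open>A relation instead of a function, as the cokernel is determined only up to isomorphism.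
  The map \<open>e\<close> is the unit: entries up to \<open>j\<close> go along the structure maps
  to entry \<open>j\<close> and then to the cokernel.\<close>

definition Rj where
  "Rj N N' e <-> (\<exists>c. is_cokernel A (Fo (en N p)) (en N j) (pth (en N) (st N) 0 j) N' c \<and>
     e = mkm (\<lambda>i. if i <= j then pth (en N) (st N) i (j - i) ;; c else zr (en N i) z))"

lemma pth_0_arr: "N \<in> Ob R ==> i <= p ==> ar (pth (en N) (st N) 0 i) (Fo (en N p)) (en N i)"
  using pth_arr[OF R_ObD(1), of N 0 i] en_0[of N] by simp

lemma RjD:
  assumes N: "N \<in> Ob R" and r: "Rj N N' e"
  obtains c where "is_cokernel A (Fo (en N p)) (en N j) (pth (en N) (st N) 0 j) N' c" "ar c (en N j) N'"
    "is_epi A (en N j) N' c" "N' \<in> Ob B" "N' \<in> Ob A" "arr R e N (Jo N')"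
    "\<And>i. 1 <= i ==> i <= j ==> cm e i = pth (en N) (st N) i (j - i) ;; c" "cm e j = c"
proof -
  note d = R_ObD[OF N]
  have jp: "j <= p" using j by simp
  obtain c where c: "is_cokernel A (Fo (en N p)) (en N j) (pth (en N) (st N) 0 j) N' c" and
    e: "e = mkm (\<lambda>i. if i <= j then pth (en N) (st N) i (j - i) ;; c else zr (en N i) z)" using r by (auto simp: Rj_def)
  have ca: "ar c (en N j) N'" "pth (en N) (st N) 0 j ;; c = zr (Fo (en N p)) N'"
    using A.cokernelD(1,2)[OF c d(3)[OF jp]] by auto
  have ce: "is_epi A (en N j) N' c" by (rule A.cokernel_epi[OF c pth_0_arr[OF N jp]])
  have NO: "N' \<in> Ob A" using ca by (simp add: arr_def)
  have pj: "ar (pth (en N) (st N) j (p - j)) (en N j) (en N p)" using pth_arr[OF d(1), of j "p - j"] jp by simp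
  \<comment> \<open>The cokernel lies in A_eta: by the root condition \<open>\<eta>\<close> at entry
    \<open>j\<close> passes through F N_p -> N_j, which \<open>c\<close> kills. Cancelling the
    epimorphism \<open>Fm c\<close> leaves \<open>\<eta> N'\<close> equal to zero.\<close>
  have "Fm c ;; \<eta> N' = \<eta> (en N j) ;; c" by (rule eta_nat[OF ca(1)])
  also have "\<dots> = Fm (pth (en N) (st N) j (p - j)) ;; (pth (en N) (st N) 0 j ;; c)"
    using d(2) j by (simp add: etac_def A.assoc[symmetric])
  also have "\<dots> = zr (Fo (en N j)) N'" unfolding ca(2) by (rule A.zr_right[OF F_arr[OF pj] NO])
  finally have "\<eta> N' = zr (Fo N') N'"
    by (rule A.epiD0[OF F_epi[OF ce ca(1)] F_Ob[OF d(3)[OF jp]] eta_arr[OF NO]])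
  then have NB: "N' \<in> Ob B" using NO by (simp add: B_Ob)
  let ?c = "\<lambda>i. if i = 0 then zr (Fo (en N p)) (Fo z) else if i <= j then pth (en N) (st N) i (j - i) ;; c else zr (en N i) z"
  have e': "e = mkm ?c" using e by (auto simp: mkm_def fun_eq_iff)
  have a: "ar (?c i) (en N i) (jen N' i)" if i: "i <= p" for i
  proof -
    have "ar (pth (en N) (st N) i (j - i) ;; c) (en N i) N'" if "i <= j" using pth_arr[OF d(1), of i "j - i"] ca(1) that jp by auto
    then show ?thesis using i zO d(3)[OF i] d(3)[OF order_refl] en_0[of N] by (auto simp: jen_def)
  qed
  have "arr R e N (Jo N')" unfolding e'
  proof (rule R_mkmI[OF N Jo_Ob[OF NB]])
    show "diam (en N) (st N) (en (Jo N')) (st (Jo N')) ?c"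
      unfolding diam_def
    proof (intro conjI allI impI)
      fix i assume "i <= p" then show "ar (?c i) (en N i) (en (Jo N') i)" using a NB by (simp add: Jo_en)
    next
      show "?c 0 = Fm (?c p)" using j zO d(3)[OF order_refl] by (simp add: F_zr)
    next
      fix i assume i: "i < p"
      have O: "en N i \<in> Ob A" "jen N' (Suc i) \<in> Ob A" using d(3)[of i] i NO zO by (auto simp: jen_def)
      have zri: "?c i ;; zr (jen N' i) (jen N' (Suc i)) = zr (en N i) (jen N' (Suc i))"
        using A.zr_right[OF a O(2)] i by simp
      have suc: "st N i ;; pth (en N) (st N) (Suc i) (j - Suc i) = pth (en N) (st N) i (j - i)" if "i < j"
        using pth_Suc_left[OF d(1), of i "j - Suc i"] that jp by (simp add: Suc_diff_Suc)
      consider "i = 0" | "1 <= i" "i < j" | "j <= i" by linarith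
      then show "st N i ;; ?c (Suc i) = ?c i ;; st (Jo N') i"
      proof cases
        case 1
        have "st N i ;; ?c (Suc i) = pth (en N) (st N) 0 j ;; c" using 1 j suc by (simp add: A.assoc[symmetric])
        also have "\<dots> = zr (en N i) (jen N' (Suc i))" using ca(2) 1 j en_0[of N] by (simp add: jen_def)
        also have "\<dots> = ?c i ;; st (Jo N') i" using zri 1 i NB by (simp add: Jo_st jst_def)
        finally show ?thesis .
      next
        case 2
        have "ar (pth (en N) (st N) i (j - i) ;; c) (en N i) N'" using a[of i] 2 i by (simp add: jen_def)
        then show ?thesis using 2 i NB suc by (simp add: Jo_st jst_def A.assoc[symmetric])
      next
        case 3
        have "st N i ;; ?c (Suc i) = zr (en N i) (jen N' (Suc i))"
          using 3 j A.zr_right[OF d(4)[OF i] zO(1)] by (simp add: jen_def)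
        also have "\<dots> = ?c i ;; st (Jo N') i" using zri 3 i NB by (simp add: Jo_st jst_def)
        finally show ?thesis .
      qed
    qed
  qed
  moreover have "cm e i = pth (en N) (st N) i (j - i) ;; c" if "1 <= i" "i <= j" for i
    using that jp by (simp add: e cm_pos mkm_def)
  moreover have "cm e j = c" using ca(1) j by (simp add: e cm_pos mkm_def)
  ultimately show ?thesis using that[OF c ca(1) ce NB NO] by blast
qed

lemma Rj_lift:
  assumes W: "W \<in> Ob R" and r: "Rj W W' \<epsilon>" and Y: "Y \<in> Ob B" and h: "arr R h W (Jo Y)"
  shows "\<exists>f'. arr B f' W' Y \<and> \<epsilon> ;;\<^sub>R Jm f' = h"
proof -
  obtain c where c: "is_cokernel A (Fo (en W p)) (en W j) (pth (en W) (st W) 0 j) W' c" "ar c (en W j) W'"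
    "is_epi A (en W j) W' c" "W' \<in> Ob B" "W' \<in> Ob A" "arr R \<epsilon> W (Jo W')"
    "\<And>i. 1 <= i ==> i <= j ==> cm \<epsilon> i = pth (en W) (st W) i (j - i) ;; c" "cm \<epsilon> j = c"
    by (rule RjD[OF W r]) (rule that, assumption+)
  note d = R_ObD[OF W] and dY = R_ObD[OF Jo_Ob[OF Y]] and hD = R_arrD[OF h]
  have jp: "j <= p" using j by simp
  have hj: "ar (cm h j) (en W j) Y" using hD(4)[OF jp] Y j by (simp add: Jo_en jen_def)
  have h0: "ar (cm h 0) (en W 0) (Fo z)" using hD(4)[of 0] Y by (simp add: Jo_en jen_def)
  have pJ: "ar (pth (en (Jo Y)) (st (Jo Y)) 0 j) (Fo z) Y"
    using pth_arr[OF dY(1), of 0 j] jp j Y by (simp add: Jo_en jen_def)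
  \<comment> \<open>Entry 0 of the target is \<open>Fo z\<close>, so component 0 of \<open>h\<close>
    is zero and component \<open>j\<close> kills F W_p. This is what lets it factor through the
    cokernel.\<close>
  have "pth (en W) (st W) 0 j ;; cm h j = cm h 0 ;; pth (en (Jo Y)) (st (Jo Y)) 0 j"
    using pth_nat[OF d(1) dY(1) hD(3), of 0 j] jp by simp
  also have "\<dots> = zr (Fo (en W p)) Y"
    unfolding A.to_zero[OF F_zero_obj[OF z] h0] using A.zr_left[OF pJ d(3)[of 0]] en_0[of W] by simp
  finally obtain f' where f': "ar f' W' Y" "c ;; f' = cm h j" using A.cokernelD(3)[OF c(1) d(3)[OF jp] hj] by blast
  have fB: "arr B f' W' Y" using f' c(4) Y by (simp add: B_arr)
  have "\<epsilon> ;;\<^sub>R Jm f' = h"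
  proof (rule R_arr_eqI[OF R.arr_cmp[OF c(6) Jm_arr[OF fB]] h])
    fix i assume i: "1 <= i" "i <= p"
    show "cm (\<epsilon> ;;\<^sub>R Jm f') i = cm h i"
    proof (cases "i <= j")
      case True
      have "pth (en W) (st W) i (j - i) ;; cm h j = cm h i ;; pth (en (Jo Y)) (st (Jo Y)) i (j - i)"
        using pth_nat[OF d(1) dY(1) hD(3), of i "j - i"] jp True by simp
      also have "pth (en (Jo Y)) (st (Jo Y)) i (j - i) = pth (jen Y) (jst Y) i (j - i)"
        using jp True Y by (intro pth_cong) (auto simp: Jo_en Jo_st)
      also have "\<dots> = idt Y" using jen_pth[OF Y i(1), of "j - i"] True by simp
      finally have "pth (en W) (st W) i (j - i) ;; cm h j = cm h i"
        using hD(4)[OF i(2)] i True Y by (simp add: Jo_en jen_def)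
      then show ?thesis
        using cm_cmp[OF c(6) Jm_arr[OF fB] i(2)] c(7)[OF i(1) True] Jm_cm[OF i, of f'] True f'(2) by (simp add: A.assoc)
    next
      case False
      have "en (Jo Y) i = z" using False i Y by (simp add: Jo_en jen_def)
      then show ?thesis
        using A.zero_objD(2)[OF z] R_arrD(4)[OF R.arr_cmp[OF c(6) Jm_arr[OF fB]] i(2)] hD(4)[OF i(2)] by simp
    qed
  qed
  then show ?thesis using fB by blast
qed

lemma Rj_uniq:
  assumes W: "W \<in> Ob R" and r: "Rj W W' \<epsilon>" and f: "arr B f W' Y" "arr B g W' Y" and e: "\<epsilon> ;;\<^sub>R Jm f = \<epsilon> ;;\<^sub>R Jm g"
  shows "f = g"
proof -
  obtain c where c: "ar c (en W j) W'" "is_epi A (en W j) W' c" "arr R \<epsilon> W (Jo W')" "cm \<epsilon> j = c"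
    by (rule RjD[OF W r]) (rule that, assumption+)
  have jp: "j <= p" using j by simp
  have k: "cm (\<epsilon> ;;\<^sub>R Jm h) j = c ;; h" if "arr B h W' Y" for h
    using cm_cmp[OF c(3) Jm_arr[OF that] jp] c(4) Jm_cm[OF j(1) jp, of h] by simp
  have "c ;; f = cm (\<epsilon> ;;\<^sub>R Jm f) j" by (rule k[OF f(1), symmetric])
  also have "\<dots> = cm (\<epsilon> ;;\<^sub>R Jm g) j" by (simp only: e)
  also have "\<dots> = c ;; g" by (rule k[OF f(2)])
  finally have "c ;; f = c ;; g" .
  moreover have "ar f W' Y" "ar g W' Y" using f by (simp_all add: B_arr)
  ultimately show ?thesis using A.epiD[OF c(2)] by blast
qed

text \<open>An instance of \<open>cokernel_ses\<close>, whose first row is entry 0 and whose second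
  row is entry \<open>j\<close>. The monomorphisms it requires come from goodness through
  \<open>good_mono\<close>.\<close>

lemma Rj_ses:
  assumes s: "short_exact R N m P e W" and P: "P \<in> Ob R" and g: "good P" "good W" and r: "Rj N N' \<epsilon>N" "Rj P P' \<epsilon>P" "Rj W W' \<epsilon>W"
    and m': "arr B m' N' P'" and e': "arr B e' P' W'" and mm: "m ;;\<^sub>R \<epsilon>P = \<epsilon>N ;;\<^sub>R Jm m'" and ee: "e ;;\<^sub>R \<epsilon>W = \<epsilon>P ;;\<^sub>R Jm e'"
  shows "short_exact B N' m' P' e' W'"
proof -
  note d = R.sesD[OF s P]
  have O: "N \<in> Ob R" "W \<in> Ob R" using d(1,2) by (simp_all add: arr_def)
  have jp: "j <= p" using j by simp
  obtain cN where cN: "is_cokernel A (Fo (en N p)) (en N j) (pth (en N) (st N) 0 j) N' cN" "arr R \<epsilon>N N (Jo N')" "cm \<epsilon>N j = cN" "N' \<in> Ob B"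
    by (rule RjD[OF O(1) r(1)]) (rule that, assumption+)
  obtain cP where cP: "is_cokernel A (Fo (en P p)) (en P j) (pth (en P) (st P) 0 j) P' cP" "arr R \<epsilon>P P (Jo P')" "cm \<epsilon>P j = cP" "P' \<in> Ob B"
    by (rule RjD[OF P r(2)]) (rule that, assumption+)
  obtain cW where cW: "is_cokernel A (Fo (en W p)) (en W j) (pth (en W) (st W) 0 j) W' cW" "arr R \<epsilon>W W (Jo W')" "cm \<epsilon>W j = cW" "W' \<in> Ob B"
    by (rule RjD[OF O(2) r(3)]) (rule that, assumption+)
  have em: "cm m j ;; cP = cN ;; m'"
    using arg_cong[OF mm, of "\<lambda>x. cm x j"] cm_cmp[OF d(1) cP(2) jp] cm_cmp[OF cN(2) Jm_arr[OF m'] jp] cP(3) cN(3) Jm_cm[OF j(1) jp, of m']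
    by simp
  have eW: "cm e j ;; cW = cP ;; e'"
    using arg_cong[OF ee, of "\<lambda>x. cm x j"] cm_cmp[OF d(2) cW(2) jp] cm_cmp[OF cP(2) Jm_arr[OF e'] jp] cW(3) cP(3) Jm_cm[OF j(1) jp, of e']
    by simp
  \<comment> \<open>Exactness of \<open>F\<close> enters here: entry 0 of a short exact sequence of
    roots is \<open>F\<close> of its last entry.\<close>
  have s0: "short_exact A (Fo (en N p)) (cm m 0) (Fo (en P p)) (cm e 0) (Fo (en W p))" using R_sesD[OF s P, of 0] en_0 by simp
  have n1: "cm m 0 ;; pth (en P) (st P) 0 j = pth (en N) (st N) 0 j ;; cm m j"
    using pth_nat[OF R_ObD(1)[OF O(1)] R_ObD(1)[OF P] R_arrD(3)[OF d(1)], of 0 j] jp by simp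
  have n2: "cm e 0 ;; pth (en W) (st W) 0 j = pth (en P) (st P) 0 j ;; cm e j"
    using pth_nat[OF R_ObD(1)[OF P] R_ObD(1)[OF O(2)] R_arrD(3)[OF d(2)], of 0 j] jp by simp
  have ma: "ar m' N' P'" "ar e' P' W'" using m' e' by (auto simp: B_arr)
  have "short_exact A N' m' P' e' W'"
    by (rule A.cokernel_ses[OF s0 F_Ob[OF R_ObD(3)[OF P order_refl]] R_sesD[OF s P jp] R_ObD(3)[OF P jp]
          pth_0_arr[OF O(1) jp] pth_0_arr[OF P jp] pth_0_arr[OF O(2) jp] n1 n2 good_mono[OF P g(1) jp] good_mono[OF O(2) g(2) jp]
          cN(1) cP(1) cW(1) ma em eW])
  then show ?thesis by (rule B_sesI[OF _ cN(4) cP(4) cW(4)])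
qed

theorem reflective_interval: "reflective_vanishing R plsR ngR B plsA ngA Jo Jm good Rj"
proof (intro reflective_vanishing.intro reflective_vanishing_axioms.intro)
  show "abcat R plsR ngR" by (rule R_abcat)
  show "abcat B plsA ngA" by (rule B_abcat)
  show "is_exact_functor B R Jo Jm" by (rule J_exact)
  show "good N" if "good P" "N \<in> Ob R" "P \<in> Ob R" "is_mono R N P m" for P N m
    using good_sub[OF that(1,4) R.mono_arr[OF that(4,2,3)]] .
  show "\<exists>P e. P \<in> Ob R \<and> good P \<and> is_epi R P W e" if "W \<in> Ob R" for W by (rule good_cover[OF that])
  show "\<exists>W' \<epsilon>. Rj W W' \<epsilon>" if W: "W \<in> Ob R" "good W" for W
  proof -
    obtain Q q where "is_cokernel A (Fo (en W p)) (en W j) (pth (en W) (st W) 0 j) Q q"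
      using A.obtain_cokernel[OF pth_0_arr[OF W(1) less_imp_le[OF j(2)]]] by blast
    then show ?thesis unfolding Rj_def by blast
  qed
  show "W' \<in> Ob B \<and> arr R \<epsilon> W (Jo W')" if W: "W \<in> Ob R" "Rj W W' \<epsilon>" for W W' \<epsilon>
    by (rule RjD[OF W]) (rule conjI)
qed ((rule Rj_lift; assumption), (rule Rj_uniq; assumption), (rule Rj_ses; assumption))

end

section \<open>Sequences in A_eta and the summands of iota delta\<close>

context root_ctx begin

abbreviation S where "S \<equiv> seq_cat B (p - 1)"
abbreviation Scmp (infixl ";;\<^sub>S" 70) where "f ;;\<^sub>S g \<equiv> cmp S f g"

lemma S_Ob: "X \<in> Ob S <-> fst X \<in> {1..p - 1} \<rightarrow>\<^sub>E Ob B \<and> snd X \<in> (\<Pi>\<^sub>E i\<in>{2..p - 1}. Hom A (fst X (i - 1)) (fst X i))"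
  by (simp add: seq_cat_def split_beta)

lemma S_Hom: "Hom S X Y = {\<phi> \<in> (\<Pi>\<^sub>E i\<in>{1..p - 1}. Hom A (fst X i) (fst Y i)).
    \<forall>i\<in>{2..p - 1}. snd X i ;; \<phi> i = \<phi> (i - 1) ;; snd Y i}"
  by (simp add: seq_cat_def split_beta)

lemma S_cmp: "\<phi> ;;\<^bsub>seq_cat B q\<^esub> \<psi> = (\<lambda>i\<in>{1..q}. \<phi> i ;; \<psi> i)"
  by (simp add: seq_cat_def)

lemma S_id: "ident (seq_cat B q) X = (\<lambda>i\<in>{1..q}. idt (fst X i))"
  by (simp add: seq_cat_def split_beta)

lemma S_ObD:
  assumes "X \<in> Ob S"
  shows "1 <= i ==> i < p ==> fst X i \<in> Ob B" "1 <= i ==> i < p ==> fst X i \<in> Ob A"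
    "1 <= i ==> Suc i < p ==> ar (snd X (Suc i)) (fst X i) (fst X (Suc i))"
proof -
  show 1: "fst X i \<in> Ob B" if "1 <= i" "i < p" for i using assms that unfolding S_Ob PiE_def Pi_def by auto
  then show 2: "fst X i \<in> Ob A" if "1 <= i" "i < p" for i using that by (simp add: B_Ob)
  show "ar (snd X (Suc i)) (fst X i) (fst X (Suc i))" if i: "1 <= i" "Suc i < p"
  proof -
    have "Suc i \<in> {2..p - 1}" using i by auto
    then have "snd X (Suc i) \<in> Hom A (fst X (Suc i - 1)) (fst X (Suc i))" using assms unfolding S_Ob PiE_def Pi_def by blast
    then show ?thesis using 2[of i] 2[of "Suc i"] i by (simp add: arr_def)
  qed
qed

lemma S_arrD:
  assumes "arr S \<phi> X Y"
  shows "X \<in> Ob S" "Y \<in> Ob S" "\<phi> \<in> extensional {1..p - 1}" "1 <= i ==> i < p ==> ar (\<phi> i) (fst X i) (fst Y i)"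
    "1 <= i ==> Suc i < p ==> snd X (Suc i) ;; \<phi> (Suc i) = \<phi> i ;; snd Y (Suc i)"
proof -
  show O: "X \<in> Ob S" "Y \<in> Ob S" using assms by (simp_all add: arr_def)
  have h: "\<phi> \<in> (\<Pi>\<^sub>E i\<in>{1..p - 1}. Hom A (fst X i) (fst Y i))" "\<forall>i\<in>{2..p - 1}. snd X i ;; \<phi> i = \<phi> (i - 1) ;; snd Y i"
    using assms unfolding arr_def S_Hom by blast+
  then show "\<phi> \<in> extensional {1..p - 1}" by (simp add: PiE_def)
  show "ar (\<phi> i) (fst X i) (fst Y i)" if "1 <= i" "i < p"
    using h(1) that S_ObD(2)[OF O(1) that] S_ObD(2)[OF O(2) that] unfolding PiE_def Pi_def arr_def by auto
  show "snd X (Suc i) ;; \<phi> (Suc i) = \<phi> i ;; snd Y (Suc i)" if "1 <= i" "Suc i < p"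
    using bspec[OF h(2), of "Suc i"] that by simp
qed

lemma S_arrI:
  assumes "X \<in> Ob S" "Y \<in> Ob S" "\<phi> \<in> extensional {1..p - 1}" "\<And>i. 1 <= i ==> i < p ==> ar (\<phi> i) (fst X i) (fst Y i)"
    "\<And>i. 1 <= i ==> Suc i < p ==> snd X (Suc i) ;; \<phi> (Suc i) = \<phi> i ;; snd Y (Suc i)"
  shows "arr S \<phi> X Y"
proof -
  have "\<phi> \<in> (\<Pi>\<^sub>E i\<in>{1..p - 1}. Hom A (fst X i) (fst Y i))" using assms(3,4) by (auto simp: PiE_def arr_def)
  moreover have "snd X i ;; \<phi> i = \<phi> (i - 1) ;; snd Y i" if "i \<in> {2..p - 1}" for i
    using assms(5)[of "i - 1"] that by (cases i) auto
  ultimately show ?thesis using assms(1,2) unfolding arr_def S_Hom by blast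
qed

lemma S_arr_cmp: assumes f: "arr S f X Y" and g: "arr S g Y Z" shows "arr S (f ;;\<^sub>S g) X Z"
proof (rule S_arrI[OF S_arrD(1)[OF f] S_arrD(2)[OF g]])
  show "f ;;\<^sub>S g \<in> extensional {1..p - 1}" by (simp add: S_cmp)
  show "ar ((f ;;\<^sub>S g) i) (fst X i) (fst Z i)" if "1 <= i" "i < p" for i
    using S_arrD(4)[OF f that] S_arrD(4)[OF g that] that by (auto simp: S_cmp)
  show "snd X (Suc i) ;; (f ;;\<^sub>S g) (Suc i) = (f ;;\<^sub>S g) i ;; snd Z (Suc i)" if i: "1 <= i" "Suc i < p" for i
  proof -
    have "snd X (Suc i) ;; (f (Suc i) ;; g (Suc i)) = f i ;; (snd Y (Suc i) ;; g (Suc i))"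
      by (simp add: A.assoc[symmetric] S_arrD(5)[OF f i])
    also have "\<dots> = f i ;; g i ;; snd Z (Suc i)" by (simp add: S_arrD(5)[OF g i] A.assoc)
    finally show ?thesis using i by (auto simp: S_cmp)
  qed
qed

lemma S_arr_id: assumes X: "X \<in> Ob S" shows "arr S (ident S X) X X"
proof (rule S_arrI[OF X X])
  show "ident S X \<in> extensional {1..p - 1}" by (simp add: S_id)
  show "ar (ident S X i) (fst X i) (fst X i)" if "1 <= i" "i < p" for i
    using S_ObD(2)[OF X that] that by (auto simp: S_id)
  show "snd X (Suc i) ;; ident S X (Suc i) = ident S X i ;; snd X (Suc i)" if i: "1 <= i" "Suc i < p" for i
    using A.id_left[OF S_ObD(3)[OF X i]] A.id_right[OF S_ObD(3)[OF X i]] i by (auto simp: S_id)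
qed

lemma S_id_left: assumes f: "arr S f X Y" shows "ident S X ;;\<^sub>S f = f" "f ;;\<^sub>S ident S Y = f"
proof -
  have *: "idt (fst X i) ;; f i = f i" "f i ;; idt (fst Y i) = f i" if "i \<in> {1..p - 1}" for i
  proof -
    have i: "1 <= i" "i < p" using that p2 by auto
    show "idt (fst X i) ;; f i = f i" "f i ;; idt (fst Y i) = f i"
      using A.id_left[OF S_arrD(4)[OF f i]] A.id_right[OF S_arrD(4)[OF f i]] by auto
  qed
  show "ident S X ;;\<^sub>S f = f" "f ;;\<^sub>S ident S Y = f"
    using * S_arrD(3)[OF f] by (auto simp: S_cmp S_id fun_eq_iff extensional_def)
qed

lemma S_category: "category S"
proof
  show "ident S X \<in> Hom S X X" if "X \<in> Ob S" for X by (rule arrD(3)[OF S_arr_id[OF that]])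
  show "f ;;\<^sub>S g \<in> Hom S X Z" if "X \<in> Ob S" "Y \<in> Ob S" "Z \<in> Ob S" "f \<in> Hom S X Y" "g \<in> Hom S Y Z" for X Y Z f g
    by (rule arrD(3)[OF S_arr_cmp[OF arrI[OF that(1,2,4)] arrI[OF that(2,3,5)]]])
  show "ident S X ;;\<^sub>S f = f" if "X \<in> Ob S" "Y \<in> Ob S" "f \<in> Hom S X Y" for X Y f
    by (rule S_id_left(1)[OF arrI[OF that]])
  show "f ;;\<^sub>S ident S Y = f" if "X \<in> Ob S" "Y \<in> Ob S" "f \<in> Hom S X Y" for X Y f
    by (rule S_id_left(2)[OF arrI[OF that]])
  show "f ;;\<^sub>S g ;;\<^sub>S h = f ;;\<^sub>S (g ;;\<^sub>S h)" for f g h by (auto simp: S_cmp A.assoc fun_eq_iff)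
qed

lemma S_zero:
  assumes X: "X \<in> Ob S" and Y: "Y \<in> Ob S"
  shows S_ex_zero: "\<exists>Z. is_zero_obj S Z"
    and S_zero_mor: "zero_mor S X Y = (\<lambda>i\<in>{1..p - 1}. zr (fst X i) (fst Y i))"
proof -
  obtain z where z: "is_zero_obj A z" using A.ex_zero_obj by blast
  have zO: "z \<in> Ob A" "z \<in> Ob B" using z B_zero_obj[OF z] by (auto simp: is_zero_obj_def)
  define Z where "Z = ((\<lambda>i\<in>{1..p - 1}. z), (\<lambda>i\<in>{2..p - 1}. zr z z))"
  have ZO: "Z \<in> Ob S" unfolding S_Ob using zO arrD(3)[OF A.ar_zr[OF zO(1) zO(1)]] by (auto simp: Z_def PiE_def)
  have fZ: "fst Z i = z" if "1 <= i" "i < p" for i using that by (auto simp: Z_def)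
  have sZ: "snd Z (Suc i) = zr z z" if "1 <= i" "Suc i < p" for i using that by (auto simp: Z_def)
  have to: "arr S (\<lambda>i\<in>{1..p - 1}. zr (fst X i) z) X Z" if X: "X \<in> Ob S" for X
  proof (rule S_arrI[OF X ZO])
    show "ar ((\<lambda>i\<in>{1..p - 1}. zr (fst X i) z) i) (fst X i) (fst Z i)" if "1 <= i" "i < p" for i
      using that fZ[OF that] zO S_ObD(2)[OF X that] by auto
    show "snd X (Suc i) ;; (\<lambda>i\<in>{1..p - 1}. zr (fst X i) z) (Suc i) = (\<lambda>i\<in>{1..p - 1}. zr (fst X i) z) i ;; snd Z (Suc i)"
      if i: "1 <= i" "Suc i < p" for i
      using i sZ[OF i] zO S_ObD(2)[OF X, of i] A.zr_right[OF S_ObD(3)[OF X i] zO(1)] by auto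
  qed simp
  have fr: "arr S (\<lambda>i\<in>{1..p - 1}. zr z (fst X i)) Z X" if X: "X \<in> Ob S" for X
  proof (rule S_arrI[OF ZO X])
    show "ar ((\<lambda>i\<in>{1..p - 1}. zr z (fst X i)) i) (fst Z i) (fst X i)" if "1 <= i" "i < p" for i
      using that fZ[OF that] zO S_ObD(2)[OF X that] by auto
    show "snd Z (Suc i) ;; (\<lambda>i\<in>{1..p - 1}. zr z (fst X i)) (Suc i) = (\<lambda>i\<in>{1..p - 1}. zr z (fst X i)) i ;; snd X (Suc i)"
      if i: "1 <= i" "Suc i < p" for i
      using i sZ[OF i] zO S_ObD(2)[OF X, of "Suc i"] A.zr_left[OF S_ObD(3)[OF X i] zO(1)] by auto
  qed simp
  have Zz: "is_zero_obj S Z" unfolding is_zero_obj_def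
  proof (intro conjI ballI)
    fix X assume X: "X \<in> Ob S"
    show "\<exists>!f. f \<in> Hom S X Z"
    proof (rule ex1I[of _ "\<lambda>i\<in>{1..p - 1}. zr (fst X i) z"])
      show "(\<lambda>i\<in>{1..p - 1}. zr (fst X i) z) \<in> Hom S X Z" by (rule arrD(3)[OF to[OF X]])
      fix f assume "f \<in> Hom S X Z"
      then have f: "arr S f X Z" using X ZO by (simp add: arr_def)
      show "f = (\<lambda>i\<in>{1..p - 1}. zr (fst X i) z)"
        by (rule extensionalityI[OF S_arrD(3)[OF f]])
          (use S_arrD(4)[OF f] fZ A.to_zero[OF z] p2 in \<open>auto simp: le_diff_conv\<close>)
    qed
    show "\<exists>!f. f \<in> Hom S Z X"
    proof (rule ex1I[of _ "\<lambda>i\<in>{1..p - 1}. zr z (fst X i)"])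
      show "(\<lambda>i\<in>{1..p - 1}. zr z (fst X i)) \<in> Hom S Z X" by (rule arrD(3)[OF fr[OF X]])
      fix f assume "f \<in> Hom S Z X"
      then have f: "arr S f Z X" using X ZO by (simp add: arr_def)
      show "f = (\<lambda>i\<in>{1..p - 1}. zr z (fst X i))"
        by (rule extensionalityI[OF S_arrD(3)[OF f]])
          (use S_arrD(4)[OF f] fZ A.from_zero[OF z] p2 in \<open>auto simp: le_diff_conv\<close>)
    qed
  qed (rule ZO)
  then show "\<exists>Z. is_zero_obj S Z" by blast
  from category.zero_mor_eq[OF S_category Zz to[OF X] fr[OF Y]]
  show "zero_mor S X Y = (\<lambda>i\<in>{1..p - 1}. zr (fst X i) (fst Y i))" using S_ObD(2)[OF X] S_ObD(2)[OF Y] zO by (auto simp: S_cmp fun_eq_iff)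
qed

text \<open>An addition suffices for what follows; it expresses the identity of a direct sum of
  sequences through projections and injections.\<close>

definition plsS where "plsS f g = (\<lambda>i\<in>{1..p - 1}. f i \<boxplus> g i)"

lemma S_arr_pls: assumes f: "arr S f X Y" and g: "arr S g X Y" shows "arr S (plsS f g) X Y"
proof (rule S_arrI[OF S_arrD(1,2)[OF f]])
  show "plsS f g \<in> extensional {1..p - 1}" by (simp add: plsS_def)
  show "ar (plsS f g i) (fst X i) (fst Y i)" if "1 <= i" "i < p" for i
    using S_arrD(4)[OF f that] S_arrD(4)[OF g that] that by (auto simp: plsS_def)
  show "snd X (Suc i) ;; plsS f g (Suc i) = plsS f g i ;; snd Y (Suc i)" if i: "1 <= i" "Suc i < p" for i
    using S_arrD(5)[OF f i] S_arrD(5)[OF g i] i by (auto simp: plsS_def A.distl A.distr)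
qed

lemma S_zero_arr: assumes X: "X \<in> Ob S" and Y: "Y \<in> Ob S" shows "arr S (zero_mor S X Y) X Y"
  unfolding S_zero_mor[OF assms]
proof (rule S_arrI[OF X Y])
  show "ar ((\<lambda>i\<in>{1..p - 1}. zr (fst X i) (fst Y i)) i) (fst X i) (fst Y i)" if "1 <= i" "i < p" for i
    using that S_ObD(2)[OF X that] S_ObD(2)[OF Y that] by auto
  show "snd X (Suc i) ;; (\<lambda>i\<in>{1..p - 1}. zr (fst X i) (fst Y i)) (Suc i) = (\<lambda>i\<in>{1..p - 1}. zr (fst X i) (fst Y i)) i ;; snd Y (Suc i)"
    if i: "1 <= i" "Suc i < p" for i
    using i A.zr_right[OF S_ObD(3)[OF X i] S_ObD(2)[OF Y, of "Suc i"]] A.zr_left[OF S_ObD(3)[OF Y i] S_ObD(2)[OF X, of i]] by auto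
qed simp

lemma S_pls_zero: assumes f: "arr S f X Y" shows "plsS f (zero_mor S X Y) = f" "plsS (zero_mor S X Y) f = f"
proof -
  have *: "f i \<boxplus> zr (fst X i) (fst Y i) = f i" if "i \<in> {1..p - 1}" for i
    using A.pls_zero[OF S_arrD(4)[OF f, of i]] that p2 by auto
  then show "plsS f (zero_mor S X Y) = f" "plsS (zero_mor S X Y) f = f"
    using S_arrD(3)[OF f] A.pls_comm unfolding S_zero_mor[OF S_arrD(1,2)[OF f]]
    by (auto simp: plsS_def fun_eq_iff extensional_def)
qed

lemma S_zero_cmp: assumes f: "arr S f X Y" and W: "W \<in> Ob S"
  shows "zero_mor S W X ;;\<^sub>S f = zero_mor S W Y" "f ;;\<^sub>S zero_mor S Y W = zero_mor S X W"
proof -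
  have "zr (fst W i) (fst X i) ;; f i = zr (fst W i) (fst Y i)" "f i ;; zr (fst Y i) (fst W i) = zr (fst X i) (fst W i)" if "i \<in> {1..p - 1}" for i
    using A.zr_left[OF S_arrD(4)[OF f, of i] S_ObD(2)[OF W, of i]] A.zr_right[OF S_arrD(4)[OF f, of i] S_ObD(2)[OF W, of i]] that p2 by auto
  then show "zero_mor S W X ;;\<^sub>S f = zero_mor S W Y" "f ;;\<^sub>S zero_mor S Y W = zero_mor S X W"
    unfolding S_zero_mor[OF W S_arrD(1)[OF f]] S_zero_mor[OF W S_arrD(2)[OF f]] S_zero_mor[OF S_arrD(2)[OF f] W] S_zero_mor[OF S_arrD(1)[OF f] W]
    by (auto simp: S_cmp fun_eq_iff)
qed

lemma S_cmp_assoc: "f ;;\<^sub>S g ;;\<^sub>S h = f ;;\<^sub>S (g ;;\<^sub>S h)"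
  by (auto simp: S_cmp A.assoc fun_eq_iff)

lemma S_distr: "f ;;\<^sub>S plsS g h = plsS (f ;;\<^sub>S g) (f ;;\<^sub>S h)"
  by (auto simp: S_cmp plsS_def A.distr fun_eq_iff)

text \<open>The functor iota on morphisms; at the last entry both objects are the fixed zero
  object.\<close>

definition im where "im z \<phi> = mkm (\<lambda>i. if i < p then \<phi> i else idt z)"

definition ien where "ien z X i = (if i = 0 then Fo z else if i < p then fst X i else z)"
definition ist where "ist z X i = (if i = 0 then zr (Fo z) (fst X 1) else if Suc i < p then snd X (Suc i) else zr (fst X i) z)"

lemma iota_mko: "iota A Fo p z X = mko (ien z X) (ist z X)"
proof -
  have "fst (iota A Fo p z X) = fst (mko (ien z X) (ist z X))"
    by (auto simp: iota_def split_beta mko_def ien_def fun_eq_iff)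
  moreover have "snd (iota A Fo p z X) i = snd (mko (ien z X) (ist z X)) i" for i
    using p2 by (cases i) (auto simp: iota_def split_beta mko_def ist_def)
  ultimately show ?thesis using prod_eqI by blast
qed

lemma ien_dia: assumes z: "is_zero_obj A z" and X: "X \<in> Ob S" shows "dia (ien z X) (ist z X)"
  unfolding dia_def
proof (intro conjI allI impI)
  have zO: "z \<in> Ob A" using z by (simp add: is_zero_obj_def)
  show "ien z X i \<in> Ob A" if "i <= p" for i using zO S_ObD(2)[OF X] that by (auto simp: ien_def)
  show "ien z X 0 = Fo (ien z X p)" using p2 by (simp add: ien_def)
  show "ar (ist z X i) (ien z X i) (ien z X (Suc i))" if i: "i < p" for i
  proof -
    consider "i = 0" | "1 <= i" "Suc i < p" | "1 <= i" "Suc i = p" using i by linarith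
    then show ?thesis
      using zO S_ObD(2)[OF X] S_ObD(3)[OF X] p2 by cases (auto simp: ien_def ist_def)
  qed
qed

lemma iota_Ob: assumes z: "is_zero_obj A z" and X: "X \<in> Ob S" shows "iota A Fo p z X \<in> Ob R"
  unfolding iota_mko
proof (rule R_mkoI[OF ien_dia[OF z X]])
  note d = ien_dia[OF z X]
  show "etac (ien z X) (ist z X)" unfolding etac_def
  proof (intro allI impI)
    fix i assume i: "1 <= i" "i <= p"
    have e: "ien z X p = z" "ien z X 0 = Fo z" using i by (auto simp: ien_def)
    have MB: "ien z X i \<in> Ob B" using B_zero_obj[OF z] S_ObD(1)[OF X] i by (auto simp: ien_def is_zero_obj_def)
    then have MO: "ien z X i \<in> Ob A" by (simp add: B_Ob)
    have a: "ar (Fm (pth (ien z X) (ist z X) i (p - i))) (Fo (ien z X i)) (Fo z)"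
      using F_arr[OF pth_arr[OF d, of i "p - i"]] i e by simp
    have b: "ar (pth (ien z X) (ist z X) 0 i) (Fo z) (ien z X i)" using pth_arr[OF d, of 0 i] i e by simp
    have "Fm (pth (ien z X) (ist z X) i (p - i)) ;; pth (ien z X) (ist z X) 0 i = zr (Fo (ien z X i)) (ien z X i)"
      unfolding A.to_zero[OF F_zero_obj[OF z] a] by (rule A.zr_left[OF b F_Ob[OF MO]])
    then show "Fm (pth (ien z X) (ist z X) i (p - i)) ;; pth (ien z X) (ist z X) 0 i = \<eta> (ien z X i)"
      using MB by (simp add: B_Ob)
  qed
qed

lemma iota_en: "i <= p ==> en (iota A Fo p z X) i = ien z X i"
  unfolding iota_mko using p2 by (intro en_mko) (auto simp: ien_def)

lemma iota_st: "i < p ==> st (iota A Fo p z X) i = ist z X i"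
  unfolding iota_mko by (rule st_mko)

lemma im_arr: assumes z: "is_zero_obj A z" and f: "arr S \<phi> X Y" shows "arr R (im z \<phi>) (iota A Fo p z X) (iota A Fo p z Y)"
proof -
  note fd = S_arrD[OF f]
  have zO: "z \<in> Ob A" using z by (simp add: is_zero_obj_def)
  let ?c = "\<lambda>i. if i = 0 then idt (Fo z) else if i < p then \<phi> i else idt z"
  have e: "im z \<phi> = mkm ?c" by (auto simp: im_def mkm_def fun_eq_iff)
  show ?thesis unfolding e
  proof (rule R_mkmI[OF iota_Ob[OF z fd(1)] iota_Ob[OF z fd(2)]])
    show "diam (en (iota A Fo p z X)) (st (iota A Fo p z X)) (en (iota A Fo p z Y)) (st (iota A Fo p z Y)) ?c"
      unfolding diam_def
    proof (intro conjI allI impI)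
      fix i assume "i <= p"
      then show "ar (?c i) (en (iota A Fo p z X) i) (en (iota A Fo p z Y) i)"
        using fd(4)[of i] zO by (auto simp: iota_en ien_def)
    next
      show "?c 0 = Fm (?c p)" using p2 zO by (simp add: F_ident)
    next
      fix i assume i: "i < p"
      consider "i = 0" | "1 <= i" "Suc i < p" | "1 <= i" "Suc i = p" using i by linarith
      then show "st (iota A Fo p z X) i ;; ?c (Suc i) = ?c i ;; st (iota A Fo p z Y) i"
      proof cases
        case 1
        then show ?thesis
          using i p2 zO A.zr_left[OF fd(4)[of 1] F_Ob[OF zO]] S_ObD(2)[OF fd(2), of 1] by (simp add: iota_st ist_def)
      next
        case 2
        then show ?thesis using fd(5)[OF 2] i by (simp add: iota_st ist_def)
      next
        case 3
        then show ?thesis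
          using i zO A.zr_right[OF fd(4)[of i] zO] S_ObD(2)[OF fd(1), of i] by (simp add: iota_st ist_def)
      qed
    qed
  qed
qed

lemma im_cmp: "z \<in> Ob A ==> im z (\<phi> ;;\<^sub>S \<psi>) = im z \<phi> ;;\<^sub>R im z \<psi>"
  using A.id_left[OF A.arr_ident, of z] by (auto simp: im_def S_cmp R_cmp mkm_def fun_eq_iff)

lemma im_ident: "im z (ident S X) = ident R (iota A Fo p z X)"
  by (auto simp: im_def S_id R_id mkm_def fun_eq_iff iota_en ien_def)

lemma im_pls: assumes z: "is_zero_obj A z" shows "im z (plsS \<phi> \<psi>) = plsR (im z \<phi>) (im z \<psi>)"
proof -
  have "idt z \<boxplus> idt z = idt z" using z A.zero_obj_iff by simp
  then show ?thesis by (auto simp: im_def plsS_def plsR_def mkm_def fun_eq_iff)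
qed

lemma im_zero: assumes z: "is_zero_obj A z" and O: "X \<in> Ob S" "Y \<in> Ob S"
  shows "im z (zero_mor S X Y) = zero_mor R (iota A Fo p z X) (iota A Fo p z Y)"
  unfolding S_zero_mor[OF O] R_zero_mor[OF iota_Ob[OF z O(1)] iota_Ob[OF z O(2)]]
  using z A.zero_obj_iff by (auto simp: im_def mkm_def fun_eq_iff iota_en ien_def)

text \<open>In the category of sequences, uniqueness in the coproduct property identifies the sum of
  all projections followed by injections with the identity. As iota is compatible with identities,
  composites and sums, it carries this to roots. Summands are numbered from 1, \<open>psum\<close>
  from 0, hence \<open>Suc k\<close>.\<close>

lemma delta_decomposition:
  assumes z: "is_zero_obj A z" and D: "is_delta B (p - 1) z T D"
  obtains a b where "iota A Fo p z D \<in> Ob R"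
    "\<And>k. k < p - 1 ==> arr R (a k) (iota A Fo p z D) (iota A Fo p z (interval_seq B (p - 1) z T (Suc k))) \<and>
       arr R (b k) (iota A Fo p z (interval_seq B (p - 1) z T (Suc k))) (iota A Fo p z D)"
    "\<And>k. k < p - 1 ==> b k ;;\<^sub>R a k = ident R (iota A Fo p z (interval_seq B (p - 1) z T (Suc k)))"
    "R.psum (iota A Fo p z D) a b (p - 1) = ident R (iota A Fo p z D)"
proof -
  let ?S = "interval_seq B (p - 1) z T"
  have zO: "z \<in> Ob A" using z by (simp add: is_zero_obj_def)
  have D': "is_direct_sum S {1..p - 1} ?S D" using D by (simp add: is_delta_def)
  then have DO: "D \<in> Ob S" and SO: "\<And>i. i \<in> {1..p - 1} ==> ?S i \<in> Ob S" by (auto simp: is_direct_sum_def)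
  obtain inj prj where ip: "\<forall>i\<in>{1..p - 1}. inj i \<in> Hom S (?S i) D \<and> prj i \<in> Hom S D (?S i)"
    and del: "\<forall>i\<in>{1..p - 1}. \<forall>k\<in>{1..p - 1}. inj i ;;\<^sub>S prj k = (if i = k then ident S (?S i) else zero_mor S (?S i) (?S k))"
    and uni: "\<forall>W\<in>Ob S. \<forall>g. (\<forall>i\<in>{1..p - 1}. g i \<in> Hom S (?S i) W) -->
        (\<exists>!u. u \<in> Hom S D W \<and> (\<forall>i\<in>{1..p - 1}. inj i ;;\<^sub>S u = g i))"
    using D' unfolding is_direct_sum_def by (elim conjE exE) rule
  have ia: "arr S (inj i) (?S i) D" and pa: "arr S (prj i) D (?S i)" if "i \<in> {1..p - 1}" for i
    using ip SO[OF that] DO that by (auto simp: arr_def)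
  define a where "a k = im z (prj (Suc k))" for k
  define b where "b k = im z (inj (Suc k))" for k
  \<comment> \<open>The partial sum \<open>e\<close> acts as the identity on the first
    \<open>m\<close> summands and as zero on the others; for \<open>m = p - 1\<close> it must be the
    identity.\<close>
  have "\<exists>e. arr S e D D \<and> (\<forall>i\<in>{1..p - 1}. inj i ;;\<^sub>S e = (if i <= m then inj i else zero_mor S (?S i) D)) \<and>
      im z e = R.psum (iota A Fo p z D) a b m" if "m <= p - 1" for m
    using that
  proof (induction m)
    case 0
    have "inj i ;;\<^sub>S zero_mor S D D = zero_mor S (?S i) D" if "i \<in> {1..p - 1}" for i
      by (rule S_zero_cmp(2)[OF ia[OF that] DO])
    then show ?case using S_zero_arr[OF DO DO] im_zero[OF z DO DO] by (intro exI[of _ "zero_mor S D D"]) simp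
  next
    case (Suc m)
    then obtain e where e: "arr S e D D" "\<And>i. i \<in> {1..p - 1} ==> inj i ;;\<^sub>S e = (if i <= m then inj i else zero_mor S (?S i) D)"
      "im z e = R.psum (iota A Fo p z D) a b m" by auto
    have sm: "Suc m \<in> {1..p - 1}" using Suc by simp
    let ?t = "prj (Suc m) ;;\<^sub>S inj (Suc m)"
    have t: "arr S ?t D D" by (rule S_arr_cmp[OF pa[OF sm] ia[OF sm]])
    have "inj i ;;\<^sub>S plsS e ?t = (if i <= Suc m then inj i else zero_mor S (?S i) D)" if i: "i \<in> {1..p - 1}" for i
    proof -
      have d: "inj i ;;\<^sub>S ?t = (if i = Suc m then inj i else zero_mor S (?S i) D)"
      proof -
        have "inj i ;;\<^sub>S ?t = inj i ;;\<^sub>S prj (Suc m) ;;\<^sub>S inj (Suc m)" by (simp only: S_cmp_assoc)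
        also have "\<dots> = (if i = Suc m then ident S (?S i) else zero_mor S (?S i) (?S (Suc m))) ;;\<^sub>S inj (Suc m)"
          by (simp only: bspec[OF bspec[OF del i] sm])
        finally show ?thesis using S_id_left(1)[OF ia[OF sm]] S_zero_cmp(1)[OF ia[OF sm] SO[OF i]] by (cases "i = Suc m") simp_all
      qed
      show ?thesis unfolding S_distr d e(2)[OF i]
        using S_pls_zero[OF ia[OF i]] S_pls_zero[OF S_zero_arr[OF SO[OF i] DO]] by auto
    qed
    moreover have "im z (plsS e ?t) = R.psum (iota A Fo p z D) a b (Suc m)"
      unfolding im_pls[OF z] im_cmp[OF zO] e(3) by (simp add: a_def b_def)
    ultimately show ?case using S_arr_pls[OF e(1) t] by blast
  qed
  from this[OF order_refl] obtain e where e: "arr S e D D" "\<And>i. i \<in> {1..p - 1} ==> inj i ;;\<^sub>S e = inj i"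
    "im z e = R.psum (iota A Fo p z D) a b (p - 1)" by auto
  have "\<exists>!u. u \<in> Hom S D D \<and> (\<forall>i\<in>{1..p - 1}. inj i ;;\<^sub>S u = inj i)"
    using uni[rule_format, OF DO, of inj] ip by blast
  then have "e = ident S D"
    using e(2) arrD(3)[OF e(1)] arrD(3)[OF S_arr_id[OF DO]] S_id_left(2)[OF ia] by (metis (no_types, lifting))
  then have "R.psum (iota A Fo p z D) a b (p - 1) = ident R (iota A Fo p z D)" using e(3) im_ident by simp
  moreover have "arr R (a k) (iota A Fo p z D) (iota A Fo p z (?S (Suc k))) \<and> arr R (b k) (iota A Fo p z (?S (Suc k))) (iota A Fo p z D)"
    if "k < p - 1" for k using im_arr[OF z pa[of "Suc k"]] im_arr[OF z ia[of "Suc k"]] that by (simp add: a_def b_def)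
  moreover have "b k ;;\<^sub>R a k = ident R (iota A Fo p z (?S (Suc k)))" if "k < p - 1" for k
  proof -
    have k: "Suc k \<in> {1..p - 1}" using that by simp
    have "inj (Suc k) ;;\<^sub>S prj (Suc k) = ident S (?S (Suc k))" using bspec[OF bspec[OF del k] k] by simp
    then show ?thesis unfolding a_def b_def im_cmp[OF zO, symmetric] by (simp only: im_ident)
  qed
  ultimately show ?thesis using that iota_Ob[OF z DO] by blast
qed

end

lemma (in abcat) psum_conj:
  assumes "X \<in> Ob C" "ar q Y X" "ar i X Y" "\<And>k. k < m ==> ar (a k) X (Z k) \<and> ar (b k) (Z k) X"
  shows "psum Y (\<lambda>k. q ;; a k) (\<lambda>k. b k ;; i) m = q ;; psum X a b m ;; i"
  using assms(4)
proof (induction m)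
  case 0
  then show ?case using assms(1-3) by (simp add: arr_def[of C q] arr_def[of C i] assms) (metis arrD(1) assms(2,3) zr_left zr_right)
next
  case (Suc m)
  then show ?case by (simp add: distl distr assoc)
qed

text \<open>Applied to roots with zero last entry: there the left adjoint of J_j simply returns
  entry \<open>j\<close>.\<close>

lemma (in abcat) cokernel_from_zero:
  assumes "is_zero_obj C Z" "ar f Z X" shows "is_cokernel C Z X f X (idt X)"
proof -
  have O: "X \<in> Ob C" "Z \<in> Ob C" using assms(2) by (simp_all add: arr_def)
  show ?thesis
  proof (rule cokernelI[OF assms(2) arr_ident[OF O(1)]])
    show "f ;; idt X = zr Z X" using assms(2) from_zero[OF assms] by simp
    fix W h assume "ar h X W"
    then show "\<exists>u. ar u X W \<and> idt X ;; u = h" by (intro exI[of _ h]) simp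
  qed (use O in simp)
qed

section \<open>The cotilting property under unconditional laws\<close>

context root_ctx begin

text \<open>Naturality at \<open>q\<close> turns \<open>Fm q ;; \<eta> Q\<close> into
  \<open>\<eta> U ;; q\<close>, which is zero, and \<open>Fm q\<close> is an epimorphism.\<close>

lemma cokernel_eta_B:
  assumes Q: "is_cokernel A (Fo U) U (\<eta> U) Q q" and UO: "U \<in> Ob A"
  shows "Q \<in> Ob B"
proof -
  have "Q \<in> Ob A" using Q by (simp add: is_cokernel_def)
  have "ar q U Q" "is_epi A U Q q" using A.cokernelD(1)[OF Q UO] A.cokernel_epi[OF Q eta_arr[OF UO]] by auto
  moreover have "\<eta> Q = zr (Fo Q) Q"
  proof (rule A.epiD0[OF F_epi[OF calculation(2,1)] F_Ob[OF UO] eta_arr[OF \<open>Q \<in> Ob A\<close>]])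
    show "Fm q ;; \<eta> Q = zr (Fo U) Q" using eta_nat[OF calculation(1)] A.cokernelD(2)[OF Q UO] by simp
  qed
  ultimately show ?thesis using \<open>Q \<in> Ob A\<close> by (simp add: B_Ob)
qed

text \<open>\<open>V\<close> is a direct sum of \<open>p\<close> pieces, namely the p - 1 interval
  roots on \<open>T\<close> and pi_rho U. Each of the four kinds of \<open>Ext\<close> between
  pieces is transported by an adjunction to \<open>A\<close> or A_eta, where it vanishes by a
  hypothesis or because one argument is zero. The same adjunctions detect the entries of a root
  orthogonal to \<open>V\<close>.\<close>

theorem cotilting_root:
  assumes T: "cotilting B T" and U: "cotilting A U" and mU: "is_mono A (Fo U) U (\<eta> U)"
    and Q: "is_cokernel A (Fo U) U (\<eta> U) Q q" and QT: "\<forall>i>0. Ext_zero B i Q T"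
    and z: "is_zero_obj A z" and D: "is_delta B (p - 1) z T D"
    and sum: "is_direct_sum2 R (iota A Fo p z D) (pi_rho A \<eta> p U) V"
  shows "cotilting R V"
proof -
  let ?i = "iota A Fo p z D" and ?U = "pi_rho A \<eta> p U"
  let ?J = "\<lambda>k. iota A Fo p z (interval_seq B (p - 1) z T (Suc k))"
  have zO: "z \<in> Ob A" "z \<in> Ob B" using z B_zero_obj[OF z] by (auto simp: is_zero_obj_def)
  have TO: "T \<in> Ob B" "T \<in> Ob A" using T by (auto simp: cotilting_def B_Ob)
  have UO: "U \<in> Ob A" using U by (simp add: cotilting_def)
  have UR: "?U \<in> Ob R" by (rule pi_rho_Ob[OF UO])
  have vU: "vanishing A n U U" for n using U A.Ext_zero_iff_vanishing[OF UO UO] by (auto simp: cotilting_def)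
  have vT: "vanishing B n T T" for n using T B.Ext_zero_iff_vanishing[OF TO(1) TO(1)] by (auto simp: cotilting_def)
  have enU: "en ?U p = U" using p2 by (simp add: pi_rho_en pen_def)
  interpret P: reflective_vanishing R plsR ngR A plsA ngA "pi_rho A \<eta> p" pm "\<lambda>_. True" Rp
    by (rule reflective_pi_rho)
  have refU: "vanishing R n X ?U <-> vanishing A n (en X p) U" if "X \<in> Ob R" for X n
    by (rule P.vanishing_reflection[OF that TrueI _ UO]) (simp add: Rp_def)
  have refU0: "Ext_zero R 0 X ?U <-> Ext_zero A 0 (en X p) U" if "X \<in> Ob R" for X
    by (rule P.Hom_zero_reflection[OF that _ UO]) (simp add: Rp_def)
  have gU: "good ?U" unfolding good_def enU by (rule mU)
  have ri: "root_interval A plsA ngA Fo Fm \<eta> p z (Suc k)" if "k < p - 1" for k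
    by unfold_locales (use z that in auto)
  have JD: "?J k \<in> Ob R" "en (?J k) p = z" "en (?J k) (Suc l) = (if l <= k then T else z)"
    if k: "k < p - 1" and l: "l < p" for k l
  proof -
    interpret I: root_interval A plsA ngA Fo Fm \<eta> p z "Suc k" by (rule ri[OF k])
    show "?J k \<in> Ob R" using I.Jo_Ob[OF TO(1)] by (simp add: I.Jo_def)
    have "\<not> p <= Suc k" "p \<noteq> 0" using k by auto
    then show "en (?J k) p = z" using I.Jo_en[OF TO(1) order_refl] by (simp add: I.Jo_def I.jen_def)
    show "en (?J k) (Suc l) = (if l <= k then T else z)"
      using I.Jo_en[OF TO(1), of "Suc l"] l by (simp add: I.Jo_def I.jen_def)
  qed
  have JR: "?J k \<in> Ob R" "en (?J k) p = z" if "k < p - 1" for k using JD[OF that p1(2)] by auto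
  have gz: "good X" if X: "X \<in> Ob R" "is_zero_obj A (en X p)" for X
    unfolding good_def
    by (rule A.zero_obj_mono[OF F_zero_obj[OF X(2)] eta_arr[OF R_ObD(3)[OF X(1) order_refl]]])
  \<comment> \<open>The index \<open>k\<close> runs from 0 and belongs to the functor J_j with j = k
    + 1, hence the entry \<open>Suc k\<close>.\<close>
  have refJ: "vanishing R n X (?J k) <-> vanishing B n X' T" "Ext_zero R 0 X (?J k) <-> Ext_zero B 0 X' T"
    if k: "k < p - 1" and X: "X \<in> Ob R" "good X"
      and c: "is_cokernel A (Fo (en X p)) (en X (Suc k)) (pth (en X) (st X) 0 (Suc k)) X' c" for n X X' c k
  proof -
    interpret I: root_interval A plsA ngA Fo Fm \<eta> p z "Suc k" by (rule ri[OF k])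
    interpret J: reflective_vanishing R plsR ngR B plsA ngA I.Jo I.Jm good I.Rj by (rule I.reflective_interval)
    obtain e where e: "I.Rj X X' e" using c unfolding I.Rj_def by blast
    show "vanishing R n X (?J k) <-> vanishing B n X' T"
      using J.vanishing_reflection[OF X e TO(1)] by (simp add: I.Jo_def)
    show "Ext_zero R 0 X (?J k) <-> Ext_zero B 0 X' T"
      using J.Hom_zero_reflection[OF X(1) e TO(1)] by (simp add: I.Jo_def)
  qed
  have refJz: "vanishing R n X (?J k) <-> vanishing B n (en X (Suc k)) T" "Ext_zero R 0 X (?J k) <-> Ext_zero B 0 (en X (Suc k)) T"
    if k: "k < p - 1" and X: "X \<in> Ob R" "is_zero_obj A (en X p)" for n X k
  proof -
    have "ar (pth (en X) (st X) 0 (Suc k)) (Fo (en X p)) (en X (Suc k))"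
      using pth_arr[OF R_ObD(1)[OF X(1)], of 0 "Suc k"] k en_0[of X] by simp
    note c = A.cokernel_from_zero[OF F_zero_obj[OF X(2)] this]
    show "vanishing R n X (?J k) <-> vanishing B n (en X (Suc k)) T" "Ext_zero R 0 X (?J k) <-> Ext_zero B 0 (en X (Suc k)) T"
      using refJ[OF k X(1) gz[OF X] c] by auto
  qed
  have UU: "vanishing R n ?U ?U" for n using refU[OF UR] vU enU by simp
  \<comment> \<open>The last entry of an interval root is zero, so the left adjoint of pi_rho sends
    it to zero.\<close>
  have JU: "vanishing R n (?J k) ?U" if "k < p - 1" for n k
    using refU[OF JR(1)[OF that]] JR(2)[OF that] A.vanishing_zero[OF z] by simp
  \<comment> \<open>As the last entry of the source is zero, its reflection is the entry at
    \<open>Suc k\<close>, which is \<open>T\<close> or zero. What remains is rigidity of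
    \<open>T\<close>.\<close>
  have JJ: "vanishing R n (?J l) (?J k)" if "k < p - 1" "l < p - 1" for n k l
  proof -
    have "k < p" using that by simp
    then show ?thesis
      using refJz(1)[OF that(1) JR(1)[OF that(2)]] JR(2)[OF that(2)] JD(3)[OF that(2), of k] z vT B.vanishing_zero[OF B_zero_obj[OF z]]
      by simp
  qed
  \<comment> \<open>In pi_rho U the map from F U to any later entry is \<open>\<eta>\<close> of
    \<open>U\<close>. All the left adjoints thus return the same object \<open>Q\<close>, and
    condition (2) is exactly what is left; condition (1) says that pi_rho U is good.\<close>
  have UJ: "vanishing R n ?U (?J k)" if k: "k < p - 1" for n k
  proof -
    have "pth (en ?U) (st ?U) 0 (Suc k) = pth (pen U) (pst U) 0 (Suc k)"
      using k by (intro pth_cong) (auto simp: pi_rho_en pi_rho_st)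
    also have "\<dots> = \<eta> U" using pen_pth0[OF UO, of "Suc k"] k by simp
    finally have "is_cokernel A (Fo (en ?U p)) (en ?U (Suc k)) (pth (en ?U) (st ?U) 0 (Suc k)) Q q"
      using Q k enU by (simp add: pi_rho_en) (simp add: pen_def)
    note r = refJ(1)[OF k UR gU this]
    have "Q \<in> Ob B" by (rule cokernel_eta_B[OF Q UO])
    then have "vanishing B n Q T" using QT B.Ext_zero_iff_vanishing[OF _ TO(1)] by blast
    then show ?thesis using r by simp
  qed
  obtain a b where ab: "?i \<in> Ob R" "\<And>k. k < p - 1 ==> arr R (a k) ?i (?J k) \<and> arr R (b k) (?J k) ?i"
    "\<And>k. k < p - 1 ==> b k ;;\<^sub>R a k = ident R (?J k)" "R.psum ?i a b (p - 1) = ident R ?i"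
    by (rule delta_decomposition[OF z D]) (rule that, assumption+)
  obtain i1 i2 q1 q2 where S: "arr R i1 ?i V" "arr R i2 ?U V" "arr R q1 V ?i" "arr R q2 V ?U"
    "i1 ;;\<^sub>R q1 = ident R ?i" "i2 ;;\<^sub>R q2 = ident R ?U" "i1 ;;\<^sub>R q2 = zero_mor R ?i ?U" "i2 ;;\<^sub>R q1 = zero_mor R ?U ?i"
    "plsR (q1 ;;\<^sub>R i1) (q2 ;;\<^sub>R i2) = ident R V"
    using R.direct_sum2D[OF ab(1) UR sum] .
  have VO: "V \<in> Ob R" using S(1) by (simp add: arr_def)
  \<comment> \<open>The pieces in one list: interval roots at the indices below
    \<open>p - 1\<close>, and pi_rho U at index \<open>p - 1\<close>.\<close>
  define Y where "Y k = (if k < p - 1 then ?J k else ?U)" for k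
  define a' where "a' k = (if k < p - 1 then q1 ;;\<^sub>R a k else q2)" for k
  define b' where "b' k = (if k < p - 1 then b k ;;\<^sub>R i1 else i2)" for k
  have ab': "arr R (a' k) V (Y k) \<and> arr R (b' k) (Y k) V" for k
    using R.arr_cmp[OF S(3), of "a k" "?J k"] R.arr_cmp[OF _ S(1), of "b k" "?J k"] ab(2)[of k] S(2,4)
    by (simp add: a'_def b'_def Y_def)
  have "R.psum V a' b' m = R.psum V (\<lambda>k. q1 ;;\<^sub>R a k) (\<lambda>k. b k ;;\<^sub>R i1) m" if "m <= p - 1" for m
    using that by (induction m) (auto simp: a'_def b'_def)
  then have "R.psum V a' b' (Suc (p - 1)) = plsR (q1 ;;\<^sub>R ident R ?i ;;\<^sub>R i1) (q2 ;;\<^sub>R i2)"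
    using R.psum_conj[OF ab(1) S(3,1) ab(2)] ab(4) by (simp add: a'_def b'_def)
  then have ps: "R.psum V a' b' (Suc (p - 1)) = ident R V" using R.id_right[OF S(3)] S(9) by simp
  have YY: "vanishing R n (Y k) (Y l)" for n k l
    using UU JU JJ UJ by (simp add: Y_def)
  have "vanishing R n V V" for n
    by (rule R.vanishing_source_sum[OF VO ab' ps]) (rule R.vanishing_target_sum[OF VO ab' ps YY])
  then have ext: "\<forall>i>0. Ext_zero R i V V"
    using R.Ext_zero_iff_vanishing[OF VO VO] by (metis gr0_implies_Suc)
  have ret: "arr R (b' k) (Y k) V" "arr R (a' k) V (Y k)" "b' k ;;\<^sub>R a' k = ident R (Y k)" if "k <= p - 1" for k
  proof -
    show 1: "arr R (b' k) (Y k) V" "arr R (a' k) V (Y k)" using ab' by auto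
    show "b' k ;;\<^sub>R a' k = ident R (Y k)"
    proof (cases "k < p - 1")
      case True
      have "b k ;;\<^sub>R i1 ;;\<^sub>R (q1 ;;\<^sub>R a k) = b k ;;\<^sub>R (i1 ;;\<^sub>R q1) ;;\<^sub>R a k" by (simp only: R.assoc)
      also have "\<dots> = b k ;;\<^sub>R a k" unfolding S(5) using R.id_right ab(2)[OF True] by metis
      finally show ?thesis using True ab(3)[OF True] by (simp add: a'_def b'_def Y_def)
    next
      case False
      then show ?thesis using S(6) by (simp add: a'_def b'_def Y_def)
    qed
  qed
  \<comment> \<open>Each piece is a retract of \<open>V\<close>, so orthogonality to
    \<open>V\<close> implies orthogonality to every piece. The last entry must be treated before the
    others, because its vanishing makes \<open>M\<close> good.\<close>
  have "is_zero_obj R M" if M: "M \<in> Ob R" and E: "\<forall>i. Ext_zero R i M V" for M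
  proof -
    have vY: "vanishing R n M (Y k)" if "k <= p - 1" for n k
      using R.vanishing_retract[OF _ ret[OF that]] E R.Ext_zero_iff_vanishing[OF M VO] by blast
    have hY: "Ext_zero R 0 M (Y k)" if k: "k <= p - 1" for k
    proof -
      have YO: "Y k \<in> Ob R" using ret(1)[OF k] by (simp add: arr_def)
      have H: "Hom R M V = {zero_mor R M V}" using E by (auto simp: Ext_zero_def)
      have "f = zero_mor R M (Y k)" if f: "arr R f M (Y k)" for f
      proof -
        have "f ;;\<^sub>R b' k = zero_mor R M V" using H arrD(3)[OF R.arr_cmp[OF f ret(1)[OF k]]] by blast
        then have "f ;;\<^sub>R (b' k ;;\<^sub>R a' k) = zero_mor R M (Y k)"
          using R.zr_left[OF ret(2)[OF k] M] by (simp add: R.assoc[symmetric])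
        then show ?thesis unfolding ret(3)[OF k] R.id_right[OF f] .
      qed
      then have "Hom R M (Y k) \<subseteq> {zero_mor R M (Y k)}" using arrI[OF M YO] by (intro subsetI) simp
      then have "Hom R M (Y k) = {zero_mor R M (Y k)}" using arrD(3)[OF R_zero_arr[OF M YO]] by auto
      then show ?thesis by (simp add: Ext_zero_def)
    qed
    have YU: "Y (p - 1) = ?U" by (simp add: Y_def)
    have MpO: "en M p \<in> Ob A" using R_ObD(3)[OF M order_refl] .
    have "Ext_zero A i (en M p) U" for i
    proof (cases i)
      case 0 then show ?thesis using hY[of "p - 1"] YU refU0[OF M] by simp
    next
      case (Suc n)
      then show ?thesis using vY[of "p - 1" n] YU refU[OF M] A.Ext_zero_iff_vanishing[OF MpO UO] by simp
    qed
    then have zp: "is_zero_obj A (en M p)" using U MpO by (auto simp: cotilting_def)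
    have zk: "is_zero_obj A (en M (Suc k))" if k: "k < p - 1" for k
    proof -
      have kp: "Suc k <= p" using k by simp
      have MO: "en M (Suc k) \<in> Ob A" using R_ObD(3)[OF M kp] .
      \<comment> \<open>By the root condition \<open>\<eta>\<close> at this entry passes through F
        M_p, which is zero by now. So the entry lies in A_eta, where \<open>T\<close> can be
        applied.\<close>
      have eta0: "\<eta> (en M (Suc k)) = zr (Fo (en M (Suc k))) (en M (Suc k))"
      proof -
        have a: "ar (Fm (pth (en M) (st M) (Suc k) (p - Suc k))) (Fo (en M (Suc k))) (Fo (en M p))"
          using F_arr[OF pth_arr[OF R_ObD(1)[OF M], of "Suc k" "p - Suc k"]] kp by simp
        have b: "ar (pth (en M) (st M) 0 (Suc k)) (Fo (en M p)) (en M (Suc k))"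
          using pth_arr[OF R_ObD(1)[OF M], of 0 "Suc k"] kp en_0[of M] by simp
        have "\<eta> (en M (Suc k)) = Fm (pth (en M) (st M) (Suc k) (p - Suc k)) ;; pth (en M) (st M) 0 (Suc k)"
          using R_ObD(2)[OF M] kp unfolding etac_def by (simp del: pth.simps)
        then show ?thesis
          unfolding A.to_zero[OF F_zero_obj[OF zp] a] A.zr_left[OF b F_Ob[OF MO]] .
      qed
      then have MB: "en M (Suc k) \<in> Ob B" using MO by (simp add: B_Ob)
      have YJ: "Y k = ?J k" using k by (simp add: Y_def)
      have "Ext_zero B i (en M (Suc k)) T" for i
      proof (cases i)
        case 0 then show ?thesis using hY[of k] YJ refJz(2)[OF k M zp] k by simp
      next
        case (Suc n)
        then show ?thesis using vY[of k n] YJ refJz(1)[OF k M zp] k B.Ext_zero_iff_vanishing[OF MB TO(1)] by simp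
      qed
      then have "is_zero_obj B (en M (Suc k))" using T MB by (auto simp: cotilting_def)
      then have "idt (en M (Suc k)) = zr (en M (Suc k)) (en M (Suc k))"
        using B.zero_obj_iff MB by (simp add: B_zero_mor)
      then show ?thesis using A.zero_obj_iff MO by blast
    qed
    have zall: "idt (en M i) = zr (en M i) (en M i)" if i: "1 <= i" "i <= p" for i
      using zk[of "i - 1"] zp i A.zero_obj_iff by (cases "i = p") auto
    have "ident R M = zero_mor R M M"
      using cm_id[OF M] cm_zero[OF M M] zall by (intro R_arr_eqI[OF R.arr_ident[OF M] R_zero_arr[OF M M]]) simp
    then show ?thesis using R.zero_obj_iff M by blast
  qed
  then show ?thesis using ext VO R_abelian by (simp add: cotilting_def)
qed

end

section \<open>Isomorphisms of categories and tagged morphisms\<close>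

text \<open>Bijections on objects and on Hom-sets, not merely an equivalence: quantifiers are then
  transferred by rewriting, and every defined notion is seen to be invariant.\<close>

locale cat_iso = category C for C :: "('o, 'm) cat" (structure) +
  fixes D :: "('p, 'n) cat" and Po :: "'o => 'p" and Pm :: "'m => 'n"
  assumes is_fun: "is_functor C D Po Pm" and Ob_bij: "bij_betw Po (Ob C) (Ob D)"
    and Hom_bij: "X \<in> Ob C ==> Y \<in> Ob C ==> bij_betw Pm (Hom C X Y) (Hom D (Po X) (Po Y))"
begin

lemma P_Ob[simp]: "X \<in> Ob C ==> Po X \<in> Ob D"
  using is_fun by (simp add: is_functor_def)

lemma P_eq[simp]: "X \<in> Ob C ==> Y \<in> Ob C ==> Po X = Po Y <-> X = Y"
  using Ob_bij by (auto simp: bij_betw_def inj_on_def)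

lemma P_ident: "X \<in> Ob C ==> ident D (Po X) = Pm (ident C X)"
  using is_fun by (simp add: is_functor_def)

lemma Pm_Hom[simp]: "X \<in> Ob C ==> Y \<in> Ob C ==> f \<in> Hom C X Y ==> Pm f \<in> Hom D (Po X) (Po Y)"
  using is_fun by (simp add: is_functor_def)

lemma Pm_cmp:
  "X \<in> Ob C ==> Y \<in> Ob C ==> Z \<in> Ob C ==> f \<in> Hom C X Y ==> g \<in> Hom C Y Z ==> Pm f ;;\<^bsub>D\<^esub> Pm g = Pm (f ;; g)"
  using is_fun unfolding is_functor_def by metis

lemma Pm_eq: "X \<in> Ob C ==> Y \<in> Ob C ==> f \<in> Hom C X Y ==> g \<in> Hom C X Y ==> Pm f = Pm g <-> f = g"
  using Hom_bij[of X Y] by (auto simp: bij_betw_def inj_on_def)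

lemma Ob_image: "Ob D = Po ` Ob C"
  using Ob_bij by (simp add: bij_betw_def)

lemma Hom_image: "X \<in> Ob C ==> Y \<in> Ob C ==> Hom D (Po X) (Po Y) = Pm ` Hom C X Y"
  using Hom_bij by (simp add: bij_betw_def)

lemma ball_Ob: "(\<forall>Y\<in>Ob D. \<Phi> Y) <-> (\<forall>X\<in>Ob C. \<Phi> (Po X))"
  by (simp add: Ob_image)

lemma bex_Ob: "(\<exists>Y\<in>Ob D. \<Phi> Y) <-> (\<exists>X\<in>Ob C. \<Phi> (Po X))"
  by (simp add: Ob_image)

lemma ball_Hom: "X \<in> Ob C ==> Y \<in> Ob C ==> (\<forall>f\<in>Hom D (Po X) (Po Y). \<Phi> f) <-> (\<forall>f\<in>Hom C X Y. \<Phi> (Pm f))"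
  by (simp add: Hom_image)

lemma bex_Hom: "X \<in> Ob C ==> Y \<in> Ob C ==> (\<exists>f\<in>Hom D (Po X) (Po Y). \<Phi> f) <-> (\<exists>f\<in>Hom C X Y. \<Phi> (Pm f))"
  by (simp add: Hom_image)

lemma ex1_Hom:
  assumes "X \<in> Ob C" "Y \<in> Ob C"
  shows "(\<exists>!f. f \<in> Hom D (Po X) (Po Y) \<and> \<Phi> f) <-> (\<exists>!f. f \<in> Hom C X Y \<and> \<Phi> (Pm f))"
proof -
  have "(\<exists>!f. f \<in> Hom D (Po X) (Po Y) \<and> \<Phi> f) <->
      (\<exists>f\<in>Hom D (Po X) (Po Y). \<Phi> f \<and> (\<forall>g\<in>Hom D (Po X) (Po Y). \<Phi> g --> g = f))"
    by blast
  also have "\<dots> <-> (\<exists>f\<in>Hom C X Y. \<Phi> (Pm f) \<and> (\<forall>g\<in>Hom C X Y. \<Phi> (Pm g) --> Pm g = Pm f))"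
    by (simp add: bex_Hom[OF assms] ball_Hom[OF assms])
  also have "\<dots> <-> (\<exists>!f. f \<in> Hom C X Y \<and> \<Phi> (Pm f))"
    using Pm_eq[OF assms] by blast
  finally show ?thesis .
qed

lemma category_image: "category D"
proof -
  have "\<forall>X\<in>Ob D. ident D X \<in> Hom D X X"
    by (simp add: ball_Ob P_ident ident_in_Hom)
  moreover have "\<forall>X\<in>Ob D. \<forall>Y\<in>Ob D. \<forall>Z\<in>Ob D. \<forall>f\<in>Hom D X Y. \<forall>g\<in>Hom D Y Z. f ;;\<^bsub>D\<^esub> g \<in> Hom D X Z"
    by (auto simp: ball_Ob ball_Hom Pm_cmp cmp_in_Hom)
  moreover have "\<forall>X\<in>Ob D. \<forall>Y\<in>Ob D. \<forall>f\<in>Hom D X Y. ident D X ;;\<^bsub>D\<^esub> f = f \<and> f ;;\<^bsub>D\<^esub> ident D Y = f"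
    by (auto simp: ball_Ob ball_Hom P_ident Pm_cmp[OF _ _ _ ident_in_Hom] Pm_cmp[OF _ _ _ _ ident_in_Hom] ident_left ident_right)
  moreover have "\<forall>W\<in>Ob D. \<forall>X\<in>Ob D. \<forall>Y\<in>Ob D. \<forall>Z\<in>Ob D. \<forall>f\<in>Hom D W X. \<forall>g\<in>Hom D X Y. \<forall>h\<in>Hom D Y Z.
      (f ;;\<^bsub>D\<^esub> g) ;;\<^bsub>D\<^esub> h = f ;;\<^bsub>D\<^esub> (g ;;\<^bsub>D\<^esub> h)"
  proof -
    have "(Pm f ;;\<^bsub>D\<^esub> Pm g) ;;\<^bsub>D\<^esub> Pm h = Pm f ;;\<^bsub>D\<^esub> (Pm g ;;\<^bsub>D\<^esub> Pm h)"
      if o: "W \<in> Ob C" "X \<in> Ob C" "Y \<in> Ob C" "Z \<in> Ob C" and m: "f \<in> Hom C W X" "g \<in> Hom C X Y" "h \<in> Hom C Y Z"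
      for W X Y Z f g h
      using Pm_cmp[OF o(1,2,3) m(1,2)] Pm_cmp[OF o(2,3,4) m(2,3)] Pm_cmp[OF o(1,3,4) cmp_in_Hom[OF o(1,2,3) m(1,2)] m(3)]
        Pm_cmp[OF o(1,2,4) m(1) cmp_in_Hom[OF o(2,3,4) m(2,3)]] cmp_assoc[OF o m] by simp
    then show ?thesis by (simp add: ball_Ob ball_Hom)
  qed
  ultimately show ?thesis by unfold_locales blast+
qed

lemma zero_obj_iff: "Z \<in> Ob C ==> is_zero_obj D (Po Z) <-> is_zero_obj C Z"
  unfolding is_zero_obj_def using ex1_Hom[where \<Phi> = "\<lambda>_. True"] by (simp add: ball_Ob)

lemma mono_iff:
  assumes "X \<in> Ob C" "Y \<in> Ob C" "f \<in> Hom C X Y"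
  shows "is_mono D (Po X) (Po Y) (Pm f) <-> is_mono C X Y f"
  using assms unfolding is_mono_def
  by (auto simp: ball_Ob ball_Hom Pm_cmp[OF _ assms(1,2) _ assms(3)] Pm_eq cmp_in_Hom[OF _ assms(1,2) _ assms(3)])

lemma epi_iff:
  assumes "X \<in> Ob C" "Y \<in> Ob C" "f \<in> Hom C X Y"
  shows "is_epi D (Po X) (Po Y) (Pm f) <-> is_epi C X Y f"
  using assms unfolding is_epi_def
  by (auto simp: ball_Ob ball_Hom Pm_cmp[OF assms(1,2) _ assms(3)] Pm_eq cmp_in_Hom[OF assms(1,2) _ assms(3)])

text \<open>Families of morphisms are pulled back pointwise by choice. The assumption
  \<open>cong\<close> reflects that a family is controlled only on \<open>I\<close>.\<close>

lemma all_fun: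
  assumes "\<And>i. i \<in> I ==> X i \<in> Ob C" "\<And>i. i \<in> I ==> Y i \<in> Ob C" and cong: "\<And>f g. (\<And>i. i \<in> I ==> f i = g i) ==> \<Phi> f = \<Phi> g"
  shows "(\<forall>f. (\<forall>i\<in>I. f i \<in> Hom D (Po (X i)) (Po (Y i))) --> \<Phi> f) <->
    (\<forall>f. (\<forall>i\<in>I. f i \<in> Hom C (X i) (Y i)) --> \<Phi> (\<lambda>i. Pm (f i)))"
proof (intro iffI allI impI)
  fix f assume a: "\<forall>f. (\<forall>i\<in>I. f i \<in> Hom C (X i) (Y i)) --> \<Phi> (\<lambda>i. Pm (f i))" and f: "\<forall>i\<in>I. f i \<in> Hom D (Po (X i)) (Po (Y i))"
  then have "\<forall>i\<in>I. \<exists>g. g \<in> Hom C (X i) (Y i) \<and> f i = Pm g" using Hom_image assms(1,2) by blast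
  from bchoice[OF this] obtain g where g: "\<forall>i\<in>I. g i \<in> Hom C (X i) (Y i) \<and> f i = Pm (g i)" by blast
  then have "\<Phi> (\<lambda>i. Pm (g i))" using a by blast
  also have "\<Phi> (\<lambda>i. Pm (g i)) = \<Phi> f" by (rule cong) (use g in simp)
  finally show "\<Phi> f" .
next
  fix f assume a: "\<forall>f. (\<forall>i\<in>I. f i \<in> Hom D (Po (X i)) (Po (Y i))) --> \<Phi> f" and f: "\<forall>i\<in>I. f i \<in> Hom C (X i) (Y i)"
  have "\<forall>i\<in>I. Pm (f i) \<in> Hom D (Po (X i)) (Po (Y i))" using f assms(1,2) by simp
  then show "\<Phi> (\<lambda>i. Pm (f i))" using spec[OF a, of "\<lambda>i. Pm (f i)"] by simp
qed

lemma ex_fun: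
  assumes "\<And>i. i \<in> I ==> X i \<in> Ob C" "\<And>i. i \<in> I ==> Y i \<in> Ob C" and cong: "\<And>f g. (\<And>i. i \<in> I ==> f i = g i) ==> \<Phi> f = \<Phi> g"
  shows "(\<exists>f. (\<forall>i\<in>I. f i \<in> Hom D (Po (X i)) (Po (Y i))) \<and> \<Phi> f) <->
    (\<exists>f. (\<forall>i\<in>I. f i \<in> Hom C (X i) (Y i)) \<and> \<Phi> (\<lambda>i. Pm (f i)))"
proof -
  have "(\<forall>f. (\<forall>i\<in>I. f i \<in> Hom D (Po (X i)) (Po (Y i))) --> \<not> \<Phi> f) <->
    (\<forall>f. (\<forall>i\<in>I. f i \<in> Hom C (X i) (Y i)) --> \<not> \<Phi> (\<lambda>i. Pm (f i)))"
    by (rule all_fun[where \<Phi> = "\<lambda>f. \<not> \<Phi> f", OF assms(1,2) arg_cong[where f = Not, OF cong]])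
  from arg_cong[where f = Not, OF this] show ?thesis by simp
qed

end

text \<open>\<open>zero_mor\<close> is a definite description, so its transfer is meaningful only
  once a zero object exists.\<close>

locale cat_iso_zero = cat_iso +
  assumes zero_ex: "\<exists>Z. is_zero_obj C Z"
begin

lemma zero_mor_Hom: assumes "X \<in> Ob C" "Y \<in> Ob C" shows "zero_mor C X Y \<in> Hom C X Y"
  by (metis arr_cmp arr_def zero_ex zero_obj_ex assms zero_mor_eq)

lemma P_zero_mor: assumes X: "X \<in> Ob C" and Y: "Y \<in> Ob C" shows "zero_mor D (Po X) (Po Y) = Pm (zero_mor C X Y)"
proof -
  interpret D: category D by (rule category_image)
  obtain Z where Z: "is_zero_obj C Z" using zero_ex by blast
  have ZO: "Z \<in> Ob C" using zero_objD(1)[OF Z] .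
  obtain a b where ab: "arr C a X Z" "arr C b Z Y" using zero_obj_ex[OF Z] X Y by blast
  have "arr D (Pm a) (Po X) (Po Z)" "arr D (Pm b) (Po Z) (Po Y)" using ab by (auto simp: arr_def)
  from D.zero_mor_eq[OF _ this] show ?thesis
    using zero_obj_iff[OF ZO] Z zero_mor_eq[OF Z ab] Pm_cmp[OF X ZO Y arrD(3)[OF ab(1)] arrD(3)[OF ab(2)]] by simp
qed

lemma Pm_eq_zero: "X \<in> Ob C ==> Y \<in> Ob C ==> f \<in> Hom C X Y ==> Pm f = zero_mor D (Po X) (Po Y) <-> f = zero_mor C X Y"
  by (simp add: P_zero_mor Pm_eq zero_mor_Hom)

lemma kernel_iff:
  assumes "X \<in> Ob C" "Y \<in> Ob C" "f \<in> Hom C X Y" "K \<in> Ob C" "k \<in> Hom C K X"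
  shows "is_kernel D (Po X) (Po Y) (Pm f) (Po K) (Pm k) <-> is_kernel C X Y f K k"
proof -
  have "(\<exists>!u. u \<in> Hom D (Po W) (Po K) \<and> u ;;\<^bsub>D\<^esub> Pm k = Pm h) <-> (\<exists>!u. u \<in> Hom C W K \<and> u ;; k = h)"
    if "W \<in> Ob C" "h \<in> Hom C W X" for W h
    unfolding ex1_Hom[OF that(1) assms(4)]
    by (rule arg_cong[where f = Ex1], rule ext) (use that assms Pm_cmp[OF that(1) assms(4,1) _ assms(5)]
      Pm_eq[OF that(1) assms(1) cmp_in_Hom[OF that(1) assms(4,1) _ assms(5)] that(2)] in auto)
  moreover have "Pm h ;;\<^bsub>D\<^esub> Pm f = zero_mor D (Po W) (Po Y) <-> h ;; f = zero_mor C W Y" if "W \<in> Ob C" "h \<in> Hom C W X" for W h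
    using that assms by (simp add: Pm_cmp[OF that(1) assms(1,2) that(2) assms(3)] Pm_eq_zero cmp_in_Hom[OF that(1) assms(1,2) that(2) assms(3)])
  ultimately show ?thesis
    unfolding is_kernel_def using assms by (simp add: ball_Ob ball_Hom)
qed

lemma cokernel_iff:
  assumes "X \<in> Ob C" "Y \<in> Ob C" "f \<in> Hom C X Y" "Q \<in> Ob C" "q \<in> Hom C Y Q"
  shows "is_cokernel D (Po X) (Po Y) (Pm f) (Po Q) (Pm q) <-> is_cokernel C X Y f Q q"
proof -
  have "(\<exists>!u. u \<in> Hom D (Po Q) (Po W) \<and> Pm q ;;\<^bsub>D\<^esub> u = Pm h) <-> (\<exists>!u. u \<in> Hom C Q W \<and> q ;; u = h)"
    if "W \<in> Ob C" "h \<in> Hom C Y W" for W h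
    unfolding ex1_Hom[OF assms(4) that(1)]
    by (rule arg_cong[where f = Ex1], rule ext) (use that assms Pm_cmp[OF assms(2,4) that(1) assms(5)]
      Pm_eq[OF assms(2) that(1) cmp_in_Hom[OF assms(2,4) that(1) assms(5)] that(2)] in auto)
  moreover have "Pm f ;;\<^bsub>D\<^esub> Pm h = zero_mor D (Po X) (Po W) <-> f ;; h = zero_mor C X W" if "W \<in> Ob C" "h \<in> Hom C Y W" for W h
    using that assms by (simp add: Pm_cmp[OF assms(1,2) that(1) assms(3) that(2)] Pm_eq_zero cmp_in_Hom[OF assms(1,2) that(1) assms(3) that(2)])
  ultimately show ?thesis
    unfolding is_cokernel_def using assms by (simp add: ball_Ob ball_Hom)
qed

lemma kernel_ex_iff:
  assumes "X \<in> Ob C" "Y \<in> Ob C" "f \<in> Hom C X Y"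
  shows "(\<exists>K k. is_kernel D (Po X) (Po Y) (Pm f) K k) <-> (\<exists>K k. is_kernel C X Y f K k)"
proof -
  have "(\<exists>K k. is_kernel D (Po X) (Po Y) (Pm f) K k) <->
      (\<exists>K\<in>Ob D. \<exists>k\<in>Hom D K (Po X). is_kernel D (Po X) (Po Y) (Pm f) K k)"
    by (auto simp: is_kernel_def)
  also have "\<dots> <-> (\<exists>K\<in>Ob C. \<exists>k\<in>Hom C K X. is_kernel C X Y f K k)"
    using assms by (simp add: bex_Ob bex_Hom kernel_iff)
  also have "\<dots> <-> (\<exists>K k. is_kernel C X Y f K k)" by (auto simp: is_kernel_def)
  finally show ?thesis .
qed

lemma cokernel_ex_iff:
  assumes "X \<in> Ob C" "Y \<in> Ob C" "f \<in> Hom C X Y"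
  shows "(\<exists>Q q. is_cokernel D (Po X) (Po Y) (Pm f) Q q) <-> (\<exists>Q q. is_cokernel C X Y f Q q)"
proof -
  have "(\<exists>Q q. is_cokernel D (Po X) (Po Y) (Pm f) Q q) <->
      (\<exists>Q\<in>Ob D. \<exists>q\<in>Hom D (Po Y) Q. is_cokernel D (Po X) (Po Y) (Pm f) Q q)"
    by (auto simp: is_cokernel_def)
  also have "\<dots> <-> (\<exists>Q\<in>Ob C. \<exists>q\<in>Hom C Y Q. is_cokernel C X Y f Q q)"
    using assms by (simp add: bex_Ob bex_Hom cokernel_iff)
  also have "\<dots> <-> (\<exists>Q q. is_cokernel C X Y f Q q)" by (auto simp: is_cokernel_def)
  finally show ?thesis .
qed

lemma short_exact_iff:
  assumes "X \<in> Ob C" "Y \<in> Ob C" "Z \<in> Ob C" "f \<in> Hom C X Y" "g \<in> Hom C Y Z"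
  shows "short_exact D (Po X) (Pm f) (Po Y) (Pm g) (Po Z) <-> short_exact C X f Y g Z"
  using assms by (simp add: short_exact_def kernel_iff cokernel_iff)

lemma exact_at_iff:
  assumes "X \<in> Ob C" "Y \<in> Ob C" "Z \<in> Ob C" "f \<in> Hom C X Y" "g \<in> Hom C Y Z"
  shows "exact_at D (Po X) (Pm f) (Po Y) (Pm g) (Po Z) <-> exact_at C X f Y g Z"
proof -
  have m: "is_kernel C X Y f K k ==> K \<in> Ob C \<and> k \<in> Hom C K X" "is_cokernel C X Y f K k ==> K \<in> Ob C \<and> k \<in> Hom C Y K"
    "is_kernel D X' Y' f' K' k' ==> K' \<in> Ob D \<and> k' \<in> Hom D K' X'" "is_cokernel D X' Y' f' K' k' ==> K' \<in> Ob D \<and> k' \<in> Hom D Y' K'"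
    for X Y f K k X' Y' f' K' k'
    by (simp_all add: is_kernel_def is_cokernel_def)
  have "exact_at D (Po X) (Pm f) (Po Y) (Pm g) (Po Z) <->
    (\<exists>Q\<in>Ob D. \<exists>q\<in>Hom D (Po Y) Q. \<exists>I\<in>Ob D. \<exists>i\<in>Hom D I (Po Y). is_cokernel D (Po X) (Po Y) (Pm f) Q q \<and>
      is_kernel D (Po Y) Q q I i \<and> is_kernel D (Po Y) (Po Z) (Pm g) I i)"
    unfolding exact_at_def Bex_def by (meson m)
  also have "\<dots> <-> (\<exists>Q\<in>Ob C. \<exists>q\<in>Hom C Y Q. \<exists>I\<in>Ob C. \<exists>i\<in>Hom C I Y. is_cokernel C X Y f Q q \<and>
      is_kernel C Y Q q I i \<and> is_kernel C Y Z g I i)"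
    using assms by (simp add: bex_Ob bex_Hom kernel_iff cokernel_iff)
  also have "\<dots> <-> exact_at C X f Y g Z"
    unfolding exact_at_def Bex_def by (meson m)
  finally show ?thesis .
qed

lemma direct_sum_iff:
  assumes E: "E \<in> Ob C" and S: "\<And>i. i \<in> I ==> S i \<in> Ob C" and S': "\<And>i. i \<in> I ==> S' i = Po (S i)"
  shows "is_direct_sum D I S' (Po E) <-> is_direct_sum C I S E"
proof -
  \<comment> \<open>The definition nests quantifiers over families. Naming its clauses allows the
    outer families of injections and projections to be transferred by \<open>ex_fun\<close> and the
    inner test families by \<open>all_fun\<close>, each separately.\<close>
  define UD where "UD inj <-> (\<forall>W\<in>Ob D. \<forall>g. (\<forall>i\<in>I. g i \<in> Hom D (Po (S i)) W) -->
    (\<exists>!u. u \<in> Hom D (Po E) W \<and> (\<forall>i\<in>I. inj i ;;\<^bsub>D\<^esub> u = g i)))" for inj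
  define UC where "UC inj <-> (\<forall>W\<in>Ob C. \<forall>g. (\<forall>i\<in>I. g i \<in> Hom C (S i) W) -->
    (\<exists>!u. u \<in> Hom C E W \<and> (\<forall>i\<in>I. inj i ;; u = g i)))" for inj
  define VD where "VD prj <-> (\<forall>W\<in>Ob D. \<forall>g. (\<forall>i\<in>I. g i \<in> Hom D W (Po (S i))) -->
    (\<exists>!u. u \<in> Hom D W (Po E) \<and> (\<forall>i\<in>I. u ;;\<^bsub>D\<^esub> prj i = g i)))" for prj
  define VC where "VC prj <-> (\<forall>W\<in>Ob C. \<forall>g. (\<forall>i\<in>I. g i \<in> Hom C W (S i)) -->
    (\<exists>!u. u \<in> Hom C W E \<and> (\<forall>i\<in>I. u ;; prj i = g i)))" for prj
  define AD where "AD inj prj <-> (\<forall>i\<in>I. \<forall>j\<in>I. inj i ;;\<^bsub>D\<^esub> prj j =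
    (if i = j then ident D (Po (S i)) else zero_mor D (Po (S i)) (Po (S j))))" for inj prj
  define AC where "AC inj prj <-> (\<forall>i\<in>I. \<forall>j\<in>I. inj i ;; prj j =
    (if i = j then ident C (S i) else zero_mor C (S i) (S j)))" for inj prj
  define QD where "QD inj <-> (\<exists>prj. (\<forall>i\<in>I. prj i \<in> Hom D (Po E) (Po (S i))) \<and> AD inj prj \<and> UD inj \<and> VD prj)" for inj
  have U: "UD (\<lambda>i. Pm (inj i)) <-> UC inj" if inj: "\<forall>i\<in>I. inj i \<in> Hom C (S i) E" for inj
  proof -
    have "(\<forall>g. (\<forall>i\<in>I. g i \<in> Hom D (Po (S i)) (Po W)) --> (\<exists>!u. u \<in> Hom D (Po E) (Po W) \<and> (\<forall>i\<in>I. Pm (inj i) ;;\<^bsub>D\<^esub> u = g i))) <->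
      (\<forall>g. (\<forall>i\<in>I. g i \<in> Hom C (S i) W) --> (\<exists>!u. u \<in> Hom C E W \<and> (\<forall>i\<in>I. inj i ;; u = g i)))" (is "?L <-> ?R")
      if W: "W \<in> Ob C" for W
    proof -
      have "?L <-> (\<forall>g. (\<forall>i\<in>I. g i \<in> Hom C (S i) W) -->
          (\<exists>!u. u \<in> Hom D (Po E) (Po W) \<and> (\<forall>i\<in>I. Pm (inj i) ;;\<^bsub>D\<^esub> u = Pm (g i))))"
        by (rule all_fun) (simp_all add: S W)
      also have "\<dots> <-> ?R"
      proof (rule arg_cong[where f = All], rule ext, rule imp_cong[OF refl])
        fix g assume g: "\<forall>i\<in>I. g i \<in> Hom C (S i) W"
        have "(u \<in> Hom C E W \<and> (\<forall>i\<in>I. Pm (inj i) ;;\<^bsub>D\<^esub> Pm u = Pm (g i))) <-> (u \<in> Hom C E W \<and> (\<forall>i\<in>I. inj i ;; u = g i))" for u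
        proof (rule conj_cong[OF refl], rule ball_cong[OF refl])
          fix i assume u: "u \<in> Hom C E W" and i: "i \<in> I"
          show "Pm (inj i) ;;\<^bsub>D\<^esub> Pm u = Pm (g i) <-> inj i ;; u = g i"
            using Pm_cmp[OF S[OF i] E W bspec[OF inj i] u] Pm_eq[OF S[OF i] W cmp_in_Hom[OF S[OF i] E W bspec[OF inj i] u] bspec[OF g i]] by simp
        qed
        then show "(\<exists>!u. u \<in> Hom D (Po E) (Po W) \<and> (\<forall>i\<in>I. Pm (inj i) ;;\<^bsub>D\<^esub> u = Pm (g i))) <->
            (\<exists>!u. u \<in> Hom C E W \<and> (\<forall>i\<in>I. inj i ;; u = g i))"
          unfolding ex1_Hom[OF E W] by simp
      qed
      finally show ?thesis .
    qed
    then show ?thesis unfolding UD_def UC_def by (simp add: ball_Ob)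
  qed
  have V: "VD (\<lambda>i. Pm (prj i)) <-> VC prj" if prj: "\<forall>i\<in>I. prj i \<in> Hom C E (S i)" for prj
  proof -
    have "(\<forall>g. (\<forall>i\<in>I. g i \<in> Hom D (Po W) (Po (S i))) --> (\<exists>!u. u \<in> Hom D (Po W) (Po E) \<and> (\<forall>i\<in>I. u ;;\<^bsub>D\<^esub> Pm (prj i) = g i))) <->
      (\<forall>g. (\<forall>i\<in>I. g i \<in> Hom C W (S i)) --> (\<exists>!u. u \<in> Hom C W E \<and> (\<forall>i\<in>I. u ;; prj i = g i)))" (is "?L <-> ?R")
      if W: "W \<in> Ob C" for W
    proof -
      have "?L <-> (\<forall>g. (\<forall>i\<in>I. g i \<in> Hom C W (S i)) -->
          (\<exists>!u. u \<in> Hom D (Po W) (Po E) \<and> (\<forall>i\<in>I. u ;;\<^bsub>D\<^esub> Pm (prj i) = Pm (g i))))"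
        by (rule all_fun) (simp_all add: S W)
      also have "\<dots> <-> ?R"
      proof (rule arg_cong[where f = All], rule ext, rule imp_cong[OF refl])
        fix g assume g: "\<forall>i\<in>I. g i \<in> Hom C W (S i)"
        have "(u \<in> Hom C W E \<and> (\<forall>i\<in>I. Pm u ;;\<^bsub>D\<^esub> Pm (prj i) = Pm (g i))) <-> (u \<in> Hom C W E \<and> (\<forall>i\<in>I. u ;; prj i = g i))" for u
        proof (rule conj_cong[OF refl], rule ball_cong[OF refl])
          fix i assume u: "u \<in> Hom C W E" and i: "i \<in> I"
          show "Pm u ;;\<^bsub>D\<^esub> Pm (prj i) = Pm (g i) <-> u ;; prj i = g i"
            using Pm_cmp[OF W E S[OF i] u bspec[OF prj i]] Pm_eq[OF W S[OF i] cmp_in_Hom[OF W E S[OF i] u bspec[OF prj i]] bspec[OF g i]] by simp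
        qed
        then show "(\<exists>!u. u \<in> Hom D (Po W) (Po E) \<and> (\<forall>i\<in>I. u ;;\<^bsub>D\<^esub> Pm (prj i) = Pm (g i))) <->
            (\<exists>!u. u \<in> Hom C W E \<and> (\<forall>i\<in>I. u ;; prj i = g i))"
          unfolding ex1_Hom[OF W E] by simp
      qed
      finally show ?thesis .
    qed
    then show ?thesis unfolding VD_def VC_def by (simp add: ball_Ob)
  qed
  have AA: "AD (\<lambda>i. Pm (inj i)) (\<lambda>i. Pm (prj i)) <-> AC inj prj"
    if inj: "\<forall>i\<in>I. inj i \<in> Hom C (S i) E" and prj: "\<forall>i\<in>I. prj i \<in> Hom C E (S i)" for inj prj
    unfolding AD_def AC_def
  proof (intro ball_cong refl)
    fix i j assume i: "i \<in> I" and j: "j \<in> I"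
    have c: "inj i ;; prj j \<in> Hom C (S i) (S j)" using cmp_in_Hom[OF S[OF i] E S[OF j] bspec[OF inj i] bspec[OF prj j]] .
    have e: "(if i = j then ident D (Po (S i)) else zero_mor D (Po (S i)) (Po (S j))) =
      Pm (if i = j then ident C (S i) else zero_mor C (S i) (S j))" using S[OF i] S[OF j] by (simp add: P_ident P_zero_mor)
    show "Pm (inj i) ;;\<^bsub>D\<^esub> Pm (prj j) = (if i = j then ident D (Po (S i)) else zero_mor D (Po (S i)) (Po (S j))) <->
      inj i ;; prj j = (if i = j then ident C (S i) else zero_mor C (S i) (S j))"
      unfolding e Pm_cmp[OF S[OF i] E S[OF j] bspec[OF inj i] bspec[OF prj j]]
      by (rule Pm_eq[OF S[OF i] S[OF j] c]) (use S[OF i] S[OF j] in \<open>auto simp: ident_in_Hom zero_mor_Hom\<close>)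
  qed
  have "is_direct_sum D I S' (Po E) <-> is_direct_sum D I (\<lambda>i. Po (S i)) (Po E)"
    unfolding is_direct_sum_def using S' by (simp cong: conj_cong)
  also have "\<dots> <-> (\<exists>inj. (\<forall>i\<in>I. inj i \<in> Hom D (Po (S i)) (Po E)) \<and> QD inj)"
    unfolding is_direct_sum_def QD_def AD_def UD_def VD_def using E S by (simp add: ball_conj_distrib)
  also have "\<dots> <-> (\<exists>inj. (\<forall>i\<in>I. inj i \<in> Hom C (S i) E) \<and> QD (\<lambda>i. Pm (inj i)))"
    by (rule ex_fun) (simp_all add: S E QD_def AD_def UD_def)
  also have "\<dots> <-> (\<exists>inj. (\<forall>i\<in>I. inj i \<in> Hom C (S i) E) \<and>
      (\<exists>prj. (\<forall>i\<in>I. prj i \<in> Hom C E (S i)) \<and> AC inj prj \<and> UC inj \<and> VC prj))"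
  proof (rule arg_cong[where f = Ex], rule ext, rule conj_cong[OF refl])
    fix inj assume inj: "\<forall>i\<in>I. inj i \<in> Hom C (S i) E"
    have "QD (\<lambda>i. Pm (inj i)) <-> (\<exists>prj. (\<forall>i\<in>I. prj i \<in> Hom C E (S i)) \<and>
        AD (\<lambda>i. Pm (inj i)) (\<lambda>i. Pm (prj i)) \<and> UD (\<lambda>i. Pm (inj i)) \<and> VD (\<lambda>i. Pm (prj i)))"
      unfolding QD_def by (rule ex_fun) (simp_all add: S E AD_def VD_def)
    then show "QD (\<lambda>i. Pm (inj i)) <-> (\<exists>prj. (\<forall>i\<in>I. prj i \<in> Hom C E (S i)) \<and> AC inj prj \<and> UC inj \<and> VC prj)"
      using AA[OF inj] U[OF inj] V by (simp cong: conj_cong)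
  qed
  also have "\<dots> <-> is_direct_sum C I S E"
    unfolding is_direct_sum_def AC_def UC_def VC_def using E S by (simp add: ball_conj_distrib)
  finally show ?thesis .
qed

lemma abelian_iff: "abelian_category D <-> abelian_category C"
proof -
  interpret D: category D by (rule category_image)
  have ds: "(\<exists>E. is_direct_sum2 D (Po X) (Po Y) E) <-> (\<exists>E. is_direct_sum2 C X Y E)" if "X \<in> Ob C" "Y \<in> Ob C" for X Y
  proof -
    have "(\<exists>E. is_direct_sum2 D (Po X) (Po Y) E) <-> (\<exists>E\<in>Ob D. is_direct_sum2 D (Po X) (Po Y) E)"
      by (auto simp: is_direct_sum_def)
    also have "\<dots> <-> (\<exists>E\<in>Ob C. is_direct_sum2 C X Y E)"
      unfolding bex_Ob using that by (intro bex_cong refl direct_sum_iff) auto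
    also have "\<dots> <-> (\<exists>E. is_direct_sum2 C X Y E)" by (auto simp: is_direct_sum_def)
    finally show ?thesis .
  qed
  have m: "is_mono D X Y f ==> f \<in> Hom D X Y" "is_epi D X Y f ==> f \<in> Hom D X Y"
    "is_mono C X' Y' f' ==> f' \<in> Hom C X' Y'" "is_epi C X' Y' f' ==> f' \<in> Hom C X' Y'" for X Y f X' Y' f'
    by (auto simp: is_mono_def is_epi_def)
  have "abelian_category D <-> (\<exists>Z. is_zero_obj D Z) \<and> (\<forall>X\<in>Ob D. \<forall>Y\<in>Ob D. (\<exists>E. is_direct_sum2 D X Y E) \<and>
    (\<forall>f\<in>Hom D X Y. (\<exists>K k. is_kernel D X Y f K k) \<and> (\<exists>Q q. is_cokernel D X Y f Q q) \<and>
      (is_mono D X Y f --> (\<exists>Z\<in>Ob D. \<exists>g\<in>Hom D Y Z. is_kernel D Y Z g X f)) \<and>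
      (is_epi D X Y f --> (\<exists>W\<in>Ob D. \<exists>g\<in>Hom D W X. is_cokernel D W X g Y f))))"
    unfolding abelian_category_def abelian_category_axioms_def using D.category_axioms m(1,2) by blast
  also have "(\<exists>Z. is_zero_obj D Z) <-> (\<exists>Z. is_zero_obj C Z)"
    using zero_ex zero_obj_iff by (metis is_zero_obj_def)
  also have "(\<exists>Z. is_zero_obj C Z) \<and> (\<forall>X\<in>Ob D. \<forall>Y\<in>Ob D. (\<exists>E. is_direct_sum2 D X Y E) \<and>
    (\<forall>f\<in>Hom D X Y. (\<exists>K k. is_kernel D X Y f K k) \<and> (\<exists>Q q. is_cokernel D X Y f Q q) \<and>
      (is_mono D X Y f --> (\<exists>Z\<in>Ob D. \<exists>g\<in>Hom D Y Z. is_kernel D Y Z g X f)) \<and>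
      (is_epi D X Y f --> (\<exists>W\<in>Ob D. \<exists>g\<in>Hom D W X. is_cokernel D W X g Y f)))) <->
    (\<exists>Z. is_zero_obj C Z) \<and> (\<forall>X\<in>Ob C. \<forall>Y\<in>Ob C. (\<exists>E. is_direct_sum2 C X Y E) \<and>
    (\<forall>f\<in>Hom C X Y. (\<exists>K k. is_kernel C X Y f K k) \<and> (\<exists>Q q. is_cokernel C X Y f Q q) \<and>
      (is_mono C X Y f --> (\<exists>Z\<in>Ob C. \<exists>g\<in>Hom C Y Z. is_kernel C Y Z g X f)) \<and>
      (is_epi C X Y f --> (\<exists>W\<in>Ob C. \<exists>g\<in>Hom C W X. is_cokernel C W X g Y f))))"
    by (simp add: ball_Ob bex_Ob ball_Hom bex_Hom ds kernel_ex_iff cokernel_ex_iff mono_iff epi_iff kernel_iff cokernel_iff)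
  also have "\<dots> <-> abelian_category C"
    unfolding abelian_category_def abelian_category_axioms_def using category_axioms m(3,4) by blast
  finally show ?thesis .
qed

definition ext_map where "ext_map n x = (\<lambda>i\<in>{0..Suc n}. Po (fst x i), \<lambda>i\<in>{0..n}. Pm (snd x i))"

lemma ext_map_iff:
  assumes O: "X \<in> Ob C" "Y \<in> Ob C" and E: "E \<in> {0..Suc n} \<rightarrow>\<^sub>E Ob C" and d: "d \<in> (\<Pi>\<^sub>E i\<in>{0..n}. Hom C (E i) (E (Suc i)))" and n: "n > 0"
  shows "ext_map n (E, d) \<in> extensions D n (Po X) (Po Y) <-> (E, d) \<in> extensions C n X Y"
proof -
  have EO: "E i \<in> Ob C" if "i <= Suc n" for i using E that by (auto simp: PiE_iff)
  have dH: "d i \<in> Hom C (E i) (E (Suc i))" if "i <= n" for i using d that by (auto simp: PiE_iff)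
  have m: "is_mono D (Po (E 0)) (Po (E 1)) (Pm (d 0)) <-> is_mono C (E 0) (E 1) (d 0)"
    using mono_iff[OF EO EO dH, of 0] n by simp
  have e: "is_epi D (Po (E n)) (Po (E (Suc n))) (Pm (d n)) <-> is_epi C (E n) (E (Suc n)) (d n)"
    using epi_iff[OF EO EO dH, of n] by simp
  have x: "exact_at D (Po (E (i - 1))) (Pm (d (i - 1))) (Po (E i)) (Pm (d i)) (Po (E (Suc i))) <->
    exact_at C (E (i - 1)) (d (i - 1)) (E i) (d i) (E (Suc i))" if "i \<in> {1..n}" for i
  proof -
    have i: "i - 1 <= n" "i - 1 <= Suc n" "i <= Suc n" "Suc i <= Suc n" "i <= n" "Suc (i - 1) = i" using that by auto
    show ?thesis using exact_at_iff[OF EO[OF i(2)] EO[OF i(3)] EO[OF i(4)] dH[OF i(1), unfolded i(6)] dH[OF i(5)]] .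
  qed
  have "(\<forall>i\<in>{1..n}. exact_at D (Po (E (i - 1))) (Pm (d (i - 1))) (Po (E i)) (Pm (d i)) (Po (E (Suc i)))) <->
    (\<forall>i\<in>{1..n}. exact_at C (E (i - 1)) (d (i - 1)) (E i) (d i) (E (Suc i)))"
    by (rule ball_cong[OF refl x])
  moreover have "(\<lambda>i\<in>{0..Suc n}. Po (E i)) \<in> {0..Suc n} \<rightarrow>\<^sub>E Ob D" using EO by auto
  moreover have "(\<lambda>i\<in>{0..n}. Pm (d i)) \<in> (\<Pi>\<^sub>E i\<in>{0..n}. Hom D ((\<lambda>i\<in>{0..Suc n}. Po (E i)) i) ((\<lambda>i\<in>{0..Suc n}. Po (E i)) (Suc i)))"
    using EO dH by (auto simp: PiE_iff)
  moreover have "(\<forall>i\<in>{1..n}. exact_at D ((\<lambda>i\<in>{0..Suc n}. Po (E i)) (i - 1)) ((\<lambda>i\<in>{0..n}. Pm (d i)) (i - 1)) ((\<lambda>i\<in>{0..Suc n}. Po (E i)) i)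
      ((\<lambda>i\<in>{0..n}. Pm (d i)) i) ((\<lambda>i\<in>{0..Suc n}. Po (E i)) (Suc i))) <->
    (\<forall>i\<in>{1..n}. exact_at D (Po (E (i - 1))) (Pm (d (i - 1))) (Po (E i)) (Pm (d i)) (Po (E (Suc i))))"
    by (rule ball_cong[OF refl]) auto
  ultimately show ?thesis
    using E d m e n O EO by (simp add: extensions_def ext_map_def)
qed

lemma extD:
  assumes "x \<in> extensions C n X Y"
  shows "fst x \<in> {0..Suc n} \<rightarrow>\<^sub>E Ob C" "snd x \<in> (\<Pi>\<^sub>E i\<in>{0..n}. Hom C (fst x i) (fst x (Suc i)))"
    "i <= Suc n ==> fst x i \<in> Ob C" "i <= n ==> snd x i \<in> Hom C (fst x i) (fst x (Suc i))" "fst x 0 = Y" "fst x (Suc n) = X"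
  using assms by (auto simp: extensions_def PiE_iff)

lemma extensions_image:
  assumes O: "X \<in> Ob C" "Y \<in> Ob C" and n: "n > 0"
  shows "extensions D n (Po X) (Po Y) = ext_map n ` extensions C n X Y"
proof (intro equalityI subsetI)
  fix y assume y: "y \<in> extensions D n (Po X) (Po Y)"
  obtain E' d' where yE: "y = (E', d')" by (cases y)
  have E': "E' \<in> {0..Suc n} \<rightarrow>\<^sub>E Ob D" and d': "d' \<in> (\<Pi>\<^sub>E i\<in>{0..n}. Hom D (E' i) (E' (Suc i)))"
    using y unfolding yE extensions_def by blast+
  have "\<forall>i\<in>{0..Suc n}. \<exists>Z. Z \<in> Ob C \<and> E' i = Po Z" using E' unfolding Ob_image by (auto simp: PiE_iff)
  from bchoice[OF this] obtain E where E: "\<forall>i\<in>{0..Suc n}. E i \<in> Ob C \<and> E' i = Po (E i)" by blast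
  have "\<forall>i\<in>{0..n}. \<exists>f. f \<in> Hom C (E i) (E (Suc i)) \<and> d' i = Pm f"
  proof
    fix i assume i: "i \<in> {0..n}"
    then have "d' i \<in> Hom D (Po (E i)) (Po (E (Suc i)))" using d' E by (auto simp: PiE_iff)
    then show "\<exists>f. f \<in> Hom C (E i) (E (Suc i)) \<and> d' i = Pm f" using Hom_image[of "E i" "E (Suc i)"] E i by auto
  qed
  from bchoice[OF this] obtain d where d: "\<forall>i\<in>{0..n}. d i \<in> Hom C (E i) (E (Suc i)) \<and> d' i = Pm (d i)" by blast
  let ?E = "\<lambda>i\<in>{0..Suc n}. E i" and ?d = "\<lambda>i\<in>{0..n}. d i"
  have "E' = (\<lambda>i\<in>{0..Suc n}. Po (?E i))" by (rule PiE_ext[OF E']) (use E in auto)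
  moreover have "d' = (\<lambda>i\<in>{0..n}. Pm (?d i))"
    by (rule extensionalityI[of _ "{0..n}"]) (use d d' in \<open>auto simp: PiE_iff\<close>)
  ultimately have ye: "y = ext_map n (?E, ?d)" unfolding yE ext_map_def by simp
  have "(?E, ?d) \<in> extensions C n X Y"
    using y ext_map_iff[OF O _ _ n, of ?E ?d] E d unfolding ye by (auto simp: PiE_iff)
  then show "y \<in> ext_map n ` extensions C n X Y" unfolding ye by blast
next
  fix y assume "y \<in> ext_map n ` extensions C n X Y"
  then obtain x where x: "x \<in> extensions C n X Y" "y = ext_map n x" by blast
  then show "y \<in> extensions D n (Po X) (Po Y)"
    using ext_map_iff[OF O extD(1,2)[OF x(1)] n] by simp
qed

lemma ext_map_inj:
  assumes x: "x \<in> extensions C n X Y" and y: "y \<in> extensions C n X Y" and e: "ext_map n x = ext_map n y"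
  shows "x = y"
proof -
  have "Po (fst x i) = Po (fst y i)" if "i <= Suc n" for i
    using fun_cong[OF arg_cong[where f = fst, OF e], of i] that by (simp add: ext_map_def)
  then have 1: "fst x i = fst y i" if "i <= Suc n" for i using P_eq[OF extD(3)[OF x that] extD(3)[OF y that]] that by blast
  have "Pm (snd x i) = Pm (snd y i)" if "i <= n" for i
    using fun_cong[OF arg_cong[where f = snd, OF e], of i] that by (simp add: ext_map_def)
  moreover have "snd x i \<in> Hom C (fst y i) (fst y (Suc i))" if "i <= n" for i
    using extD(4)[OF x that] 1 that by simp
  ultimately have 2: "snd x i = snd y i" if "i <= n" for i
    using Pm_eq[OF extD(3)[OF y le_SucI[OF that]] extD(3)[OF y iffD2[OF Suc_le_mono that]] _ extD(4)[OF y that]] that by blast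
  have "fst x = fst y" by (rule PiE_ext[OF extD(1)[OF x] extD(1)[OF y]]) (use 1 in auto)
  moreover have "snd x = snd y"
    by (rule extensionalityI[of _ "{0..n}"]) (use 2 extD(2)[OF x] extD(2)[OF y] in \<open>auto simp: PiE_iff\<close>)
  ultimately show ?thesis by (rule prod_eqI)
qed

lemma step_iff:
  assumes O: "X \<in> Ob C" "Y \<in> Ob C" and n: "n > 0" and x: "x \<in> extensions C n X Y" and y: "y \<in> extensions C n X Y"
  shows "(ext_map n x, ext_map n y) \<in> extension_step D n (Po X) (Po Y) <-> (x, y) \<in> extension_step C n X Y"
proof -
  let ?I = "{0..Suc n}"
  define Q where "Q u <-> u 0 = ident D (Po Y) \<and> u (Suc n) = ident D (Po X) \<and>
      (\<forall>i\<in>{0..n}. Pm (snd x i) ;;\<^bsub>D\<^esub> u (Suc i) = u i ;;\<^bsub>D\<^esub> Pm (snd y i))" for u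
  have X: "i \<in> ?I ==> fst x i \<in> Ob C" "i \<in> ?I ==> fst y i \<in> Ob C" for i
    using extD(3)[OF x] extD(3)[OF y] by auto
  have "(ext_map n x, ext_map n y) \<in> extension_step D n (Po X) (Po Y) <->
      (\<exists>u. (\<forall>i\<in>?I. u i \<in> Hom D (Po (fst x i)) (Po (fst y i))) \<and> Q u)"
    using extensions_image[OF O n] x y unfolding extension_step_def Q_def by (simp add: ext_map_def split_beta)
  also have "\<dots> <-> (\<exists>u. (\<forall>i\<in>?I. u i \<in> Hom C (fst x i) (fst y i)) \<and> Q (\<lambda>i. Pm (u i)))"
    by (rule ex_fun[OF X]) (auto simp: Q_def)
  also have "\<dots> <-> (\<exists>u. (\<forall>i\<in>?I. u i \<in> Hom C (fst x i) (fst y i)) \<and> u 0 = ident C Y \<and> u (Suc n) = ident C X \<and>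
      (\<forall>i\<in>{0..n}. snd x i ;; u (Suc i) = u i ;; snd y i))"
  proof (rule arg_cong[where f = Ex], rule ext, rule conj_cong[OF refl])
    fix u assume u: "\<forall>i\<in>?I. u i \<in> Hom C (fst x i) (fst y i)"
    have uY: "u 0 \<in> Hom C Y Y" "u (Suc n) \<in> Hom C X X"
      using bspec[OF u, of 0] bspec[OF u, of "Suc n"] extD(5,6)[OF x] extD(5,6)[OF y] by auto
    have sq: "Pm (snd x i) ;;\<^bsub>D\<^esub> Pm (u (Suc i)) = Pm (u i) ;;\<^bsub>D\<^esub> Pm (snd y i) <-> snd x i ;; u (Suc i) = u i ;; snd y i"
      if i: "i \<in> {0..n}" for i
    proof -
      have o: "fst x i \<in> Ob C" "fst x (Suc i) \<in> Ob C" "fst y i \<in> Ob C" "fst y (Suc i) \<in> Ob C" using X i by auto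
      have h: "snd x i \<in> Hom C (fst x i) (fst x (Suc i))" "snd y i \<in> Hom C (fst y i) (fst y (Suc i))"
        using extD(4)[OF x] extD(4)[OF y] i by auto
      have h2: "u i \<in> Hom C (fst x i) (fst y i)" "u (Suc i) \<in> Hom C (fst x (Suc i)) (fst y (Suc i))" using u i by auto
      show ?thesis
        unfolding Pm_cmp[OF o(1,2,4) h(1) h2(2)] Pm_cmp[OF o(1,3,4) h2(1) h(2)]
        by (rule Pm_eq[OF o(1,4) cmp_in_Hom[OF o(1,2,4) h(1) h2(2)] cmp_in_Hom[OF o(1,3,4) h2(1) h(2)]])
    qed
    show "Q (\<lambda>i. Pm (u i)) <-> u 0 = ident C Y \<and> u (Suc n) = ident C X \<and>
        (\<forall>i\<in>{0..n}. snd x i ;; u (Suc i) = u i ;; snd y i)"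
      unfolding Q_def P_ident[OF O(1)] P_ident[OF O(2)] Pm_eq[OF O(2,2) uY(1) ident_in_Hom[OF O(2)]] Pm_eq[OF O(1,1) uY(2) ident_in_Hom[OF O(1)]]
      using ball_cong[OF refl sq, of "{0..n}" "\<lambda>i. i"] sq by (auto cong: ball_cong)
  qed
  also have "\<dots> <-> (x, y) \<in> extension_step C n X Y"
    using x y unfolding extension_step_def by (simp add: split_beta)
  finally show ?thesis .
qed

text \<open>\<open>ext_map\<close> is a bijection between the sets of extensions that preserves and
  reflects single steps, hence also the equivalence generated by them.\<close>

lemma Ext_zero_iff:
  assumes O: "X \<in> Ob C" "Y \<in> Ob C"
  shows "Ext_zero D n (Po X) (Po Y) <-> Ext_zero C n X Y"
proof (cases n)
  case 0
  have "Hom C X Y = {zero_mor C X Y} <-> (\<forall>f\<in>Hom C X Y. f = zero_mor C X Y)" using zero_mor_Hom[OF O] by blast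
  also have "\<dots> <-> (\<forall>f\<in>Hom D (Po X) (Po Y). f = zero_mor D (Po X) (Po Y))"
    using ball_Hom[OF O] Pm_eq_zero[OF O] by simp
  also have "\<dots> <-> Hom D (Po X) (Po Y) = {zero_mor D (Po X) (Po Y)}"
    using Pm_Hom[OF O zero_mor_Hom[OF O]] unfolding P_zero_mor[OF O, symmetric] by blast
  finally show ?thesis using 0 by (simp add: Ext_zero_def)
next
  case (Suc m)
  have n: "n > 0" using Suc by simp
  let ?C = "extensions C n X Y" and ?D = "extensions D n (Po X) (Po Y)"
  let ?RC = "(extension_step C n X Y \<union> (extension_step C n X Y)\<inverse>)\<^sup>*"
  let ?RD = "(extension_step D n (Po X) (Po Y) \<union> (extension_step D n (Po X) (Po Y))\<inverse>)\<^sup>*"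
  have sC: "(x, y) \<in> extension_step C n X Y ==> x \<in> ?C \<and> y \<in> ?C" for x y by (auto simp: extension_step_def)
  have sD: "(x, y) \<in> extension_step D n (Po X) (Po Y) ==> x \<in> ?D \<and> y \<in> ?D" for x y by (auto simp: extension_step_def)
  have im: "?D = ext_map n ` ?C" by (rule extensions_image[OF O n])
  have 1: "(ext_map n x, ext_map n y) \<in> ?RD" if "(x, y) \<in> ?RC" for x y
    using that
  proof (induction rule: rtrancl_induct)
    case (step y z)
    then have yz: "y \<in> ?C" "z \<in> ?C" using sC by blast+
    have "(ext_map n y, ext_map n z) \<in> extension_step D n (Po X) (Po Y) \<union> (extension_step D n (Po X) (Po Y))\<inverse>"
      using step(2) step_iff[OF O n yz] step_iff[OF O n yz(2,1)] by simp
    then show ?case using step(3) by (rule rtrancl_into_rtrancl[rotated])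
  qed simp
  \<comment> \<open>Every step joins two extensions, so each intermediate point of a zigzag in
    \<open>D\<close> lies in the image of \<open>ext_map\<close> and the zigzag can be pulled
    back.\<close>
  have 2: "\<forall>y\<in>?C. b = ext_map n y --> (x, y) \<in> ?RC" if "(a, b) \<in> ?RD" "a = ext_map n x" "x \<in> ?C" for a b x
    using that
  proof (induction rule: rtrancl_induct)
    case base then show ?case using ext_map_inj by blast
  next
    case (step b c)
    show ?case
    proof (intro ballI impI)
      fix z assume z: "z \<in> ?C" "c = ext_map n z"
      have "b \<in> ?D" using step(2) sD by blast
      then obtain y where y: "y \<in> ?C" "b = ext_map n y" unfolding im by blast
      have "(y, z) \<in> extension_step C n X Y \<union> (extension_step C n X Y)\<inverse>"
        using step(2) step_iff[OF O n y(1) z(1)] step_iff[OF O n z(1) y(1)] unfolding y z by simp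
      moreover have "(x, y) \<in> ?RC" using step(3)[OF step(4,5)] y by blast
      ultimately show "(x, z) \<in> ?RC" by (rule rtrancl_into_rtrancl[rotated])
    qed
  qed
  have "(\<forall>x\<in>?D. \<forall>y\<in>?D. (x, y) \<in> ?RD) <-> (\<forall>x\<in>?C. \<forall>y\<in>?C. (x, y) \<in> ?RC)"
    unfolding im using 1 2 by blast
  moreover have "?D \<noteq> {} <-> ?C \<noteq> {}" unfolding im by simp
  ultimately show ?thesis unfolding Suc Ext_zero_Suc_iff by simp
qed

lemma cotilting_iff: "T \<in> Ob C ==> cotilting D (Po T) <-> cotilting C T"
  unfolding cotilting_def by (simp add: abelian_iff ball_Ob Ext_zero_iff zero_obj_iff)

end

text \<open>Tagging records source and target, and \<open>None\<close> is the value of ill-typed composites and sums.\<close>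

type_synonym ('o, 'm) tagged = "('o \<times> 'm \<times> 'o) option"

definition untag :: "('o, 'm) tagged => 'm" where
  "untag x = fst (snd (the x))"

lemma untag_Some[simp]: "untag (Some (X, f, Y)) = f"
  by (simp add: untag_def)

fun tag_cmp :: "('o, 'm) cat => ('o, 'm) tagged => ('o, 'm) tagged => ('o, 'm) tagged" where
  "tag_cmp C (Some (X, f, Y)) (Some (Y', g, Z)) =
    (if Y = Y' \<and> arr C f X Y \<and> arr C g Y Z then Some (X, f ;;\<^bsub>C\<^esub> g, Z) else None)"
| "tag_cmp C _ _ = None"

definition tag_cat :: "('o, 'm) cat => ('o, ('o, 'm) tagged) cat" where
  "tag_cat C = \<lparr>Ob = Ob C, Hom = (\<lambda>X Y. (\<lambda>f. Some (X, f, Y)) ` Hom C X Y),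
    ident = (\<lambda>X. Some (X, ident C X, X)), cmp = tag_cmp C\<rparr>"

lemma tag_cat_simps[simp]:
  "Ob (tag_cat C) = Ob C" "Hom (tag_cat C) X Y = (\<lambda>f. Some (X, f, Y)) ` Hom C X Y"
  "ident (tag_cat C) X = Some (X, ident C X, X)" "cmp (tag_cat C) = tag_cmp C"
  by (simp_all add: tag_cat_def)

lemma arr_tag_cat: "arr (tag_cat C) x X Y <-> (\<exists>f. x = Some (X, f, Y) \<and> arr C f X Y)"
  by (auto simp: arr_def)

context category begin

lemma tag_cmp_assoc: "tag_cmp C (tag_cmp C f g) h = tag_cmp C f (tag_cmp C g h)"
proof (cases "f = None \<or> g = None \<or> h = None")
  case True
  then show ?thesis by (cases f; cases g; cases h) auto
next
  case False
  then obtain W f' X X' g' Y Y' h' Z where "f = Some (W, f', X)" "g = Some (X', g', Y)" "h = Some (Y', h', Z)" by (metis not_None_eq prod_cases3)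
  then show ?thesis by (auto simp: arr_assoc)
qed

lemma category_tag_cat: "category (tag_cat C)"
  by unfold_locales (auto simp: arr_def ident_in_Hom cmp_in_Hom ident_left ident_right tag_cmp_assoc)

lemma cat_iso_untag: "cat_iso (tag_cat C) C (\<lambda>X. X) untag"
proof -
  interpret T: category "tag_cat C" by (rule category_tag_cat)
  show ?thesis
  proof
    show "is_functor (tag_cat C) C (\<lambda>X. X) untag" by (auto simp: is_functor_def arr_def)
    show "bij_betw (\<lambda>X. X) (Ob (tag_cat C)) (Ob C)" by (simp add: bij_betw_def)
    show "bij_betw untag (Hom (tag_cat C) X Y) (Hom C X Y)" for X Y
      by (rule bij_betw_byWitness[where f' = "\<lambda>f. Some (X, f, Y)"]) auto
  qed
qed

end

lemma (in abelian_category) cat_iso_zero_untag: "cat_iso_zero (tag_cat C) C (\<lambda>X. X) untag"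
proof -
  interpret I: cat_iso "tag_cat C" C "\<lambda>X. X" untag by (rule cat_iso_untag)
  show ?thesis
  proof
    obtain Z where Z: "is_zero_obj C Z" using ex_zero_obj by blast
    then have "Z \<in> Ob C" by (simp add: is_zero_obj_def)
    then show "\<exists>Z. is_zero_obj (tag_cat C) Z" using I.zero_obj_iff[of Z] Z by auto
  qed
qed

fun tag_add :: "('o, 'm) cat => ('o => 'o => ('k, 'm) module) => ('o, 'm) tagged => ('o, 'm) tagged => ('o, 'm) tagged" where
  "tag_add C H (Some (X, f, Y)) (Some (X', g, Y')) =
    (if X = X' \<and> Y = Y' \<and> arr C f X Y \<and> arr C g X Y then Some (X, f \<oplus>\<^bsub>H X Y\<^esub> g, Y) else None)"
| "tag_add C H _ _ = None"

fun tag_neg :: "('o, 'm) cat => ('o => 'o => ('k, 'm) module) => ('o, 'm) tagged => ('o, 'm) tagged" where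
  "tag_neg C H (Some (X, f, Y)) = (if arr C f X Y then Some (X, \<ominus>\<^bsub>H X Y\<^esub> f, Y) else None)"
| "tag_neg C H None = None"

section \<open>The linear structure on tagged morphisms\<close>

context linear_category begin

lemma Hom_group: "X \<in> Ob C ==> Y \<in> Ob C ==> abelian_group (H X Y)"
  using Hom_module by (simp add: module_def)

lemma arr_carrier: "arr C f X Y <-> X \<in> Ob C \<and> Y \<in> Ob C \<and> f \<in> carrier (H X Y)"
  by (auto simp: arr_def carrier_Hom)

lemma arr_group: "arr C f X Y ==> abelian_group (H X Y)" "arr C f X Y ==> f \<in> carrier (H X Y)"
  by (auto simp: arr_carrier Hom_group)

lemma arr_add: "arr C f X Y ==> arr C g X Y ==> arr C (f \<oplus>\<^bsub>H X Y\<^esub> g) X Y"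
  using abelian_monoid.a_closed[OF abelian_group.axioms(1)[OF arr_group(1)]] by (auto simp: arr_carrier)

lemma arr_minus: "arr C f X Y ==> arr C (\<ominus>\<^bsub>H X Y\<^esub> f) X Y"
  using abelian_group.a_inv_closed[OF arr_group(1)] by (auto simp: arr_carrier)

lemma arr_zero: "X \<in> Ob C ==> Y \<in> Ob C ==> arr C \<zero>\<^bsub>H X Y\<^esub> X Y"
  using abelian_monoid.zero_closed[OF abelian_group.axioms(1)[OF Hom_group]] by (auto simp: arr_carrier)

lemma add_cmp:
  "arr C f X Y ==> arr C f' X Y ==> arr C g Y Z ==> (f \<oplus>\<^bsub>H X Y\<^esub> f') ;; g = (f ;; g) \<oplus>\<^bsub>H X Z\<^esub> (f' ;; g)"
  by (simp add: arr_def cmp_add_left)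

lemma cmp_add:
  "arr C f X Y ==> arr C g Y Z ==> arr C g' Y Z ==> f ;; (g \<oplus>\<^bsub>H Y Z\<^esub> g') = (f ;; g) \<oplus>\<^bsub>H X Z\<^esub> (f ;; g')"
  by (simp add: arr_def cmp_add_right)

lemma zero_cmp: assumes X: "X \<in> Ob C" and g: "arr C g Y Z" shows "\<zero>\<^bsub>H X Y\<^esub> ;; g = \<zero>\<^bsub>H X Z\<^esub>"
proof -
  have YZ: "Y \<in> Ob C" "Z \<in> Ob C" using g by (auto simp: arr_def)
  interpret XY: abelian_group "H X Y" by (rule Hom_group[OF X YZ(1)])
  interpret XZ: abelian_group "H X Z" by (rule Hom_group[OF X YZ(2)])
  have "\<zero>\<^bsub>H X Y\<^esub> ;; g \<oplus>\<^bsub>H X Z\<^esub> \<zero>\<^bsub>H X Y\<^esub> ;; g = \<zero>\<^bsub>H X Y\<^esub> ;; g"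
    using add_cmp[OF arr_zero[OF X YZ(1)] arr_zero[OF X YZ(1)] g] by simp
  then show ?thesis using arr_group(2)[OF arr_cmp[OF arr_zero[OF X YZ(1)] g]] XZ.add.l_cancel_one by blast
qed

lemma cmp_zero: assumes f: "arr C f X Y" and Z: "Z \<in> Ob C" shows "f ;; \<zero>\<^bsub>H Y Z\<^esub> = \<zero>\<^bsub>H X Z\<^esub>"
proof -
  have XY: "X \<in> Ob C" "Y \<in> Ob C" using f by (auto simp: arr_def)
  interpret YZ: abelian_group "H Y Z" by (rule Hom_group[OF XY(2) Z])
  interpret XZ: abelian_group "H X Z" by (rule Hom_group[OF XY(1) Z])
  have "f ;; \<zero>\<^bsub>H Y Z\<^esub> \<oplus>\<^bsub>H X Z\<^esub> f ;; \<zero>\<^bsub>H Y Z\<^esub> = f ;; \<zero>\<^bsub>H Y Z\<^esub>"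
    using cmp_add[OF f arr_zero[OF XY(2) Z] arr_zero[OF XY(2) Z]] by simp
  then show ?thesis using arr_group(2)[OF arr_cmp[OF f arr_zero[OF XY(2) Z]]] XZ.add.l_cancel_one by blast
qed

lemma minus_cmp: assumes f: "arr C f X Y" and g: "arr C g Y Z" shows "(\<ominus>\<^bsub>H X Y\<^esub> f) ;; g = \<ominus>\<^bsub>H X Z\<^esub> (f ;; g)"
proof -
  have X: "X \<in> Ob C" using f by (auto simp: arr_def)
  interpret XY: abelian_group "H X Y" by (rule arr_group(1)[OF f])
  interpret XZ: abelian_group "H X Z" by (rule arr_group(1)[OF arr_cmp[OF f g]])
  have "(\<ominus>\<^bsub>H X Y\<^esub> f) ;; g \<oplus>\<^bsub>H X Z\<^esub> f ;; g = \<zero>\<^bsub>H X Z\<^esub>"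
    using add_cmp[OF arr_minus[OF f] f g] zero_cmp[OF X g] XY.l_neg[OF arr_group(2)[OF f]] by simp
  then show ?thesis
    using XZ.minus_equality[OF _ arr_group(2)[OF arr_cmp[OF f g]] arr_group(2)[OF arr_cmp[OF arr_minus[OF f] g]]] by simp
qed

lemma cmp_minus: assumes f: "arr C f X Y" and g: "arr C g Y Z" shows "f ;; (\<ominus>\<^bsub>H Y Z\<^esub> g) = \<ominus>\<^bsub>H X Z\<^esub> (f ;; g)"
proof -
  have Z: "Z \<in> Ob C" using g by (auto simp: arr_def)
  interpret YZ: abelian_group "H Y Z" by (rule arr_group(1)[OF g])
  interpret XZ: abelian_group "H X Z" by (rule arr_group(1)[OF arr_cmp[OF f g]])
  have "f ;; (\<ominus>\<^bsub>H Y Z\<^esub> g) \<oplus>\<^bsub>H X Z\<^esub> f ;; g = \<zero>\<^bsub>H X Z\<^esub>"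
    using cmp_add[OF f arr_minus[OF g] g] cmp_zero[OF f Z] YZ.l_neg[OF arr_group(2)[OF g]] by simp
  then show ?thesis
    using XZ.minus_equality[OF _ arr_group(2)[OF arr_cmp[OF f g]] arr_group(2)[OF arr_cmp[OF f arr_minus[OF g]]]] by simp
qed

text \<open>A map into a zero object is unique, hence the neutral element of its Hom-group, and
  composition preserves neutral elements.\<close>

lemma zero_mor_zero:
  assumes "\<exists>Z. is_zero_obj C Z" and O: "X \<in> Ob C" "Y \<in> Ob C"
  shows "zero_mor C X Y = \<zero>\<^bsub>H X Y\<^esub>"
proof -
  obtain Z where Z: "is_zero_obj C Z" using assms(1) by blast
  obtain a b where ab: "arr C a X Z" "arr C b Z Y" using zero_obj_ex[OF Z] O by blast
  have "a = \<zero>\<^bsub>H X Z\<^esub>" by (rule zero_objD(2)[OF Z ab(1) arr_zero[OF O(1) zero_objD(1)[OF Z]]])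
  then show ?thesis using zero_mor_eq[OF Z ab] zero_cmp[OF O(1) ab(2)] by simp
qed

text \<open>In each law either both sides are \<open>None\<close>, or all terms are well typed and
  the law is the corresponding one for Hom-groups and bilinear composition. This provides the
  unconditional laws that \<open>abcat\<close> demands.\<close>

lemma tag_laws:
  "tag_add C H (tag_add C H f g) h = tag_add C H f (tag_add C H g h)"
  "tag_add C H f g = tag_add C H g f"
  "tag_cmp C (tag_add C H f g) h = tag_add C H (tag_cmp C f h) (tag_cmp C g h)"
  "tag_cmp C f (tag_add C H g h) = tag_add C H (tag_cmp C f g) (tag_cmp C f h)"
  "tag_cmp C (tag_neg C H f) g = tag_neg C H (tag_cmp C f g)"
  "tag_cmp C f (tag_neg C H g) = tag_neg C H (tag_cmp C f g)"
proof -
  have as: "(a \<oplus>\<^bsub>H X Y\<^esub> b) \<oplus>\<^bsub>H X Y\<^esub> c = a \<oplus>\<^bsub>H X Y\<^esub> (b \<oplus>\<^bsub>H X Y\<^esub> c)" "a \<oplus>\<^bsub>H X Y\<^esub> b = b \<oplus>\<^bsub>H X Y\<^esub> a"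
    if "arr C a X Y" "arr C b X Y" "arr C c X Y" for a b c X Y
    using that abelian_group.axioms(1)[OF arr_group(1)[OF that(1)]] arr_group(2)
    by (simp_all add: abelian_monoid.a_assoc abelian_monoid.a_comm)
  have inv: "arr C (\<ominus>\<^bsub>H X Y\<^esub> a) X Y" if "arr C a X Y" for a X Y by (rule arr_minus[OF that])
  have e: "x = None \<or> (\<exists>X a Y. x = Some (X, a, Y))" for x :: "('b, 'c) tagged" by (metis not_None_eq prod_cases3)
  show "tag_add C H (tag_add C H f g) h = tag_add C H f (tag_add C H g h)"
    using e[of f] e[of g] e[of h] by (auto simp: arr_add as(1))
  show "tag_add C H f g = tag_add C H g f"
    using e[of f] e[of g] as(2) by auto
  show "tag_cmp C (tag_add C H f g) h = tag_add C H (tag_cmp C f h) (tag_cmp C g h)"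
    using e[of f] e[of g] e[of h] by (auto simp: arr_add add_cmp)
  show "tag_cmp C f (tag_add C H g h) = tag_add C H (tag_cmp C f g) (tag_cmp C f h)"
    using e[of f] e[of g] e[of h] by (auto simp: arr_add cmp_add)
  show "tag_cmp C (tag_neg C H f) g = tag_neg C H (tag_cmp C f g)"
    using e[of f] e[of g] by (auto simp: inv minus_cmp)
  show "tag_cmp C f (tag_neg C H g) = tag_neg C H (tag_cmp C f g)"
    using e[of f] e[of g] by (auto simp: inv cmp_minus)
qed

end

lemma abcat_tag_cat:
  assumes ab: "abelian_category C" and lin: "linear_category C k H"
  shows "abcat (tag_cat C) (tag_add C H) (tag_neg C H)"
proof -
  interpret C: abelian_category C by (rule ab)
  interpret L: linear_category C k H by (rule lin)
  interpret I: cat_iso_zero "tag_cat C" C "\<lambda>X. X" untag by (rule C.cat_iso_zero_untag)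
  interpret T: abelian_category "tag_cat C" using I.abelian_iff ab by blast
  have z: "zero_mor (tag_cat C) X Y = Some (X, \<zero>\<^bsub>H X Y\<^esub>, Y)" if "X \<in> Ob C" "Y \<in> Ob C" for X Y
    using I.zero_mor_Hom[of X Y] I.P_zero_mor[of X Y] L.zero_mor_zero[OF C.ex_zero_obj that] that by auto
  have r: "f \<oplus>\<^bsub>H X Y\<^esub> \<zero>\<^bsub>H X Y\<^esub> = f" "f \<oplus>\<^bsub>H X Y\<^esub> \<ominus>\<^bsub>H X Y\<^esub> f = \<zero>\<^bsub>H X Y\<^esub>" if "arr C f X Y" for f X Y
    using abelian_monoid.r_zero[OF abelian_group.axioms(1)[OF L.arr_group(1)[OF that]] L.arr_group(2)[OF that]]
      abelian_group.r_neg[OF L.arr_group[OF that]] by simp_all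
  show ?thesis
  proof
    fix f X Y assume f: "arr (tag_cat C) f X Y"
    then obtain a where a: "f = Some (X, a, Y)" "arr C a X Y" unfolding arr_tag_cat by blast
    then have O: "X \<in> Ob C" "Y \<in> Ob C" by (auto simp: arr_def)
    show "tag_add C H f (zero_mor (tag_cat C) X Y) = f" using a z[OF O] r L.arr_zero[OF O] by simp
    show "tag_add C H f (tag_neg C H f) = zero_mor (tag_cat C) X Y" using a z[OF O] r L.arr_minus by simp
    show "arr (tag_cat C) (tag_neg C H f) X Y" using a by (simp add: arr_tag_cat L.arr_minus)
    fix g assume "arr (tag_cat C) g X Y"
    then show "arr (tag_cat C) (tag_add C H f g) X Y" using a by (auto simp: arr_tag_cat L.arr_add)
  qed (simp_all only: tag_cat_simps L.tag_laws(1,3-6) C.tag_cmp_assoc, rule L.tag_laws(2))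
qed

lemma (in category) category_full:
  assumes "S \<subseteq> Ob C"
  shows "category (C\<lparr>Ob := S\<rparr>)"
proof -
  have *: "X \<in> S ==> X \<in> Ob C" for X using assms by blast
  show ?thesis
    by unfold_locales (simp_all add: ident_in_Hom cmp_in_Hom[OF * * *] ident_left[OF * *] ident_right[OF * *] cmp_assoc[OF * * * *] *)
qed

fun tag_fun :: "('o => 'p) => ('m => 'n) => ('o, 'm) tagged => ('p, 'n) tagged" where
  "tag_fun Fo Fm (Some (X, f, Y)) = Some (Fo X, Fm f, Fo Y)"
| "tag_fun Fo Fm None = None"

definition tag_nat :: "('o => 'o) => ('o => 'm) => 'o => ('o, 'm) tagged" where
  "tag_nat Fo \<eta> X = Some (Fo X, \<eta> X, X)"

text \<open>A tagged composite is not \<open>None\<close> only if its types match at every place;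
  following source and target along the path ensures this, and the untagged composite is read
  off.\<close>

lemma (in category) path_typed:
  assumes "\<And>l. i <= l ==> l < i + n ==> arr C (f (Suc l)) (e l) (e (Suc l)) \<and> f' (Suc l) = Some (e l, f (Suc l), e (Suc l))"
    and "e i \<in> Ob C"
  shows "arr C (path C (e i) f i n) (e i) (e (i + n)) \<and>
    path (tag_cat C) (e i) f' i n = Some (e i, path C (e i) f i n, e (i + n))"
  using assms(1)
proof (induction n)
  case 0
  then show ?case using assms(2) by auto
next
  case (Suc n)
  have 1: "arr C (path C (e i) f i n) (e i) (e (i + n)) \<and>
    path (tag_cat C) (e i) f' i n = Some (e i, path C (e i) f i n, e (i + n))"
    by (rule Suc.IH) (use Suc.prems in simp)
  have 2: "arr C (f (Suc (i + n))) (e (i + n)) (e (Suc (i + n))) \<and> f' (Suc (i + n)) = Some (e (i + n), f (Suc (i + n)), e (Suc (i + n)))"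
    by (rule Suc.prems) auto
  show ?case using 1 2 by auto
qed

section \<open>Transport of the result from the tagged category\<close>

definition untag_obj where
  "untag_obj I = (\<lambda>(M, f). (M, \<lambda>j\<in>I. untag (f j)))"
  for I :: "nat set" and M :: "nat => 'o" and f :: "nat => ('o, 'm) tagged"

definition untag_mor where
  "untag_mor I \<phi> = (\<lambda>j\<in>I. untag (\<phi> j))" for I :: "nat set" and \<phi> :: "nat => ('o, 'm) tagged"

locale tag_ctx = A: abelian_category A for A :: "('o, 'm) cat" +
  fixes H :: "'o => 'o => ('k, 'm) module" and k :: "'k ring"
    and Fo :: "'o => 'o" and Fm :: "'m => 'm" and \<eta> :: "'o => 'm" and p :: nat
  assumes lin: "linear_category A k H"
    and F: "is_exact_functor A A Fo Fm" and nat: "is_nat_transf A A Fo Fm (\<lambda>X. X) (\<lambda>f. f) \<eta>" and p2: "p \<ge> 2"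
begin

abbreviation A' where "A' \<equiv> tag_cat A"
abbreviation Fm' where "Fm' \<equiv> tag_fun Fo Fm"
abbreviation \<eta>' where "\<eta>' \<equiv> tag_nat Fo \<eta>"

interpretation I: cat_iso_zero A' A "\<lambda>X. X" untag by (rule A.cat_iso_zero_untag)

interpretation T: abcat A' "tag_add A H" "tag_neg A H" by (rule abcat_tag_cat[OF A.abelian_category_axioms lin])

lemma Fo_Ob: "X \<in> Ob A ==> Fo X \<in> Ob A"
  using F by (simp add: is_exact_functor_def is_functor_def)

lemma Fm_Hom: "X \<in> Ob A ==> Y \<in> Ob A ==> f \<in> Hom A X Y ==> Fm f \<in> Hom A (Fo X) (Fo Y)"
  using F by (simp add: is_exact_functor_def is_functor_def)

lemma eta_Hom: "X \<in> Ob A ==> \<eta> X \<in> Hom A (Fo X) X"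
  using nat by (simp add: is_nat_transf_def)

lemma short_exact_tag:
  assumes "X \<in> Ob A" "Y \<in> Ob A" "Z \<in> Ob A" "f \<in> Hom A X Y" "g \<in> Hom A Y Z"
  shows "short_exact A' X (Some (X, f, Y)) Y (Some (Y, g, Z)) Z <-> short_exact A X f Y g Z"
  using I.short_exact_iff[of X Y Z "Some (X, f, Y)" "Some (Y, g, Z)"] assms by simp

lemma exact_tag: "is_exact_functor A' A' Fo Fm'"
proof -
  have 1: "is_functor A A Fo Fm" and
    2: "\<And>X Y Z f g. X \<in> Ob A ==> Y \<in> Ob A ==> Z \<in> Ob A ==> f \<in> Hom A X Y ==> g \<in> Hom A Y Z ==> short_exact A X f Y g Z
      ==> short_exact A (Fo X) (Fm f) (Fo Y) (Fm g) (Fo Z)"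
    using F unfolding is_exact_functor_def by blast+
  have "is_functor A' A' Fo Fm'" using 1 Fm_Hom by (auto simp: is_functor_def arr_def)
  moreover have "short_exact A' (Fo X) (Fm' x) (Fo Y) (Fm' y) (Fo Z)"
    if O: "X \<in> Ob A" "Y \<in> Ob A" "Z \<in> Ob A" and x: "x \<in> Hom A' X Y" and y: "y \<in> Hom A' Y Z" and s: "short_exact A' X x Y y Z" for X Y Z x y
  proof -
    obtain f g where fg: "x = Some (X, f, Y)" "y = Some (Y, g, Z)" "f \<in> Hom A X Y" "g \<in> Hom A Y Z" using x y by auto
    then have "short_exact A X f Y g Z" using s short_exact_tag[OF O] by simp
    from 2[OF O fg(3,4) this] show ?thesis
      using short_exact_tag[OF Fo_Ob Fo_Ob Fo_Ob Fm_Hom Fm_Hom] O fg by simp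
  qed
  ultimately show ?thesis unfolding is_exact_functor_def by simp
qed

lemma nat_tag: "is_nat_transf A' A' Fo Fm' (\<lambda>X. X) (\<lambda>f. f) \<eta>'"
  using nat Fo_Ob Fm_Hom by (auto simp: is_nat_transf_def tag_nat_def arr_def)

lemma zero_mor_tag: "X \<in> Ob A ==> Y \<in> Ob A ==> zero_mor A' X Y = Some (X, zero_mor A X Y, Y)"
  using I.zero_mor_Hom[of X Y] I.P_zero_mor[of X Y] by auto

abbreviation B where "B \<equiv> ker_cat A Fo \<eta>"
abbreviation B' where "B' \<equiv> ker_cat A' Fo \<eta>'"

lemma B_sel: "Ob B = {M \<in> Ob A. \<eta> M = zero_mor A (Fo M) M}" "Hom B = Hom A" "ident B = ident A" "cmp B = cmp A"
  "Hom B' = Hom A'" "ident B' = ident A'" "cmp B' = cmp A'"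
  by (simp_all add: ker_cat_def)

lemma B'_Ob: "Ob B' = Ob B"
  using zero_mor_tag Fo_Ob by (auto simp: ker_cat_def tag_nat_def)

lemma B_ObA: "X \<in> Ob B ==> X \<in> Ob A"
  by (simp add: B_sel)

lemma cat_iso_zero_B: assumes "abelian_category B" shows "cat_iso_zero B' B (\<lambda>X. X) untag"
proof -
  interpret B: abelian_category B by (rule assms)
  have f: "is_functor A' A (\<lambda>X. X) untag" by (rule I.is_fun)
  have c: "category B'" unfolding ker_cat_def by (rule category.category_full[OF A.category_tag_cat]) simp
  interpret J: cat_iso B' B "\<lambda>X. X" untag
  proof
    show "is_functor B' B (\<lambda>X. X) untag" using f B_ObA unfolding is_functor_def B'_Ob B_sel(2-) by simp
    show "bij_betw (\<lambda>X. X) (Ob B') (Ob B)" by (simp add: bij_betw_def B'_Ob)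
    show "bij_betw untag (Hom B' X Y) (Hom B X Y)" if "X \<in> Ob B'" "Y \<in> Ob B'" for X Y
      using I.Hom_bij that B_ObA by (simp add: B'_Ob B_sel(2-))
  qed (rule category.cmp_in_Hom[OF c] category.ident_in_Hom[OF c] category.cmp_assoc[OF c]
      category.ident_left[OF c] category.ident_right[OF c]; assumption)+
  show ?thesis
  proof
    obtain Z where Z: "is_zero_obj B Z" using B.ex_zero_obj by blast
    then have "Z \<in> Ob B'" by (simp add: is_zero_obj_def B'_Ob)
    then show "\<exists>Z. is_zero_obj B' Z" using J.zero_obj_iff[of Z] Z by auto
  qed
qed

abbreviation R where "R \<equiv> root_cat A Fo Fm \<eta> p"
abbreviation R' where "R' \<equiv> root_cat A' Fo Fm' \<eta>' p"

text \<open>The inverse of untagging. Sources and targets of the structure maps can be recovered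
  because they are entries of the diagram.\<close>

definition tag_root :: "(nat => 'o) \<times> (nat => 'm) => (nat => 'o) \<times> (nat => ('o, 'm) tagged)" where
  "tag_root = (\<lambda>(M, f). (M, \<lambda>j\<in>{1..p}. Some (root_entry Fo p M (j - 1), f j, M j)))"

text \<open>The root condition mixes structure maps and their images under \<open>F\<close>, so
  \<open>path_typed\<close> is applied once to each of the two composites.\<close>

lemma root_Ob_iff:
  assumes M: "M \<in> {1..p} \<rightarrow>\<^sub>E Ob A" and f: "f \<in> (\<Pi>\<^sub>E j\<in>{1..p}. Hom A (root_entry Fo p M (j - 1)) (M j))"
  shows "tag_root (M, f) \<in> Ob R' <-> (M, f) \<in> Ob R"
proof -
  let ?f = "\<lambda>j\<in>{1..p}. Some (root_entry Fo p M (j - 1), f j, M j)"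
  let ?e = "root_entry Fo p M"
  have MO: "j \<in> {1..p} ==> M j \<in> Ob A" for j using M by (auto simp: PiE_iff)
  have eO: "j <= p ==> ?e j \<in> Ob A" for j using MO p2 Fo_Ob by (auto simp: root_entry_def)
  have fH: "arr A (f (Suc l)) (?e l) (?e (Suc l))" if "l < p" for l
  proof -
    have "f (Suc l) \<in> Hom A (?e (Suc l - 1)) (M (Suc l))" using PiE_mem[OF f, of "Suc l"] that by simp
    then show ?thesis using eO[of l] eO[of "Suc l"] that by (simp add: arr_def root_entry_def[of _ _ _ "Suc l"])
  qed
  have eq: "path A' (Fo (M j)) (\<lambda>i. Fm' (?f i)) j (p - j) ;;\<^bsub>A'\<^esub> path A' (Fo (M p)) ?f 0 j = \<eta>' (M j) <->
    path A (Fo (M j)) (\<lambda>i. Fm (f i)) j (p - j) ;;\<^bsub>A\<^esub> path A (Fo (M p)) f 0 j = \<eta> (M j)" if j: "j \<in> {1..p}" for j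
  proof -
    have e0: "?e 0 = Fo (M p)" "?e j = M j" using j by (auto simp: root_entry_def)
    have "arr A (path A (?e 0) f 0 j) (?e 0) (?e (0 + j)) \<and> path A' (?e 0) ?f 0 j = Some (?e 0, path A (?e 0) f 0 j, ?e (0 + j))"
    proof (rule A.path_typed)
      show "arr A (f (Suc l)) (?e l) (?e (Suc l)) \<and> ?f (Suc l) = Some (?e l, f (Suc l), ?e (Suc l))" if "l < 0 + j" for l
        using fH[of l] that j by (auto simp: root_entry_def)
    qed (use eO in auto)
    then have 1: "arr A (path A (Fo (M p)) f 0 j) (Fo (M p)) (M j)"
      "path A' (Fo (M p)) ?f 0 j = Some (Fo (M p), path A (Fo (M p)) f 0 j, M j)" using e0 by auto
    have "arr A (path A (Fo (M j)) (\<lambda>i. Fm (f i)) j (p - j)) (Fo (M j)) (Fo (M (j + (p - j)))) \<and>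
      path A' (Fo (M j)) (\<lambda>i. Fm' (?f i)) j (p - j) = Some (Fo (M j), path A (Fo (M j)) (\<lambda>i. Fm (f i)) j (p - j), Fo (M (j + (p - j))))"
    proof (rule A.path_typed[where e = "\<lambda>l. Fo (M l)"])
      fix l assume l: "j <= l" "l < j + (p - j)"
      then have "?e l = M l" "?e (Suc l) = M (Suc l)" using j by (auto simp: root_entry_def)
      moreover have "M l \<in> Ob A" "M (Suc l) \<in> Ob A" using MO l j by auto
      ultimately show "arr A (Fm (f (Suc l))) (Fo (M l)) (Fo (M (Suc l))) \<and> Fm' (?f (Suc l)) = Some (Fo (M l), Fm (f (Suc l)), Fo (M (Suc l)))"
        using fH[of l] l j Fm_Hom Fo_Ob by (auto simp: arr_def)
    qed (use MO[OF j] Fo_Ob in auto)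
    then have 2: "arr A (path A (Fo (M j)) (\<lambda>i. Fm (f i)) j (p - j)) (Fo (M j)) (Fo (M p))"
      "path A' (Fo (M j)) (\<lambda>i. Fm' (?f i)) j (p - j) = Some (Fo (M j), path A (Fo (M j)) (\<lambda>i. Fm (f i)) j (p - j), Fo (M p))"
      using j by auto
    show ?thesis unfolding 1(2) 2(2) using 1(1) 2(1) by (simp add: tag_nat_def)
  qed
  have "?f \<in> (\<Pi>\<^sub>E j\<in>{1..p}. Hom A' (root_entry Fo p M (j - 1)) (M j))" using f by (auto simp: PiE_iff)
  then show ?thesis using M f eq unfolding root_cat_def tag_root_def by simp
qed

lemma root_ObD:
  assumes "X \<in> Ob R"
  shows "fst X \<in> {1..p} \<rightarrow>\<^sub>E Ob A" "snd X \<in> (\<Pi>\<^sub>E j\<in>{1..p}. Hom A (root_entry Fo p (fst X) (j - 1)) (fst X j))"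
  using assms by (auto simp: root_cat_def)

lemma untag_tag_root: "snd X \<in> extensional {1..p} ==> untag_obj {1..p} (tag_root X) = X"
  by (auto simp: untag_obj_def tag_root_def split_beta fun_eq_iff extensional_def intro!: prod_eqI)

lemma tag_root_cases:
  assumes "x \<in> Ob R'"
  obtains X where "X \<in> Ob R" "x = tag_root X" "untag_obj {1..p} x = X"
proof -
  obtain M f where x: "x = (M, f)" by (cases x)
  have M: "M \<in> {1..p} \<rightarrow>\<^sub>E Ob A" and f: "f \<in> (\<Pi>\<^sub>E j\<in>{1..p}. Hom A' (root_entry Fo p M (j - 1)) (M j))"
    using assms unfolding x root_cat_def by auto
  define g where "g = (\<lambda>j\<in>{1..p}. untag (f j))"
  have fj: "\<exists>h\<in>Hom A (root_entry Fo p M (j - 1)) (M j). f j = Some (root_entry Fo p M (j - 1), h, M j)" if "j \<in> {1..p}" for j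
    using PiE_mem[OF f that] by auto
  have "f j = Some (root_entry Fo p M (j - 1), g j, M j) \<and> g j \<in> Hom A (root_entry Fo p M (j - 1)) (M j)" if "j \<in> {1..p}" for j
    using fj[OF that] that by (auto simp: g_def)
  then have g: "g \<in> (\<Pi>\<^sub>E j\<in>{1..p}. Hom A (root_entry Fo p M (j - 1)) (M j))" and
    e: "f = (\<lambda>j\<in>{1..p}. Some (root_entry Fo p M (j - 1), g j, M j))"
    using f by (auto simp: g_def PiE_iff extensional_def fun_eq_iff)
  have t: "x = tag_root (M, g)" unfolding x tag_root_def using e by simp
  show ?thesis
    by (rule that[OF _ t]) (use root_Ob_iff[OF M g] assms t untag_tag_root[of "(M, g)"] in \<open>auto simp: g_def\<close>)
qed

lemma root_Hom_iff:
  assumes X: "X \<in> Ob R" and Y: "Y \<in> Ob R" and \<phi>: "\<phi> \<in> (\<Pi>\<^sub>E j\<in>{1..p}. Hom A (fst X j) (fst Y j))"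
  shows "(\<lambda>j\<in>{1..p}. Some (fst X j, \<phi> j, fst Y j)) \<in> Hom R' (tag_root X) (tag_root Y) <-> \<phi> \<in> Hom R X Y"
proof -
  let ?\<phi> = "\<lambda>j\<in>{1..p}. Some (fst X j, \<phi> j, fst Y j)"
  have pj: "p \<in> {1..p}" using p2 by simp
  have O: "fst X j \<in> Ob A" "fst Y j \<in> Ob A" "arr A (\<phi> j) (fst X j) (fst Y j)" if "j \<in> {1..p}" for j
    using PiE_mem[OF root_ObD(1)[OF X] that] PiE_mem[OF root_ObD(1)[OF Y] that] PiE_mem[OF \<phi> that] by (auto simp: arr_def)
  have sq: "snd (tag_root X) j ;;\<^bsub>A'\<^esub> ?\<phi> j = root_comp Fm' p ?\<phi> (j - 1) ;;\<^bsub>A'\<^esub> snd (tag_root Y) j <->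
    snd X j ;;\<^bsub>A\<^esub> \<phi> j = root_comp Fm p \<phi> (j - 1) ;;\<^bsub>A\<^esub> snd Y j" if j: "j \<in> {1..p}" for j
  proof -
    have rO: "root_entry Fo p (fst X) (j - 1) \<in> Ob A" "root_entry Fo p (fst Y) (j - 1) \<in> Ob A"
    proof -
      consider "j - 1 = 0" | "j - 1 \<in> {1..p}" "j - 1 \<noteq> 0" using j by force
      then have "root_entry Fo p (fst X) (j - 1) \<in> Ob A \<and> root_entry Fo p (fst Y) (j - 1) \<in> Ob A"
        by cases (use O pj Fo_Ob in \<open>simp_all add: root_entry_def\<close>)
      then show "root_entry Fo p (fst X) (j - 1) \<in> Ob A" "root_entry Fo p (fst Y) (j - 1) \<in> Ob A" by blast+
    qed
    have x: "arr A (snd X j) (root_entry Fo p (fst X) (j - 1)) (fst X j)"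
      using PiE_mem[OF root_ObD(2)[OF X] j] rO O(1)[OF j] by (simp add: arr_def)
    have y: "arr A (snd Y j) (root_entry Fo p (fst Y) (j - 1)) (fst Y j)"
      using PiE_mem[OF root_ObD(2)[OF Y] j] rO O(2)[OF j] by (simp add: arr_def)
    have r: "root_comp Fm' p ?\<phi> (j - 1) = Some (root_entry Fo p (fst X) (j - 1), root_comp Fm p \<phi> (j - 1), root_entry Fo p (fst Y) (j - 1)) \<and>
      arr A (root_comp Fm p \<phi> (j - 1)) (root_entry Fo p (fst X) (j - 1)) (root_entry Fo p (fst Y) (j - 1))"
    proof -
      consider "j = 1" | "j - 1 \<in> {1..p}" "j - 1 \<noteq> 0" using j by force
      then show ?thesis
      proof cases
        case 1
        then show ?thesis using O[OF pj] pj Fm_Hom Fo_Ob by (auto simp: root_comp_def root_entry_def arr_def)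
      next
        case 2
        then show ?thesis using O[OF 2(1)] by (simp add: root_comp_def root_entry_def)
      qed
    qed
    have t: "snd (tag_root X) j = Some (root_entry Fo p (fst X) (j - 1), snd X j, fst X j)"
      "snd (tag_root Y) j = Some (root_entry Fo p (fst Y) (j - 1), snd Y j, fst Y j)" "?\<phi> j = Some (fst X j, \<phi> j, fst Y j)"
      using j by (simp_all add: tag_root_def split_beta)
    show ?thesis unfolding t conjunct1[OF r] using x y conjunct2[OF r] O(3)[OF j] by simp
  qed
  have f1: "fst (tag_root X) = fst X" "fst (tag_root Y) = fst Y" by (simp_all add: tag_root_def split_beta)
  have R: "Hom R X Y = {\<phi> \<in> (\<Pi>\<^sub>E j\<in>{1..p}. Hom A (fst X j) (fst Y j)).
       \<forall>j\<in>{1..p}. snd X j ;;\<^bsub>A\<^esub> \<phi> j = root_comp Fm p \<phi> (j - 1) ;;\<^bsub>A\<^esub> snd Y j}"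
    by (simp add: root_cat_def split_beta)
  have R': "Hom R' x y = {\<phi> \<in> (\<Pi>\<^sub>E j\<in>{1..p}. Hom A' (fst x j) (fst y j)).
       \<forall>j\<in>{1..p}. snd x j ;;\<^bsub>A'\<^esub> \<phi> j = root_comp Fm' p \<phi> (j - 1) ;;\<^bsub>A'\<^esub> snd y j}" for x y
    by (simp add: root_cat_def split_beta)
  have "?\<phi> \<in> (\<Pi>\<^sub>E j\<in>{1..p}. Hom A' (fst X j) (fst Y j))" using PiE_mem[OF \<phi>] by auto
  then show ?thesis unfolding R R' f1 mem_Collect_eq using \<phi> by (intro conj_cong ball_cong refl) (simp_all only: sq)
qed

lemma fst_untag_obj[simp]: "fst (untag_obj I x) = fst x"
  by (simp add: untag_obj_def split_beta)

lemma untag_mor_Some: "\<phi> \<in> extensional I ==> untag_mor I (\<lambda>j\<in>I. Some (M j, \<phi> j, N j)) = \<phi>"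
  by (auto simp: untag_mor_def extensional_def fun_eq_iff)

lemma tag_mor_untag:
  assumes "\<phi> \<in> (\<Pi>\<^sub>E j\<in>I. Hom A' (M j) (N j))"
  shows "untag_mor I \<phi> \<in> (\<Pi>\<^sub>E j\<in>I. Hom A (M j) (N j))" "(\<lambda>j\<in>I. Some (M j, untag_mor I \<phi> j, N j)) = \<phi>"
proof -
  have *: "\<exists>f\<in>Hom A (M j) (N j). \<phi> j = Some (M j, f, N j)" if "j \<in> I" for j using PiE_mem[OF assms that] by auto
  show "untag_mor I \<phi> \<in> (\<Pi>\<^sub>E j\<in>I. Hom A (M j) (N j))" using * by (force simp: untag_mor_def)
  show "(\<lambda>j\<in>I. Some (M j, untag_mor I \<phi> j, N j)) = \<phi>"
    by (rule extensionalityI[of _ I]) (use * assms in \<open>force simp: untag_mor_def PiE_iff\<close>)+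
qed

lemma untag_mor_cmp:
  assumes "\<phi> \<in> (\<Pi>\<^sub>E j\<in>I. Hom A' (L j) (M j))" "\<psi> \<in> (\<Pi>\<^sub>E j\<in>I. Hom A' (M j) (N j))"
    "\<And>j. j \<in> I ==> L j \<in> Ob A \<and> M j \<in> Ob A \<and> N j \<in> Ob A"
  shows "untag_mor I (\<lambda>j\<in>I. \<phi> j ;;\<^bsub>A'\<^esub> \<psi> j) = (\<lambda>j\<in>I. untag_mor I \<phi> j ;;\<^bsub>A\<^esub> untag_mor I \<psi> j)"
proof
  fix j
  show "untag_mor I (\<lambda>j\<in>I. \<phi> j ;;\<^bsub>A'\<^esub> \<psi> j) j = (\<lambda>j\<in>I. untag_mor I \<phi> j ;;\<^bsub>A\<^esub> untag_mor I \<psi> j) j"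
  proof (cases "j \<in> I")
    case True
    then show ?thesis using PiE_mem[OF assms(1) True] PiE_mem[OF assms(2) True] assms(3)[OF True]
      by (auto simp: untag_mor_def arr_def)
  qed (simp add: untag_mor_def)
qed

interpretation Q: root A' "tag_add A H" "tag_neg A H" Fo Fm' \<eta>' p
  by unfold_locales (rule exact_tag nat_tag p2)+

text \<open>Common to roots and sequences. The structure maps are indexed by \<open>I\<close>,
  entries and components by \<open>J\<close>; for sequences these differ, since the map into the
  first entry is not stored.\<close>

lemma cat_iso_untag_diagram:
  fixes X :: "((nat => 'o) \<times> (nat => 'm), nat => 'm) cat"
    and X' :: "((nat => 'o) \<times> (nat => ('o, 'm) tagged), nat => ('o, 'm) tagged) cat"
  assumes c: "category X'"
    and untag: "\<And>x. x \<in> Ob X' ==> untag_obj I x \<in> Ob X \<and> t (untag_obj I x) = x"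
    and tag: "\<And>x. x \<in> Ob X ==> t x \<in> Ob X' \<and> untag_obj I (t x) = x"
    and O: "\<And>x j. x \<in> Ob X' ==> j \<in> J ==> fst x j \<in> Ob A"
    and H': "\<And>x y. Hom X' x y \<subseteq> (\<Pi>\<^sub>E j\<in>J. Hom A' (fst x j) (fst y j))"
    and H: "\<And>x y. Hom X x y \<subseteq> (\<Pi>\<^sub>E j\<in>J. Hom A (fst x j) (fst y j))"
    and iff: "\<And>x y \<phi>. x \<in> Ob X ==> y \<in> Ob X ==> \<phi> \<in> (\<Pi>\<^sub>E j\<in>J. Hom A (fst x j) (fst y j)) ==>
      (\<lambda>j\<in>J. Some (fst x j, \<phi> j, fst y j)) \<in> Hom X' (t x) (t y) <-> \<phi> \<in> Hom X x y"
    and id: "\<And>x. ident X x = (\<lambda>j\<in>J. ident A (fst x j))" "\<And>x. ident X' x = (\<lambda>j\<in>J. ident A' (fst x j))"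
    and cm: "\<And>\<phi> \<psi>. \<phi> ;;\<^bsub>X\<^esub> \<psi> = (\<lambda>j\<in>J. \<phi> j ;;\<^bsub>A\<^esub> \<psi> j)" "\<And>\<phi> \<psi>. \<phi> ;;\<^bsub>X'\<^esub> \<psi> = (\<lambda>j\<in>J. \<phi> j ;;\<^bsub>A'\<^esub> \<psi> j)"
  shows "cat_iso X' X (untag_obj I) (untag_mor J)"
proof (intro cat_iso.intro cat_iso_axioms.intro)
  have Hom_im: "untag_mor J \<phi> \<in> Hom X (untag_obj I x) (untag_obj I y)"
    if "x \<in> Ob X'" "y \<in> Ob X'" "\<phi> \<in> Hom X' x y" for x y \<phi>
    using iff[of "untag_obj I x" "untag_obj I y" "untag_mor J \<phi>"] tag_mor_untag[OF subsetD[OF H' that(3)]] untag that by simp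
  show "is_functor X' X (untag_obj I) (untag_mor J)"
    unfolding is_functor_def
  proof (intro conjI ballI)
    fix x assume x: "x \<in> Ob X'"
    show "untag_obj I x \<in> Ob X" using untag[OF x] ..
    show "untag_mor J (ident X' x) = ident X (untag_obj I x)"
      unfolding id by (auto simp: untag_mor_def fun_eq_iff)
  next
    fix x y w \<phi> \<psi> assume a: "x \<in> Ob X'" "y \<in> Ob X'" "w \<in> Ob X'" "\<phi> \<in> Hom X' x y" "\<psi> \<in> Hom X' y w"
    show "untag_mor J (\<phi> ;;\<^bsub>X'\<^esub> \<psi>) = untag_mor J \<phi> ;;\<^bsub>X\<^esub> untag_mor J \<psi>"
      unfolding cm by (rule untag_mor_cmp[OF subsetD[OF H' a(4)] subsetD[OF H' a(5)]]) (use O a in blast)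
  qed (rule Hom_im)
  show "bij_betw (untag_obj I) (Ob X') (Ob X)"
    by (rule bij_betw_byWitness[where f' = t]) (use untag tag in blast)+
  fix x y assume xy: "x \<in> Ob X'" "y \<in> Ob X'"
  show "bij_betw (untag_mor J) (Hom X' x y) (Hom X (untag_obj I x) (untag_obj I y))"
  proof (rule bij_betw_byWitness[where f' = "\<lambda>\<phi>. \<lambda>j\<in>J. Some (fst x j, \<phi> j, fst y j)"])
    show "\<forall>\<phi>\<in>Hom X' x y. (\<lambda>j\<in>J. Some (fst x j, untag_mor J \<phi> j, fst y j)) = \<phi>"
      using tag_mor_untag(2)[OF subsetD[OF H']] by blast
    show "\<forall>\<phi>\<in>Hom X (untag_obj I x) (untag_obj I y). untag_mor J (\<lambda>j\<in>J. Some (fst x j, \<phi> j, fst y j)) = \<phi>"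
      by (intro ballI untag_mor_Some) (use H in \<open>unfold PiE_def, blast\<close>)
    show "untag_mor J ` Hom X' x y \<subseteq> Hom X (untag_obj I x) (untag_obj I y)" using Hom_im[OF xy] by blast
    show "(\<lambda>\<phi>. \<lambda>j\<in>J. Some (fst x j, \<phi> j, fst y j)) ` Hom X (untag_obj I x) (untag_obj I y) \<subseteq> Hom X' x y"
      using iff[OF conjunct1[OF untag[OF xy(1)]] conjunct1[OF untag[OF xy(2)]] subsetD[OF H]] untag xy by (auto simp del: tag_cat_simps)
  qed
qed (rule c)

lemma cat_iso_zero_R: "cat_iso_zero R' R (untag_obj {1..p}) (untag_mor {1..p})"
proof -
  have Ob_im: "untag_obj {1..p} x \<in> Ob R \<and> tag_root (untag_obj {1..p} x) = x" if "x \<in> Ob R'" for x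
    by (rule tag_root_cases[OF that]) simp
  interpret J: cat_iso R' R "untag_obj {1..p}" "untag_mor {1..p}"
  proof (rule cat_iso_untag_diagram[where t = tag_root])
    show "category R'" by (rule Q.R.category_axioms)
    show "tag_root x \<in> Ob R' \<and> untag_obj {1..p} (tag_root x) = x" if "x \<in> Ob R" for x
      using root_Ob_iff[OF root_ObD[OF that]] root_ObD(2)[OF that] untag_tag_root that by (simp add: PiE_def)
    show "fst x j \<in> Ob A" if "x \<in> Ob R'" "j \<in> {1..p}" for x j
      using PiE_mem[OF root_ObD(1)[OF conjunct1[OF Ob_im[OF that(1)]]] that(2)] by simp
    show "Hom R' x y \<subseteq> (\<Pi>\<^sub>E j\<in>{1..p}. Hom A' (fst x j) (fst y j))" for x y
      by (auto simp: root_cat_def split_beta)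
    show "Hom R x y \<subseteq> (\<Pi>\<^sub>E j\<in>{1..p}. Hom A (fst x j) (fst y j))" for x y
      by (auto simp: root_cat_def split_beta)
  qed ((rule Ob_im root_Hom_iff; assumption) | simp add: root_cat_def split_beta)+
  show ?thesis by unfold_locales (rule Q.R.ex_zero_obj)
qed

abbreviation S where "S q \<equiv> seq_cat B q"
abbreviation S' where "S' q \<equiv> seq_cat B' q"

lemma S_Ob: "X \<in> Ob (S q) <-> fst X \<in> {1..q} \<rightarrow>\<^sub>E Ob B \<and> snd X \<in> (\<Pi>\<^sub>E j\<in>{2..q}. Hom A (fst X (j - 1)) (fst X j))"
  "x \<in> Ob (S' q) <-> fst x \<in> {1..q} \<rightarrow>\<^sub>E Ob B \<and> snd x \<in> (\<Pi>\<^sub>E j\<in>{2..q}. Hom A' (fst x (j - 1)) (fst x j))"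
  by (simp_all add: seq_cat_def split_beta B_sel(2-) B'_Ob del: tag_cat_simps)

lemma S_Hom:
  "Hom (S q) X Y = {\<phi> \<in> (\<Pi>\<^sub>E j\<in>{1..q}. Hom A (fst X j) (fst Y j)). \<forall>j\<in>{2..q}. snd X j ;;\<^bsub>A\<^esub> \<phi> j = \<phi> (j - 1) ;;\<^bsub>A\<^esub> snd Y j}"
  "Hom (S' q) x y = {\<phi> \<in> (\<Pi>\<^sub>E j\<in>{1..q}. Hom A' (fst x j) (fst y j)). \<forall>j\<in>{2..q}. snd x j ;;\<^bsub>A'\<^esub> \<phi> j = \<phi> (j - 1) ;;\<^bsub>A'\<^esub> snd y j}"
  by (simp_all add: seq_cat_def split_beta B_sel(2-) del: tag_cat_simps)

definition tag_seq where "tag_seq q X = (fst X, \<lambda>j\<in>{2..q}. Some (fst X (j - 1), snd X j, fst X j))" for q :: nat and X :: "(nat => 'o) \<times> (nat => 'm)"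

lemma tag_seq_Ob: assumes "X \<in> Ob (S q)" shows "tag_seq q X \<in> Ob (S' q)" "untag_obj {2..q} (tag_seq q X) = X"
proof -
  have X: "snd X \<in> (\<Pi>\<^sub>E j\<in>{2..q}. Hom A (fst X (j - 1)) (fst X j))" using assms by (simp add: S_Ob)
  show "tag_seq q X \<in> Ob (S' q)" using assms PiE_mem[OF X] unfolding S_Ob by (auto simp: tag_seq_def)
  show "untag_obj {2..q} (tag_seq q X) = X"
    using X by (auto simp: tag_seq_def untag_obj_def PiE_iff extensional_def fun_eq_iff intro!: prod_eqI)
qed

lemma untag_seq_Ob: assumes "x \<in> Ob (S' q)" shows "untag_obj {2..q} x \<in> Ob (S q)" "tag_seq q (untag_obj {2..q} x) = x"
proof -
  have x: "snd x \<in> (\<Pi>\<^sub>E j\<in>{2..q}. Hom A' (fst x (j - 1)) (fst x j))" using assms by (simp add: S_Ob del: tag_cat_simps)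
  have u: "snd (untag_obj {2..q} x) = untag_mor {2..q} (snd x)" by (simp add: untag_obj_def untag_mor_def split_beta)
  show "untag_obj {2..q} x \<in> Ob (S q)" using assms tag_mor_untag(1)[OF x] unfolding S_Ob u by simp
  show "tag_seq q (untag_obj {2..q} x) = x" unfolding tag_seq_def u fst_untag_obj tag_mor_untag(2)[OF x] by simp
qed

lemma seq_Hom_iff:
  assumes X: "X \<in> Ob (S q)" and Y: "Y \<in> Ob (S q)" and \<phi>: "\<phi> \<in> (\<Pi>\<^sub>E j\<in>{1..q}. Hom A (fst X j) (fst Y j))"
  shows "(\<lambda>j\<in>{1..q}. Some (fst X j, \<phi> j, fst Y j)) \<in> Hom (S' q) (tag_seq q X) (tag_seq q Y) <-> \<phi> \<in> Hom (S q) X Y"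
proof -
  let ?\<phi> = "\<lambda>j\<in>{1..q}. Some (fst X j, \<phi> j, fst Y j)"
  have O: "fst X j \<in> Ob A" "fst Y j \<in> Ob A" "arr A (\<phi> j) (fst X j) (fst Y j)" if "j \<in> {1..q}" for j
    using X Y PiE_mem[OF \<phi> that] B_ObA that unfolding S_Ob by (auto simp: arr_def PiE_iff)
  have sq: "snd (tag_seq q X) j ;;\<^bsub>A'\<^esub> ?\<phi> j = ?\<phi> (j - 1) ;;\<^bsub>A'\<^esub> snd (tag_seq q Y) j <->
    snd X j ;;\<^bsub>A\<^esub> \<phi> j = \<phi> (j - 1) ;;\<^bsub>A\<^esub> snd Y j" if j: "j \<in> {2..q}" for j
  proof -
    have j': "j \<in> {1..q}" "j - 1 \<in> {1..q}" using j by auto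
    have "arr A (snd X j) (fst X (j - 1)) (fst X j)" "arr A (snd Y j) (fst Y (j - 1)) (fst Y j)"
      using X Y j O[OF j'(1)] O[OF j'(2)] unfolding S_Ob by (auto simp: arr_def PiE_iff)
    then show ?thesis using j j' O(3)[OF j'(1)] O(3)[OF j'(2)] by (simp add: tag_seq_def)
  qed
  have f1: "fst (tag_seq q Z) = fst Z" for Z by (simp add: tag_seq_def)
  have "?\<phi> \<in> (\<Pi>\<^sub>E j\<in>{1..q}. Hom A' (fst X j) (fst Y j))" using PiE_mem[OF \<phi>] by auto
  then show ?thesis unfolding S_Hom f1 mem_Collect_eq using \<phi> by (intro conj_cong ball_cong refl) (simp_all only: sq)
qed

lemma cat_iso_zero_S:
  assumes c: "category (S' q)" and z: "\<exists>Z. is_zero_obj (S' q) Z"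
  shows "cat_iso_zero (S' q) (S q) (untag_obj {2..q}) (untag_mor {1..q})"
proof -
  interpret J: cat_iso "S' q" "S q" "untag_obj {2..q}" "untag_mor {1..q}"
  proof (rule cat_iso_untag_diagram[where t = "tag_seq q"])
    show "fst x j \<in> Ob A" if "x \<in> Ob (S' q)" "j \<in> {1..q}" for x j
      using that B_ObA by (auto simp: S_Ob PiE_iff)
    show "Hom (S' q) x y \<subseteq> (\<Pi>\<^sub>E j\<in>{1..q}. Hom A' (fst x j) (fst y j))" for x y
      unfolding S_Hom by blast
    show "Hom (S q) x y \<subseteq> (\<Pi>\<^sub>E j\<in>{1..q}. Hom A (fst x j) (fst y j))" for x y
      unfolding S_Hom by blast
  qed (rule c | (rule seq_Hom_iff; assumption) | (rule conjI untag_seq_Ob tag_seq_Ob; assumption?) | simp add: seq_cat_def split_beta B_sel)+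
  show ?thesis by unfold_locales (rule z)
qed

lemma zero_mor_untag: "X \<in> Ob A ==> Y \<in> Ob A ==> untag (zero_mor A' X Y) = zero_mor A X Y"
  by (simp add: zero_mor_tag)

lemma untag_iota:
  assumes z: "z \<in> Ob A" and D: "\<And>j. j \<in> {1..p - 1} ==> fst D j \<in> Ob A"
  shows "untag_obj {1..p} (iota A' Fo p z D) = iota A Fo p z (untag_obj {2..p - 1} D)"
proof -
  have "fst D 1 \<in> Ob A" "fst D (p - 1) \<in> Ob A" using D p2 by auto
  then show ?thesis
    using z Fo_Ob[OF z] by (auto simp: iota_def untag_obj_def split_beta zero_mor_untag fun_eq_iff simp del: tag_cat_simps)
qed

lemma untag_pi_rho: "untag_obj {1..p} (pi_rho A' \<eta>' p U) = pi_rho A \<eta> p U"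
  by (auto simp: pi_rho_def untag_obj_def tag_nat_def fun_eq_iff)

text \<open>All hypotheses are carried to the tagged copies of the categories, where the laws hold
  unconditionally and \<open>cotilting_root\<close> applies. The conclusion returns along the
  isomorphism of root categories.\<close>

lemma cotilting_root_cat:
  assumes enough: "\<forall>X\<in>Ob A. \<exists>M\<in>Ob A. (\<exists>e. is_epi A M X e) \<and> is_mono A (Fo M) M (\<eta> M)"
    and T: "cotilting B T" and U: "cotilting A U" and mU: "is_mono A (Fo U) U (\<eta> U)"
    and Q: "is_cokernel A (Fo U) U (\<eta> U) Q q" and QT: "\<forall>i>0. Ext_zero B i Q T"
    and z: "is_zero_obj A z" and D: "is_delta B (p - 1) z T D"
    and sum: "is_direct_sum2 R (iota A Fo p z D) (pi_rho A \<eta> p U) V"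
  shows "cotilting R V"
proof -
  interpret B: abelian_category B using T by (simp add: cotilting_def)
  interpret J: cat_iso_zero B' B "\<lambda>X. X" untag by (rule cat_iso_zero_B) unfold_locales
  have O: "T \<in> Ob B" "U \<in> Ob A" "z \<in> Ob A" "Q \<in> Ob A" using T U z Q by (simp_all add: cotilting_def is_zero_obj_def is_cokernel_def)
  have enough': "\<exists>M\<in>Ob A'. (\<exists>e. is_epi A' M X e) \<and> is_mono A' (Fo M) M (\<eta>' M)" if "X \<in> Ob A'" for X
  proof -
    have X: "X \<in> Ob A" using that by simp
    obtain M e where M: "M \<in> Ob A" "is_epi A M X e" "is_mono A (Fo M) M (\<eta> M)" using enough X by blast
    have "is_epi A' M X (Some (M, e, X))" using I.epi_iff[of M X "Some (M, e, X)"] M X by (simp add: is_epi_def[of A])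
    moreover have "is_mono A' (Fo M) M (\<eta>' M)"
      using I.mono_iff[of "Fo M" M "\<eta>' M"] M Fo_Ob eta_Hom by (simp add: tag_nat_def)
    ultimately show ?thesis using M(1) by auto
  qed
  have B': "abelian_category B'" using J.abelian_iff B.abelian_category_axioms by blast
  interpret RC: root_ctx A' "tag_add A H" "tag_neg A H" Fo Fm' \<eta>' p
    by (intro root_ctx.intro root_ctx_axioms.intro Q.root_axioms enough' B')
  have zA: "is_zero_obj A' z" using I.zero_obj_iff[of z] z O by simp
  have eU: "\<eta>' U \<in> Hom A' (Fo U) U" using eta_Hom[OF O(2)] by (simp add: tag_nat_def)
  have q: "q \<in> Hom A U Q" using Q by (simp add: is_cokernel_def)
  have U': "cotilting A' U" using I.cotilting_iff[of U] U O by simp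
  have T': "cotilting B' T" using J.cotilting_iff[of T] T O by (simp add: B'_Ob)
  have mU': "is_mono A' (Fo U) U (\<eta>' U)"
    using I.mono_iff[OF _ _ eU] mU O Fo_Ob by (simp add: tag_nat_def)
  have Q': "is_cokernel A' (Fo U) U (\<eta>' U) Q (Some (U, q, Q))"
    using I.cokernel_iff[OF _ _ eU, of Q "Some (U, q, Q)"] Q q O Fo_Ob by (simp add: tag_nat_def)
  have QB: "Q \<in> Ob B'" by (rule RC.cokernel_eta_B[OF Q']) (simp add: O)
  have QT': "\<forall>i>0. Ext_zero B' i Q T" using QT J.Ext_zero_iff[OF QB, of T] O by (simp add: B'_Ob)
  let ?S = "S (p - 1)" and ?S' = "S' (p - 1)"
  interpret K: cat_iso_zero ?S' ?S "untag_obj {2..p - 1}" "untag_mor {1..p - 1}"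
  proof (rule cat_iso_zero_S)
    show "category ?S'" by (rule RC.S_category)
    have "D \<in> Ob ?S" using D by (simp add: is_delta_def is_direct_sum_def)
    then show "\<exists>Z. is_zero_obj ?S' Z" using RC.S_ex_zero tag_seq_Ob(1) by blast
  qed
  interpret L: cat_iso_zero R' R "untag_obj {1..p}" "untag_mor {1..p}" by (rule cat_iso_zero_R)
  have DO: "D \<in> Ob ?S" using D by (simp add: is_delta_def is_direct_sum_def)
  have intv: "interval_seq B (p - 1) z T j \<in> Ob ?S" if "j \<in> {1..p - 1}" for j
    using D that by (simp add: is_delta_def is_direct_sum_def)
  have zB: "z \<in> Ob B" using Q.B_zero_obj[OF zA] by (simp add: is_zero_obj_def B'_Ob)
  have int_untag: "untag_obj {2..p - 1} (interval_seq B' (p - 1) z T j) = interval_seq B (p - 1) z T j" for j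
    using J.P_zero_mor[of T z] J.P_zero_mor[of z z] zB O
    by (auto simp: interval_seq_def untag_obj_def B'_Ob B_sel fun_eq_iff)
  \<comment> \<open>The direct sum \<open>D\<close> is given in the untagged category. Since
    untagging is bijective on objects it comes from a tagged sequence, and being a direct sum is
    reflected.\<close>
  obtain D' where D': "D' \<in> Ob ?S'" "untag_obj {2..p - 1} D' = D" using tag_seq_Ob[OF DO] by blast
  have intv': "interval_seq B' (p - 1) z T j \<in> Ob ?S'" for j
    unfolding S_Ob
  proof (intro conjI PiE_I)
    have h: "ident B' T \<in> Hom A' T T" "zero_mor B' T z \<in> Hom A' T z" "zero_mor B' z z \<in> Hom A' z z"
      using zB O J.zero_mor_Hom[of T z] J.zero_mor_Hom[of z z] J.ident_in_Hom[of T] unfolding B_sel(5) B'_Ob by blast+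
    fix i assume i: "i \<in> {2..p - 1}"
    then have "i \<in> {1..p - 1}" "i - 1 \<in> {1..p - 1}" by auto
    then show "snd (interval_seq B' (p - 1) z T j) i \<in> Hom A' (fst (interval_seq B' (p - 1) z T j) (i - 1)) (fst (interval_seq B' (p - 1) z T j) i)"
      using h i by (auto simp: interval_seq_def simp del: tag_cat_simps)
  qed (use zB O in \<open>auto simp: interval_seq_def\<close>)
  have dl: "is_delta B' (p - 1) z T D'"
    using K.direct_sum_iff[where S' = "interval_seq B (p - 1) z T" and I = "{1..p - 1}", OF D'(1) intv' int_untag[symmetric]] D
    unfolding is_delta_def D'(2) by blast
  \<comment> \<open>In the same way the total object \<open>V\<close> is the untagging of a tagged
    root.\<close>
  obtain V' where V': "V' \<in> Ob R'" "untag_obj {1..p} V' = V"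
    using sum L.Ob_image by (auto simp: is_direct_sum_def)
  have i1: "untag_obj {1..p} (iota A' Fo p z D') = iota A Fo p z D"
    using untag_iota[OF O(3)] D' B_ObA by (auto simp: S_Ob PiE_iff)
  have i2: "iota A' Fo p z D' \<in> Ob R'" by (rule RC.delta_decomposition[OF zA dl])
  have i3: "pi_rho A' \<eta>' p U \<in> Ob R'" by (rule Q.pi_rho_Ob) (simp add: O)
  have "is_direct_sum2 R' (iota A' Fo p z D') (pi_rho A' \<eta>' p U) V'"
  proof (rule iffD1[OF L.direct_sum_iff[OF V'(1)]])
    show "is_direct_sum2 R (iota A Fo p z D) (pi_rho A \<eta> p U) (untag_obj {1..p} V')" unfolding V'(2) by (rule sum)
  qed (use i2 i3 i1 untag_pi_rho in \<open>auto simp del: One_nat_def\<close>)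
  from RC.cotilting_root[OF T' U' mU' Q' QT' zA dl this] have "cotilting R' V'" .
  then show ?thesis using L.cotilting_iff[OF V'(1)] V'(2) by simp
qed

end

theorem theorem3p13:
  fixes k :: "'k ring"
    and A :: "('o, 'm) cat"
    and H :: "'o \<Rightarrow> 'o \<Rightarrow> ('k, 'm) module"
    and Fo :: "'o \<Rightarrow> 'o" and Fm :: "'m \<Rightarrow> 'm" and \<eta> :: "'o \<Rightarrow> 'm"
    and p :: nat
    and T U Q z :: 'o and q :: 'm
    and D S :: "(nat \<Rightarrow> 'o) \<times> (nat \<Rightarrow> 'm)"
  assumes "algebraically_closed k"
    and "abelian_category A" and "linear_category A k H" and "hom_finite A k H"
    and "is_exact_functor A A Fo Fm"
    and "is_nat_transf A A Fo Fm (\<lambda>X. X) (\<lambda>f. f) \<eta>"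
    and "p \<ge> 2"
    and "\<forall>X\<in>Ob A. \<exists>M\<in>Ob A. (\<exists>e. is_epi A M X e) \<and> is_mono A (Fo M) M (\<eta> M)"
    and "cotilting (ker_cat A Fo \<eta>) T"
    and "cotilting A U"
    and "is_mono A (Fo U) U (\<eta> U)"
    and "is_cokernel A (Fo U) U (\<eta> U) Q q"
    and "\<forall>i>0. Ext_zero (ker_cat A Fo \<eta>) i Q T"
    and "is_zero_obj A z"
    and "is_delta (ker_cat A Fo \<eta>) (p - 1) z T D"
    and "is_direct_sum2 (root_cat A Fo Fm \<eta> p) (iota A Fo p z D) (pi_rho A \<eta> p U) S"
  shows "cotilting (root_cat A Fo Fm \<eta> p) S"
proof -
  interpret tag_ctx A H k Fo Fm \<eta> p
    by (intro tag_ctx.intro tag_ctx_axioms.intro assms(2,3,5-7))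
  show ?thesis by (rule cotilting_root_cat[OF assms(8-16)])
qed

end
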